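(* Let $\alpha>0$, let $g:\mathbb N=\{0,1,2,\dots\}\to\mathbb R_+$ satisfy $g(0)=0$, $g(k)>0$ for $k>0$, $\sup_k|g(k+1)-g(k)|<\infty$, and suppose that $Z(\lambda)=\sum_{k\ge0}\lambda^k/g(k)!<\infty$ for all $\lambda>0$. Let $\lambda_-,\lambda_+:[0,\infty)\to(0,\infty)$ be differentiable with bounded derivative. For each $N$ let $(\eta_t)_{t\ge0}$ be the zero range process with boundary reservoirs on $\mathbb N^{\{-N,\dots,N\}}$ with time-dependent generator $L^{0r}_{N,t}$ (defined in the context), and suppose that $\eta_0$ is distributed according to a probability measure with density $f_{N,0}$ with respect to $\mu_0^N$ such that $$\sum_\eta f_{N,0}(\eta)\log f_{N,0}(\eta)\,\mu^N_0(\eta)\le CN$$ for some constant $C>0$. Then for every $t>0$, any local function $\varphi$ and any measurable bounded test function $G$ on $[-1,1]$, $$\lim_{N\to\infty}\mathbb E\left(\int_0^t ds\,\left|\frac1N\sum_x G\Big(\frac xN\Big)\theta_x\varphi(\eta_s)-\int_{-1}^1G(y)\,\hat\varphi(\bar\lambda(y,s))\,dy\right|\right)=0.$$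
   Context: The generator is $$L^{0r}_{N,t}f(\eta)=\frac{N^{2+\alpha}}2\Big\{\sum_{x=-N}^{N}g(\eta(x))\sum_{\sigma=\pm1}[f(\eta^{x,x+\sigma})-f(\eta)]+\sum_{\sigma=\pm}\lambda_\sigma(t)[f(\eta^{\sigma N,+})-f(\eta)]\Big\},$$ where for $x,y\in\{-N,\dots,N\}$ $\eta^{x,y}$ is $\eta$ with one particle moved from $x$ to $y$; $\eta^{N,N+1}$ and $\eta^{-N,-N-1}$ are $\eta$ with one particle removed from $N$, respectively $-N$; and $\eta^{\pm N,+}$ is $\eta$ with one particle added at $\pm N$. Notation: $g(k)!=g(1)\cdots g(k)$, $g(0)!=1$; $\mu_\lambda(k)=\frac{\lambda^k}{g(k)!\,Z(\lambda)}$, $k\ge0$; $\mu_\lambda$ also denotes the corresponding homogeneous product measure; $\bar\lambda(r,t)=\frac12[\lambda_+(t)-\lambda_-(t)]r+\frac12[\lambda_+(t)+\lambda_-(t)]$ for $r\in[-1,1]$; $\mu^N_t(\eta)=\prod_{x=-N}^N\mu_{\bar\lambda(x/N,t)}(\eta(x))$. A local function depends on finitely many occupation numbers; $\theta_x$ is the spatial shift by $x$ (if $\varphi$ depends on $\eta(z)$, $z\in A$, then $\theta_x\varphi$ is the same function of $\eta(z+x)$, $z\in A$), well defined for $N$ large enough, and the sum over $x$ runs over those sites of $\{-N,\dots,N\}$ for which $\theta_x\varphi$ depends only on sites of $\{-N,\dots,N\}$; $\hat\varphi(\lambda)=\langle\varphi\rangle_\lambda$ is the average of $\varphi$ with respect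 to $\mu_\lambda$; $\mathbb E$ is expectation for the process with the given initial distribution.
   Formalization: The test function G is additionally assumed continuous at almost every point of [-1,1], and the local function φ is assumed to satisfy ⟨exp(γ|φ|)⟩_λ < ∞ for all γ, λ > 0; the claim fails for merely bounded measurable G (indicator of the rationals) and for arbitrary unbounded φ. *)

theory Defs
  imports "HOL-Probability.Probability"
begin

definition gfact :: "(nat \<Rightarrow> real) \<Rightarrow> nat \<Rightarrow> real" where
  "gfact g k = (\<Prod>i=1..k. g i)"

definition partition_fun :: "(nat \<Rightarrow> real) \<Rightarrow> real \<Rightarrow> real" where
  "partition_fun g lam = (\<Sum>k. lam ^ k / gfact g k)"

text \<open>The single-site law \<open>\<mu>\<^sub>\<lambda>\<close>.  It is meaningful when \<open>lam > 0\<close>, \<open>g\<close> is positive on positive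
  numbers and the partition function converges; see \<open>pmf_site_law\<close>.\<close>

definition site_law :: "(nat \<Rightarrow> real) \<Rightarrow> real \<Rightarrow> nat pmf" where
  "site_law g lam = embed_pmf (\<lambda>k. lam ^ k / (gfact g k * partition_fun g lam))"

lemma pmf_site_law:
  assumes g: "\<And>k. k > 0 \<Longrightarrow> g k > 0" and "lam > 0"
    and sm: "summable (\<lambda>k. lam ^ k / gfact g k)"
  shows "pmf (site_law g lam) k = lam ^ k / (gfact g k * partition_fun g lam)"
proof -
  have pos: "lam ^ j / gfact g j > 0" for j
    using g \<open>lam > 0\<close> unfolding gfact_def by (intro divide_pos_pos prod_pos) auto
  have Z: "partition_fun g lam > 0"
    unfolding partition_fun_def by (rule suminf_pos[OF sm pos])
  have eq: "lam ^ j / (gfact g j * partition_fun g lam)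
      = (lam ^ j / gfact g j) / partition_fun g lam" for j
    by simp
  have nn: "0 \<le> lam ^ j / (gfact g j * partition_fun g lam)" for j
    unfolding eq using divide_pos_pos[OF pos Z] by (rule less_imp_le)
  have "(\<lambda>j. lam ^ j / (gfact g j * partition_fun g lam)) sums
      (partition_fun g lam / partition_fun g lam)"
    unfolding eq using sums_divide[OF summable_sums[OF sm], of "partition_fun g lam"]
    by (simp only: partition_fun_def)
  then have "(\<lambda>j. lam ^ j / (gfact g j * partition_fun g lam)) sums 1"
    using Z by simp
  then have "(\<integral>\<^sup>+j. ennreal (lam ^ j / (gfact g j * partition_fun g lam)) \<partial>count_space UNIV) = 1"
    using suminf_ennreal_eq[OF nn] by (simp add: nn_integral_count_space_nat)
  then show ?thesis
    unfolding site_law_def by (intro pmf_embed_pmf nn)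
qed

definition lambda_bar :: "(real \<Rightarrow> real) \<Rightarrow> (real \<Rightarrow> real) \<Rightarrow> real \<Rightarrow> real \<Rightarrow> real" where
  "lambda_bar lm lp r t = (lp t - lm t) / 2 * r + (lp t + lm t) / 2"

definition sites :: "nat \<Rightarrow> int set" where
  "sites N = {- int N..int N}"

text \<open>Configurations on \<open>{-N..N}\<close> are functions on \<open>\<int>\<close> that vanish off \<open>{-N..N}\<close>, so that
  functions of configurations on \<open>\<int>\<close> can be evaluated on them for every \<open>N\<close>.\<close>

definition configs :: "nat \<Rightarrow> (int \<Rightarrow> nat) set" where
  "configs N = {\<eta>. \<forall>x. x \<notin> sites N \<longrightarrow> \<eta> x = 0}"

definition profile_law ::
    "(nat \<Rightarrow> real) \<Rightarrow> (real \<Rightarrow> real) \<Rightarrow> (real \<Rightarrow> real) \<Rightarrow> nat \<Rightarrow> real \<Rightarrow> (int \<Rightarrow> nat) pmf" where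
  "profile_law g lm lp N t =
    Pi_pmf (sites N) 0 (\<lambda>x. site_law g (lambda_bar lm lp (of_int x / real N) t))"

definition homogeneous_law :: "(nat \<Rightarrow> real) \<Rightarrow> real \<Rightarrow> (int \<Rightarrow> nat) measure" where
  "homogeneous_law g lam = PiM UNIV (\<lambda>_. measure_pmf (site_law g lam))"

definition depends_on :: "((int \<Rightarrow> nat) \<Rightarrow> real) \<Rightarrow> int set \<Rightarrow> bool" where
  "depends_on \<phi> A \<longleftrightarrow> (\<forall>\<eta> \<xi>. (\<forall>z\<in>A. \<eta> z = \<xi> z) \<longrightarrow> \<phi> \<eta> = \<phi> \<xi>)"

definition local_function :: "((int \<Rightarrow> nat) \<Rightarrow> real) \<Rightarrow> bool" where
  "local_function \<phi> \<longleftrightarrow> (\<exists>A. finite A \<and> depends_on \<phi> A)"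

definition shift :: "int \<Rightarrow> ((int \<Rightarrow> nat) \<Rightarrow> real) \<Rightarrow> (int \<Rightarrow> nat) \<Rightarrow> real" where
  "shift x \<phi> \<eta> = \<phi> (\<lambda>z. \<eta> (z + x))"

definition phi_hat :: "(nat \<Rightarrow> real) \<Rightarrow> ((int \<Rightarrow> nat) \<Rightarrow> real) \<Rightarrow> real \<Rightarrow> real" where
  "phi_hat g \<phi> lam = (LINT \<eta>|homogeneous_law g lam. \<phi> \<eta>)"

definition empirical_average ::
    "nat \<Rightarrow> (real \<Rightarrow> real) \<Rightarrow> ((int \<Rightarrow> nat) \<Rightarrow> real) \<Rightarrow> (int \<Rightarrow> nat) \<Rightarrow> real" where
  "empirical_average N G \<phi> \<eta> =
    1 / real N * (\<Sum>x\<in>{x \<in> sites N. depends_on (shift x \<phi>) (sites N)}.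
                    G (of_int x / real N) * shift x \<phi> \<eta>)"

definition add_particle :: "(int \<Rightarrow> nat) \<Rightarrow> int \<Rightarrow> int \<Rightarrow> nat" where
  "add_particle \<eta> x = \<eta>(x := \<eta> x + 1)"

text \<open>If \<open>\<eta> x = 0\<close>, the truncated subtraction gives a spurious value, but the jump then has
  rate \<open>g 0 = 0\<close>.  A particle jumping out of \<open>{-N..N}\<close> is lost.\<close>

definition move_particle :: "nat \<Rightarrow> (int \<Rightarrow> nat) \<Rightarrow> int \<Rightarrow> int \<Rightarrow> int \<Rightarrow> nat" where
  "move_particle N \<eta> x y =
    (let \<zeta> = \<eta>(x := \<eta> x - 1) in if y \<in> sites N then add_particle \<zeta> y else \<zeta>)"

definition zr_generator ::
    "real \<Rightarrow> (nat \<Rightarrow> real) \<Rightarrow> (real \<Rightarrow> real) \<Rightarrow> (real \<Rightarrow> real) \<Rightarrow> nat \<Rightarrow> real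
      \<Rightarrow> ((int \<Rightarrow> nat) \<Rightarrow> real) \<Rightarrow> (int \<Rightarrow> nat) \<Rightarrow> real" where
  "zr_generator \<alpha> g lm lp N t f \<eta> =
    real N powr (2 + \<alpha>) / 2 *
      ((\<Sum>x\<in>sites N. g (\<eta> x) * (\<Sum>\<sigma>\<in>{1, -1}. f (move_particle N \<eta> x (x + \<sigma>)) - f \<eta>))
       + (lp t * (f (add_particle \<eta> (int N)) - f \<eta>)
          + lm t * (f (add_particle \<eta> (- int N)) - f \<eta>)))"

definition natural_filtration ::
    "'w measure \<Rightarrow> (real \<Rightarrow> 'w \<Rightarrow> int \<Rightarrow> nat) \<Rightarrow> real \<Rightarrow> 'w measure" where
  "natural_filtration M X t =
    sigma (space M) {X s -` {\<xi>} \<inter> space M | s \<xi>. 0 \<le> s \<and> s \<le> t}"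

definition dynkin_process ::
    "real \<Rightarrow> (nat \<Rightarrow> real) \<Rightarrow> (real \<Rightarrow> real) \<Rightarrow> (real \<Rightarrow> real) \<Rightarrow> nat
      \<Rightarrow> (real \<Rightarrow> 'w \<Rightarrow> int \<Rightarrow> nat) \<Rightarrow> ((int \<Rightarrow> nat) \<Rightarrow> real) \<Rightarrow> real \<Rightarrow> 'w \<Rightarrow> real" where
  "dynkin_process \<alpha> g lm lp N X f t \<omega> =
    f (X t \<omega>) - f (X 0 \<omega>) - (LINT s:{0..t}|lborel. zr_generator \<alpha> g lm lp N s f (X s \<omega>))"

text \<open>The process with generator \<open>zr_generator\<close>, as the solution of its martingale problem.
  Its paths are right continuous with left limits in the discrete space \<open>configs N\<close>, so they
  make finitely many jumps in bounded time.  The test functions have finite support because the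
  jump rates may be unbounded: the generator maps such functions to bounded ones, and on the
  indicators of single configurations the martingale property contains the forward equation.\<close>

definition zero_range_process ::
    "real \<Rightarrow> (nat \<Rightarrow> real) \<Rightarrow> (real \<Rightarrow> real) \<Rightarrow> (real \<Rightarrow> real) \<Rightarrow> nat
      \<Rightarrow> 'w measure \<Rightarrow> (real \<Rightarrow> 'w \<Rightarrow> int \<Rightarrow> nat) \<Rightarrow> bool" where
  "zero_range_process \<alpha> g lm lp N M X \<longleftrightarrow>
    prob_space M \<and>
    (\<forall>t\<ge>0. X t \<in> M \<rightarrow>\<^sub>M count_space (configs N)) \<and>
    (\<forall>\<omega>\<in>space M. \<forall>t\<ge>0. eventually (\<lambda>s. X s \<omega> = X t \<omega>) (at_right t)) \<and>
    (\<forall>\<omega>\<in>space M. \<forall>t>0. \<exists>\<xi>\<in>configs N. eventually (\<lambda>s. X s \<omega> = \<xi>) (at_left t)) \<and>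
    (\<forall>f. finite {\<eta>. f \<eta> \<noteq> 0} \<longrightarrow>
      (\<forall>t\<ge>0. integrable M (dynkin_process \<alpha> g lm lp N X f t)) \<and>
      (\<forall>s t. 0 \<le> s \<and> s \<le> t \<longrightarrow>
        (AE \<omega> in M. real_cond_exp M (natural_filtration M X s)
                       (dynkin_process \<alpha> g lm lp N X f t) \<omega>
                    = dynkin_process \<alpha> g lm lp N X f s \<omega>)))"

end

theory Submission
  imports Defs
begin

text \<open>The reservoirs are treated as two additional sites \<open>\<plusminus>(N + 1)\<close> that carry the fugacities \<open>lp\<close>
  and \<open>lm\<close>.  As the profile between them is linear, the product measure with this profile is stationary
  for the dynamics with frozen reservoirs, and the entropy relative to it stays of order \<open>N\<close> on bounded
  time intervals; since time runs at speed \<open>N powr (2 + \<alpha>)\<close>, the time integral of the Dirichlet form over the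
  bonds is of order \<open>N powr (- 1 - \<alpha>)\<close>.  Connecting a site \<open>z\<close> to a reservoir by a path of length at most
  \<open>2 * N + 2\<close>, one controls the Dirichlet form for the creation of a particle at \<open>z\<close> by
  \<open>O(N powr (- \<alpha>))\<close>, which tends to \<open>0\<close>.  So already a single site is in equilibrium with the reservoirs: under the law
  of the process, and against any bounded function of the other sites, the weights \<open>q k\<close> of
  \<open>\<eta> z = k\<close> nearly satisfy \<open>g (k + 1) * q (k + 1) = \<lambda> * q k\<close>, the recursion that characterises
  \<open>\<mu>\<^sub>\<lambda>\<close>.  Hence local patterns are asymptotically independent with the expected probabilities, and
  a second moment bound gives the law of large numbers for truncated \<open>\<phi>\<close>.  No replacement on mesoscopic
  blocks is needed.  The truncation error is controlled by the entropy inequality and the exponential moments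
  of \<open>\<phi>\<close>.\<close>

section \<open>Truncated relative entropy\<close>

text \<open>The process is given by its martingale problem for finitely supported functions only,
  the rates may be unbounded, and at the start no moment of the particle number is known. So the
  entropy is not differentiated directly: it carries the cutoff \<open>chi K\<close>, and its convex
  function is linear beyond \<open>B\<close>. For a given finite set of configurations
  \<open>B\<close> is chosen first and \<open>K\<close> last. The error of \<open>chi K\<close>
  needs no moments, since the particle number divided by \<open>K\<close> is bounded where the
  cutoff acts, and the resulting estimates contain neither \<open>B\<close> nor \<open>K\<close>.

  Two hypotheses on G and \<phi> have the following origin. The sum sees G at rational points only:
  for the indicator of the rationals and \<phi> = 1 it tends to 2 while the integral is 0. Hence G
  is almost everywhere continuous. An entropy of order N controls a mean through exponential
  moments, and the truncation error of \<phi> is made small by taking a large exponent. Hence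
  exponential moments of every order are assumed.\<close>

definition ent :: "real \<Rightarrow> real" where
  "ent u = (1 + u) * ln (1 + u) - u"

text \<open>The shift by \<open>1\<close> in \<open>ent\<close> keeps the derivative finite at \<open>0\<close>, where the density may vanish.  The function is continued linearly beyond \<open>B\<close>, so the entropy production
  is a sum of terms with bounded coefficients.\<close>

definition trunc_ent :: "real \<Rightarrow> real \<Rightarrow> real" where
  "trunc_ent B u = ent (min u B) + ln (1 + B) * (u - min u B)"

text \<open>With F for \<open>trunc_ent B\<close>, this is \<open>u * F' u - F u\<close>, see
  \<open>trunc_ent_dual\<close>: minus the derivative of \<open>n * F (p / n)\<close> in the
  reference weight \<open>n\<close>. Its differences are also what telescopes over the bonds in the
  entropy production.\<close>

definition trunc_dual :: "real \<Rightarrow> real \<Rightarrow> real" where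
  "trunc_dual B u = min u B - ln (1 + min u B)"

lemma ent_has_derivative: "u > -1 \<Longrightarrow> (ent has_real_derivative ln (1 + u)) (at u within S)"
  unfolding ent_def[abs_def] by (auto intro!: derivative_eq_intros)

lemma ent_0 [simp]: "ent 0 = 0" by (simp add: ent_def)

lemma ent_tangent:
  assumes "u > -1" "v > -1" shows "ent u \<ge> ent v + ln (1 + v) * (u - v)"
proof -
  have "ln ((1 + v) / (1 + u)) \<le> (1 + v) / (1 + u) - 1"
    using assms by (intro ln_le_minus_one) auto
  then have "(1 + u) * (ln (1 + v) - ln (1 + u)) \<le> (1 + u) * ((1 + v) / (1 + u) - 1)"
    using assms by (intro mult_left_mono) (auto simp: ln_div)
  also have "\<dots> = v - u" using assms by (simp add: field_simps)
  finally show ?thesis by (simp add: ent_def algebra_simps)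
qed

lemma ent_nonneg: "u \<ge> 0 \<Longrightarrow> 0 \<le> ent u"
  using ent_tangent[of u 0] by (simp)

text \<open>The two pieces agree at \<open>B\<close> in value and in slope, so they glue to a
  differentiable function, and the entropy can be differentiated in time although densities may
  cross the level \<open>B\<close>.\<close>

lemma trunc_ent_has_derivative:
  assumes "u \<ge> 0" "B > 0"
  shows "(trunc_ent B has_real_derivative ln (1 + min u B)) (at u within S)"
proof -
  have clos: "closure {..B} = {..B}" "closure {B<..} = {B..}" "frontier {..B} = {B}"
    by (auto simp: frontier_def)
  let ?F = "\<lambda>x. if x \<in> {..B} then ent x else ent B + ln (1 + B) * (x - B)"
  have "(?F has_derivative (if u \<in> {..B} then (\<lambda>h. h * ln (1 + u)) else (\<lambda>h. h * ln (1 + B)))) (at u within {..B} \<union> {B<..})"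
  proof (rule has_derivative_If_within_closures[where S="{..B}" and T="{B<..}" and f'="\<lambda>u h. h * ln (1+u)" and g'="\<lambda>u h. h * ln (1+B)"])
  qed (use assms ent_has_derivative[of u] in \<open>auto simp: has_field_derivative_def mult.commute[of _ "ln _"] clos intro!: derivative_eq_intros\<close>)
  moreover have "?F = trunc_ent B" by (auto simp: trunc_ent_def fun_eq_iff min_def)
  moreover have "(if u \<in> {..B} then (\<lambda>h. h * ln (1 + u)) else (\<lambda>h. h * ln (1 + B))) = (*) (ln (1 + min u B))"
    by (auto simp: min_def mult.commute)
  moreover have "{..B} \<union> {B<..} = UNIV" by auto
  ultimately have "(trunc_ent B has_derivative (*) (ln (1 + min u B))) (at u)" by simp
  then show ?thesis by (simp add: has_field_derivative_def has_derivative_at_withinI)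
qed

lemma trunc_ent_eq: "u \<le> B \<Longrightarrow> trunc_ent B u = ent u"
  by (simp add: trunc_ent_def)

lemma ent_min_le_trunc: "u \<ge> 0 \<Longrightarrow> B > 0 \<Longrightarrow> ent (min u B) \<le> trunc_ent B u"
  by (simp add: trunc_ent_def)

lemma trunc_ent_nonneg: "u \<ge> 0 \<Longrightarrow> B > 0 \<Longrightarrow> 0 \<le> trunc_ent B u"
  using ent_min_le_trunc[of u B] ent_nonneg[of "min u B"] by simp

lemma trunc_ent_le: "u \<ge> 0 \<Longrightarrow> B > 0 \<Longrightarrow> trunc_ent B u \<le> ent u"
  using ent_tangent[of u B] by (auto simp: trunc_ent_def min_def)

lemma trunc_dual_bounds:
  assumes "u \<ge> 0" "B > 0" shows "0 \<le> trunc_dual B u" "trunc_dual B u \<le> min u B"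
proof -
  have "0 \<le> min u B" using assms by auto
  then have "0 \<le> ln (1 + min u B)" "ln (1 + min u B) \<le> min u B"
    using ln_le_minus_one[of "1 + min u B"] ln_ge_zero[of "1 + min u B"] by linarith+
  then show "0 \<le> trunc_dual B u" "trunc_dual B u \<le> min u B"
    unfolding trunc_dual_def by linarith+
qed

lemma trunc_ent_dual: "trunc_ent B u - u * ln (1 + min u B) = - trunc_dual B u"
proof (cases "u \<le> B")
  case True then show ?thesis by (simp add: trunc_ent_def trunc_dual_def ent_def algebra_simps)
next
  case False then show ?thesis by (simp add: trunc_ent_def trunc_dual_def ent_def algebra_simps min_def)
qed

text \<open>\<open>m * ln m - m\<close> and \<open>exp\<close> are convex conjugates. Summed against
  a weight this becomes the entropy inequality; the pointwise form allows weights that are not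
  normalised.\<close>

lemma young_xlnx:
  fixes m v :: real assumes "m \<ge> 0" shows "m * v \<le> m * ln m - m + exp v"
proof (cases "m = 0")
  case False
  with assms have "m > 0" by simp
  have "m * (1 + (v - ln m)) \<le> m * exp (v - ln m)"
    using \<open>m > 0\<close> by (intro mult_left_mono exp_ge_add_one_self) auto
  also have "\<dots> = exp v" using \<open>m > 0\<close> by (simp add: exp_diff)
  finally show ?thesis by (simp add: algebra_simps)
qed auto

lemma young_ent:
  assumes "m \<ge> 0" shows "m * v \<le> ent m + exp v"
proof -
  have "m * ln m \<le> (1 + m) * ln (1 + m)"
  proof (cases "m = 0")
    case False
    then have "m * ln m \<le> m * ln (1 + m)" using assms by (intro mult_left_mono) auto
    also have "\<dots> \<le> (1 + m) * ln (1 + m)" using assms by (intro mult_right_mono) auto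
    finally show ?thesis .
  qed auto
  then show ?thesis using young_xlnx[OF assms, of v] by (simp add: ent_def)
qed

text \<open>Passes from the entropy in the hypothesis of the theorem to the shifted one. The loss of
  1, integrated against the reference weight, costs at most its total mass.\<close>

lemma ent_le_xlnx:
  assumes "u \<ge> 0" shows "ent u \<le> u * ln u + 1"
proof (cases "u = 0")
  case False
  then have u: "u > 0" using assms by simp
  have "u * ln ((1 + u) / u) \<le> u * ((1 + u) / u - 1)"
    using u by (intro mult_left_mono ln_le_minus_one) auto
  also have "\<dots> = 1" using u by (simp add: field_simps)
  finally have "u * ln (1 + u) - u * ln u \<le> 1" using u by (simp add: ln_div algebra_simps)
  moreover have "ln (1 + u) \<le> u" using ln_le_minus_one[of "1 + u"] u by simp
  ultimately show ?thesis by (simp add: ent_def algebra_simps)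
qed auto

lemma xlnx_ge: "(0::real) \<le> u \<Longrightarrow> - 1 \<le> u * ln u"
  using young_xlnx[of u 0] young_xlnx[of u 1] ent_le_xlnx[of u] ent_nonneg[of u] by simp

text \<open>Let \<open>a'\<close>, \<open>b'\<close> be the truncations at \<open>B\<close>, with
  \<open>s = sqrt (1 + a')\<close> and \<open>r = sqrt (1 + b')\<close>. From
  \<open>ln x \<le> x - 1\<close> at \<open>x = r / s\<close> one gets \<open>2 * s * s * ln (r / s)
  \<le> 2 * s * (r - s) = r * r - s * s - (r - s) * (r - s)\<close>. The left side is
  \<open>1 + a'\<close> times the difference of logarithms; moving the part with factor 1 to the
  right turns \<open>b' - a'\<close> into a difference of \<open>trunc_dual\<close>.\<close>

lemma trunc_dissipation:
  assumes "a \<ge> 0" "b \<ge> 0" "B > 0"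
  shows "a * (ln (1 + min b B) - ln (1 + min a B))
    \<le> trunc_dual B b - trunc_dual B a - (sqrt (1 + min b B) - sqrt (1 + min a B))\<^sup>2"
proof -
  define a' b' where "a' = min a B" and "b' = min b B"
  have nn: "a' \<ge> 0" "b' \<ge> 0" using assms by (auto simp: a'_def b'_def)
  \<comment> \<open>If \<open>a > B\<close>, then \<open>a' = B\<close> is at least
    \<open>b'\<close>, so the difference of logarithms is at most 0 and lowering the factor
    \<open>a\<close> to \<open>a'\<close> can only increase the product.\<close>
  have *: "a * (ln (1 + b') - ln (1 + a')) \<le> a' * (ln (1 + b') - ln (1 + a'))"
  proof (cases "a \<le> B")
    case False
    then have "ln (1 + b') - ln (1 + a') \<le> 0" using nn by (auto simp: a'_def b'_def)
    then show ?thesis using False by (intro mult_right_mono_neg) (auto simp: a'_def)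
  qed (simp add: a'_def)
  define s r where "s = sqrt (1 + a')" and "r = sqrt (1 + b')"
  have sr: "s > 0" "r > 0" "s\<^sup>2 = 1 + a'" "r\<^sup>2 = 1 + b'" using nn by (auto simp: s_def r_def)
  have "ln (r / s) \<le> r / s - 1" using sr by (intro ln_le_minus_one) auto
  then have "s\<^sup>2 * (2 * ln (r / s)) \<le> s\<^sup>2 * (2 * (r / s - 1))" by (intro mult_left_mono) auto
  also have "\<dots> = r\<^sup>2 - s\<^sup>2 - (r - s)\<^sup>2" using sr(1) by (simp add: field_simps power2_eq_square)
  also have "2 * ln (r / s) = ln (1 + b') - ln (1 + a')"
    using sr by (simp add: ln_div flip: sr(3,4)) (simp add: ln_realpow)
  finally have "(1 + a') * (ln (1 + b') - ln (1 + a')) \<le> b' - a' - (r - s)\<^sup>2"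
    by (simp add: sr(3,4))
  with * show ?thesis
    by (simp add: trunc_dual_def a'_def[symmetric] b'_def[symmetric] s_def[symmetric] r_def[symmetric] algebra_simps)
qed

text \<open>The difference factors as \<open>(s - r) * (s + r)\<close> in the square roots, and
  \<open>e\<close> balances the two factors. In the application the square sums to a Dirichlet form
  that vanishes in the limit, the rest to \<open>e\<close> times a bounded mass; so \<open>e\<close>
  can be fixed before N grows.\<close>

lemma diff_via_sqrt:
  assumes "a \<ge> 0" "b \<ge> 0" "e > 0"
  shows "\<bar>a - b\<bar> \<le> (sqrt (1 + a) - sqrt (1 + b))\<^sup>2 / (2 * e) + e * (2 + a + b)"
proof -
  define s r where "s = sqrt (1 + a)" and "r = sqrt (1 + b)"
  have sr: "s > 0" "r > 0" "s\<^sup>2 = 1 + a" "r\<^sup>2 = 1 + b" using assms by (auto simp: s_def r_def)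
  have "\<bar>a - b\<bar> = \<bar>s - r\<bar> * (s + r)"
  proof -
    have "a - b = (s - r) * (s + r)" using sr(3,4) by (simp add: algebra_simps power2_eq_square)
    then show ?thesis using sr by (simp add: abs_mult)
  qed
  also have "\<dots> \<le> (s - r)\<^sup>2 / (2 * e) + e / 2 * (s + r)\<^sup>2"
  proof -
    have "0 \<le> (\<bar>s - r\<bar> - e * (s + r))\<^sup>2 / (2 * e)" using assms(3) by simp
    also have "\<dots> = (s - r)\<^sup>2 / (2 * e) + e / 2 * (s + r)\<^sup>2 - \<bar>s - r\<bar> * (s + r)"
      using assms by (simp add: power2_diff power_mult_distrib field_simps power2_eq_square)
    finally show ?thesis by simp
  qed
  also have "e / 2 * (s + r)\<^sup>2 \<le> e / 2 * (2 * (s\<^sup>2 + r\<^sup>2))"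
  proof (intro mult_left_mono)
    show "(s + r)\<^sup>2 \<le> 2 * (s\<^sup>2 + r\<^sup>2)" using sum_squares_bound[of s r] by (simp add: power2_sum)
  qed (use assms in auto)
  also have "e / 2 * (2 * (s\<^sup>2 + r\<^sup>2)) = e * (2 + a + b)" by (simp add: sr(3,4))
  finally show ?thesis using sr by (simp add: s_def[symmetric] r_def[symmetric])
qed

text \<open>\<open>D\<close> is not assumed to be integrable. Therefore \<open>Y\<close> minus the
  primitive of \<open>r\<close> is shown to be nonincreasing, instead of integrating
  \<open>D\<close>.\<close>

lemma derivative_bound_imp_le:
  fixes Y :: "real \<Rightarrow> real"
  assumes "0 \<le> \<tau>" "\<tau> \<le> T"
    and der: "\<And>s. s \<in> {0..T} \<Longrightarrow> (Y has_real_derivative D s) (at s within {0..T})"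
    and le: "\<And>s. s \<in> {0..T} \<Longrightarrow> D s \<le> r s"
    and cont: "continuous_on {0..T} r"
  shows "Y \<tau> - Y 0 \<le> integral {0..\<tau>} r"
proof -
  define Z where "Z = (\<lambda>s. Y s - integral {0..s} r)"
  have Z: "(Z has_real_derivative (D s - r s)) (at s within {0..T})" if "s \<in> {0..T}" for s
    unfolding Z_def by (intro derivative_intros der integral_has_real_derivative cont that)
  have "Z \<tau> \<le> Z 0"
  proof (rule DERIV_nonpos_imp_decreasing_open[OF assms(1)])
    fix x assume x: "0 < x" "x < \<tau>"
    then have "at x within {0..T} = at x" using assms by (intro at_within_interior) auto
    with Z[of x] x assms le[of x] show "\<exists>y. (Z has_real_derivative y) (at x) \<and> y \<le> 0"
      by (intro exI[of _ "D x - r x"]) auto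
  next
    have "continuous_on {0..T} Z"
      using Z by (meson DERIV_continuous continuous_on_eq_continuous_within)
    then show "continuous_on {0..\<tau>} Z" by (rule continuous_on_subset) (use assms in auto)
  qed
  then show ?thesis by (simp add: Z_def)
qed

section \<open>The generator as a sum over bonds\<close>

definition nparts :: "nat \<Rightarrow> (int \<Rightarrow> nat) \<Rightarrow> nat" where
  "nparts N \<eta> = (\<Sum>x\<in>sites N. \<eta> x)"

definition bounded_configs :: "nat \<Rightarrow> nat \<Rightarrow> (int \<Rightarrow> nat) set" where
  "bounded_configs N K = {\<eta> \<in> configs N. nparts N \<eta> \<le> K}"

text \<open>The points \<open>\<plusminus>(N + 1)\<close> stand for the reservoirs, whose content is not recorded; the jumps into and out of
  the system then have the same form as those between sites.\<close>

definition add_at :: "nat \<Rightarrow> int \<Rightarrow> (int \<Rightarrow> nat) \<Rightarrow> int \<Rightarrow> nat" where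
  "add_at N x \<xi> = (if x \<in> sites N then \<xi>(x := \<xi> x + 1) else \<xi>)"

text \<open>A bond is named by its left end, so \<open>- int N - 1\<close> and \<open>int N\<close>
  are the bonds to the two reservoirs.\<close>

definition bonds :: "nat \<Rightarrow> int set" where
  "bonds N = {- int N - 1..int N}"

lemma finite_sites [simp, intro]: "finite (sites N)" by (simp add: sites_def)
lemma finite_bonds [simp, intro]: "finite (bonds N)" by (simp add: bonds_def)
lemma card_sites: "card (sites N) = 2 * N + 1" by (simp add: sites_def)
lemma card_bonds: "card (bonds N) = 2 * N + 2" by (simp add: bonds_def)

lemma finite_bounded_configs [simp, intro]: "finite (bounded_configs N K)"
proof (rule finite_subset)
  show "bounded_configs N K \<subseteq> {\<eta>. \<forall>x. (x \<in> sites N \<longrightarrow> \<eta> x \<in> {..K}) \<and> (x \<notin> sites N \<longrightarrow> \<eta> x = 0)}"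
    unfolding bounded_configs_def configs_def nparts_def by (auto intro: order_trans[OF member_le_sum])
  show "finite \<dots>" by (rule finite_set_of_finite_funs) auto
qed

lemma bounded_configs_subset: "bounded_configs N K \<subseteq> configs N" by (auto simp: bounded_configs_def)
lemma bounded_configs_mono: "K \<le> L \<Longrightarrow> bounded_configs N K \<subseteq> bounded_configs N L" by (auto simp: bounded_configs_def)
lemma configs_UN_bounded_configs: "configs N = (\<Union>K. bounded_configs N K)" by (auto simp: bounded_configs_def)

lemma finite_subset_bounded_configs:
  assumes "finite F" "F \<subseteq> configs N" obtains K where "F \<subseteq> bounded_configs N K"
proof
  show "F \<subseteq> bounded_configs N (\<Sum>\<eta>\<in>F. nparts N \<eta>)"
    using assms by (auto simp: bounded_configs_def intro: member_le_sum)
qed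

lemma add_at_configs [simp]: "\<xi> \<in> configs N \<Longrightarrow> add_at N x \<xi> \<in> configs N"
  by (auto simp: add_at_def configs_def)

lemma nparts_add_at: "nparts N (add_at N x \<xi>) = nparts N \<xi> + (if x \<in> sites N then 1 else 0)"
  unfolding nparts_def add_at_def by (auto simp: sum.remove[of "sites N" x])

lemma add_at_inj: "add_at N x \<xi> = add_at N x \<zeta> \<longleftrightarrow> \<xi> = \<zeta>"
  by (auto simp: add_at_def fun_eq_iff split: if_splits)

lemma add_at_outside: "x \<notin> sites N \<Longrightarrow> add_at N x \<xi> = \<xi>" by (simp add: add_at_def)

lemma add_at_bounded_configs: "\<xi> \<in> bounded_configs N K \<Longrightarrow> add_at N x \<xi> \<in> bounded_configs N (Suc K)"
  by (auto simp: bounded_configs_def nparts_add_at)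

text \<open>Later \<open>l\<close> is the whole fugacity profile. As a rate it enters only at the
  reservoir points, where it is the rate of creation.\<close>

definition rate :: "(nat \<Rightarrow> real) \<Rightarrow> nat \<Rightarrow> (int \<Rightarrow> real) \<Rightarrow> int \<Rightarrow> (int \<Rightarrow> nat) \<Rightarrow> real" where
  "rate g N l x \<eta> = (if x \<in> sites N then g (\<eta> x) else l x)"

definition flux :: "(nat \<Rightarrow> real) \<Rightarrow> nat \<Rightarrow> (int \<Rightarrow> real) \<Rightarrow> ((int \<Rightarrow> nat) \<Rightarrow> real) \<Rightarrow> int \<Rightarrow> (int \<Rightarrow> nat) \<Rightarrow> real" where
  "flux g N l p x \<xi> = p (add_at N x \<xi>) * rate g N l x (add_at N x \<xi>)"

text \<open>A jump over a bond is indexed by the configuration \<open>\<xi>\<close> without the jumping particle.  For the point mass \<open>p\<close> at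
  a configuration this is the generator applied to \<open>f\<close> (up to the speed), see \<open>generator_eq_drift\<close>; for the law of the process it is the
  right-hand side of the forward equation.\<close>

definition drift :: "(nat \<Rightarrow> real) \<Rightarrow> nat \<Rightarrow> (int \<Rightarrow> real) \<Rightarrow> ((int \<Rightarrow> nat) \<Rightarrow> real) \<Rightarrow> nat
    \<Rightarrow> ((int \<Rightarrow> nat) \<Rightarrow> real) \<Rightarrow> real" where
  "drift g N l p K f = (\<Sum>\<xi>\<in>bounded_configs N K. \<Sum>x\<in>bonds N.
     flux g N l p x \<xi> * (f (add_at N (x + 1) \<xi>) - f (add_at N x \<xi>))
   + flux g N l p (x + 1) \<xi> * (f (add_at N x \<xi>) - f (add_at N (x + 1) \<xi>)))"

lemma sum_flux_indicator:
  assumes g0: "g 0 = 0" and f: "\<And>\<eta>. \<eta> \<notin> bounded_configs N K \<Longrightarrow> f \<eta> = 0" and \<eta>: "\<eta> \<in> configs N"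
  shows "(\<Sum>\<xi>\<in>bounded_configs N K. flux g N l (\<lambda>\<zeta>. of_bool (\<zeta> = \<eta>)) x \<xi> * (f (add_at N y \<xi>) - f (add_at N x \<xi>)))
    = rate g N l x \<eta> * (f (if x \<in> sites N then move_particle N \<eta> x y else add_at N y \<eta>) - f \<eta>)"
proof (cases "x \<in> sites N \<and> \<eta> x = 0")
  \<comment> \<open>No configuration of the form \<open>add_at N x \<xi>\<close> is empty at
    \<open>x\<close>, so the left side vanishes; on the right the rate \<open>g 0 = 0\<close>
    removes the spurious target of the truncated subtraction.\<close>
  case True
  then have "add_at N x \<xi> \<noteq> \<eta>" for \<xi> by (auto simp: add_at_def)
  then show ?thesis using True g0 by (simp add: flux_def rate_def)
next
  case False
  define \<zeta> where "\<zeta> = (if x \<in> sites N then \<eta>(x := \<eta> x - 1) else \<eta>)"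
  have \<zeta>: "add_at N x \<zeta> = \<eta>" using False by (auto simp: \<zeta>_def add_at_def fun_eq_iff)
  have \<zeta>c: "\<zeta> \<in> configs N" using \<eta> by (auto simp: \<zeta>_def configs_def)
  have mv: "(if x \<in> sites N then move_particle N \<eta> x y else add_at N y \<eta>) = add_at N y \<zeta>"
    by (auto simp: move_particle_def \<zeta>_def add_at_def add_particle_def Let_def)
  have eq: "add_at N x \<xi> = \<eta> \<longleftrightarrow> \<xi> = \<zeta>" for \<xi> using add_at_inj[of N x \<xi> \<zeta>] \<zeta> by auto
  have "(\<Sum>\<xi>\<in>bounded_configs N K. flux g N l (\<lambda>\<zeta>. of_bool (\<zeta> = \<eta>)) x \<xi> * (f (add_at N y \<xi>) - f (add_at N x \<xi>)))
    = (\<Sum>\<xi>\<in>bounded_configs N K. if \<xi> = \<zeta> then rate g N l x \<eta> * (f (add_at N y \<zeta>) - f \<eta>) else 0)"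
    unfolding flux_def eq by (intro sum.cong) (auto simp: \<zeta>)
  also have "\<dots> = (if \<zeta> \<in> bounded_configs N K then rate g N l x \<eta> * (f (add_at N y \<zeta>) - f \<eta>) else 0)"
    by simp
  also have "\<dots> = rate g N l x \<eta> * (f (add_at N y \<zeta>) - f \<eta>)"
  proof (cases "\<zeta> \<in> bounded_configs N K")
    \<comment> \<open>Adding a particle never lowers the number. If \<open>\<zeta>\<close> is
      already beyond the cutoff, so are both ends of the jump, and \<open>f\<close> vanishes at
      both.\<close>
    case False
    then have "nparts N \<zeta> > K" using \<zeta>c by (auto simp: bounded_configs_def)
    then have "add_at N y \<zeta> \<notin> bounded_configs N K" "\<eta> \<notin> bounded_configs N K"
      using nparts_add_at[of N y \<zeta>] nparts_add_at[of N x \<zeta>] \<zeta> by (auto simp: bounded_configs_def)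
    then show ?thesis using f by simp
  qed simp
  finally show ?thesis by (simp only: mv)
qed

text \<open>Over the bonds, jumps to the right are indexed by their start and jumps to the left by
  their target. On each side one index is left over that starts at a reservoir point; it is the
  creation of a particle at that boundary.\<close>

lemma generator_eq_drift:
  assumes g0: "g 0 = 0" and f: "\<And>\<eta>. \<eta> \<notin> bounded_configs N K \<Longrightarrow> f \<eta> = 0" and \<eta>: "\<eta> \<in> configs N"
    and l: "l (int N + 1) = lp s" "l (- int N - 1) = lm s"
  shows "zr_generator \<alpha> g lm lp N s f \<eta>
    = real N powr (2 + \<alpha>) / 2 * drift g N l (\<lambda>\<zeta>. of_bool (\<zeta> = \<eta>)) K f"
proof -
  define A where "A = (\<lambda>x y. rate g N l x \<eta> * (f (if x \<in> sites N then move_particle N \<eta> x y else add_at N y \<eta>) - f \<eta>))"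
  have A: "(\<Sum>\<xi>\<in>bounded_configs N K. flux g N l (\<lambda>\<zeta>. of_bool (\<zeta> = \<eta>)) x \<xi> * (f (add_at N y \<xi>) - f (add_at N x \<xi>))) = A x y" for x y
    unfolding A_def by (rule sum_flux_indicator) (use assms in auto)
  have "drift g N l (\<lambda>\<zeta>. of_bool (\<zeta> = \<eta>)) K f = (\<Sum>x\<in>bonds N. A x (x + 1) + A (x + 1) x)"
    unfolding drift_def sum.swap[of _ "bonds N" "bounded_configs N K"] sum.distrib A ..
  also have "\<dots> = (\<Sum>x\<in>bonds N. A x (x + 1)) + (\<Sum>x\<in>bonds N. A (x + 1) x)"
    by (simp add: sum.distrib)
  also have "bonds N = insert (- int N - 1) (sites N)"
    by (auto simp: bonds_def sites_def)
  also have "(\<Sum>x\<in>insert (- int N - 1) (sites N). A x (x + 1)) = A (- int N - 1) (- int N) + (\<Sum>x\<in>sites N. A x (x + 1))"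
    by (subst sum.insert) (auto simp: sites_def)
  also have "(\<Sum>x\<in>insert (- int N - 1) (sites N). A (x + 1) x) = (\<Sum>x\<in>insert (int N + 1) (sites N). A x (x - 1))"
    by (rule sum.reindex_bij_witness[of _ "\<lambda>x. x - 1" "\<lambda>x. x + 1"]) (auto simp: sites_def)
  also have "\<dots> = A (int N + 1) (int N) + (\<Sum>x\<in>sites N. A x (x - 1))"
    by (subst sum.insert) (auto simp: sites_def)
  finally have *: "drift g N l (\<lambda>\<zeta>. of_bool (\<zeta> = \<eta>)) K f
    = (\<Sum>x\<in>sites N. A x (x + 1) + A x (x - 1)) + (A (int N + 1) (int N) + A (- int N - 1) (- int N))"
    by (simp add: sum.distrib)
  have "(\<Sum>x\<in>sites N. A x (x + 1) + A x (x - 1))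
    = (\<Sum>x\<in>sites N. g (\<eta> x) * (\<Sum>\<sigma>\<in>{1, -1}. f (move_particle N \<eta> x (x + \<sigma>)) - f \<eta>))"
    by (intro sum.cong) (auto simp: A_def rate_def algebra_simps)
  moreover have "A (int N + 1) (int N) = lp s * (f (add_particle \<eta> (int N)) - f \<eta>)"
    "A (- int N - 1) (- int N) = lm s * (f (add_particle \<eta> (- int N)) - f \<eta>)"
    using l by (auto simp: A_def rate_def sites_def add_at_def add_particle_def)
  ultimately show ?thesis unfolding zr_generator_def * by simp
qed

text \<open>The profile is taken at \<open>x / (N + 1)\<close> and not at \<open>x / N\<close>: it then takes the reservoir values at \<open>\<plusminus>(N + 1)\<close>,
  which makes it exactly stationary.\<close>

definition site_fugacity :: "(real \<Rightarrow> real) \<Rightarrow> (real \<Rightarrow> real) \<Rightarrow> nat \<Rightarrow> real \<Rightarrow> int \<Rightarrow> real" where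
  "site_fugacity lm lp N s x = lambda_bar lm lp (of_int x / real (N + 1)) s"

text \<open>All sites have the same normalisation \<open>z\<close>, later the largest value of the partition function.  The weights thus form a
  subprobability only, but their time derivative contains no derivative of the partition function.\<close>

definition ref_weight :: "(nat \<Rightarrow> real) \<Rightarrow> real \<Rightarrow> nat \<Rightarrow> (int \<Rightarrow> real) \<Rightarrow> (int \<Rightarrow> nat) \<Rightarrow> real" where
  "ref_weight g z N l \<xi> = (\<Prod>x\<in>sites N. l x ^ \<xi> x / (gfact g (\<xi> x) * z))"

lemma gfact_0 [simp]: "gfact g 0 = 1" by (simp add: gfact_def)
lemma gfact_Suc [simp]: "gfact g (Suc k) = gfact g k * g (Suc k)" by (simp add: gfact_def)
lemma gfact_pos: "(\<And>k. k > 0 \<Longrightarrow> g k > 0) \<Longrightarrow> gfact g k > 0"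
  unfolding gfact_def by (intro prod_pos) auto

text \<open>The factor \<open>g (Suc k)\<close> that \<open>gfact\<close> gains with a particle
  cancels the jump rate, so under the weight a particle leaves \<open>x\<close> with intensity
  \<open>l x\<close> whatever \<open>\<xi>\<close> is. At a reservoir nothing is added and the rate
  is \<open>l x\<close> itself.\<close>

lemma ref_weight_add_at:
  assumes gpos: "\<And>k. k > 0 \<Longrightarrow> g k > 0"
  shows "ref_weight g z N l (add_at N x \<xi>) * rate g N l x (add_at N x \<xi>) = l x * ref_weight g z N l \<xi>"
proof (cases "x \<in> sites N")
  case True
  have "gfact g k \<noteq> 0" for k using gfact_pos[of g k] gpos by simp
  then show ?thesis
    using True gpos[of "Suc (\<xi> x)"] unfolding ref_weight_def
    by (simp add: prod.remove[of "sites N" x] add_at_def rate_def)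
qed (simp add: add_at_def rate_def)

locale zr_params =
  fixes g :: "nat \<Rightarrow> real" and lm lp lm' lp' :: "real \<Rightarrow> real" and T l0 l1 Lam Cg :: real
  assumes g0: "g 0 = 0" and gpos: "\<And>k. k > 0 \<Longrightarrow> g k > 0" and g_le: "\<And>k. g k \<le> Cg * real k"
    and sm: "\<And>lam. lam > 0 \<Longrightarrow> summable (\<lambda>k. lam ^ k / gfact g k)"
    and T: "T > 0" and l0: "l0 > 0"
    and lm_bounds: "\<And>s. s \<in> {0..T} \<Longrightarrow> l0 \<le> lm s \<and> lm s \<le> l1"
    and lp_bounds: "\<And>s. s \<in> {0..T} \<Longrightarrow> l0 \<le> lp s \<and> lp s \<le> l1"
    and lm_deriv: "\<And>s. s \<in> {0..T} \<Longrightarrow> (lm has_real_derivative lm' s) (at s within {0..T})"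
    and lp_deriv: "\<And>s. s \<in> {0..T} \<Longrightarrow> (lp has_real_derivative lp' s) (at s within {0..T})"
    and lm'_bound: "\<And>s. s \<in> {0..T} \<Longrightarrow> \<bar>lm' s\<bar> \<le> Lam"
    and lp'_bound: "\<And>s. s \<in> {0..T} \<Longrightarrow> \<bar>lp' s\<bar> \<le> Lam"
begin

lemma l01: "l0 \<le> l1" using lm_bounds[of 0] T by auto
lemma l1: "l1 > 0" using l0 l01 by simp
lemma Lam: "Lam \<ge> 0" using lm'_bound[of 0] T by auto
lemma Cg: "Cg > 0" using g_le[of 1] gpos[of 1] by simp
lemma gfp: "gfact g k > 0" using gpos by (rule gfact_pos)

abbreviation lx :: "nat \<Rightarrow> real \<Rightarrow> int \<Rightarrow> real" where "lx \<equiv> site_fugacity lm lp"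
definition Z :: "real \<Rightarrow> real" where "Z = partition_fun g"
abbreviation nm :: "nat \<Rightarrow> real \<Rightarrow> (int \<Rightarrow> nat) \<Rightarrow> real" where "nm N s \<equiv> ref_weight g (Z l1) N (lx N s)"

lemma lambda_bar_convex: "lambda_bar a b r s = (1 + r) / 2 * b s + (1 - r) / 2 * a s"
  by (simp add: lambda_bar_def field_simps)

lemma lb_bounds:
  assumes "r \<in> {-1..1}" "s \<in> {0..T}" shows "l0 \<le> lambda_bar lm lp r s" "lambda_bar lm lp r s \<le> l1"
proof -
  have r: "0 \<le> (1 + r) / 2" "0 \<le> (1 - r) / 2" using assms by auto
  have "(1 + r) / 2 * l0 + (1 - r) / 2 * l0 \<le> lambda_bar lm lp r s"
    unfolding lambda_bar_convex using r lm_bounds lp_bounds assms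
    by (intro add_mono mult_left_mono) auto
  then show "l0 \<le> lambda_bar lm lp r s" by (simp add: field_simps)
  have "lambda_bar lm lp r s \<le> (1 + r) / 2 * l1 + (1 - r) / 2 * l1"
    unfolding lambda_bar_convex using r lm_bounds lp_bounds assms
    by (intro add_mono mult_left_mono) auto
  then show "lambda_bar lm lp r s \<le> l1" by (simp add: field_simps)
qed

lemma lb_deriv:
  assumes "s \<in> {0..T}"
  shows "(lambda_bar lm lp r has_real_derivative lambda_bar lm' lp' r s) (at s within {0..T})"
  unfolding lambda_bar_convex[abs_def]
  by (auto intro!: derivative_eq_intros lm_deriv lp_deriv assms simp: field_simps)

lemma lb_deriv_bound:
  assumes "r \<in> {-1..1}" "s \<in> {0..T}" shows "\<bar>lambda_bar lm' lp' r s\<bar> \<le> Lam"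
proof -
  have r: "0 \<le> (1 + r) / 2" "0 \<le> (1 - r) / 2" using assms by auto
  have "\<bar>lambda_bar lm' lp' r s\<bar> \<le> (1 + r) / 2 * \<bar>lp' s\<bar> + (1 - r) / 2 * \<bar>lm' s\<bar>"
    unfolding lambda_bar_convex using abs_triangle_ineq[of "(1 + r) / 2 * lp' s" "(1 - r) / 2 * lm' s"]
    by (simp only: abs_mult abs_of_nonneg[OF r(1)] abs_of_nonneg[OF r(2)])
  also have "\<dots> \<le> (1 + r) / 2 * Lam + (1 - r) / 2 * Lam"
    using r lm'_bound lp'_bound assms by (intro add_mono mult_left_mono) auto
  finally show ?thesis by (simp add: field_simps)
qed

lemma lb_cont: "continuous_on {0..T} (lambda_bar lm lp r)"
  using lb_deriv by (meson DERIV_continuous continuous_on_eq_continuous_within)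

lemma lx_range: "x \<in> {- int N - 1..int N + 1} \<Longrightarrow> of_int x / real (N + 1) \<in> {-1..1}"
  by (auto simp: field_simps)

lemma bonds_range:
  "x \<in> bonds N \<Longrightarrow> x \<in> {- int N - 1..int N + 1} \<and> x + 1 \<in> {- int N - 1..int N + 1}"
  "x \<in> sites N \<Longrightarrow> x \<in> {- int N - 1..int N + 1}"
  by (auto simp: bonds_def sites_def)

lemma lx_bounds:
  assumes "x \<in> {- int N - 1..int N + 1}" "s \<in> {0..T}" shows "l0 \<le> lx N s x" "lx N s x \<le> l1"
  using lb_bounds[OF lx_range[OF assms(1)] assms(2)] by (auto simp: site_fugacity_def)

lemma lx_pos: "x \<in> {- int N - 1..int N + 1} \<Longrightarrow> s \<in> {0..T} \<Longrightarrow> lx N s x > 0"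
  using lx_bounds[of x N s] l0 by simp

lemma lx_cont: "continuous_on {0..T} (\<lambda>s. lx N s x)"
  using lb_cont by (simp add: site_fugacity_def)

lemma lx_step: "lx N s (x + 1) - lx N s x = (lp s - lm s) / (2 * (N + 1))"
proof -
  have "of_int (x + 1) / real (N + 1) = of_int x / real (N + 1) + 1 / real (N + 1)"
    by (simp add: add_divide_distrib)
  then show ?thesis by (simp add: site_fugacity_def lambda_bar_def algebra_simps)
qed

lemma lx_deriv:
  "s \<in> {0..T} \<Longrightarrow> ((\<lambda>s. lx N s x) has_real_derivative lambda_bar lm' lp' (of_int x / real (N + 1)) s) (at s within {0..T})"
  unfolding site_fugacity_def by (rule lb_deriv)

lemma Z_ge_1: assumes "lam > 0" shows "1 \<le> Z lam"
proof -
  have "(\<Sum>k\<in>{0}. lam ^ k / gfact g k) \<le> Z lam"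
    unfolding Z_def partition_fun_def using assms gfp
    by (intro sum_le_suminf sm) (auto intro: less_imp_le)
  then show ?thesis by simp
qed

lemma Z_mono: "0 < a \<Longrightarrow> a \<le> b \<Longrightarrow> Z a \<le> Z b"
  unfolding Z_def partition_fun_def
  by (intro suminf_le sm) (auto intro!: divide_right_mono power_mono less_imp_le[OF gfp])

lemma pmf_site: "lam > 0 \<Longrightarrow> pmf (site_law g lam) k = lam ^ k / (gfact g k * Z lam)"
  unfolding Z_def by (rule pmf_site_law) (use gpos sm in auto)

lemma nm_pos: "s \<in> {0..T} \<Longrightarrow> nm N s \<xi> > 0"
  unfolding ref_weight_def using gfp Z_ge_1[OF l1]
  by (intro prod_pos divide_pos_pos mult_pos_pos zero_less_power ballI lx_pos) (auto simp: sites_def)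

lemma nm_add_at:
  "nm N s (add_at N x \<xi>) * rate g N (lx N s) x (add_at N x \<xi>) = lx N s x * nm N s \<xi>"
  using ref_weight_add_at gpos by blast

text \<open>Because of the common normalisation \<open>Z l1\<close>, this one probability law
  dominates the weights \<open>nm N s\<close> for all times at once, see
  \<open>nm_le_max_law\<close>. Exponential moments are computed only under it.\<close>

definition max_law :: "nat \<Rightarrow> (int \<Rightarrow> nat) pmf" where
  "max_law N = Pi_pmf (sites N) 0 (\<lambda>_. site_law g l1)"

lemma nm_le_max_law:
  assumes "s \<in> {0..T}" "\<xi> \<in> configs N" shows "nm N s \<xi> \<le> pmf (max_law N) \<xi>"
proof -
  have "pmf (max_law N) \<xi> = (\<Prod>x\<in>sites N. pmf (site_law g l1) (\<xi> x))"
    unfolding max_law_def using assms by (intro pmf_Pi') (auto simp: configs_def)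
  moreover have "nm N s \<xi> \<le> (\<Prod>x\<in>sites N. pmf (site_law g l1) (\<xi> x))"
    unfolding ref_weight_def
  proof (intro prod_mono conjI)
    fix x assume "x \<in> sites N"
    then have "l0 \<le> lx N s x" "lx N s x \<le> l1" using lx_bounds bonds_range assms by auto
    then have l: "0 < lx N s x" "lx N s x \<le> l1" using l0 by auto
    have "gfact g (\<xi> x) * Z l1 > 0" using gfp Z_ge_1[OF l1] by (intro mult_pos_pos) auto
    then show "0 \<le> lx N s x ^ \<xi> x / (gfact g (\<xi> x) * Z l1)"
      "lx N s x ^ \<xi> x / (gfact g (\<xi> x) * Z l1) \<le> pmf (site_law g l1) (\<xi> x)"
      using l l1 by (auto simp: pmf_site intro!: divide_right_mono power_mono)
  qed
  ultimately show ?thesis by simp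
qed

lemma sum_pmf_weight_le:
  fixes W :: "'b \<Rightarrow> real" and Q :: "'b pmf"
  assumes "finite F" "\<And>\<xi>. \<xi> \<in> F \<Longrightarrow> W \<xi> \<ge> 0" "c \<ge> 0"
    and "(\<integral>\<^sup>+\<xi>. ennreal (W \<xi>) \<partial>measure_pmf Q) \<le> ennreal c"
  shows "(\<Sum>\<xi>\<in>F. pmf Q \<xi> * W \<xi>) \<le> c"
proof -
  have "ennreal (\<Sum>\<xi>\<in>F. pmf Q \<xi> * W \<xi>) = (\<Sum>\<xi>\<in>F. ennreal (W \<xi>) * emeasure (measure_pmf Q) {\<xi>})"
    using assms by (subst sum_ennreal[symmetric])
      (auto simp: emeasure_pmf_single ennreal_mult'' mult.commute intro!: sum.cong)
  also have "\<dots> = (\<integral>\<^sup>+\<xi>. (\<Sum>\<zeta>\<in>F. ennreal (W \<zeta>) * indicator {\<zeta>} \<xi>) \<partial>measure_pmf Q)"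
    by (subst nn_integral_sum) (auto simp: nn_integral_cmult_indicator)
  also have "\<dots> \<le> (\<integral>\<^sup>+\<xi>. ennreal (W \<xi>) \<partial>measure_pmf Q)"
  proof (intro nn_integral_mono)
    fix \<xi>
    have "(\<Sum>\<zeta>\<in>F. ennreal (W \<zeta>) * indicator {\<zeta>} \<xi>) = (if \<xi> \<in> F then ennreal (W \<xi>) else 0)"
      using assms(1) by (auto simp: indicator_def sum.delta if_distrib[of "\<lambda>x. _ * x"] cong: if_cong)
    then show "(\<Sum>\<zeta>\<in>F. ennreal (W \<zeta>) * indicator {\<zeta>} \<xi>) \<le> ennreal (W \<xi>)" by simp
  qed
  finally show ?thesis using assms(3,4) by (metis ennreal_le_iff order_trans)
qed

lemma nm_weight_le:
  assumes "s \<in> {0..T}" "finite F" "F \<subseteq> configs N" "\<And>\<xi>. W \<xi> \<ge> 0" "c \<ge> 0"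
    and "(\<integral>\<^sup>+\<xi>. ennreal (W \<xi>) \<partial>measure_pmf (max_law N)) \<le> ennreal c"
  shows "(\<Sum>\<xi>\<in>F. nm N s \<xi> * W \<xi>) \<le> c"
proof -
  have "(\<Sum>\<xi>\<in>F. nm N s \<xi> * W \<xi>) \<le> (\<Sum>\<xi>\<in>F. pmf (max_law N) \<xi> * W \<xi>)"
    using assms by (intro sum_mono mult_right_mono nm_le_max_law) auto
  also have "\<dots> \<le> c" using assms by (intro sum_pmf_weight_le) auto
  finally show ?thesis .
qed

lemma nm_mass_le: "s \<in> {0..T} \<Longrightarrow> finite F \<Longrightarrow> F \<subseteq> configs N \<Longrightarrow> (\<Sum>\<xi>\<in>F. nm N s \<xi>) \<le> 1"
  using nm_weight_le[of s F N "\<lambda>_. 1" 1] by simp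

lemma nn_integral_site:
  assumes "lam > 0"
  shows "(\<integral>\<^sup>+k. ennreal (exp (real k)) \<partial>measure_pmf (site_law g lam)) = ennreal (Z (exp 1 * lam) / Z lam)"
proof -
  have "(\<integral>\<^sup>+k. ennreal (exp (real k)) \<partial>measure_pmf (site_law g lam))
    = (\<integral>\<^sup>+k. ennreal ((exp 1 * lam) ^ k / gfact g k / Z lam) \<partial>count_space UNIV)"
    unfolding nn_integral_measure_pmf
  proof (intro nn_integral_cong)
    fix k :: nat
    show "ennreal (pmf (site_law g lam) k) * ennreal (exp (real k)) = ennreal ((exp 1 * lam) ^ k / gfact g k / Z lam)"
    proof -
      have e: "exp (real k) = exp 1 ^ k" using exp_of_nat_mult[of k "1::real"] by simp
      have "pmf (site_law g lam) k * exp (real k) = (exp 1 * lam) ^ k / gfact g k / Z lam"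
        unfolding e power_mult_distrib pmf_site[OF assms] by simp
      then show ?thesis by (simp add: ennreal_mult''[symmetric])
    qed
  qed
  also have "\<dots> = (\<Sum>k. ennreal ((exp 1 * lam) ^ k / gfact g k / Z lam))"
    by (rule nn_integral_count_space_nat)
  also have "\<dots> = ennreal (Z (exp 1 * lam) / Z lam)"
  proof (rule suminf_ennreal_eq)
    show "(\<lambda>i. (exp 1 * lam) ^ i / gfact g i / Z lam) sums (Z (exp 1 * lam) / Z lam)"
      unfolding Z_def partition_fun_def using assms by (intro sums_divide summable_sums sm) auto
    show "0 \<le> (exp 1 * lam) ^ i / gfact g i / Z lam" for i
      using gfp[of i] Z_ge_1[OF assms] assms by (intro divide_nonneg_nonneg) auto
  qed
  finally show ?thesis .
qed

text \<open>Three times the logarithmic moment generating function of a site at 1, since there are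
  \<open>2 * N + 1 \<le> 3 * N\<close> sites.\<close>

definition mgf_const :: real where "mgf_const = 3 * ln (Z (exp 1 * l1) / Z l1)"

lemma mgf_const_nonneg: "mgf_const \<ge> 0"
proof -
  have "l1 \<le> exp 1 * l1" using l1 by simp
  then have "Z l1 \<le> Z (exp 1 * l1)" by (rule Z_mono[OF l1])
  then show ?thesis using Z_ge_1[OF l1] by (simp add: mgf_const_def)
qed

lemma nn_integral_exp_nparts:
  fixes p :: "int \<Rightarrow> real"
  assumes "N \<ge> 1" "\<And>x. x \<in> sites N \<Longrightarrow> 0 < p x \<and> Z (exp 1 * p x) / Z (p x) \<le> exp (c / 3)" "c \<ge> 0"
  shows "(\<integral>\<^sup>+\<xi>. ennreal (exp (real (nparts N \<xi>))) \<partial>measure_pmf (Pi_pmf (sites N) 0 (\<lambda>x. site_law g (p x))))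
     \<le> ennreal (exp (c * N))"
proof -
  have "(\<integral>\<^sup>+\<xi>. ennreal (exp (real (nparts N \<xi>))) \<partial>measure_pmf (Pi_pmf (sites N) 0 (\<lambda>x. site_law g (p x))))
    = (\<integral>\<^sup>+\<xi>. (\<Prod>x\<in>sites N. ennreal (exp (real (\<xi> x)))) \<partial>measure_pmf (Pi_pmf (sites N) 0 (\<lambda>x. site_law g (p x))))"
    by (simp add: nparts_def exp_sum prod_ennreal)
  also have "\<dots> = (\<Prod>x\<in>sites N. ennreal (Z (exp 1 * p x) / Z (p x)))"
    using assms by (subst nn_integral_prod_Pi_pmf) (auto simp: nn_integral_site)
  also have "\<dots> \<le> (\<Prod>x\<in>sites N. ennreal (exp (c / 3)))"
    using assms by (intro prod_mono_ennreal ennreal_leI) auto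
  also have "\<dots> = ennreal (exp (real (2 * N + 1) * (c / 3)))"
    by (simp only: prod_constant card_sites ennreal_power exp_ge_zero exp_of_nat_mult)
  also have "\<dots> \<le> ennreal (exp (c * N))"
  proof -
    have "real (2 * N + 1) * (c / 3) \<le> (3 * real N) * (c / 3)"
      using assms by (intro mult_right_mono) auto
    then show ?thesis by (intro ennreal_leI) (simp add: mult.commute)
  qed
  finally show ?thesis .
qed

lemma max_law_exp_nparts:
  assumes "N \<ge> 1"
  shows "(\<integral>\<^sup>+\<xi>. ennreal (exp (real (nparts N \<xi>))) \<partial>measure_pmf (max_law N)) \<le> ennreal (exp (mgf_const * N))"
  unfolding max_law_def
proof (rule nn_integral_exp_nparts[OF assms])
  show "0 < l1 \<and> Z (exp 1 * l1) / Z l1 \<le> exp (mgf_const / 3)" if "x \<in> sites N" for x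
    using l1 Z_ge_1[of l1] Z_ge_1[of "exp 1 * l1"] by (simp add: mgf_const_def)
qed (rule mgf_const_nonneg)

text \<open>With a normalisation that does not depend on time, the logarithmic derivative is the sum
  of \<open>\<xi> x\<close> times the logarithmic derivative of the fugacity. It grows only linearly
  in the particle number, which the entropy inequality can absorb.\<close>

lemma nm_deriv:
  assumes s: "s \<in> {0..T}"
  shows "\<exists>d. ((\<lambda>s. nm N s \<xi>) has_real_derivative d) (at s within {0..T}) \<and> \<bar>d\<bar> \<le> nm N s \<xi> * (Lam / l0 * nparts N \<xi>)"
proof -
  define k where "k = (\<Prod>x\<in>sites N. 1 / (gfact g (\<xi> x) * Z l1))"
  define D where "D = (\<Sum>x\<in>sites N. real (\<xi> x) * (lambda_bar lm' lp' (of_int x / real (N + 1)) s / lx N s x))"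
  have eq: "nm N u \<xi> = exp (\<Sum>x\<in>sites N. real (\<xi> x) * ln (lx N u x)) * k" if "u \<in> {0..T}" for u
  proof -
    have "exp (\<Sum>x\<in>sites N. real (\<xi> x) * ln (lx N u x)) = (\<Prod>x\<in>sites N. lx N u x ^ \<xi> x)"
      unfolding exp_sum[OF finite_sites]
      by (intro prod.cong refl) (simp add: exp_of_nat_mult lx_pos[OF bonds_range(2) that])
    then show ?thesis by (simp add: ref_weight_def k_def flip: prod.distrib)
  qed
  have "((\<lambda>u. exp (\<Sum>x\<in>sites N. real (\<xi> x) * ln (lx N u x)) * k) has_real_derivative
      exp (\<Sum>x\<in>sites N. real (\<xi> x) * ln (lx N s x)) * D * k) (at s within {0..T})"
    unfolding D_def
    by (auto intro!: derivative_eq_intros lx_deriv s sum.cong lx_pos[OF bonds_range(2) s] simp: divide_inverse)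
  moreover have "exp (\<Sum>x\<in>sites N. real (\<xi> x) * ln (lx N s x)) * D * k = nm N s \<xi> * D"
    using eq[OF s] by (simp add: mult_ac)
  ultimately have "((\<lambda>u. nm N u \<xi>) has_real_derivative nm N s \<xi> * D) (at s within {0..T})"
    using has_field_derivative_transform_within[OF _ zero_less_one s, of _ _ "\<lambda>u. nm N u \<xi>"] eq by auto
  moreover have "\<bar>nm N s \<xi> * D\<bar> \<le> nm N s \<xi> * (Lam / l0 * nparts N \<xi>)"
  proof -
    have "\<bar>D\<bar> \<le> (\<Sum>x\<in>sites N. real (\<xi> x) * (Lam / l0))"
      unfolding D_def
    proof (rule order_trans[OF sum_abs], intro sum_mono)
      fix x assume x: "x \<in> sites N"
      have "\<bar>lambda_bar lm' lp' (of_int x / real (N + 1)) s\<bar> / lx N s x \<le> Lam / l0"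
        using lb_deriv_bound[OF lx_range[OF bonds_range(2)[OF x]] s] lx_bounds[OF bonds_range(2)[OF x] s] l0 Lam
        by (intro frac_le) auto
      then have "\<bar>lambda_bar lm' lp' (of_int x / real (N + 1)) s / lx N s x\<bar> \<le> Lam / l0"
        using lx_pos[OF bonds_range(2)[OF x] s] by (simp only: abs_divide abs_of_pos)
      then show "\<bar>real (\<xi> x) * (lambda_bar lm' lp' (of_int x / real (N + 1)) s / lx N s x)\<bar> \<le> real (\<xi> x) * (Lam / l0)"
        unfolding abs_mult by (intro mult_mono) auto
    qed
    also have "\<dots> = Lam / l0 * nparts N \<xi>" by (simp add: nparts_def sum_distrib_left mult.commute)
    finally have "nm N s \<xi> * \<bar>D\<bar> \<le> nm N s \<xi> * (Lam / l0 * nparts N \<xi>)"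
      using nm_pos[OF s, of N \<xi>] by (intro mult_left_mono) auto
    then show ?thesis using nm_pos[OF s, of N \<xi>] by (simp only: abs_mult abs_of_pos)
  qed
  ultimately show ?thesis by blast
qed

lemma nm_cont: "continuous_on {0..T} (\<lambda>s. nm N s \<xi>)"
  using nm_deriv by (meson DERIV_continuous continuous_on_eq_continuous_within)

lemma nm_lower: "\<exists>c>0. \<forall>s\<in>{0..T}. c \<le> nm N s \<xi>"
proof -
  have "\<exists>x\<in>{0..T}. \<forall>y\<in>{0..T}. nm N x \<xi> \<le> nm N y \<xi>"
    using T by (intro continuous_attains_inf nm_cont) auto
  then show ?thesis using nm_pos by blast
qed

end

text \<open>The function tested in the entropy production changes with time, whereas the forward
  equation is stated for fixed functions. So it is applied to single configurations, and their
  contributions are reassembled here.\<close>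

lemma drift_linear:
  assumes f: "\<And>\<eta>. \<eta> \<notin> bounded_configs N K \<Longrightarrow> f \<eta> = 0"
  shows "drift g N l p K f = (\<Sum>\<zeta>\<in>bounded_configs N K. f \<zeta> * drift g N l p K (\<lambda>\<eta>. of_bool (\<eta> = \<zeta>)))"
proof -
  define H where "H = (\<lambda>\<zeta> \<xi> x. f \<zeta> *
     (flux g N l p x \<xi> * (of_bool (add_at N (x + 1) \<xi> = \<zeta>) - of_bool (add_at N x \<xi> = \<zeta>))
   + flux g N l p (x + 1) \<xi> * (of_bool (add_at N x \<xi> = \<zeta>) - of_bool (add_at N (x + 1) \<xi> = \<zeta>))))"
  have f': "f \<eta> = (\<Sum>\<zeta>\<in>bounded_configs N K. f \<zeta> * of_bool (\<eta> = \<zeta>))" for \<eta>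
    using f[of \<eta>] by (cases "\<eta> \<in> bounded_configs N K") (auto simp: of_bool_def if_distrib[of "\<lambda>x. _ * x"] cong: if_cong)
  have fd: "f a - f b = (\<Sum>\<zeta>\<in>bounded_configs N K. f \<zeta> * (of_bool (a = \<zeta>) - of_bool (b = \<zeta>)))" for a b
    unfolding right_diff_distrib sum_subtractf f'[of a, symmetric] f'[of b, symmetric] ..
  have "(\<Sum>\<zeta>\<in>bounded_configs N K. f \<zeta> * drift g N l p K (\<lambda>\<eta>. of_bool (\<eta> = \<zeta>)))
    = (\<Sum>\<zeta>\<in>bounded_configs N K. \<Sum>\<xi>\<in>bounded_configs N K. \<Sum>x\<in>bonds N. H \<zeta> \<xi> x)"
    unfolding drift_def sum_distrib_left H_def ..
  also have "\<dots> = (\<Sum>\<xi>\<in>bounded_configs N K. \<Sum>\<zeta>\<in>bounded_configs N K. \<Sum>x\<in>bonds N. H \<zeta> \<xi> x)"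
    by (rule sum.swap)
  also have "\<dots> = (\<Sum>\<xi>\<in>bounded_configs N K. \<Sum>x\<in>bonds N. \<Sum>\<zeta>\<in>bounded_configs N K. H \<zeta> \<xi> x)"
    by (intro sum.cong refl sum.swap)
  also have "\<dots> = drift g N l p K f"
    unfolding drift_def fd H_def
    by (simp only: sum_distrib_left sum.distrib[symmetric] distrib_left mult.left_commute)
  finally show ?thesis ..
qed

lemma sum_bonds_telescope:
  fixes F :: "int \<Rightarrow> real"
  shows "(\<Sum>x\<in>bonds N. F (x + 1) - F x) = F (int N + 1) - F (- int N - 1)"
proof -
  have b: "bonds N = insert (- int N - 1) (sites N)"
    by (auto simp: bonds_def sites_def)
  have "(\<Sum>x\<in>bonds N. F (x + 1)) = (\<Sum>x\<in>insert (int N + 1) (sites N). F x)"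
    by (rule sum.reindex_bij_witness[of _ "\<lambda>x. x - 1" "\<lambda>x. x + 1"]) (auto simp: sites_def bonds_def)
  also have "\<dots> = F (int N + 1) + (\<Sum>x\<in>sites N. F x)"
    by (subst sum.insert) (auto simp: sites_def)
  finally have "(\<Sum>x\<in>bonds N. F (x + 1)) = F (int N + 1) + (\<Sum>x\<in>sites N. F x)" .
  moreover have "(\<Sum>x\<in>bonds N. F x) = F (- int N - 1) + (\<Sum>x\<in>sites N. F x)"
    unfolding b by (subst sum.insert) (auto simp: sites_def)
  ultimately show ?thesis by (simp add: sum_subtractf)
qed

section \<open>Entropy and Dirichlet form bounds\<close>

text \<open>The estimates in this locale use only the one-time laws and the forward equation; the
  process itself returns in \<open>zr_proc\<close>. The entropy bound is stated for finite partial
  sums: the terms are nonnegative, so nothing is lost, and no summability has to be known.\<close>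

locale zr_evol = zr_params +
  fixes N :: nat and c C0 :: real and P :: "real \<Rightarrow> (int \<Rightarrow> nat) pmf"
  assumes N: "N \<ge> 1" and c: "c > 0"
    and P_configs: "\<And>s. s \<in> {0..T} \<Longrightarrow> set_pmf (P s) \<subseteq> configs N"
    and forward: "\<And>K f s. (\<And>\<eta>. \<eta> \<notin> bounded_configs N K \<Longrightarrow> f \<eta> = 0) \<Longrightarrow> s \<in> {0..T} \<Longrightarrow>
        ((\<lambda>s. \<Sum>\<zeta>\<in>bounded_configs N K. f \<zeta> * pmf (P s) \<zeta>) has_real_derivative
          c * drift g N (lx N s) (pmf (P s)) K f) (at s within {0..T})"
    and init: "\<And>F. finite F \<Longrightarrow> F \<subseteq> configs N \<Longrightarrow>
        (\<Sum>\<xi>\<in>F. nm N 0 \<xi> * ent (pmf (P 0) \<xi> / nm N 0 \<xi>)) \<le> C0 * N"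
begin

definition rel_density :: "real \<Rightarrow> (int \<Rightarrow> nat) \<Rightarrow> real" where
  "rel_density s \<xi> = pmf (P s) \<xi> / nm N s \<xi>"

text \<open>Piecewise linear and not an indicator: adding a particle changes it by at most
  \<open>1 / K\<close>, and this times the total flux tends to 0 as \<open>K\<close> grows.\<close>

definition chi :: "nat \<Rightarrow> (int \<Rightarrow> nat) \<Rightarrow> real" where
  "chi K \<xi> = max 0 (1 - nparts N \<xi> / K)"

definition cutoff_entropy :: "nat \<Rightarrow> real \<Rightarrow> real \<Rightarrow> real" where
  "cutoff_entropy K B s = (\<Sum>\<xi>\<in>bounded_configs N K. chi K \<xi> * (nm N s \<xi> * trunc_ent B (rel_density s \<xi>)))"

definition dissipation :: "nat \<Rightarrow> real \<Rightarrow> real \<Rightarrow> real" where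
  "dissipation K B s = (\<Sum>\<xi>\<in>bounded_configs N K. \<Sum>x\<in>bonds N. chi K \<xi> * (nm N s \<xi> *
     (sqrt (1 + min (rel_density s (add_at N (x + 1) \<xi>)) B) - sqrt (1 + min (rel_density s (add_at N x \<xi>)) B))\<^sup>2))"

abbreviation law_flux :: "real \<Rightarrow> int \<Rightarrow> (int \<Rightarrow> nat) \<Rightarrow> real" where
  "law_flux s \<equiv> flux g N (lx N s) (pmf (P s))"

definition cutoff_flux :: "nat \<Rightarrow> real \<Rightarrow> real" where
  "cutoff_flux K s = (\<Sum>\<xi>\<in>bounded_configs N K. \<Sum>x\<in>bonds N. law_flux s x \<xi> + law_flux s (x + 1) \<xi>)"

lemma C0: "C0 \<ge> 0"
proof -
  have "0 \<le> C0 * N" using init[of "{}"] by simp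
  then show ?thesis using N by (simp add: zero_le_mult_iff)
qed

lemma pmf_deriv:
  assumes "\<xi> \<in> bounded_configs N K" "s \<in> {0..T}"
  shows "((\<lambda>s. pmf (P s) \<xi>) has_real_derivative c * drift g N (lx N s) (pmf (P s)) K (\<lambda>\<eta>. of_bool (\<eta> = \<xi>)))
    (at s within {0..T})"
proof -
  have "(\<Sum>\<zeta>\<in>bounded_configs N K. of_bool (\<zeta> = \<xi>) * pmf (P s) \<zeta>) = pmf (P s) \<xi>" for s
    using assms(1) by (auto simp: of_bool_def if_distrib[of "\<lambda>x. x * _"] cong: if_cong)
  then show ?thesis using forward[of K "\<lambda>\<eta>. of_bool (\<eta> = \<xi>)" s] assms by auto
qed

lemma pmf_cont:
  assumes "\<xi> \<in> configs N" shows "continuous_on {0..T} (\<lambda>s. pmf (P s) \<xi>)"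
proof -
  obtain K where "\<xi> \<in> bounded_configs N K" using assms configs_UN_bounded_configs by auto
  from pmf_deriv[OF this] show ?thesis by (meson DERIV_continuous continuous_on_eq_continuous_within)
qed

lemma rel_density_cont: "\<xi> \<in> configs N \<Longrightarrow> continuous_on {0..T} (\<lambda>s. rel_density s \<xi>)"
  unfolding rel_density_def by (intro continuous_on_divide pmf_cont nm_cont) (metis less_irrefl nm_pos)+

lemma rel_density_nonneg: "s \<in> {0..T} \<Longrightarrow> rel_density s \<xi> \<ge> 0"
  unfolding rel_density_def using nm_pos[of s N \<xi>] by simp

lemma nm_dens: "s \<in> {0..T} \<Longrightarrow> nm N s \<xi> * rel_density s \<xi> = pmf (P s) \<xi>"
  unfolding rel_density_def using nm_pos[of s N \<xi>] by simp

lemma flux_eq: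
  assumes "s \<in> {0..T}"
  shows "law_flux s x \<xi> = lx N s x * nm N s \<xi> * rel_density s (add_at N x \<xi>)"
  unfolding flux_def nm_add_at[symmetric] using nm_dens[OF assms, of "add_at N x \<xi>"] by (simp add: mult_ac)

lemma chi_bounds: "0 \<le> chi K \<xi>" "chi K \<xi> \<le> 1"
  by (auto simp: chi_def)

lemma chi_add_at:
  assumes "K \<ge> 1" shows "chi K (add_at N x \<xi>) \<le> chi K \<xi>" "chi K \<xi> - 1 / K \<le> chi K (add_at N x \<xi>)"
proof -
  have "0 \<le> 1 / real K" by simp
  then show "chi K (add_at N x \<xi>) \<le> chi K \<xi>" "chi K \<xi> - 1 / K \<le> chi K (add_at N x \<xi>)"
    by (auto simp only: chi_def nparts_add_at of_nat_add of_nat_1 of_nat_0 add_divide_distrib max_def split: if_split)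
qed

lemma chi_outside: "K \<ge> 1 \<Longrightarrow> \<eta> \<in> configs N \<Longrightarrow> \<eta> \<notin> bounded_configs N K \<Longrightarrow> chi K \<eta> = 0"
  by (auto simp: chi_def bounded_configs_def)

lemma law_flux_nonneg: "s \<in> {0..T} \<Longrightarrow> x \<in> {- int N - 1..int N + 1} \<Longrightarrow> 0 \<le> law_flux s x \<xi>"
  using flux_eq[of s x \<xi>] lx_pos[of x N s] nm_pos[of s N \<xi>] rel_density_nonneg[of s "add_at N x \<xi>"] by simp

text \<open>The cutoff is evaluated at \<open>\<xi>\<close> instead of at the configurations before and after the jump, at the price of the last term,
  which vanishes in the time integral as \<open>K\<close> tends to infinity.\<close>

lemma flux_term_bound:
  assumes s: "s \<in> {0..T}" and x: "x \<in> {- int N - 1..int N + 1}" and "K \<ge> 1" "B > 0"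
  defines "f \<equiv> rel_density s"
  shows "law_flux s x \<xi> * (chi K (add_at N y \<xi>) * ln (1 + min (f (add_at N y \<xi>)) B)
          - chi K (add_at N x \<xi>) * ln (1 + min (f (add_at N x \<xi>)) B))
    \<le> chi K \<xi> * (nm N s \<xi> * (lx N s x * (trunc_dual B (f (add_at N y \<xi>)) - trunc_dual B (f (add_at N x \<xi>)))))
      - l0 * (chi K \<xi> * (nm N s \<xi> * (sqrt (1 + min (f (add_at N y \<xi>)) B) - sqrt (1 + min (f (add_at N x \<xi>)) B))\<^sup>2))
      + ln (1 + B) / K * law_flux s x \<xi>"
proof -
  define a b where "a = f (add_at N x \<xi>)" and "b = f (add_at N y \<xi>)"
  define La Lb where "La = ln (1 + min a B)" and "Lb = ln (1 + min b B)"
  define D where "D = (sqrt (1 + min b B) - sqrt (1 + min a B))\<^sup>2"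
  have ab: "a \<ge> 0" "b \<ge> 0" using rel_density_nonneg[OF s] by (auto simp: a_def b_def f_def)
  have L: "0 \<le> La" "La \<le> ln (1 + B)" "0 \<le> Lb" using ab \<open>B > 0\<close> by (auto simp: La_def Lb_def)
  have D: "0 \<le> D" by (simp add: D_def)
  have w: "0 \<le> lx N s x * nm N s \<xi>" "l0 * nm N s \<xi> \<le> lx N s x * nm N s \<xi>"
    using lx_bounds[OF x s] l0 nm_pos[OF s, of N \<xi>] by auto
  have law_flux: "law_flux s x \<xi> = lx N s x * nm N s \<xi> * a" using flux_eq[OF s] by (simp add: a_def f_def)
  have "chi K (add_at N y \<xi>) * Lb - chi K (add_at N x \<xi>) * La \<le> chi K \<xi> * Lb - (chi K \<xi> - 1 / K) * La"
    using L chi_add_at[OF \<open>K \<ge> 1\<close>] by (intro diff_mono mult_right_mono) auto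
  also have "\<dots> \<le> chi K \<xi> * (Lb - La) + ln (1 + B) / K"
    using divide_right_mono[OF L(2), of "real K"] by (simp add: algebra_simps)
  finally have "law_flux s x \<xi> * (chi K (add_at N y \<xi>) * Lb - chi K (add_at N x \<xi>) * La)
    \<le> law_flux s x \<xi> * (chi K \<xi> * (Lb - La) + ln (1 + B) / K)"
    by (intro mult_left_mono law_flux_nonneg s x)
  also have "\<dots> = chi K \<xi> * (lx N s x * nm N s \<xi>) * (a * (Lb - La)) + ln (1 + B) / K * law_flux s x \<xi>"
    unfolding law_flux by (simp add: algebra_simps)
  also have "a * (Lb - La) \<le> trunc_dual B b - trunc_dual B a - D"
    unfolding La_def Lb_def D_def by (rule trunc_dissipation) (use ab \<open>B > 0\<close> in auto)
  also have "chi K \<xi> * (lx N s x * nm N s \<xi>) * (trunc_dual B b - trunc_dual B a - D)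
    \<le> chi K \<xi> * (nm N s \<xi> * (lx N s x * (trunc_dual B b - trunc_dual B a))) - l0 * (chi K \<xi> * (nm N s \<xi> * D))"
  proof -
    have "chi K \<xi> * (l0 * nm N s \<xi>) * D \<le> chi K \<xi> * (lx N s x * nm N s \<xi>) * D"
      by (rule mult_right_mono[OF mult_left_mono[OF w(2) chi_bounds(1)] D])
    then show ?thesis by (simp add: algebra_simps)
  qed
  finally show ?thesis
    using chi_bounds[of K \<xi>] w by (simp add: a_def b_def La_def Lb_def D_def mult_left_mono)
qed

text \<open>The \<open>trunc_dual\<close> differences cancel: the fugacity is linear in the position, so over the bonds they form a telescoping sum
  with equal contributions of the two reservoirs.\<close>

lemma drift_entropy_bound:
  assumes s: "s \<in> {0..T}" and K: "K \<ge> 1" and B: "B > 0"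
  shows "drift g N (lx N s) (pmf (P s)) K (\<lambda>\<eta>. chi K \<eta> * ln (1 + min (rel_density s \<eta>) B))
    \<le> - 2 * l0 * dissipation K B s + ln (1 + B) / K * cutoff_flux K s"
proof -
  define d where "d = (lp s - lm s) / (2 * real (N + 1))"
  define D where "D = (\<lambda>x \<xi>. chi K \<xi> * (nm N s \<xi> *
     (sqrt (1 + min (rel_density s (add_at N (x + 1) \<xi>)) B) - sqrt (1 + min (rel_density s (add_at N x \<xi>)) B))\<^sup>2))"
  define F where "F = (\<lambda>\<xi> x. trunc_dual B (rel_density s (add_at N x \<xi>)))"
  have F: "trunc_dual B (rel_density s (add_at N x \<xi>)) = F \<xi> x" for x \<xi> by (simp add: F_def)
  have D: "chi K \<xi> * (nm N s \<xi> * (sqrt (1 + min (rel_density s (add_at N (x + 1) \<xi>)) B) - sqrt (1 + min (rel_density s (add_at N x \<xi>)) B))\<^sup>2) = D x \<xi>" for x \<xi>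
    by (simp add: D_def)
  define E where "E = (\<lambda>x \<xi>. law_flux s x \<xi> + law_flux s (x + 1) \<xi>)"
  have E: "law_flux s x \<xi> + law_flux s (x + 1) \<xi> = E x \<xi>" for x \<xi> by (simp add: E_def)
  have bond: "law_flux s x \<xi> * (chi K (add_at N (x + 1) \<xi>) * ln (1 + min (rel_density s (add_at N (x + 1) \<xi>)) B)
          - chi K (add_at N x \<xi>) * ln (1 + min (rel_density s (add_at N x \<xi>)) B))
      + law_flux s (x + 1) \<xi> * (chi K (add_at N x \<xi>) * ln (1 + min (rel_density s (add_at N x \<xi>)) B)
          - chi K (add_at N (x + 1) \<xi>) * ln (1 + min (rel_density s (add_at N (x + 1) \<xi>)) B))
     \<le> - (chi K \<xi> * nm N s \<xi> * d) * (F \<xi> (x + 1) - F \<xi> x) - 2 * l0 * D x \<xi>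
       + ln (1 + B) / K * (law_flux s x \<xi> + law_flux s (x + 1) \<xi>)" if "x \<in> bonds N" for x \<xi>
  proof -
    have x: "x \<in> {- int N - 1..int N + 1}" "x + 1 \<in> {- int N - 1..int N + 1}"
      using bonds_range(1)[OF that] by auto
    have sq: "(sqrt (1 + min (rel_density s (add_at N x \<xi>)) B) - sqrt (1 + min (rel_density s (add_at N (x + 1) \<xi>)) B))\<^sup>2
      = (sqrt (1 + min (rel_density s (add_at N (x + 1) \<xi>)) B) - sqrt (1 + min (rel_density s (add_at N x \<xi>)) B))\<^sup>2"
      by (rule power2_commute)
    have "lx N s x * (F \<xi> (x + 1) - F \<xi> x) + lx N s (x + 1) * (F \<xi> x - F \<xi> (x + 1)) = - d * (F \<xi> (x + 1) - F \<xi> x)"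
    proof -
      have st: "lx N s (x + 1) = lx N s x + d" using lx_step[of N s x] by (simp add: d_def)
      show ?thesis unfolding st by (simp add: algebra_simps)
    qed
    then have eq: "chi K \<xi> * (nm N s \<xi> * (lx N s x * (F \<xi> (x + 1) - F \<xi> x)))
      + chi K \<xi> * (nm N s \<xi> * (lx N s (x + 1) * (F \<xi> x - F \<xi> (x + 1))))
      = - (chi K \<xi> * nm N s \<xi> * d) * (F \<xi> (x + 1) - F \<xi> x)"
      by (simp only: distrib_left[symmetric] mult.assoc mult_minus_left mult_minus_right)
    define W where "W = ln (1 + B) / K"
    show ?thesis
      using flux_term_bound[OF s x(1) K B, of \<xi> "x + 1"] flux_term_bound[OF s x(2) K B, of \<xi> x] eq
      unfolding sq F D W_def[symmetric] distrib_left[of W] by linarith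
  qed
  have "drift g N (lx N s) (pmf (P s)) K (\<lambda>\<eta>. chi K \<eta> * ln (1 + min (rel_density s \<eta>) B))
    \<le> (\<Sum>\<xi>\<in>bounded_configs N K. \<Sum>x\<in>bonds N. - (chi K \<xi> * nm N s \<xi> * d) * (F \<xi> (x + 1) - F \<xi> x) - 2 * l0 * D x \<xi>
       + ln (1 + B) / K * (law_flux s x \<xi> + law_flux s (x + 1) \<xi>))"
    unfolding drift_def by (intro sum_mono bond)
  also have "\<dots> = (\<Sum>\<xi>\<in>bounded_configs N K. - (chi K \<xi> * nm N s \<xi> * d) * (\<Sum>x\<in>bonds N. F \<xi> (x + 1) - F \<xi> x))
      - 2 * l0 * dissipation K B s + ln (1 + B) / K * cutoff_flux K s"
    unfolding dissipation_def cutoff_flux_def D E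
    by (simp only: sum.distrib sum_subtractf sum_distrib_left)
       (simp add: sum_negf sum_subtractf flip: sum_distrib_left)
  also have "(\<Sum>\<xi>\<in>bounded_configs N K. - (chi K \<xi> * nm N s \<xi> * d) * (\<Sum>x\<in>bonds N. F \<xi> (x + 1) - F \<xi> x)) = 0"
    unfolding sum_bonds_telescope by (simp add: F_def add_at_outside sites_def)
  finally show ?thesis by simp
qed

text \<open>With F for \<open>trunc_ent B\<close> and \<open>u = p / n\<close>, the time derivative
  of \<open>n * F u\<close> is \<open>F' u * p' - trunc_dual B u * n'\<close>. The first part is a
  drift and yields the dissipation. The second, due to the moving reservoirs, is estimated by
  Young's inequality by the entropy itself plus a term of order N, so that a Gronwall inequality
  results.\<close>

lemma cutoff_entropy_deriv:
  assumes s: "s \<in> {0..T}" and K: "K \<ge> 1" and B: "B > 0"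
  shows "\<exists>d. (cutoff_entropy K B has_real_derivative d) (at s within {0..T}) \<and>
    d \<le> Lam / l0 * cutoff_entropy K B s + (Lam / l0 * (1 + mgf_const * N) - 2 * l0 * c * dissipation K B s + c * ln (1 + B) * (cutoff_flux K s / K))"
proof -
  define \<psi> where "\<psi> = (\<lambda>\<eta>. if \<eta> \<in> bounded_configs N K then chi K \<eta> * ln (1 + min (rel_density s \<eta>) B) else 0)"
  define p' where "p' = (\<lambda>\<xi>. c * drift g N (lx N s) (pmf (P s)) K (\<lambda>\<eta>. of_bool (\<eta> = \<xi>)))"
  obtain n' where n': "\<And>\<xi>. ((\<lambda>s. nm N s \<xi>) has_real_derivative n' \<xi>) (at s within {0..T})"
    "\<And>\<xi>. \<bar>n' \<xi>\<bar> \<le> nm N s \<xi> * (Lam / l0 * nparts N \<xi>)" using nm_deriv[OF s] by metis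
  define d where "d = (\<Sum>\<xi>\<in>bounded_configs N K. chi K \<xi> * (ln (1 + min (rel_density s \<xi>) B) * p' \<xi> - trunc_dual B (rel_density s \<xi>) * n' \<xi>))"
  have "((\<lambda>s. nm N s \<xi> * trunc_ent B (rel_density s \<xi>)) has_real_derivative
      ln (1 + min (rel_density s \<xi>) B) * p' \<xi> - trunc_dual B (rel_density s \<xi>) * n' \<xi>) (at s within {0..T})" if "\<xi> \<in> bounded_configs N K" for \<xi>
  proof -
    have nz: "nm N s \<xi> \<noteq> 0" using nm_pos[OF s, of N \<xi>] by simp
    define L where "L = ln (1 + min (rel_density s \<xi>) B)"
    define X where "X = (p' \<xi> * nm N s \<xi> - pmf (P s) \<xi> * n' \<xi>) / (nm N s \<xi> * nm N s \<xi>)"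
    have f: "((\<lambda>s. rel_density s \<xi>) has_real_derivative X) (at s within {0..T})"
      unfolding rel_density_def p'_def X_def by (rule DERIV_divide[OF pmf_deriv[OF that s] n'(1) nz])
    have "((\<lambda>s. trunc_ent B (rel_density s \<xi>)) has_real_derivative L * X) (at s within {0..T})"
      unfolding L_def by (rule DERIV_chain2[OF trunc_ent_has_derivative[OF rel_density_nonneg[OF s] B] f])
    from DERIV_mult[OF n'(1)[of \<xi>] this]
    have *: "((\<lambda>s. nm N s \<xi> * trunc_ent B (rel_density s \<xi>)) has_real_derivative
       n' \<xi> * trunc_ent B (rel_density s \<xi>) + L * X * nm N s \<xi>) (at s within {0..T})" .
    have "X * nm N s \<xi> = p' \<xi> - rel_density s \<xi> * n' \<xi>"
      using nz by (simp add: X_def rel_density_def field_simps)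
    moreover have te: "trunc_ent B (rel_density s \<xi>) = rel_density s \<xi> * L - trunc_dual B (rel_density s \<xi>)"
      using trunc_ent_dual[of B "rel_density s \<xi>"] by (simp add: L_def)
    ultimately have "n' \<xi> * trunc_ent B (rel_density s \<xi>) + L * X * nm N s \<xi> = L * p' \<xi> - trunc_dual B (rel_density s \<xi>) * n' \<xi>"
      unfolding te mult.assoc[of L] by (simp only:) (simp add: algebra_simps)
    with * show ?thesis by (simp only: L_def)
  qed
  then have der: "(cutoff_entropy K B has_real_derivative d) (at s within {0..T})"
    unfolding cutoff_entropy_def[abs_def] d_def by (intro DERIV_sum DERIV_cmult) auto
  have "d = (\<Sum>\<xi>\<in>bounded_configs N K. \<psi> \<xi> * p' \<xi>) - (\<Sum>\<xi>\<in>bounded_configs N K. chi K \<xi> * (trunc_dual B (rel_density s \<xi>) * n' \<xi>))"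
    unfolding d_def by (simp add: sum_subtractf[symmetric] \<psi>_def algebra_simps)
  also have "(\<Sum>\<xi>\<in>bounded_configs N K. \<psi> \<xi> * p' \<xi>) = c * drift g N (lx N s) (pmf (P s)) K \<psi>"
    using drift_linear[of N K \<psi> g "lx N s" "pmf (P s)"] by (simp add: \<psi>_def p'_def sum_distrib_left mult_ac)
  \<comment> \<open>The drift evaluates its function also at configurations with
    \<open>K + 1\<close> particles. There \<open>chi K\<close> is 0, so the cut-off
    \<open>\<psi>\<close> may be replaced by the formula.\<close>
  also have "drift g N (lx N s) (pmf (P s)) K \<psi> = drift g N (lx N s) (pmf (P s)) K (\<lambda>\<eta>. chi K \<eta> * ln (1 + min (rel_density s \<eta>) B))"
  proof -
    have "\<psi> \<eta> = chi K \<eta> * ln (1 + min (rel_density s \<eta>) B)" if "\<eta> \<in> configs N" for \<eta>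
      using chi_outside[OF K that] by (auto simp: \<psi>_def)
    then show ?thesis unfolding drift_def using bounded_configs_subset by (intro sum.cong refl) (auto simp: subset_iff)
  qed
  finally have d1: "d = c * drift g N (lx N s) (pmf (P s)) K (\<lambda>\<eta>. chi K \<eta> * ln (1 + min (rel_density s \<eta>) B))
     - (\<Sum>\<xi>\<in>bounded_configs N K. chi K \<xi> * (trunc_dual B (rel_density s \<xi>) * n' \<xi>))" .
  have d2: "c * drift g N (lx N s) (pmf (P s)) K (\<lambda>\<eta>. chi K \<eta> * ln (1 + min (rel_density s \<eta>) B))
     \<le> c * (- 2 * l0 * dissipation K B s + ln (1 + B) / K * cutoff_flux K s)"
    using c by (intro mult_left_mono drift_entropy_bound s K B) auto
  define m where "m = (\<lambda>\<xi>. min (rel_density s \<xi>) B)"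
  have m: "0 \<le> m \<xi>" for \<xi> using rel_density_nonneg[OF s, of \<xi>] B by (simp add: m_def)
  have "- (\<Sum>\<xi>\<in>bounded_configs N K. chi K \<xi> * (trunc_dual B (rel_density s \<xi>) * n' \<xi>))
    \<le> (\<Sum>\<xi>\<in>bounded_configs N K. chi K \<xi> * (m \<xi> * (nm N s \<xi> * (Lam / l0 * nparts N \<xi>))))"
    unfolding sum_negf[symmetric]
  proof (intro sum_mono)
    fix \<xi>
    have "- (trunc_dual B (rel_density s \<xi>) * n' \<xi>) \<le> \<bar>trunc_dual B (rel_density s \<xi>)\<bar> * \<bar>n' \<xi>\<bar>"
      by (simp flip: abs_mult)
    also have "\<dots> \<le> m \<xi> * (nm N s \<xi> * (Lam / l0 * nparts N \<xi>))"
      using trunc_dual_bounds[OF rel_density_nonneg[OF s] B, of \<xi>] n'(2)[of \<xi>] m[of \<xi>]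
      by (intro mult_mono) (auto simp: m_def)
    finally show "- (chi K \<xi> * (trunc_dual B (rel_density s \<xi>) * n' \<xi>)) \<le> chi K \<xi> * (m \<xi> * (nm N s \<xi> * (Lam / l0 * nparts N \<xi>)))"
      using mult_left_mono[OF _ chi_bounds(1)[of K \<xi>]] by (simp only: mult_minus_right[symmetric])
  qed
  \<comment> \<open>The particle number is centred at \<open>mgf_const * N\<close>: the exponential
    in Young's inequality then has weight at most 1, and the subtracted part is multiplied by a mass
    of at most 1.\<close>
  also have "\<dots> = Lam / l0 * (\<Sum>\<xi>\<in>bounded_configs N K. chi K \<xi> * nm N s \<xi> * (m \<xi> * (nparts N \<xi> - mgf_const * N)))
      + Lam / l0 * (mgf_const * N) * (\<Sum>\<xi>\<in>bounded_configs N K. chi K \<xi> * (nm N s \<xi> * m \<xi>))"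
    by (simp add: sum_distrib_left sum.distrib[symmetric] algebra_simps)
  also have "\<dots> \<le> Lam / l0 * (cutoff_entropy K B s + 1) + Lam / l0 * (mgf_const * N) * 1"
  proof (intro add_mono mult_left_mono)
    have "(\<Sum>\<xi>\<in>bounded_configs N K. chi K \<xi> * nm N s \<xi> * (m \<xi> * (nparts N \<xi> - mgf_const * N)))
      \<le> (\<Sum>\<xi>\<in>bounded_configs N K. chi K \<xi> * (nm N s \<xi> * trunc_ent B (rel_density s \<xi>)) + nm N s \<xi> * exp (nparts N \<xi>) * exp (- mgf_const * N))"
    proof (intro sum_mono)
      fix \<xi>
      have "m \<xi> * (nparts N \<xi> - mgf_const * N) \<le> trunc_ent B (rel_density s \<xi>) + exp (nparts N \<xi> - mgf_const * N)"
        using young_ent[OF m, of \<xi> "nparts N \<xi> - mgf_const * N"] ent_min_le_trunc[OF rel_density_nonneg[OF s] B, of \<xi>]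
        by (simp add: m_def)
      then have "chi K \<xi> * nm N s \<xi> * (m \<xi> * (nparts N \<xi> - mgf_const * N))
         \<le> chi K \<xi> * nm N s \<xi> * (trunc_ent B (rel_density s \<xi>) + exp (nparts N \<xi> - mgf_const * N))"
        using chi_bounds[of K \<xi>] nm_pos[OF s, of N \<xi>] by (intro mult_left_mono) auto
      also have "\<dots> = chi K \<xi> * (nm N s \<xi> * trunc_ent B (rel_density s \<xi>)) + chi K \<xi> * (nm N s \<xi> * exp (nparts N \<xi> - mgf_const * N))"
        by (simp add: algebra_simps)
      also have "chi K \<xi> * (nm N s \<xi> * exp (nparts N \<xi> - mgf_const * N)) \<le> nm N s \<xi> * exp (nparts N \<xi> - mgf_const * N)"
        using chi_bounds[of K \<xi>] nm_pos[OF s, of N \<xi>] by (simp add: mult_left_le_one_le)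
      also have "exp (nparts N \<xi> - mgf_const * N) = exp (nparts N \<xi>) * exp (- mgf_const * N)" by (simp flip: exp_add)
      finally show "chi K \<xi> * nm N s \<xi> * (m \<xi> * (nparts N \<xi> - mgf_const * N))
        \<le> chi K \<xi> * (nm N s \<xi> * trunc_ent B (rel_density s \<xi>)) + nm N s \<xi> * exp (nparts N \<xi>) * exp (- mgf_const * N)"
        by (simp add: mult.assoc)
    qed
    also have "\<dots> = cutoff_entropy K B s + (\<Sum>\<xi>\<in>bounded_configs N K. nm N s \<xi> * exp (nparts N \<xi>)) * exp (- mgf_const * N)"
      by (simp add: sum.distrib cutoff_entropy_def sum_distrib_right)
    also have "\<dots> \<le> cutoff_entropy K B s + exp (mgf_const * N) * exp (- mgf_const * N)"
      by (intro add_mono order_refl mult_right_mono nm_weight_le[OF s] max_law_exp_nparts N bounded_configs_subset) auto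
    finally show "(\<Sum>\<xi>\<in>bounded_configs N K. chi K \<xi> * nm N s \<xi> * (m \<xi> * (nparts N \<xi> - mgf_const * N))) \<le> cutoff_entropy K B s + 1"
      by (simp flip: exp_add)
    have "(\<Sum>\<xi>\<in>bounded_configs N K. chi K \<xi> * (nm N s \<xi> * m \<xi>)) \<le> (\<Sum>\<xi>\<in>bounded_configs N K. pmf (P s) \<xi>)"
    proof (intro sum_mono)
      fix \<xi>
      have "chi K \<xi> * (nm N s \<xi> * m \<xi>) \<le> 1 * (nm N s \<xi> * rel_density s \<xi>)"
        using chi_bounds[of K \<xi>] nm_pos[OF s, of N \<xi>] m[of \<xi>] by (intro mult_mono) (auto simp: m_def)
      then show "chi K \<xi> * (nm N s \<xi> * m \<xi>) \<le> pmf (P s) \<xi>" using nm_dens[OF s] by simp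
    qed
    also have "\<dots> \<le> 1" using measure_measure_pmf_finite[of "bounded_configs N K" "P s"] measure_pmf.prob_le_1[of "P s" "bounded_configs N K"] by simp
    finally show "(\<Sum>\<xi>\<in>bounded_configs N K. chi K \<xi> * (nm N s \<xi> * m \<xi>)) \<le> 1" .
  qed (use Lam l0 mgf_const_nonneg in auto)
  finally have d3: "- (\<Sum>\<xi>\<in>bounded_configs N K. chi K \<xi> * (trunc_dual B (rel_density s \<xi>) * n' \<xi>))
     \<le> Lam / l0 * (cutoff_entropy K B s + 1) + Lam / l0 * (mgf_const * N)" by simp
  have "c * (- 2 * l0 * dissipation K B s + ln (1 + B) / K * cutoff_flux K s) = - (2 * l0 * c * dissipation K B s) + c * ln (1 + B) * (cutoff_flux K s / K)"
    "Lam / l0 * (cutoff_entropy K B s + 1) + Lam / l0 * (mgf_const * N) = Lam / l0 * cutoff_entropy K B s + Lam / l0 * (1 + mgf_const * N)"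
    by (simp_all add: algebra_simps)
  then have "d \<le> Lam / l0 * cutoff_entropy K B s + (Lam / l0 * (1 + mgf_const * N) - 2 * l0 * c * dissipation K B s + c * ln (1 + B) * (cutoff_flux K s / K))"
    using d1 d2 d3 by linarith
  with der show ?thesis by blast
qed

end

section \<open>A priori bounds free of the cutoffs\<close>

lemma nn_integral_cont_Icc:
  fixes f :: "real \<Rightarrow> real"
  assumes "continuous_on {a..b} f" "\<And>s. s \<in> {a..b} \<Longrightarrow> 0 \<le> f s"
  shows "(\<integral>\<^sup>+s\<in>{a..b}. ennreal (f s) \<partial>lborel) = ennreal (integral {a..b} f)"
proof -
  have si: "set_integrable lborel {a..b} f" by (rule borel_integrable_atLeastAtMost'[OF assms(1)])
  have "(\<integral>\<^sup>+s\<in>{a..b}. ennreal (f s) \<partial>lborel) = (\<integral>\<^sup>+s. ennreal (indicator {a..b} s *\<^sub>R f s) \<partial>lborel)"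
    by (intro nn_integral_cong) (auto simp: indicator_def)
  also have "\<dots> = ennreal (LINT s:{a..b}|lborel. f s)"
    unfolding set_lebesgue_integral_def
    using si assms(2) by (intro nn_integral_eq_integral) (auto simp: set_integrable_def indicator_def)
  also have "(LINT s:{a..b}|lborel. f s) = integral {a..b} f"
    by (rule set_borel_integral_eq_integral(2)[OF si])
  finally show ?thesis .
qed

context zr_evol begin

abbreviation (input) "C1 \<equiv> Lam / l0"

lemma law_flux_cont: "\<xi> \<in> configs N \<Longrightarrow> continuous_on {0..T} (\<lambda>s. law_flux s x \<xi>)"
  unfolding flux_def rate_def by (cases "x \<in> sites N") (auto intro!: continuous_intros pmf_cont lx_cont)

lemma dissipation_cont: "continuous_on {0..T} (dissipation K B)"
  unfolding dissipation_def[abs_def]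
proof (intro continuous_on_sum)
  fix \<xi> x assume "\<xi> \<in> bounded_configs N K"
  then have "\<xi> \<in> configs N" using bounded_configs_subset by blast
  then show "continuous_on {0..T} (\<lambda>s. chi K \<xi> * (nm N s \<xi> *
     (sqrt (1 + min (rel_density s (add_at N (x + 1) \<xi>)) B) - sqrt (1 + min (rel_density s (add_at N x \<xi>)) B))\<^sup>2))"
    by (intro continuous_intros continuous_on_min nm_cont rel_density_cont add_at_configs)
qed

lemma cutoff_flux_cont: "continuous_on {0..T} (cutoff_flux K)"
  unfolding cutoff_flux_def[abs_def] using bounded_configs_subset by (intro continuous_intros law_flux_cont) blast+

lemma dissipation_nonneg: "s \<in> {0..T} \<Longrightarrow> 0 \<le> dissipation K B s"
  unfolding dissipation_def by (intro sum_nonneg mult_nonneg_nonneg chi_bounds(1) less_imp_le[OF nm_pos] zero_le_power2)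

lemma cutoff_flux_nonneg: "s \<in> {0..T} \<Longrightarrow> 0 \<le> cutoff_flux K s"
  unfolding cutoff_flux_def using bonds_range(1) by (intro sum_nonneg add_nonneg_nonneg law_flux_nonneg) auto

lemma cutoff_entropy_nonneg: "s \<in> {0..T} \<Longrightarrow> B > 0 \<Longrightarrow> 0 \<le> cutoff_entropy K B s"
  unfolding cutoff_entropy_def
  by (intro sum_nonneg mult_nonneg_nonneg trunc_ent_nonneg chi_bounds(1) less_imp_le[OF nm_pos] rel_density_nonneg)

lemma sum_law_flux_le:
  assumes s: "s \<in> {0..T}" and x: "x \<in> {- int N - 1..int N + 1}"
  shows "(\<Sum>\<xi>\<in>bounded_configs N K. law_flux s x \<xi>) \<le> (\<Sum>\<eta>\<in>bounded_configs N (Suc K). (Cg * nparts N \<eta> + l1) * pmf (P s) \<eta>)"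
proof -
  have "(\<Sum>\<xi>\<in>bounded_configs N K. law_flux s x \<xi>) \<le> (\<Sum>\<xi>\<in>bounded_configs N K. (Cg * nparts N (add_at N x \<xi>) + l1) * pmf (P s) (add_at N x \<xi>))"
  proof (intro sum_mono)
    fix \<xi>
    have "rate g N (lx N s) x \<eta> \<le> Cg * nparts N \<eta> + l1" for \<eta>
    proof (cases "x \<in> sites N")
      case True
      then have "\<eta> x \<le> nparts N \<eta>" unfolding nparts_def by (intro member_le_sum) auto
      then have "Cg * \<eta> x \<le> Cg * nparts N \<eta>" using Cg by simp
      with True g_le[of "\<eta> x"] l1 show ?thesis by (simp add: rate_def)
    next
      case False
      then show ?thesis using lx_bounds[OF x s] Cg by (simp add: rate_def add_increasing)
    qed
    then show "law_flux s x \<xi> \<le> (Cg * nparts N (add_at N x \<xi>) + l1) * pmf (P s) (add_at N x \<xi>)"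
      unfolding flux_def by (subst mult.commute) (intro mult_right_mono, auto)
  qed
  also have "\<dots> = (\<Sum>\<eta>\<in>add_at N x ` bounded_configs N K. (Cg * nparts N \<eta> + l1) * pmf (P s) \<eta>)"
    by (subst sum.reindex) (auto simp: inj_on_def add_at_inj)
  also have "\<dots> \<le> (\<Sum>\<eta>\<in>bounded_configs N (Suc K). (Cg * nparts N \<eta> + l1) * pmf (P s) \<eta>)"
    using Cg l1 add_at_bounded_configs by (intro sum_mono2) auto
  finally show ?thesis .
qed

lemma cutoff_flux_le:
  assumes s: "s \<in> {0..T}"
  shows "cutoff_flux K s \<le> 4 * (N + 1) * measure_pmf.expectation (P s) (\<lambda>\<eta>. indicator (bounded_configs N (Suc K)) \<eta> * (Cg * nparts N \<eta> + l1))"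
proof -
  let ?W = "\<Sum>\<eta>\<in>bounded_configs N (Suc K). (Cg * nparts N \<eta> + l1) * pmf (P s) \<eta>"
  have "cutoff_flux K s = (\<Sum>x\<in>bonds N. (\<Sum>\<xi>\<in>bounded_configs N K. law_flux s x \<xi>) + (\<Sum>\<xi>\<in>bounded_configs N K. law_flux s (x + 1) \<xi>))"
    unfolding cutoff_flux_def by (subst sum.swap) (simp add: sum.distrib)
  also have "\<dots> \<le> (\<Sum>x\<in>bonds N. ?W + ?W)"
    using bonds_range(1) by (intro sum_mono add_mono sum_law_flux_le s) auto
  also have "\<dots> = 4 * (N + 1) * ?W" by (simp add: card_bonds algebra_simps)
  also have "?W = measure_pmf.expectation (P s) (\<lambda>\<eta>. indicator (bounded_configs N (Suc K)) \<eta> * (Cg * nparts N \<eta> + l1))"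
    by (subst integral_measure_pmf_real[of "bounded_configs N (Suc K)"]) (auto simp: indicator_def split: if_splits intro!: sum.cong)
  finally show ?thesis .
qed

text \<open>Dominated convergence without any moment bound: on the cutoff set there are at most
  \<open>K + 1 \<le> 2 * K\<close> particles, so the quotient is at most \<open>2 * Cg + l1\<close>,
  while for each fixed configuration it tends to 0. For \<open>K = 0\<close> the quotient is 0 by
  convention.\<close>

lemma expectation_cut:
  "(\<lambda>K. measure_pmf.expectation Q (\<lambda>\<eta>. indicator (bounded_configs N (Suc K)) \<eta> * (Cg * nparts N \<eta> + l1)) / K) \<longlonglongrightarrow> 0"
  "measure_pmf.expectation Q (\<lambda>\<eta>. indicator (bounded_configs N (Suc K)) \<eta> * (Cg * nparts N \<eta> + l1)) / K \<le> 2 * Cg + l1"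
proof -
  define f where "f = (\<lambda>K \<eta>. indicator (bounded_configs N (Suc K)) \<eta> * (Cg * nparts N \<eta> + l1) / real K)"
  have f0: "0 \<le> f K \<eta>" for K \<eta> using Cg l1 by (auto simp: f_def)
  have fb: "f K \<eta> \<le> 2 * Cg + l1" for K \<eta>
  proof (cases "\<eta> \<in> bounded_configs N (Suc K) \<and> K > 0")
    case True
    then have n: "real (nparts N \<eta>) \<le> 2 * real K" by (auto simp: bounded_configs_def)
    have "Cg * nparts N \<eta> + l1 \<le> Cg * (2 * K) + l1 * K"
      using True n Cg l1 by (intro add_mono mult_left_mono) auto
    then show ?thesis using True by (simp add: f_def field_simps)
  qed (use Cg l1 in \<open>auto simp: f_def\<close>)
  have int: "integrable (measure_pmf Q) (f K)" for K
    using f0 fb by (intro measure_pmf.integrable_const_bound[where B="2 * Cg + l1"]) auto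
  have eq: "measure_pmf.expectation Q (\<lambda>\<eta>. indicator (bounded_configs N (Suc K)) \<eta> * (Cg * nparts N \<eta> + l1)) / K = measure_pmf.expectation Q (f K)" for K
    by (simp add: f_def)
  have "(\<lambda>K. measure_pmf.expectation Q (f K)) \<longlonglongrightarrow> measure_pmf.expectation Q (\<lambda>\<eta>. 0)"
  proof (rule integral_dominated_convergence[where w="\<lambda>_. 2 * Cg + l1"])
    have "(\<lambda>K. f K \<eta>) \<longlonglongrightarrow> 0" for \<eta>
    proof (rule tendsto_sandwich[OF _ _ tendsto_const])
      show "(\<lambda>K. (Cg * nparts N \<eta> + l1) / real K) \<longlonglongrightarrow> 0" by (rule lim_const_over_n)
    qed (use f0 Cg l1 in \<open>auto simp: f_def indicator_def\<close>)
    then show "AE \<eta> in measure_pmf Q. (\<lambda>K. f K \<eta>) \<longlonglongrightarrow> 0" by simp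
  qed (use f0 fb in auto)
  then show "(\<lambda>K. measure_pmf.expectation Q (\<lambda>\<eta>. indicator (bounded_configs N (Suc K)) \<eta> * (Cg * nparts N \<eta> + l1)) / K) \<longlonglongrightarrow> 0"
    by (simp add: eq)
  show "measure_pmf.expectation Q (\<lambda>\<eta>. indicator (bounded_configs N (Suc K)) \<eta> * (Cg * nparts N \<eta> + l1)) / K \<le> 2 * Cg + l1"
    unfolding eq by (rule measure_pmf.integral_le_const[OF int]) (use fb in auto)
qed

lemma integral_cutoff_flux_tendsto: "(\<lambda>K. integral {0..T} (\<lambda>s. cutoff_flux K s / K)) \<longlonglongrightarrow> 0"
proof -
  have "(\<lambda>K. integral {0..T} (\<lambda>s. cutoff_flux K s / K)) \<longlonglongrightarrow> integral {0..T} (\<lambda>s. 0::real)"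
  proof (rule dominated_convergence(2)[where h="\<lambda>_. 4 * (N + 1) * (2 * Cg + l1)"])
    fix K :: nat and s assume s: "s \<in> {0..T}"
    have "cutoff_flux K s / K \<le> 4 * (N + 1) * (measure_pmf.expectation (P s) (\<lambda>\<eta>. indicator (bounded_configs N (Suc K)) \<eta> * (Cg * nparts N \<eta> + l1)) / K)"
      using divide_right_mono[OF cutoff_flux_le[OF s, of K], of "real K"] by simp
    also have "\<dots> \<le> 4 * (N + 1) * (2 * Cg + l1)"
      by (intro mult_left_mono expectation_cut) auto
    finally show "norm (cutoff_flux K s / K) \<le> 4 * (N + 1) * (2 * Cg + l1)" using cutoff_flux_nonneg[OF s, of K] by simp
  next
    fix s assume s: "s \<in> {0..T}"
    show "(\<lambda>K. cutoff_flux K s / K) \<longlonglongrightarrow> 0"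
    proof (rule tendsto_sandwich[OF _ _ tendsto_const])
      show "(\<lambda>K. 4 * (N + 1) * (measure_pmf.expectation (P s) (\<lambda>\<eta>. indicator (bounded_configs N (Suc K)) \<eta> * (Cg * nparts N \<eta> + l1)) / K)) \<longlonglongrightarrow> 0"
        by (rule tendsto_mult_right_zero[OF expectation_cut(1)])
      show "\<forall>\<^sub>F K in sequentially. cutoff_flux K s / K \<le> 4 * (N + 1) * (measure_pmf.expectation (P s) (\<lambda>\<eta>. indicator (bounded_configs N (Suc K)) \<eta> * (Cg * nparts N \<eta> + l1)) / K)"
        using divide_right_mono[OF cutoff_flux_le[OF s] of_nat_0_le_iff] by (intro always_eventually allI) (simp only: times_divide_eq_right)
    qed (use cutoff_flux_nonneg[OF s] in auto)
  next
    show "(\<lambda>s. cutoff_flux K s / K) integrable_on {0..T}" for K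
      unfolding divide_inverse by (intro integrable_continuous_interval continuous_intros cutoff_flux_cont)
  qed auto
  then show ?thesis by simp
qed

text \<open>Gronwall's argument with the integrating factor \<open>exp (- C1 * s)\<close>. In front
  of the dissipation the factor is bounded below by its value at \<open>T\<close>, in the source
  terms above by 1; so the dissipation stays on the left together with the final entropy.\<close>

lemma entropy_inequality:
  assumes \<tau>: "\<tau> \<in> {0..T}" and K: "K \<ge> 1" and B: "B > 0"
  shows "exp (- C1 * T) * cutoff_entropy K B \<tau> + exp (- C1 * T) * (2 * l0 * c) * integral {0..\<tau>} (dissipation K B)
    \<le> C0 * N + T * (C1 * (1 + mgf_const * N)) + c * ln (1 + B) * integral {0..T} (\<lambda>s. cutoff_flux K s / K)"
proof -
  have C1: "C1 \<ge> 0" using Lam l0 by simp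
  have sub: "{0..\<tau>} \<subseteq> {0..T}" using \<tau> by auto
  obtain d where d: "\<And>s. s \<in> {0..T} \<Longrightarrow> (cutoff_entropy K B has_real_derivative d s) (at s within {0..T})"
     "\<And>s. s \<in> {0..T} \<Longrightarrow> d s \<le> C1 * cutoff_entropy K B s + (C1 * (1 + mgf_const * N) - 2 * l0 * c * dissipation K B s + c * ln (1 + B) * (cutoff_flux K s / K))"
    using cutoff_entropy_deriv[OF _ K B] by metis
  define r where "r = (\<lambda>s. C1 * (1 + mgf_const * N) - exp (- C1 * T) * (2 * l0 * c) * dissipation K B s + c * ln (1 + B) * (cutoff_flux K s / K))"
  have ErrK: "continuous_on {0..T} (\<lambda>s. cutoff_flux K s / K)"
    unfolding divide_inverse by (intro continuous_intros cutoff_flux_cont)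
  have "exp (- C1 * \<tau>) * cutoff_entropy K B \<tau> - exp (- C1 * 0) * cutoff_entropy K B 0 \<le> integral {0..\<tau>} r"
  proof (rule derivative_bound_imp_le[of \<tau> T "\<lambda>s. exp (- C1 * s) * cutoff_entropy K B s"])
    fix s assume s: "s \<in> {0..T}"
    have "((\<lambda>s. exp (- k * s) * cutoff_entropy K B s) has_real_derivative exp (- k * s) * (d s - k * cutoff_entropy K B s)) (at s within {0..T})" for k
      by (auto intro!: derivative_eq_intros d(1)[OF s] simp: algebra_simps)
    then show "((\<lambda>s. exp (- C1 * s) * cutoff_entropy K B s) has_real_derivative exp (- C1 * s) * (d s - C1 * cutoff_entropy K B s)) (at s within {0..T})" .
    have e: "exp (- C1 * T) \<le> exp (- C1 * s)" "exp (- C1 * s) \<le> 1" "0 \<le> exp (- C1 * s)"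
      using mult_left_mono[of s T C1] mult_nonneg_nonneg[of C1 s] s C1 by auto
    have X: "0 \<le> C1 * (1 + mgf_const * N)" by (rule mult_nonneg_nonneg[OF C1]) (simp add: mgf_const_nonneg)
    have Y: "0 \<le> 2 * l0 * c * dissipation K B s" using l0 c dissipation_nonneg[OF s] by simp
    have Z: "0 \<le> c * ln (1 + B) * (cutoff_flux K s / K)" using c B cutoff_flux_nonneg[OF s] by simp
    have "exp (- C1 * s) * (d s - C1 * cutoff_entropy K B s)
      \<le> exp (- C1 * s) * (C1 * (1 + mgf_const * N) - 2 * l0 * c * dissipation K B s + c * ln (1 + B) * (cutoff_flux K s / K))"
      using d(2)[OF s] e by (intro mult_left_mono) auto
    also have "\<dots> = exp (- C1 * s) * (C1 * (1 + mgf_const * N)) - exp (- C1 * s) * (2 * l0 * c * dissipation K B s) + exp (- C1 * s) * (c * ln (1 + B) * (cutoff_flux K s / K))"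
      by (simp only: distrib_left right_diff_distrib)
    also have "\<dots> \<le> 1 * (C1 * (1 + mgf_const * N)) - exp (- C1 * T) * (2 * l0 * c * dissipation K B s) + 1 * (c * ln (1 + B) * (cutoff_flux K s / K))"
      by (intro add_mono diff_mono mult_right_mono e X Y Z)
    finally show "exp (- C1 * s) * (d s - C1 * cutoff_entropy K B s) \<le> r s" by (simp add: r_def mult.assoc)
  next
    show "continuous_on {0..T} r" unfolding r_def
      by (intro continuous_on_add continuous_on_diff continuous_on_mult[OF continuous_on_const] continuous_on_const dissipation_cont ErrK)
  qed (use \<tau> in auto)
  also have "integral {0..\<tau>} r = \<tau> * (C1 * (1 + mgf_const * N)) - exp (- C1 * T) * (2 * l0 * c) * integral {0..\<tau>} (dissipation K B)
      + c * ln (1 + B) * integral {0..\<tau>} (\<lambda>s. cutoff_flux K s / K)"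
  proof -
    have i: "(dissipation K B) integrable_on {0..\<tau>}" "(\<lambda>s. cutoff_flux K s / K) integrable_on {0..\<tau>}"
      by (intro integrable_continuous_interval continuous_on_subset[OF dissipation_cont sub] continuous_on_subset[OF ErrK sub])+
    have ci: "((\<lambda>s. k) has_integral (\<tau> - 0) *\<^sub>R k) {0..\<tau>}" for k :: real
      using has_integral_const_real[of k 0 \<tau>] \<tau> by simp
    have "(r has_integral ((\<tau> - 0) *\<^sub>R (C1 * (1 + mgf_const * N)) - exp (- C1 * T) * (2 * l0 * c) * integral {0..\<tau>} (dissipation K B)
      + c * ln (1 + B) * integral {0..\<tau>} (\<lambda>s. cutoff_flux K s / K))) {0..\<tau>}"
      unfolding r_def by (intro has_integral_add has_integral_diff ci has_integral_mult_right integrable_integral i)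
    then show ?thesis by (simp add: integral_unique)
  qed
  also have "\<tau> * (C1 * (1 + mgf_const * N)) \<le> T * (C1 * (1 + mgf_const * N))"
    using \<tau> mgf_const_nonneg by (intro mult_right_mono mult_nonneg_nonneg[OF C1]) auto
  also have "c * ln (1 + B) * integral {0..\<tau>} (\<lambda>s. cutoff_flux K s / K) \<le> c * ln (1 + B) * integral {0..T} (\<lambda>s. cutoff_flux K s / K)"
    using c B cutoff_flux_nonneg
    by (intro mult_left_mono integral_subset_le sub integrable_continuous_interval continuous_on_subset[OF ErrK] ErrK) auto
  finally have 1: "exp (- C1 * \<tau>) * cutoff_entropy K B \<tau> + exp (- C1 * T) * (2 * l0 * c) * integral {0..\<tau>} (dissipation K B)
    \<le> cutoff_entropy K B 0 + T * (C1 * (1 + mgf_const * N)) + c * ln (1 + B) * integral {0..T} (\<lambda>s. cutoff_flux K s / K)" by simp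
  have z: "0 \<in> {0..T}" using T by simp
  have "cutoff_entropy K B 0 \<le> (\<Sum>\<xi>\<in>bounded_configs N K. nm N 0 \<xi> * ent (pmf (P 0) \<xi> / nm N 0 \<xi>))"
    unfolding cutoff_entropy_def
  proof (intro sum_mono)
    fix \<xi>
    have "chi K \<xi> * (nm N 0 \<xi> * trunc_ent B (rel_density 0 \<xi>)) \<le> 1 * (nm N 0 \<xi> * ent (rel_density 0 \<xi>))"
      using chi_bounds[of K \<xi>] nm_pos[OF z, of N \<xi>] trunc_ent_le[OF rel_density_nonneg[OF z] B, of \<xi>]
        trunc_ent_nonneg[OF rel_density_nonneg[OF z] B, of \<xi>]
      by (intro mult_mono mult_left_mono mult_nonneg_nonneg) auto
    then show "chi K \<xi> * (nm N 0 \<xi> * trunc_ent B (rel_density 0 \<xi>)) \<le> nm N 0 \<xi> * ent (pmf (P 0) \<xi> / nm N 0 \<xi>)"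
      by (simp add: rel_density_def)
  qed
  also have "\<dots> \<le> C0 * N" by (intro init bounded_configs_subset) auto
  finally have 2: "cutoff_entropy K B 0 \<le> C0 * N" .
  have "exp (- C1 * T) * cutoff_entropy K B \<tau> \<le> exp (- C1 * \<tau>) * cutoff_entropy K B \<tau>"
    using mult_left_mono[of \<tau> T C1] \<tau> C1 cutoff_entropy_nonneg[OF \<tau> B] by (intro mult_right_mono) auto
  with 1 2 show ?thesis by linarith
qed

text \<open>Half of this times N bounds the cutoff entropy; the factor 2 pays for
  \<open>chi K \<ge> 1 / 2\<close> on the given finite set. The summand 1 is the cutoff error, which
  \<open>cutoff_choice\<close> keeps below 1.\<close>

definition entropy_const :: real where "entropy_const = 2 * exp (C1 * T) * (C0 + T * (C1 * (1 + mgf_const)) + 1)"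

lemma entropy_const: "entropy_const \<ge> 0"
  unfolding entropy_const_def using Lam l0 T C0 mgf_const_nonneg by (intro mult_nonneg_nonneg add_nonneg_nonneg) auto

text \<open>By compactness in time each reference weight stays away from 0 and probabilities are at
  most 1. With this \<open>B\<close> the truncation is invisible on \<open>F\<close>.\<close>

lemma rel_density_bounded:
  assumes "finite F"
  shows "\<exists>B>0. \<forall>s\<in>{0..T}. \<forall>\<xi>\<in>F. rel_density s \<xi> \<le> B"
  using assms
proof (induction F)
  case empty
  then show ?case by (auto intro: exI[of _ 1])
next
  case (insert \<zeta> F)
  then obtain B where B: "B > 0" "\<And>s \<xi>. s \<in> {0..T} \<Longrightarrow> \<xi> \<in> F \<Longrightarrow> rel_density s \<xi> \<le> B" by auto
  obtain a where a: "a > 0" "\<And>s. s \<in> {0..T} \<Longrightarrow> a \<le> nm N s \<zeta>" using nm_lower by blast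
  have "rel_density s \<zeta> \<le> 1 / a" if "s \<in> {0..T}" for s
    unfolding rel_density_def using a a(2)[OF that] by (intro frac_le) (auto simp: pmf_le_1)
  then show ?case using B a by (intro exI[of _ "max B (1 / a)"]) (auto simp: le_max_iff_disj)
qed

text \<open>\<open>B\<close> is fixed before \<open>K\<close>, so the factor
  \<open>ln (1 + B)\<close> does no harm. A \<open>K\<close> of at least twice the largest particle
  number on \<open>F\<close> keeps the cutoff above \<open>1 / 2\<close> there.\<close>

lemma cutoff_choice:
  assumes F: "finite F" "F \<subseteq> configs N" and B: "B > 0"
  obtains K where "K \<ge> 1" "F \<subseteq> bounded_configs N K" "\<And>\<xi>. \<xi> \<in> F \<Longrightarrow> chi K \<xi> \<ge> 1 / 2"
    "c * ln (1 + B) * integral {0..T} (\<lambda>s. cutoff_flux K s / K) \<le> 1"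
proof -
  obtain L where L: "F \<subseteq> bounded_configs N L" using finite_subset_bounded_configs[OF F] by blast
  have "(\<lambda>K. c * ln (1 + B) * integral {0..T} (\<lambda>s. cutoff_flux K s / K)) \<longlonglongrightarrow> 0"
    by (rule tendsto_mult_right_zero[OF integral_cutoff_flux_tendsto])
  then have "\<forall>\<^sub>F K in sequentially. c * ln (1 + B) * integral {0..T} (\<lambda>s. cutoff_flux K s / K) < 1"
    by (rule order_tendstoD) simp
  then obtain K0 where K0: "\<And>K. K \<ge> K0 \<Longrightarrow> c * ln (1 + B) * integral {0..T} (\<lambda>s. cutoff_flux K s / K) < 1"
    by (auto simp: eventually_sequentially)
  define K where "K = max K0 (2 * L + 1)"
  have K: "K \<ge> 1" "L \<le> K" "2 * L \<le> K" "K \<ge> K0" by (auto simp: K_def)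
  show ?thesis
  proof (rule that[of K])
    show "F \<subseteq> bounded_configs N K" using L bounded_configs_mono[OF K(2), of N] by blast
    fix \<xi> assume "\<xi> \<in> F"
    then have "real (nparts N \<xi>) \<le> real K / 2" using L K by (auto simp: bounded_configs_def subset_iff)
    then show "chi K \<xi> \<ge> 1 / 2" using K(1) by (simp add: chi_def field_simps max_def)
  qed (use K K0[OF K(4)] in auto)
qed

lemma entropy_rhs_le:
  assumes "e \<le> 1" shows "exp (C1 * T) * (C0 * N + T * (C1 * (1 + mgf_const * N)) + e) \<le> entropy_const * N / 2"
proof -
  have C1: "C1 \<ge> 0" using Lam l0 by simp
  have "T * (C1 * (1 + mgf_const * N)) \<le> T * (C1 * (N + mgf_const * N))"
    using T C1 N mgf_const_nonneg by (intro mult_left_mono add_mono) auto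
  then have "C0 * N + T * (C1 * (1 + mgf_const * N)) + e \<le> C0 * N + T * (C1 * (N + mgf_const * N)) + N"
    using assms N by simp
  also have "\<dots> = (C0 + T * (C1 * (1 + mgf_const)) + 1) * N" by (simp add: algebra_simps)
  finally have "exp (C1 * T) * (C0 * N + T * (C1 * (1 + mgf_const * N)) + e) \<le> exp (C1 * T) * ((C0 + T * (C1 * (1 + mgf_const)) + 1) * N)"
    by (intro mult_left_mono) auto
  then show ?thesis by (simp add: entropy_const_def mult.assoc)
qed

lemma entropy_bound:
  assumes \<tau>: "\<tau> \<in> {0..T}" and F: "finite F" "F \<subseteq> configs N"
  shows "(\<Sum>\<xi>\<in>F. nm N \<tau> \<xi> * ent (rel_density \<tau> \<xi>)) \<le> entropy_const * N"
proof -
  obtain B where B: "B > 0" "\<And>s \<xi>. s \<in> {0..T} \<Longrightarrow> \<xi> \<in> F \<Longrightarrow> rel_density s \<xi> \<le> B"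
    using rel_density_bounded[OF F(1)] by blast
  obtain K where K: "K \<ge> 1" "F \<subseteq> bounded_configs N K" "\<And>\<xi>. \<xi> \<in> F \<Longrightarrow> chi K \<xi> \<ge> 1 / 2"
    "c * ln (1 + B) * integral {0..T} (\<lambda>s. cutoff_flux K s / K) \<le> 1" using cutoff_choice[OF F B(1)] by blast
  have nn: "0 \<le> nm N \<tau> \<xi> * trunc_ent B (rel_density \<tau> \<xi>)" for \<xi>
    using nm_pos[OF \<tau>, of N \<xi>] trunc_ent_nonneg[OF rel_density_nonneg[OF \<tau>] B(1)] by simp
  have "(\<Sum>\<xi>\<in>F. nm N \<tau> \<xi> * ent (rel_density \<tau> \<xi>)) \<le> (\<Sum>\<xi>\<in>F. 2 * (chi K \<xi> * (nm N \<tau> \<xi> * trunc_ent B (rel_density \<tau> \<xi>))))"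
  proof (intro sum_mono)
    fix \<xi> assume \<xi>: "\<xi> \<in> F"
    have "1 / 2 * (nm N \<tau> \<xi> * trunc_ent B (rel_density \<tau> \<xi>)) \<le> chi K \<xi> * (nm N \<tau> \<xi> * trunc_ent B (rel_density \<tau> \<xi>))"
      using K(3)[OF \<xi>] nn by (intro mult_right_mono) auto
    then show "nm N \<tau> \<xi> * ent (rel_density \<tau> \<xi>) \<le> 2 * (chi K \<xi> * (nm N \<tau> \<xi> * trunc_ent B (rel_density \<tau> \<xi>)))"
      using trunc_ent_eq[OF B(2)[OF \<tau> \<xi>]] by simp
  qed
  also have "\<dots> \<le> 2 * cutoff_entropy K B \<tau>"
    unfolding cutoff_entropy_def sum_distrib_left using K(2) nn chi_bounds by (intro sum_mono2) auto
  also have "cutoff_entropy K B \<tau> \<le> entropy_const * N / 2"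
  proof -
    have "exp (- C1 * T) * cutoff_entropy K B \<tau> + exp (- C1 * T) * (2 * l0 * c) * integral {0..\<tau>} (dissipation K B)
        \<le> C0 * N + T * (C1 * (1 + mgf_const * N)) + c * ln (1 + B) * integral {0..T} (\<lambda>s. cutoff_flux K s / K)"
      by (rule entropy_inequality[OF \<tau> K(1) B(1)])
    moreover have "0 \<le> exp (- C1 * T) * (2 * l0 * c) * integral {0..\<tau>} (dissipation K B)"
      using l0 c dissipation_nonneg \<tau>
      by (intro mult_nonneg_nonneg integral_nonneg integrable_continuous_interval continuous_on_subset[OF dissipation_cont]) auto
    ultimately have "exp (- C1 * T) * cutoff_entropy K B \<tau>
       \<le> C0 * N + T * (C1 * (1 + mgf_const * N)) + c * ln (1 + B) * integral {0..T} (\<lambda>s. cutoff_flux K s / K)" by linarith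
    then have "exp (C1 * T) * (exp (- C1 * T) * cutoff_entropy K B \<tau>)
       \<le> exp (C1 * T) * (C0 * N + T * (C1 * (1 + mgf_const * N)) + c * ln (1 + B) * integral {0..T} (\<lambda>s. cutoff_flux K s / K))"
      by (intro mult_left_mono exp_ge_zero)
    also have "\<dots> \<le> entropy_const * N / 2" by (rule entropy_rhs_le[OF K(4)])
    finally show ?thesis by (simp add: mult.assoc[symmetric] exp_add[symmetric])
  qed
  finally show ?thesis by simp
qed

definition bond_dissipation :: "int \<Rightarrow> (int \<Rightarrow> nat) \<Rightarrow> real \<Rightarrow> real" where
  "bond_dissipation x \<xi> s = nm N s \<xi> * (sqrt (1 + rel_density s (add_at N (x + 1) \<xi>)) - sqrt (1 + rel_density s (add_at N x \<xi>)))\<^sup>2"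

definition Glauber_term :: "int \<Rightarrow> (int \<Rightarrow> nat) \<Rightarrow> real \<Rightarrow> real" where
  "Glauber_term z \<xi> s = nm N s \<xi> * (sqrt (1 + rel_density s (add_at N z \<xi>)) - sqrt (1 + rel_density s \<xi>))\<^sup>2"

lemma bond_dissipation_cont: "\<xi> \<in> configs N \<Longrightarrow> continuous_on {0..T} (bond_dissipation x \<xi>)"
  unfolding bond_dissipation_def[abs_def] by (intro continuous_intros nm_cont rel_density_cont) auto

lemma Glauber_term_cont: "\<xi> \<in> configs N \<Longrightarrow> continuous_on {0..T} (Glauber_term x \<xi>)"
  unfolding Glauber_term_def[abs_def] by (intro continuous_intros nm_cont rel_density_cont) auto

lemma bond_dissipation_nonneg: "s \<in> {0..T} \<Longrightarrow> 0 \<le> bond_dissipation x \<xi> s"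
  unfolding bond_dissipation_def using nm_pos[of s N \<xi>] by simp

lemma Glauber_term_nonneg: "s \<in> {0..T} \<Longrightarrow> 0 \<le> Glauber_term x \<xi> s"
  unfolding Glauber_term_def using nm_pos[of s N \<xi>] by simp

lemma dissipation_bound:
  assumes F: "finite F" "F \<subseteq> configs N"
  shows "integral {0..T} (\<lambda>s. \<Sum>\<xi>\<in>F. \<Sum>x\<in>bonds N. bond_dissipation x \<xi> s) \<le> entropy_const * N / (2 * l0 * c)"
proof -
  \<comment> \<open>The densities in a bond term are taken after a particle has been added, so
    \<open>B\<close> must dominate them on these configurations as well.\<close>
  define F' where "F' = F \<union> (\<Union>\<xi>\<in>F. (\<lambda>x. add_at N x \<xi>) ` {- int N - 1..int N + 1})"
  have F': "finite F'" using F(1) by (auto simp: F'_def)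
  obtain B where B: "B > 0" "\<And>s \<xi>. s \<in> {0..T} \<Longrightarrow> \<xi> \<in> F' \<Longrightarrow> rel_density s \<xi> \<le> B"
    using rel_density_bounded[OF F'] by blast
  obtain K where K: "K \<ge> 1" "F \<subseteq> bounded_configs N K" "\<And>\<xi>. \<xi> \<in> F \<Longrightarrow> chi K \<xi> \<ge> 1 / 2"
    "c * ln (1 + B) * integral {0..T} (\<lambda>s. cutoff_flux K s / K) \<le> 1" using cutoff_choice[OF F B(1)] by blast
  have \<tau>: "T \<in> {0..T}" using T by simp
  have C1: "C1 \<ge> 0" using Lam l0 by simp
  have le: "(\<Sum>\<xi>\<in>F. \<Sum>x\<in>bonds N. bond_dissipation x \<xi> s) \<le> 2 * dissipation K B s" if s: "s \<in> {0..T}" for s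
  proof -
    have "(\<Sum>\<xi>\<in>F. \<Sum>x\<in>bonds N. bond_dissipation x \<xi> s) \<le> (\<Sum>\<xi>\<in>F. \<Sum>x\<in>bonds N. 2 * (chi K \<xi> * (nm N s \<xi> *
     (sqrt (1 + min (rel_density s (add_at N (x + 1) \<xi>)) B) - sqrt (1 + min (rel_density s (add_at N x \<xi>)) B))\<^sup>2)))"
    proof (intro sum_mono)
      fix \<xi> x assume \<xi>: "\<xi> \<in> F" and x: "x \<in> bonds N"
      have "add_at N x \<xi> \<in> (\<lambda>x. add_at N x \<xi>) ` {- int N - 1..int N + 1}" "add_at N (x + 1) \<xi> \<in> (\<lambda>x. add_at N x \<xi>) ` {- int N - 1..int N + 1}"
        using bonds_range(1)[OF x] by auto
      then have "add_at N x \<xi> \<in> F'" "add_at N (x + 1) \<xi> \<in> F'" using \<xi> unfolding F'_def by blast+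
      then have "rel_density s (add_at N (x + 1) \<xi>) \<le> B" "rel_density s (add_at N x \<xi>) \<le> B" using B(2)[OF s] by auto
      then have eq: "bond_dissipation x \<xi> s = nm N s \<xi> *
         (sqrt (1 + min (rel_density s (add_at N (x + 1) \<xi>)) B) - sqrt (1 + min (rel_density s (add_at N x \<xi>)) B))\<^sup>2"
        by (simp add: bond_dissipation_def)
      have "1 / 2 * bond_dissipation x \<xi> s \<le> chi K \<xi> * bond_dissipation x \<xi> s"
        using K(3)[OF \<xi>] bond_dissipation_nonneg[OF s] by (intro mult_right_mono) auto
      then show "bond_dissipation x \<xi> s \<le> 2 * (chi K \<xi> * (nm N s \<xi> *
         (sqrt (1 + min (rel_density s (add_at N (x + 1) \<xi>)) B) - sqrt (1 + min (rel_density s (add_at N x \<xi>)) B))\<^sup>2))"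
        unfolding eq[symmetric] by simp
    qed
    also have "\<dots> \<le> 2 * dissipation K B s"
      unfolding dissipation_def sum_distrib_left using K(2) chi_bounds nm_pos[OF s]
      by (intro sum_mono2) (auto intro!: sum_nonneg mult_nonneg_nonneg less_imp_le[OF nm_pos[OF s]])
    finally show ?thesis .
  qed
  have "integral {0..T} (\<lambda>s. \<Sum>\<xi>\<in>F. \<Sum>x\<in>bonds N. bond_dissipation x \<xi> s) \<le> integral {0..T} (\<lambda>s. 2 * dissipation K B s)"
    using F(2) le
    by (intro integral_le integrable_continuous_interval continuous_intros dissipation_cont bond_dissipation_cont) auto
  also have "\<dots> = 2 * integral {0..T} (dissipation K B)" by simp
  also have "integral {0..T} (dissipation K B) \<le> entropy_const * N / 2 / (2 * l0 * c)"
  proof -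
    have "exp (- C1 * T) * cutoff_entropy K B T + exp (- C1 * T) * (2 * l0 * c) * integral {0..T} (dissipation K B)
        \<le> C0 * N + T * (C1 * (1 + mgf_const * N)) + c * ln (1 + B) * integral {0..T} (\<lambda>s. cutoff_flux K s / K)"
      by (rule entropy_inequality[OF \<tau> K(1) B(1)])
    moreover have "0 \<le> exp (- C1 * T) * cutoff_entropy K B T" using cutoff_entropy_nonneg[OF \<tau> B(1)] by simp
    ultimately have "exp (- C1 * T) * (2 * l0 * c) * integral {0..T} (dissipation K B)
       \<le> C0 * N + T * (C1 * (1 + mgf_const * N)) + c * ln (1 + B) * integral {0..T} (\<lambda>s. cutoff_flux K s / K)" by linarith
    then have "exp (C1 * T) * (exp (- C1 * T) * (2 * l0 * c) * integral {0..T} (dissipation K B))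
       \<le> exp (C1 * T) * (C0 * N + T * (C1 * (1 + mgf_const * N)) + c * ln (1 + B) * integral {0..T} (\<lambda>s. cutoff_flux K s / K))"
      by (intro mult_left_mono exp_ge_zero)
    also have "\<dots> \<le> entropy_const * N / 2" by (rule entropy_rhs_le[OF K(4)])
    finally have "(2 * l0 * c) * integral {0..T} (dissipation K B) \<le> entropy_const * N / 2" by (simp add: mult.assoc[symmetric] exp_add[symmetric])
    then show ?thesis using l0 c by (simp add: field_simps)
  qed
  finally show ?thesis by (simp add: mult_ac)
qed

text \<open>The additional particle is carried from \<open>z\<close> bond by bond to the right
  reservoir, where adding it changes nothing. Cauchy-Schwarz costs a factor of at most the number of
  bonds. Since \<open>\<xi>\<close> does not contain the travelling particle, the weight
  \<open>nm N s \<xi>\<close> is the same along the whole path.\<close>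

lemma Glauber_term_le_bond_dissipation:
  assumes z: "z \<in> sites N" and s: "s \<in> {0..T}"
  shows "Glauber_term z \<xi> s \<le> (2 * N + 2) * (\<Sum>x\<in>bonds N. bond_dissipation x \<xi> s)"
proof -
  define h where "h = (\<lambda>x. sqrt (1 + rel_density s (add_at N x \<xi>)))"
  have sub: "{z..int N} \<subseteq> bonds N" using z by (auto simp: bonds_def sites_def)
  have tel: "(\<Sum>x\<in>{z..z + int n}. h (x + 1) - h x) = h (z + int n + 1) - h z" for n
  proof (induction n)
    case (Suc n)
    have "{z..z + int (Suc n)} = insert (z + int n + 1) {z..z + int n}" by auto
    then show ?case using Suc by (simp add: algebra_simps)
  qed simp
  have "(\<Sum>x\<in>{z..int N}. h (x + 1) - h x) = h (int N + 1) - h z"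
    using tel[of "nat (int N - z)"] z by (auto simp: sites_def)
  then have "(h z - h (int N + 1))\<^sup>2 = (\<Sum>x\<in>{z..int N}. h (x + 1) - h x)\<^sup>2"
    by (simp add: power2_commute)
  also have "\<dots> \<le> (\<Sum>x\<in>{z..int N}. (h (x + 1) - h x)\<^sup>2) * card {z..int N}"
    by (rule sum_squared_le_sum_of_squares)
  also have "\<dots> \<le> (\<Sum>x\<in>bonds N. (h (x + 1) - h x)\<^sup>2) * (2 * N + 2)"
    using sub card_mono[OF finite_bonds sub] z
    by (intro mult_mono sum_mono2 sum_nonneg) (auto simp: card_bonds sites_def)
  finally have "nm N s \<xi> * (h z - h (int N + 1))\<^sup>2 \<le> nm N s \<xi> * ((\<Sum>x\<in>bonds N. (h (x + 1) - h x)\<^sup>2) * (2 * N + 2))"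
    using nm_pos[OF s, of N \<xi>] by (intro mult_left_mono) auto
  moreover have "h (int N + 1) = sqrt (1 + rel_density s \<xi>)" by (simp add: h_def add_at_outside sites_def)
  ultimately show ?thesis
    by (simp add: Glauber_term_def bond_dissipation_def h_def sum_distrib_left sum_distrib_right mult_ac)
qed

text \<open>Valued in \<open>ennreal\<close>, because only the time integral is known to be finite;
  at single times the form may be infinite.\<close>

definition Glauber_form :: "int \<Rightarrow> real \<Rightarrow> ennreal" where
  "Glauber_form z s = (SUP K. ennreal (\<Sum>\<xi>\<in>bounded_configs N K. Glauber_term z \<xi> s))"

lemma Glauber_form_measurable: "(\<lambda>s. Glauber_form z s * indicator {0..T} s) \<in> borel_measurable lborel"
proof -
  have "(\<lambda>s. ennreal (indicator {0..T} s *\<^sub>R (\<Sum>\<xi>\<in>bounded_configs N K. Glauber_term z \<xi> s))) \<in> borel_measurable borel" for K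
    using bounded_configs_subset
    by (intro measurable_compose[OF _ measurable_ennreal] borel_measurable_continuous_on_indicator continuous_intros Glauber_term_cont) auto
  then have "(\<lambda>s. SUP K. ennreal (indicator {0..T} s *\<^sub>R (\<Sum>\<xi>\<in>bounded_configs N K. Glauber_term z \<xi> s))) \<in> borel_measurable borel"
    by (intro borel_measurable_SUP) auto
  moreover have "(\<lambda>s. SUP K. ennreal (indicator {0..T} s *\<^sub>R (\<Sum>\<xi>\<in>bounded_configs N K. Glauber_term z \<xi> s))) = (\<lambda>s. Glauber_form z s * indicator {0..T} s)"
    by (auto simp: Glauber_form_def fun_eq_iff indicator_def)
  ultimately show ?thesis by simp
qed

lemma Glauber_term_le_form: "finite F \<Longrightarrow> F \<subseteq> configs N \<Longrightarrow> s \<in> {0..T} \<Longrightarrow> ennreal (\<Sum>\<xi>\<in>F. Glauber_term z \<xi> s) \<le> Glauber_form z s"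
proof -
  assume F: "finite F" "F \<subseteq> configs N" and s: "s \<in> {0..T}"
  then obtain K where "F \<subseteq> bounded_configs N K" using finite_subset_bounded_configs by blast
  then have "ennreal (\<Sum>\<xi>\<in>F. Glauber_term z \<xi> s) \<le> ennreal (\<Sum>\<xi>\<in>bounded_configs N K. Glauber_term z \<xi> s)"
    using Glauber_term_nonneg[OF s] by (intro ennreal_leI sum_mono2) auto
  also have "\<dots> \<le> Glauber_form z s" unfolding Glauber_form_def by (rule SUP_upper) simp
  finally show ?thesis .
qed

lemma integral_Glauber_form:
  assumes z: "z \<in> sites N"
  shows "(\<integral>\<^sup>+s\<in>{0..T}. Glauber_form z s \<partial>lborel) \<le> ennreal (2 * entropy_const * real N ^ 2 / (l0 * c))"
proof -
  have cont: "continuous_on {0..T} (\<lambda>s. \<Sum>\<xi>\<in>bounded_configs N K. Glauber_term z \<xi> s)" for K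
    using bounded_configs_subset by (intro continuous_intros Glauber_term_cont) auto
  have "(\<integral>\<^sup>+s\<in>{0..T}. Glauber_form z s \<partial>lborel) = (\<integral>\<^sup>+s. (SUP K. ennreal (\<Sum>\<xi>\<in>bounded_configs N K. Glauber_term z \<xi> s) * indicator {0..T} s) \<partial>lborel)"
    unfolding Glauber_form_def by (simp add: SUP_mult_right_ennreal)
  also have "\<dots> = (SUP K. \<integral>\<^sup>+s\<in>{0..T}. ennreal (\<Sum>\<xi>\<in>bounded_configs N K. Glauber_term z \<xi> s) \<partial>lborel)"
  proof (rule nn_integral_monotone_convergence_SUP)
    show "incseq (\<lambda>K s. ennreal (\<Sum>\<xi>\<in>bounded_configs N K. Glauber_term z \<xi> s) * indicator {0..T} s)"
    proof (intro incseq_SucI le_funI)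
      fix K s
      have "bounded_configs N K \<subseteq> bounded_configs N (Suc K)" by (rule bounded_configs_mono) simp
      then show "ennreal (\<Sum>\<xi>\<in>bounded_configs N K. Glauber_term z \<xi> s) * indicator {0..T} s \<le> ennreal (\<Sum>\<xi>\<in>bounded_configs N (Suc K). Glauber_term z \<xi> s) * indicator {0..T} s"
        using Glauber_term_nonneg by (cases "s \<in> {0..T}") (auto intro!: ennreal_leI sum_mono2)
    qed
    show "(\<lambda>s. ennreal (\<Sum>\<xi>\<in>bounded_configs N K. Glauber_term z \<xi> s) * indicator {0..T} s) \<in> borel_measurable lborel" for K
    proof -
      have "(\<lambda>s. ennreal (indicator {0..T} s *\<^sub>R (\<Sum>\<xi>\<in>bounded_configs N K. Glauber_term z \<xi> s))) \<in> borel_measurable borel"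
        by (intro measurable_compose[OF _ measurable_ennreal] borel_measurable_continuous_on_indicator cont) auto
      moreover have "(\<lambda>s. ennreal (indicator {0..T} s *\<^sub>R (\<Sum>\<xi>\<in>bounded_configs N K. Glauber_term z \<xi> s))) = (\<lambda>s. ennreal (\<Sum>\<xi>\<in>bounded_configs N K. Glauber_term z \<xi> s) * indicator {0..T} s)"
        by (auto simp: indicator_def fun_eq_iff)
      ultimately show ?thesis by simp
    qed
  qed
  also have "\<dots> \<le> ennreal (2 * entropy_const * real N ^ 2 / (l0 * c))"
  proof (rule SUP_least)
    fix K
    have "(\<integral>\<^sup>+s\<in>{0..T}. ennreal (\<Sum>\<xi>\<in>bounded_configs N K. Glauber_term z \<xi> s) \<partial>lborel) = ennreal (integral {0..T} (\<lambda>s. \<Sum>\<xi>\<in>bounded_configs N K. Glauber_term z \<xi> s))"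
      using Glauber_term_nonneg by (intro nn_integral_cont_Icc cont sum_nonneg) auto
    also have "integral {0..T} (\<lambda>s. \<Sum>\<xi>\<in>bounded_configs N K. Glauber_term z \<xi> s) \<le> integral {0..T} (\<lambda>s. (2 * N + 2) * (\<Sum>\<xi>\<in>bounded_configs N K. \<Sum>x\<in>bonds N. bond_dissipation x \<xi> s))"
    proof (intro integral_le integrable_continuous_interval cont)
      show "continuous_on {0..T} (\<lambda>s. (2 * N + 2) * (\<Sum>\<xi>\<in>bounded_configs N K. \<Sum>x\<in>bonds N. bond_dissipation x \<xi> s))"
        using bounded_configs_subset by (intro continuous_intros bond_dissipation_cont) blast
      show "(\<Sum>\<xi>\<in>bounded_configs N K. Glauber_term z \<xi> s) \<le> (2 * N + 2) * (\<Sum>\<xi>\<in>bounded_configs N K. \<Sum>x\<in>bonds N. bond_dissipation x \<xi> s)" if "s \<in> {0..T}" for s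
        unfolding sum_distrib_left[of _ _ "bounded_configs N K"] by (intro sum_mono Glauber_term_le_bond_dissipation[OF z that])
    qed
    also have "\<dots> = (2 * N + 2) * integral {0..T} (\<lambda>s. \<Sum>\<xi>\<in>bounded_configs N K. \<Sum>x\<in>bonds N. bond_dissipation x \<xi> s)"
      by simp
    \<comment> \<open>\<open>2 * N + 2 \<le> 4 * N\<close> since \<open>N \<ge> 1\<close>. The first
      factor is the cost of the path, the second the time integral of the bond terms.\<close>
    also have "\<dots> \<le> (4 * N) * (entropy_const * N / (2 * l0 * c))"
      using N entropy_const l0 c
      by (intro mult_mono dissipation_bound integral_nonneg integrable_continuous_interval continuous_on_sum
          bond_dissipation_cont bond_dissipation_nonneg sum_nonneg bounded_configs_subset subsetD[OF bounded_configs_subset]) auto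
    also have "\<dots> = 2 * entropy_const * real N ^ 2 / (l0 * c)" by (simp add: power2_eq_square mult_ac)
    finally show "(\<integral>\<^sup>+s\<in>{0..T}. ennreal (\<Sum>\<xi>\<in>bounded_configs N K. Glauber_term z \<xi> s) \<partial>lborel) \<le> ennreal (2 * entropy_const * real N ^ 2 / (l0 * c))"
      by (simp add: ennreal_leI)
  qed
  finally show ?thesis .
qed

end

lemma sum_bounded_configs_add_at:
  assumes z: "z \<in> sites N"
  shows "(\<Sum>\<eta>\<in>bounded_configs N (Suc M). of_bool (\<eta> z = Suc k) * F \<eta>) = (\<Sum>\<xi>\<in>bounded_configs N M. of_bool (\<xi> z = k) * (F (add_at N z \<xi>) :: real))"
proof -
  have "(\<Sum>\<eta>\<in>bounded_configs N (Suc M). of_bool (\<eta> z = Suc k) * F \<eta>) = (\<Sum>\<eta>\<in>{\<eta>\<in>bounded_configs N (Suc M). \<eta> z = Suc k}. F \<eta>)"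
    by (rule sum.mono_neutral_cong_right) auto
  also have "\<dots> = (\<Sum>\<xi>\<in>{\<xi>\<in>bounded_configs N M. \<xi> z = k}. F (add_at N z \<xi>))"
  proof (rule sum.reindex_bij_witness[of _ "add_at N z" "\<lambda>\<eta>. \<eta>(z := \<eta> z - 1)"])
    fix \<eta> assume \<eta>: "\<eta> \<in> {\<eta>\<in>bounded_configs N (Suc M). \<eta> z = Suc k}"
    show "add_at N z (\<eta>(z := \<eta> z - 1)) = \<eta>" using \<eta> z by (auto simp: add_at_def fun_eq_iff)
    have "nparts N (add_at N z (\<eta>(z := \<eta> z - 1))) = nparts N (\<eta>(z := \<eta> z - 1)) + 1" using z by (simp add: nparts_add_at)
    then show "\<eta>(z := \<eta> z - 1) \<in> {\<xi>\<in>bounded_configs N M. \<xi> z = k}"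
      using \<eta> z \<open>add_at N z (\<eta>(z := \<eta> z - 1)) = \<eta>\<close> by (auto simp: bounded_configs_def configs_def)
    show "F (add_at N z (\<eta>(z := \<eta> z - 1))) = F \<eta>" using \<open>add_at N z (\<eta>(z := \<eta> z - 1)) = \<eta>\<close> by simp
  next
    fix \<xi> assume \<xi>: "\<xi> \<in> {\<xi>\<in>bounded_configs N M. \<xi> z = k}"
    show "(add_at N z \<xi>)(z := add_at N z \<xi> z - 1) = \<xi>" using z by (auto simp: add_at_def)
    show "add_at N z \<xi> \<in> {\<eta>\<in>bounded_configs N (Suc M). \<eta> z = Suc k}" using \<xi> z add_at_bounded_configs[of \<xi> N M z] by (auto simp: add_at_def)
  qed
  also have "\<dots> = (\<Sum>\<xi>\<in>bounded_configs N M. of_bool (\<xi> z = k) * F (add_at N z \<xi>))"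
    by (rule sum.mono_neutral_cong_left) auto
  finally show ?thesis .
qed

lemma sum_split4:
  fixes A e a b :: real
  shows "(\<Sum>x\<in>S. A * F1 x + e * (2 * a * F2 x + D x * (b * F3 x) + a * F4 x))
    = A * (\<Sum>x\<in>S. F1 x) + e * (2 * a * (\<Sum>x\<in>S. F2 x) + b * (\<Sum>x\<in>S. D x * F3 x) + a * (\<Sum>x\<in>S. F4 x))"
proof -
  have "(\<Sum>x\<in>S. A * F1 x + e * (2 * a * F2 x + D x * (b * F3 x) + a * F4 x))
    = (\<Sum>x\<in>S. A * F1 x + ((e * 2 * a) * F2 x + ((e * b) * (D x * F3 x) + (e * a) * F4 x)))"
    by (intro sum.cong refl) (simp add: distrib_left mult_ac)
  also have "\<dots> = A * (\<Sum>x\<in>S. F1 x) + ((e * 2 * a) * (\<Sum>x\<in>S. F2 x) + ((e * b) * (\<Sum>x\<in>S. D x * F3 x) + (e * a) * (\<Sum>x\<in>S. F4 x)))"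
    by (simp only: sum.distrib sum_distrib_left)
  finally show ?thesis by (simp only: distrib_left mult.assoc add.assoc)
qed

lemma expectation_bounded_configs_tendsto:
  fixes f :: "(int \<Rightarrow> nat) \<Rightarrow> real"
  assumes Q: "set_pmf Q \<subseteq> configs N" and f: "\<And>\<eta>. \<bar>f \<eta>\<bar> \<le> C"
  shows "(\<lambda>K. \<Sum>\<eta>\<in>bounded_configs N K. f \<eta> * pmf Q \<eta>) \<longlonglongrightarrow> measure_pmf.expectation Q f"
proof -
  have "(\<lambda>K. measure_pmf.expectation Q (\<lambda>\<eta>. indicator (bounded_configs N K) \<eta> * f \<eta>)) \<longlonglongrightarrow> measure_pmf.expectation Q f"
  proof (rule integral_dominated_convergence[where w="\<lambda>_. C"])
    show "AE \<eta> in measure_pmf Q. (\<lambda>K. indicator (bounded_configs N K) \<eta> * f \<eta>) \<longlonglongrightarrow> f \<eta>"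
    proof (rule AE_pmfI)
      fix \<eta> assume "\<eta> \<in> set_pmf Q"
      then have "\<eta> \<in> configs N" using Q by auto
      then have "\<forall>\<^sub>F K in sequentially. indicator (bounded_configs N K) \<eta> * f \<eta> = f \<eta>"
        by (intro eventually_sequentiallyI[of "nparts N \<eta>"]) (auto simp: bounded_configs_def)
      then show "(\<lambda>K. indicator (bounded_configs N K) \<eta> * f \<eta>) \<longlonglongrightarrow> f \<eta>" by (rule tendsto_eventually)
    qed
    show "AE \<eta> in measure_pmf Q. norm (indicator (bounded_configs N K) \<eta> * f \<eta>) \<le> C" for K
      using f order_trans[OF abs_ge_zero f] by (intro AE_pmfI) (auto simp: indicator_def)
  qed auto
  moreover have "measure_pmf.expectation Q (\<lambda>\<eta>. indicator (bounded_configs N K) \<eta> * f \<eta>) = (\<Sum>\<eta>\<in>bounded_configs N K. f \<eta> * pmf Q \<eta>)" for K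
    by (subst integral_measure_pmf_real[of "bounded_configs N K"]) (auto simp: indicator_def split: if_splits intro!: sum.cong)
  ultimately show ?thesis by simp
qed

lemma nn_integral_pmf_le:
  fixes W :: "(int \<Rightarrow> nat) \<Rightarrow> real"
  assumes Q: "set_pmf Q \<subseteq> configs N" and le: "\<And>K. (\<Sum>\<eta>\<in>bounded_configs N K. pmf Q \<eta> * W \<eta>) \<le> b" and W: "\<And>\<eta>. W \<eta> \<ge> 0"
  shows "(\<integral>\<^sup>+\<eta>. ennreal (W \<eta>) \<partial>measure_pmf Q) \<le> ennreal b"
proof -
  have "(\<integral>\<^sup>+\<eta>. ennreal (W \<eta>) \<partial>measure_pmf Q) = (\<integral>\<^sup>+\<eta>. (SUP K. ennreal (W \<eta>) * indicator (bounded_configs N K) \<eta>) \<partial>measure_pmf Q)"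
  proof (rule nn_integral_cong_AE, rule AE_pmfI)
    fix \<eta> assume "\<eta> \<in> set_pmf Q"
    then have \<eta>: "\<eta> \<in> bounded_configs N (nparts N \<eta>)" using Q by (auto simp: bounded_configs_def)
    show "ennreal (W \<eta>) = (SUP K. ennreal (W \<eta>) * indicator (bounded_configs N K) \<eta>)"
    proof (rule antisym)
      show "ennreal (W \<eta>) \<le> (SUP K. ennreal (W \<eta>) * indicator (bounded_configs N K) \<eta>)"
        using \<eta> by (intro SUP_upper2[of "nparts N \<eta>"]) auto
    qed (auto intro!: SUP_least simp: indicator_def)
  qed
  also have "\<dots> = (SUP K. \<integral>\<^sup>+\<eta>. ennreal (W \<eta>) * indicator (bounded_configs N K) \<eta> \<partial>measure_pmf Q)"
  proof (rule nn_integral_monotone_convergence_SUP)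
    show "incseq (\<lambda>K \<eta>. ennreal (W \<eta>) * indicator (bounded_configs N K) \<eta>)"
      by (intro incseq_SucI le_funI) (auto simp: indicator_def bounded_configs_def)
  qed auto
  also have "\<dots> \<le> ennreal b"
  proof (rule SUP_least)
    fix K
    have "(\<integral>\<^sup>+\<eta>. ennreal (W \<eta>) * indicator (bounded_configs N K) \<eta> \<partial>measure_pmf Q) = (\<Sum>\<eta>\<in>bounded_configs N K. ennreal (W \<eta>) * ennreal (pmf Q \<eta>))"
      by (subst nn_integral_measure_pmf_support[of "bounded_configs N K"]) (auto simp: indicator_def intro!: sum.cong)
    also have "\<dots> = ennreal (\<Sum>\<eta>\<in>bounded_configs N K. pmf Q \<eta> * W \<eta>)"
      using W by (subst sum_ennreal[symmetric]) (auto simp: ennreal_mult mult.commute)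
    also have "\<dots> \<le> ennreal b" by (intro ennreal_leI le)
    finally show "(\<integral>\<^sup>+\<eta>. ennreal (W \<eta>) * indicator (bounded_configs N K) \<eta> \<partial>measure_pmf Q) \<le> ennreal b" .
  qed
  finally show ?thesis .
qed

context zr_params begin

abbreviation site :: "real \<Rightarrow> nat \<Rightarrow> real" where "site lam \<equiv> pmf (site_law g lam)"

text \<open>The terms of the series increase with the fugacity, so this one tail bounds the tails
  for all fugacities up to \<open>l1\<close>, see \<open>tail_ge\<close>.\<close>

definition tail :: "nat \<Rightarrow> real" where
  "tail R = Z l1 - (\<Sum>j\<le>R. l1 ^ j / gfact g j)"

section \<open>Equilibrium at a single site\<close>

text \<open>An error of size \<open>1\<close> in each step of \<open>g (j + 1) * q (j + 1) = \<lambda> * q j\<close> adds up to an error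
  of at most \<open>recursion_coeff j\<close> in \<open>q j\<close>.\<close>

fun recursion_coeff :: "nat \<Rightarrow> real" where
  "recursion_coeff 0 = 0" | "recursion_coeff (Suc j) = (l1 * recursion_coeff j + 1) / g (Suc j)"

text \<open>In \<open>single_site\<close> the recursion error enters twice, for the value at
  \<open>k\<close> and for the sum over all values that fixes the normalisation. The 1 keeps the
  constant positive also for \<open>R = 0\<close>, so that an infinite \<open>Glauber_form\<close>
  makes \<open>site_error\<close> infinite.\<close>

definition recursion_sum :: "nat \<Rightarrow> real" where "recursion_sum R = 1 + 2 * (\<Sum>j\<le>R. recursion_coeff j)"

lemma recursion_coeff_nonneg: "recursion_coeff j \<ge> 0"
proof (induction j)
  case (Suc j)
  then show ?case using l1 gpos[of "Suc j"] by simp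
qed simp

lemma recursion_sum_pos: "recursion_sum R > 0"
  unfolding recursion_sum_def using sum_nonneg[of "{..R}" recursion_coeff] recursion_coeff_nonneg by (simp add: add_pos_nonneg)

lemma tail_tendsto: "tail \<longlonglongrightarrow> 0"
proof -
  have "(\<lambda>R. \<Sum>j\<le>R. l1 ^ j / gfact g j) \<longlonglongrightarrow> Z l1"
    unfolding Z_def partition_fun_def using sm[OF l1] by (rule summable_LIMSEQ')
  from tendsto_diff[OF tendsto_const[of "Z l1"] this] show ?thesis by (simp add: tail_def[abs_def])
qed

lemma tail_ge:
  assumes "0 < lam" "lam \<le> l1" shows "Z lam - (\<Sum>j\<le>R. lam ^ j / gfact g j) \<le> tail R"
proof -
  have *: "Z a - (\<Sum>j\<le>R. a ^ j / gfact g j) = (\<Sum>j. a ^ (j + Suc R) / gfact g (j + Suc R))" if "a > 0" for a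
    unfolding Z_def partition_fun_def
    using suminf_split_initial_segment[OF sm[OF that], of "Suc R"] by (simp add: lessThan_Suc_atMost)
  show ?thesis unfolding tail_def *[OF assms(1)] *[OF l1]
  proof (intro suminf_le)
    show "lam ^ (j + Suc R) / gfact g (j + Suc R) \<le> l1 ^ (j + Suc R) / gfact g (j + Suc R)" for j
      using assms by (intro divide_right_mono power_mono less_imp_le[OF gfp]) auto
    show "summable (\<lambda>j. lam ^ (j + Suc R) / gfact g (j + Suc R))" "summable (\<lambda>j. l1 ^ (j + Suc R) / gfact g (j + Suc R))"
      using summable_ignore_initial_segment[OF sm[OF assms(1)], of "Suc R"] summable_ignore_initial_segment[OF sm[OF l1], of "Suc R"] by simp_all
  qed
qed

lemma partial_Z_le: "0 < lam \<Longrightarrow> (\<Sum>j\<le>R. lam ^ j / gfact g j) \<le> Z lam"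
  unfolding Z_def partition_fun_def
  by (intro sum_le_suminf sm) (auto intro!: divide_nonneg_nonneg less_imp_le[OF gfp])

lemma tail_nonneg: "tail R \<ge> 0"
  using partial_Z_le[OF l1] by (simp add: tail_def)

end

context zr_evol
begin

text \<open>The entropy inequality: Young's inequality for the density and \<open>W - b\<close>,
  summed against \<open>nm N s\<close>. The centring by \<open>b\<close> makes the exponential part
  at most 1, and \<open>b\<close> returns multiplied by the mass of the law.\<close>

lemma exp_moment_bound:
  assumes s: "s \<in> {0..T}" and W: "\<And>\<eta>. W \<eta> \<ge> 0" and b: "b \<ge> 0"
    and "(\<integral>\<^sup>+\<eta>. ennreal (exp (W \<eta>)) \<partial>measure_pmf (max_law N)) \<le> ennreal (exp b)"
  shows "(\<integral>\<^sup>+\<eta>. ennreal (W \<eta>) \<partial>measure_pmf (P s)) \<le> ennreal (entropy_const * N + 1 + b)"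
proof (rule nn_integral_pmf_le[OF P_configs[OF s] _ W])
  fix K
  have "(\<Sum>\<eta>\<in>bounded_configs N K. pmf (P s) \<eta> * W \<eta>)
    \<le> (\<Sum>\<eta>\<in>bounded_configs N K. nm N s \<eta> * ent (rel_density s \<eta>) + nm N s \<eta> * exp (W \<eta>) * exp (- b) + b * pmf (P s) \<eta>)"
  proof (intro sum_mono)
    fix \<eta>
    have "nm N s \<eta> * (rel_density s \<eta> * (W \<eta> - b)) \<le> nm N s \<eta> * (ent (rel_density s \<eta>) + exp (W \<eta> - b))"
      using nm_pos[OF s, of N \<eta>] by (intro mult_left_mono young_ent rel_density_nonneg[OF s]) auto
    also have "exp (W \<eta> - b) = exp (W \<eta>) * exp (- b)" by (simp flip: exp_add)
    finally show "pmf (P s) \<eta> * W \<eta> \<le> nm N s \<eta> * ent (rel_density s \<eta>) + nm N s \<eta> * exp (W \<eta>) * exp (- b) + b * pmf (P s) \<eta>"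
      using nm_dens[OF s, of \<eta>] by (simp add: algebra_simps)
  qed
  also have "\<dots> = (\<Sum>\<eta>\<in>bounded_configs N K. nm N s \<eta> * ent (rel_density s \<eta>)) + (\<Sum>\<eta>\<in>bounded_configs N K. nm N s \<eta> * exp (W \<eta>)) * exp (- b)
      + b * (\<Sum>\<eta>\<in>bounded_configs N K. pmf (P s) \<eta>)"
    by (simp add: sum.distrib sum_distrib_left sum_distrib_right)
  also have "\<dots> \<le> entropy_const * N + exp b * exp (- b) + b * 1"
  proof (intro add_mono mult_left_mono mult_right_mono entropy_bound[OF s] nm_weight_le[OF s])
    show "sum (pmf (P s)) (bounded_configs N K) \<le> 1"
      using measure_measure_pmf_finite[of "bounded_configs N K" "P s"] measure_pmf.prob_le_1[of "P s" "bounded_configs N K"] by simp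
  qed (use assms bounded_configs_subset in auto)
  finally show "(\<Sum>\<eta>\<in>bounded_configs N K. pmf (P s) \<eta> * W \<eta>) \<le> entropy_const * N + 1 + b" by (simp flip: exp_add)
qed

definition particle_const :: real where "particle_const = entropy_const + 1 + mgf_const"

lemma particle_const: "particle_const \<ge> 0" unfolding particle_const_def using entropy_const mgf_const_nonneg by simp

lemma nparts_moment:
  assumes s: "s \<in> {0..T}"
  shows "(\<integral>\<^sup>+\<eta>. ennreal (nparts N \<eta>) \<partial>measure_pmf (P s)) \<le> ennreal (particle_const * N)"
proof -
  have "(\<integral>\<^sup>+\<eta>. ennreal (nparts N \<eta>) \<partial>measure_pmf (P s)) \<le> ennreal (entropy_const * N + 1 + mgf_const * N)"
    by (rule exp_moment_bound[OF s]) (use max_law_exp_nparts[OF N] mgf_const_nonneg in auto)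
  also have "\<dots> \<le> ennreal (particle_const * N)" using N by (intro ennreal_leI) (simp add: particle_const_def algebra_simps)
  finally show ?thesis .
qed

text \<open>Markov's inequality summed over the sites. Only the sum is bounded here, not each term,
  which is why the errors of single sites are kept apart until they are averaged.\<close>

lemma sum_tail_prob:
  assumes s: "s \<in> {0..T}" and "R \<ge> 1"
  shows "(\<Sum>y\<in>sites N. measure_pmf.prob (P s) {\<eta>. \<eta> y > R}) \<le> particle_const * N / R"
proof -
  have "ennreal (\<Sum>y\<in>sites N. measure_pmf.prob (P s) {\<eta>. \<eta> y > R}) = (\<integral>\<^sup>+\<eta>. (\<Sum>y\<in>sites N. indicator {\<eta>. \<eta> y > R} \<eta>) \<partial>measure_pmf (P s))"
    by (subst nn_integral_sum) (auto simp: measure_pmf.emeasure_eq_measure)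
  also have "\<dots> \<le> (\<integral>\<^sup>+\<eta>. ennreal (nparts N \<eta>) * ennreal (1 / R) \<partial>measure_pmf (P s))"
  proof (intro nn_integral_mono)
    fix \<eta>
    have "(\<Sum>y\<in>sites N. indicator {\<eta>. \<eta> y > R} \<eta> :: ennreal) = ennreal (\<Sum>y\<in>sites N. indicator {\<eta>. \<eta> y > R} \<eta>)"
      by (subst sum_ennreal[symmetric]) (auto simp: indicator_def of_bool_def simp del: sum_ennreal intro!: sum.cong split: if_split)
    also have "(\<Sum>y\<in>sites N. indicator {\<eta>. \<eta> y > R} \<eta> :: real) \<le> (\<Sum>y\<in>sites N. \<eta> y / R)"
      using \<open>R \<ge> 1\<close> by (intro sum_mono) (auto simp: indicator_def field_simps)
    also have "\<dots> = nparts N \<eta> * (1 / R)" by (simp add: nparts_def sum_divide_distrib)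
    finally show "(\<Sum>y\<in>sites N. indicator {\<eta>. \<eta> y > R} \<eta>) \<le> ennreal (nparts N \<eta>) * ennreal (1 / R)"
      by (simp add: ennreal_mult'[symmetric] ennreal_leI)
  qed
  also have "\<dots> = (\<integral>\<^sup>+\<eta>. ennreal (nparts N \<eta>) \<partial>measure_pmf (P s)) * ennreal (1 / R)"
    by (rule nn_integral_multc) auto
  also have "\<dots> \<le> ennreal (particle_const * N) * ennreal (1 / R)" by (intro mult_right_mono nparts_moment[OF s]) auto
  also have "\<dots> = ennreal (particle_const * N / R)" using particle_const by (simp add: ennreal_mult'[symmetric])
  finally show ?thesis using particle_const by (subst (asm) ennreal_le_iff) auto
qed

text \<open>A configuration with \<open>Suc k\<close> particles at \<open>z\<close> is paired with
  the one lacking a particle there. The two sides of the recursion become the fugacity times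
  \<open>nm N s \<xi>\<close> times the densities at \<open>add_at N z \<xi>\<close> and at
  \<open>\<xi>\<close>, with the common factor \<open>\<Psi> \<xi>\<close>, so
  \<open>diff_via_sqrt\<close> applies. In \<open>3 * l1\<close> two parts come from the mass of the
  reference weight and one from the law.\<close>

lemma one_site_recursion:
  assumes s: "s \<in> {0..T}" and z: "z \<in> sites N" and \<Psi>: "\<And>\<eta>. \<bar>\<Psi> \<eta>\<bar> \<le> 1"
    and inv: "\<And>\<xi>. \<xi> \<in> configs N \<Longrightarrow> \<Psi> (add_at N z \<xi>) = \<Psi> \<xi>"
    and Gl: "Glauber_form z s \<le> ennreal Gl" "Gl \<ge> 0" and e: "e > 0"
  defines "q \<equiv> \<lambda>k. measure_pmf.expectation (P s) (\<lambda>\<eta>. of_bool (\<eta> z = k) * \<Psi> \<eta>)"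
  shows "\<bar>g (Suc k) * q (Suc k) - lx N s z * q k\<bar> \<le> l1 * Gl / (2 * e) + e * (3 * l1 + g (Suc k))"
proof -
  define p where "p = pmf (P s)"
  define la where "la = lx N s z"
  have la: "0 < la" "la \<le> l1" using lx_pos lx_bounds bonds_range(2)[OF z] s by (auto simp: la_def)
  have gk: "g (Suc k) > 0" using gpos by simp
  define qq where "qq = (\<lambda>k M. \<Sum>\<eta>\<in>bounded_configs N M. (of_bool (\<eta> z = k) * \<Psi> \<eta>) * p \<eta>)"
  have qq: "qq k \<longlonglongrightarrow> q k" for k
    unfolding qq_def q_def p_def by (rule expectation_bounded_configs_tendsto[OF P_configs[OF s], of _ 1]) (use \<Psi> in \<open>auto simp: of_bool_def\<close>)
  have pm: "(\<Sum>\<xi>\<in>bounded_configs N M. p \<xi>) \<le> 1" for M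
    using measure_measure_pmf_finite[of "bounded_configs N M" "P s"] measure_pmf.prob_le_1[of "P s" "bounded_configs N M"] by (simp add: p_def)
  have bound: "\<bar>g (Suc k) * qq (Suc k) (Suc M) - la * qq k M\<bar> \<le> l1 * Gl / (2 * e) + e * (3 * l1 + g (Suc k))" for M
  proof -
    have "qq (Suc k) (Suc M) = (\<Sum>\<eta>\<in>bounded_configs N (Suc M). of_bool (\<eta> z = Suc k) * (\<Psi> \<eta> * p \<eta>))"
      by (simp add: qq_def mult.assoc)
    also have "\<dots> = (\<Sum>\<xi>\<in>bounded_configs N M. of_bool (\<xi> z = k) * (\<Psi> (add_at N z \<xi>) * p (add_at N z \<xi>)))"
      by (rule sum_bounded_configs_add_at[OF z])
    also have "\<dots> = (\<Sum>\<xi>\<in>bounded_configs N M. of_bool (\<xi> z = k) * (\<Psi> \<xi> * p (add_at N z \<xi>)))"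
      using inv bounded_configs_subset by (intro sum.cong refl) auto
    finally have 1: "qq (Suc k) (Suc M) = (\<Sum>\<xi>\<in>bounded_configs N M. of_bool (\<xi> z = k) * (\<Psi> \<xi> * p (add_at N z \<xi>)))" .
    have rel: "g (Suc k) * p (add_at N z \<xi>) = la * nm N s \<xi> * rel_density s (add_at N z \<xi>)" if "\<xi> z = k" for \<xi>
      using flux_eq[OF s, of z \<xi>] z that by (simp add: flux_def rate_def add_at_def p_def la_def mult.commute)
    have eq: "g (Suc k) * qq (Suc k) (Suc M) - la * qq k M
      = (\<Sum>\<xi>\<in>bounded_configs N M. of_bool (\<xi> z = k) * (\<Psi> \<xi> * (g (Suc k) * p (add_at N z \<xi>) - la * p \<xi>)))"
      unfolding 1 unfolding qq_def by (simp add: sum_distrib_left sum_subtractf[symmetric] algebra_simps)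
    have "\<bar>g (Suc k) * qq (Suc k) (Suc M) - la * qq k M\<bar> \<le> (\<Sum>\<xi>\<in>bounded_configs N M. la / (2 * e) * Glauber_term z \<xi> s + e * (2 * la * nm N s \<xi> + of_bool (\<xi> z = k) * (g (Suc k) * p (add_at N z \<xi>)) + la * p \<xi>))"
      unfolding eq
    proof (rule order_trans[OF sum_abs], intro sum_mono)
      fix \<xi>
      show "\<bar>of_bool (\<xi> z = k) * (\<Psi> \<xi> * (g (Suc k) * p (add_at N z \<xi>) - la * p \<xi>))\<bar>
        \<le> la / (2 * e) * Glauber_term z \<xi> s + e * (2 * la * nm N s \<xi> + of_bool (\<xi> z = k) * (g (Suc k) * p (add_at N z \<xi>)) + la * p \<xi>)"
      proof (cases "\<xi> z = k")
        case True
        define a b where "a = rel_density s (add_at N z \<xi>)" and "b = rel_density s \<xi>"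
        have ob: "of_bool (\<xi> z = k) = (1::real)" using True by simp
        have ab: "a \<ge> 0" "b \<ge> 0" using rel_density_nonneg[OF s] by (auto simp: a_def b_def)
        have n: "0 \<le> la * nm N s \<xi>" using la nm_pos[OF s, of N \<xi>] by simp
        have p: "g (Suc k) * p (add_at N z \<xi>) = la * nm N s \<xi> * a" "p \<xi> = nm N s \<xi> * b"
          using rel[of \<xi>, OF True] nm_dens[OF s, of \<xi>] by (auto simp: a_def b_def p_def)
        have "\<bar>\<Psi> \<xi> * (g (Suc k) * p (add_at N z \<xi>) - la * p \<xi>)\<bar> \<le> 1 * \<bar>la * nm N s \<xi> * (a - b)\<bar>"
          unfolding abs_mult[of "\<Psi> \<xi>"] p using \<Psi> by (intro mult_mono) (auto simp: algebra_simps)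
        also have "\<dots> = la * nm N s \<xi> * \<bar>a - b\<bar>" using n by (simp only: abs_mult[of "la * nm N s \<xi>"] abs_of_nonneg)
        also have "\<dots> \<le> la * nm N s \<xi> * ((sqrt (1 + a) - sqrt (1 + b))\<^sup>2 / (2 * e) + e * (2 + a + b))"
          by (intro mult_left_mono diff_via_sqrt ab e n)
        also have "\<dots> = la / (2 * e) * Glauber_term z \<xi> s + e * (2 * la * nm N s \<xi> + la * nm N s \<xi> * a + la * (nm N s \<xi> * b))"
          by (simp add: Glauber_term_def a_def b_def algebra_simps)
        finally show ?thesis by (simp only: ob mult_1 p)
      next
        case False
        have ob: "of_bool (\<xi> z = k) = (0::real)" using False by simp
        have "0 \<le> la / (2 * e) * Glauber_term z \<xi> s" "0 \<le> e * (2 * la * nm N s \<xi> + la * p \<xi>)"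
          using la e Glauber_term_nonneg[OF s, of z \<xi>] nm_pos[OF s, of N \<xi>] by (auto simp: p_def)
        then show ?thesis by (simp only: ob mult_zero_left abs_zero add_0_right add_nonneg_nonneg)
      qed
    qed
    also have "\<dots> = la / (2 * e) * (\<Sum>\<xi>\<in>bounded_configs N M. Glauber_term z \<xi> s)
       + e * (2 * la * (\<Sum>\<xi>\<in>bounded_configs N M. nm N s \<xi>) + g (Suc k) * (\<Sum>\<xi>\<in>bounded_configs N M. of_bool (\<xi> z = k) * p (add_at N z \<xi>)) + la * (\<Sum>\<xi>\<in>bounded_configs N M. p \<xi>))"
      by (rule sum_split4)
    also have "\<dots> \<le> l1 / (2 * e) * Gl + e * (2 * l1 * 1 + g (Suc k) * 1 + l1 * 1)"
    proof (intro add_mono mult_mono mult_left_mono)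
      have "ennreal (\<Sum>\<xi>\<in>bounded_configs N M. Glauber_term z \<xi> s) \<le> ennreal Gl"
        using Glauber_term_le_form[of "bounded_configs N M" s z] bounded_configs_subset s Gl(1) by (meson finite_bounded_configs order_trans)
      then show "(\<Sum>\<xi>\<in>bounded_configs N M. Glauber_term z \<xi> s) \<le> Gl" using Gl(2) by (simp add: ennreal_le_iff)
      show "(\<Sum>\<xi>\<in>bounded_configs N M. nm N s \<xi>) \<le> 1" by (intro nm_mass_le s bounded_configs_subset) auto
      have "(\<Sum>\<xi>\<in>bounded_configs N M. of_bool (\<xi> z = k) * p (add_at N z \<xi>)) = (\<Sum>\<eta>\<in>bounded_configs N (Suc M). of_bool (\<eta> z = Suc k) * p \<eta>)"
        by (rule sum_bounded_configs_add_at[OF z, symmetric])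
      also have "\<dots> \<le> (\<Sum>\<eta>\<in>bounded_configs N (Suc M). p \<eta>)" by (intro sum_mono) (auto simp: p_def of_bool_def)
      also have "\<dots> \<le> 1" by (rule pm)
      finally show "(\<Sum>\<xi>\<in>bounded_configs N M. of_bool (\<xi> z = k) * p (add_at N z \<xi>)) \<le> 1" .
      show "(\<Sum>\<xi>\<in>bounded_configs N M. p \<xi>) \<le> 1" by (rule pm)
      show "la / (2 * e) \<le> l1 / (2 * e)" using la e by (intro divide_right_mono) auto
    qed (use la e l1 gk in \<open>auto intro!: sum_nonneg add_nonneg_nonneg mult_nonneg_nonneg Glauber_term_nonneg[OF s] less_imp_le[OF nm_pos[OF s]] simp: p_def\<close>)
    finally show ?thesis by (simp add: algebra_simps)
  qed
  have "(\<lambda>M. \<bar>g (Suc k) * qq (Suc k) (Suc M) - la * qq k M\<bar>) \<longlonglongrightarrow> \<bar>g (Suc k) * q (Suc k) - la * q k\<bar>"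
    by (intro tendsto_intros qq LIMSEQ_Suc[OF qq])
  then show ?thesis unfolding la_def[symmetric] by (rule LIMSEQ_le_const2) (use bound in auto)
qed

end

lemma pmf_integrable_bounded:
  fixes f :: "'b \<Rightarrow> real" shows "(\<And>x. \<bar>f x\<bar> \<le> C) \<Longrightarrow> integrable (measure_pmf Q) f"
  by (intro measure_pmf.integrable_const_bound[where B=C]) auto

lemma pmf_abs_expectation_le:
  fixes f :: "'b \<Rightarrow> real" assumes "\<And>x. \<bar>f x\<bar> \<le> C" shows "\<bar>measure_pmf.expectation Q f\<bar> \<le> C"
proof -
  have "\<bar>measure_pmf.expectation Q f\<bar> \<le> measure_pmf.expectation Q (\<lambda>x. \<bar>f x\<bar>)" by (rule integral_abs_bound)
  also have "\<dots> \<le> C" using assms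
    by (intro measure_pmf.integral_le_const pmf_integrable_bounded[of _ C]) auto
  finally show ?thesis .
qed

context zr_evol begin

abbreviation (input) "msite s z \<equiv> pmf (site_law g (lx N s z))"

text \<open>\<open>R\<close> is the occupation number up to which the recursion is followed,
  \<open>e\<close> the balance parameter of \<open>diff_via_sqrt\<close>.\<close>

definition site_error :: "nat \<Rightarrow> real \<Rightarrow> int \<Rightarrow> real \<Rightarrow> ennreal" where
  "site_error R e z s = ennreal (recursion_sum R * l1 / (2 * e)) * Glauber_form z s
     + ennreal (recursion_sum R * (e * (3 * l1 + Cg * R)) + tail R + measure_pmf.prob (P s) {\<eta>. \<eta> z > R})"

text \<open>Solving the recursion upwards gives \<open>q j\<close> close to
  \<open>w j * q 0\<close>. Summing over \<open>j \<le> R\<close> makes the mean of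
  \<open>\<Psi>\<close> close to \<open>Z la * q 0\<close>, and eliminating \<open>q 0\<close>
  leaves \<open>w k / Z la\<close> times this mean.\<close>

lemma single_site:
  assumes s: "s \<in> {0..T}" and z: "z \<in> sites N" and \<Psi>: "\<And>\<eta>. \<bar>\<Psi> \<eta>\<bar> \<le> 1"
    and inv: "\<And>\<xi>. \<xi> \<in> configs N \<Longrightarrow> \<Psi> (add_at N z \<xi>) = \<Psi> \<xi>"
    and e: "e > 0" and k: "k \<le> R"
  shows "ennreal \<bar>measure_pmf.expectation (P s) (\<lambda>\<eta>. (of_bool (\<eta> z = k) - msite s z k) * \<Psi> \<eta>)\<bar> \<le> site_error R e z s"
proof (cases "Glauber_form z s = \<top>")
  \<comment> \<open>The coefficient of the form is positive, so the right-hand side is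
    infinite.\<close>
  case True
  have "ennreal (recursion_sum R * l1 / (2 * e)) \<noteq> 0" using recursion_sum_pos[of R] l1 e by simp
  then show ?thesis unfolding site_error_def True by (simp add: ennreal_mult_top)
next
  case False
  define Gl where "Gl = enn2real (Glauber_form z s)"
  have Gl: "Glauber_form z s = ennreal Gl" "Gl \<ge> 0" using False by (auto simp: Gl_def less_top)
  define la where "la = lx N s z"
  have la: "0 < la" "la \<le> l1" using lx_pos lx_bounds bonds_range(2)[OF z] s by (auto simp: la_def)
  define E :: "((int \<Rightarrow> nat) \<Rightarrow> real) \<Rightarrow> real" where "E = measure_pmf.expectation (P s)"
  define q where "q = (\<lambda>k. E (\<lambda>\<eta>. of_bool (\<eta> z = k) * \<Psi> \<eta>))"
  define w where "w = (\<lambda>j. la ^ j / gfact g j)"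
  define \<rho> where "\<rho> = l1 * Gl / (2 * e) + e * (3 * l1 + Cg * R)"
  have \<rho>: "\<rho> \<ge> 0" unfolding \<rho>_def using l1 Gl e Cg by simp
  have rel: "\<bar>g (Suc j) * q (Suc j) - la * q j\<bar> \<le> \<rho>" if "Suc j \<le> R" for j
  proof -
    have "\<bar>g (Suc j) * q (Suc j) - la * q j\<bar> \<le> l1 * Gl / (2 * e) + e * (3 * l1 + g (Suc j))"
      unfolding q_def E_def la_def by (rule one_site_recursion[where \<Psi>=\<Psi>, OF s z _ inv]) (use \<Psi> Gl e in auto)
    also have "g (Suc j) \<le> Cg * R"
      by (rule order_trans[OF g_le mult_left_mono]) (use that Cg in auto)
    finally show ?thesis using e by (simp add: \<rho>_def)
  qed
  have rec: "\<bar>q j - w j * q 0\<bar> \<le> recursion_coeff j * \<rho>" if "j \<le> R" for j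
    using that
  proof (induction j)
    case (Suc j)
    have gj: "g (Suc j) > 0" using gpos by simp
    have ws: "w (Suc j) = la * w j / g (Suc j)" by (simp add: w_def)
    have "q (Suc j) - w (Suc j) * q 0 = ((g (Suc j) * q (Suc j) - la * q j) + la * (q j - w j * q 0)) / g (Suc j)"
      using gj by (simp add: ws field_simps)
    then have "\<bar>q (Suc j) - w (Suc j) * q 0\<bar> = \<bar>(g (Suc j) * q (Suc j) - la * q j) + la * (q j - w j * q 0)\<bar> / g (Suc j)"
      using gj by (simp add: abs_divide)
    also have "\<dots> \<le> (\<rho> + l1 * (recursion_coeff j * \<rho>)) / g (Suc j)"
    proof (intro divide_right_mono order_trans[OF abs_triangle_ineq] add_mono)
      show "\<bar>la * (q j - w j * q 0)\<bar> \<le> l1 * (recursion_coeff j * \<rho>)"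
        unfolding abs_mult using la Suc by (intro mult_mono) auto
    qed (use rel Suc gj in auto)
    also have "\<dots> = recursion_coeff (Suc j) * \<rho>" by (simp add: algebra_simps add_divide_distrib)
    finally show ?case .
  qed (simp add: w_def)
  have w0: "w j \<ge> 0" for j using la gfp[of j] by (simp add: w_def)
  have Zla: "Z la \<ge> 1" by (rule Z_ge_1[OF la(1)])
  define ZR where "ZR = (\<Sum>j\<le>R. w j)"
  have ZR: "Z la - ZR \<le> tail R" "ZR \<le> Z la"
    using tail_ge[OF la, of R] partial_Z_le[OF la(1), of R] by (auto simp: ZR_def w_def)
  have wk: "w k \<le> Z la"
  proof -
    have "w k \<le> ZR" unfolding ZR_def using k w0 by (intro member_le_sum) auto
    with ZR show ?thesis by simp
  qed
  have q0: "\<bar>q 0\<bar> \<le> 1" unfolding q_def E_def using \<Psi> by (intro pmf_abs_expectation_le) (auto simp: of_bool_def)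
  define QR where "QR = (\<Sum>j\<le>R. q j)"
  have int: "integrable (measure_pmf (P s)) (\<lambda>\<eta>. of_bool (A \<eta>) * \<Psi> \<eta>)" for A
    using \<Psi> by (intro pmf_integrable_bounded[of _ 1]) (auto simp: of_bool_def)
  have int\<Psi>: "integrable (measure_pmf (P s)) \<Psi>" by (rule pmf_integrable_bounded[OF \<Psi>])
  have QRE: "QR = E (\<lambda>\<eta>. of_bool (\<eta> z \<le> R) * \<Psi> \<eta>)"
  proof -
    have "QR = E (\<lambda>\<eta>. \<Sum>j\<le>R. of_bool (\<eta> z = j) * \<Psi> \<eta>)"
      unfolding QR_def q_def E_def using int by (subst Bochner_Integration.integral_sum) auto
    also have "(\<lambda>\<eta>. \<Sum>j\<le>R. of_bool (\<eta> z = j) * \<Psi> \<eta>) = (\<lambda>\<eta>. of_bool (\<eta> z \<le> R) * \<Psi> \<eta>)"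
      by (auto simp: fun_eq_iff of_bool_def if_distrib[of "\<lambda>x. x * _"] cong: if_cong)
    finally show ?thesis .
  qed
  have QRd: "\<bar>E \<Psi> - QR\<bar> \<le> measure_pmf.prob (P s) {\<eta>. \<eta> z > R}"
  proof -
    have "E \<Psi> - QR = E (\<lambda>\<eta>. \<Psi> \<eta> - of_bool (\<eta> z \<le> R) * \<Psi> \<eta>)"
      unfolding QRE E_def using int int\<Psi> by (subst Bochner_Integration.integral_diff) auto
    also have "\<bar>\<dots>\<bar> \<le> E (\<lambda>\<eta>. \<bar>\<Psi> \<eta> - of_bool (\<eta> z \<le> R) * \<Psi> \<eta>\<bar>)"
      unfolding E_def by (rule integral_abs_bound)
    also have "\<dots> \<le> E (indicator {\<eta>. \<eta> z > R})"
      unfolding E_def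
    proof (rule integral_mono)
      show "integrable (measure_pmf (P s)) (\<lambda>\<eta>. \<bar>\<Psi> \<eta> - of_bool (\<eta> z \<le> R) * \<Psi> \<eta>\<bar>)"
        using int int\<Psi> by (intro integrable_abs Bochner_Integration.integrable_diff)
      show "integrable (measure_pmf (P s)) (indicator {\<eta>. \<eta> z > R} :: _ \<Rightarrow> real)"
        by (intro pmf_integrable_bounded[of _ 1]) (auto simp: indicator_def)
      show "\<bar>\<Psi> \<eta> - of_bool (\<eta> z \<le> R) * \<Psi> \<eta>\<bar> \<le> indicator {\<eta>. \<eta> z > R} \<eta>" for \<eta>
        using \<Psi>[of \<eta>] by (auto simp: indicator_def)
    qed
    also have "\<dots> = measure_pmf.prob (P s) {\<eta>. \<eta> z > R}" by (simp add: E_def)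
    finally show ?thesis .
  qed
  have QRq: "\<bar>QR - ZR * q 0\<bar> \<le> (\<Sum>j\<le>R. recursion_coeff j) * \<rho>"
  proof -
    have "QR - ZR * q 0 = (\<Sum>j\<le>R. q j - w j * q 0)"
      by (simp add: QR_def ZR_def sum_subtractf sum_distrib_right)
    also have "\<bar>\<dots>\<bar> \<le> (\<Sum>j\<le>R. recursion_coeff j * \<rho>)"
      by (rule order_trans[OF sum_abs]) (intro sum_mono rec, simp)
    finally show ?thesis by (simp add: sum_distrib_right)
  qed
  have ms: "msite s z k = w k / Z la" using pmf_site[OF la(1), of k] by (simp add: w_def la_def)
  define v where "v = w k / Z la"
  have v: "0 \<le> v" "v \<le> 1" using w0[of k] wk Zla by (auto simp: v_def)
  have wv: "w k = v * Z la" using Zla by (simp add: v_def)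
  have Ek: "E (\<lambda>\<eta>. (of_bool (\<eta> z = k) - v) * \<Psi> \<eta>) = q k - v * E \<Psi>"
  proof -
    have "E (\<lambda>\<eta>. (of_bool (\<eta> z = k) - v) * \<Psi> \<eta>) = E (\<lambda>\<eta>. of_bool (\<eta> z = k) * \<Psi> \<eta> - v * \<Psi> \<eta>)"
      by (simp add: left_diff_distrib)
    also have "\<dots> = q k - v * E \<Psi>"
      unfolding q_def E_def using int int\<Psi> by (subst Bochner_Integration.integral_diff) auto
    finally show ?thesis .
  qed
  \<comment> \<open>The four differences are the recursion error at \<open>k\<close>, the tail of
    the partition function, the recursion error summed over \<open>j \<le> R\<close>, and the part
    of \<open>\<Psi>\<close> with more than \<open>R\<close> particles at \<open>z\<close>. The last
    three carry the factor \<open>v \<le> 1\<close>.\<close>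
  have "q k - v * E \<Psi> = (q k - w k * q 0) + v * ((Z la - ZR) * q 0) - v * (QR - ZR * q 0) - v * (E \<Psi> - QR)"
    by (simp add: wv algebra_simps)
  also have "\<bar>\<dots>\<bar> \<le> recursion_coeff k * \<rho> + tail R + (\<Sum>j\<le>R. recursion_coeff j) * \<rho> + measure_pmf.prob (P s) {\<eta>. \<eta> z > R}"
  proof -
    have 1: "\<bar>q k - w k * q 0\<bar> \<le> recursion_coeff k * \<rho>" by (rule rec[OF k])
    have "\<bar>v * ((Z la - ZR) * q 0)\<bar> \<le> 1 * ((Z la - ZR) * 1)"
      unfolding abs_mult using v ZR q0 by (intro mult_mono) auto
    then have 2: "\<bar>v * ((Z la - ZR) * q 0)\<bar> \<le> tail R" using ZR by simp
    have vb: "\<bar>v * x\<bar> \<le> \<bar>x\<bar>" for x using v by (simp add: abs_mult mult_left_le_one_le)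
    have 3: "\<bar>v * (QR - ZR * q 0)\<bar> \<le> (\<Sum>j\<le>R. recursion_coeff j) * \<rho>" using vb QRq by (rule order_trans)
    have 4: "\<bar>v * (E \<Psi> - QR)\<bar> \<le> measure_pmf.prob (P s) {\<eta>. \<eta> z > R}" using vb QRd by (rule order_trans)
    from 1 2 3 4 show ?thesis by linarith
  qed
  also have "\<dots> \<le> recursion_sum R * \<rho> + tail R + measure_pmf.prob (P s) {\<eta>. \<eta> z > R}"
  proof -
    have "recursion_coeff k \<le> (\<Sum>j\<le>R. recursion_coeff j)" using k recursion_coeff_nonneg by (intro member_le_sum) auto
    then have "(recursion_coeff k + (\<Sum>j\<le>R. recursion_coeff j)) * \<rho> \<le> recursion_sum R * \<rho>" unfolding recursion_sum_def using \<rho> by (intro mult_right_mono) auto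
    then show ?thesis by (simp add: algebra_simps)
  qed
  also have "\<dots> = recursion_sum R * l1 / (2 * e) * Gl + (recursion_sum R * (e * (3 * l1 + Cg * R)) + tail R + measure_pmf.prob (P s) {\<eta>. \<eta> z > R})"
    by (simp add: \<rho>_def algebra_simps)
  finally have fin: "\<bar>q k - v * E \<Psi>\<bar> \<le> \<dots>" .
  have "site_error R e z s = ennreal (recursion_sum R * l1 / (2 * e) * Gl + (recursion_sum R * (e * (3 * l1 + Cg * R)) + tail R + measure_pmf.prob (P s) {\<eta>. \<eta> z > R}))"
    unfolding site_error_def Gl(1) using recursion_sum_pos[of R] l1 e Gl(2) Cg tail_nonneg[of R]
    by (subst ennreal_mult'[symmetric], simp, subst ennreal_plus[symmetric]) auto
  moreover have "E (\<lambda>\<eta>. (of_bool (\<eta> z = k) - msite s z k) * \<Psi> \<eta>) = q k - v * E \<Psi>"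
    unfolding ms v_def[symmetric] by (rule Ek)
  ultimately show ?thesis using fin by (simp add: E_def ennreal_leI)
qed

lemma prod_of_bool: "finite B \<Longrightarrow> (\<Prod>z\<in>B. of_bool (Q z) :: real) = of_bool (\<forall>z\<in>B. Q z)"
  by (induction B rule: finite_induct) auto

text \<open>Sites are split off one at a time. The indicators at the remaining sites are bounded by
  1 and do not see the site split off, so they join the test function; \<open>single_site\<close>
  admits arbitrary \<open>\<Psi>\<close> for this purpose.\<close>

lemma multi_site:
  assumes s: "s \<in> {0..T}" and "finite B" "B \<subseteq> sites N"
    and e: "e > 0" and k: "\<And>z. z \<in> B \<Longrightarrow> k z \<le> R"
    and "\<And>\<eta>. \<bar>\<Psi> \<eta>\<bar> \<le> 1"
    and "\<And>\<xi> z. \<xi> \<in> configs N \<Longrightarrow> z \<in> B \<Longrightarrow> \<Psi> (add_at N z \<xi>) = \<Psi> \<xi>"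
  shows "ennreal \<bar>measure_pmf.expectation (P s) (\<lambda>\<eta>. ((\<Prod>z\<in>B. of_bool (\<eta> z = k z)) - (\<Prod>z\<in>B. msite s z (k z))) * \<Psi> \<eta>)\<bar>
    \<le> (\<Sum>z\<in>B. site_error R e z s)"
  using assms(2-)
proof (induction B arbitrary: \<Psi> rule: finite_induct)
  case (insert y B)
  define E :: "((int \<Rightarrow> nat) \<Rightarrow> real) \<Rightarrow> real" where "E = measure_pmf.expectation (P s)"
  define Y where "Y = (\<lambda>\<eta>. \<Prod>z\<in>B. of_bool (\<eta> z = k z) :: real)"
  define M where "M = (\<Prod>z\<in>B. msite s z (k z))"
  define a where "a = msite s y (k y)"
  have a: "0 \<le> a" "a \<le> 1" by (auto simp: a_def pmf_le_1)
  have M: "0 \<le> M" "M \<le> 1" unfolding M_def by (auto intro!: prod_nonneg prod_le_1 simp: pmf_le_1)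
  have Y: "0 \<le> Y \<eta>" "Y \<eta> \<le> 1" for \<eta> unfolding Y_def prod_of_bool[OF insert(1)] by auto
  have Ya: "\<bar>Y \<eta>\<bar> \<le> 1" for \<eta> using Y[of \<eta>] by simp
  have bnd: "\<bar>x\<bar> \<le> 1 \<Longrightarrow> \<bar>y\<bar> \<le> 1 \<Longrightarrow> \<bar>x * y\<bar> \<le> 1" for x y :: real by (simp add: abs_mult mult_le_one)
  have "E (\<lambda>\<eta>. ((\<Prod>z\<in>insert y B. of_bool (\<eta> z = k z)) - (\<Prod>z\<in>insert y B. msite s z (k z))) * \<Psi> \<eta>)
    = E (\<lambda>\<eta>. (of_bool (\<eta> y = k y) - a) * (Y \<eta> * \<Psi> \<eta>) + a * ((Y \<eta> - M) * \<Psi> \<eta>))"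
    using insert(1,2) by (simp add: Y_def M_def a_def algebra_simps)
  also have "\<dots> = E (\<lambda>\<eta>. (of_bool (\<eta> y = k y) - a) * (Y \<eta> * \<Psi> \<eta>)) + a * E (\<lambda>\<eta>. (Y \<eta> - M) * \<Psi> \<eta>)"
  proof -
    have "integrable (measure_pmf (P s)) (\<lambda>\<eta>. (of_bool (\<eta> y = k y) - a) * (Y \<eta> * \<Psi> \<eta>))"
      by (intro pmf_integrable_bounded[of _ 1] bnd Ya insert.prems(4)) (use a in \<open>auto simp: of_bool_def\<close>)
    moreover have "integrable (measure_pmf (P s)) (\<lambda>\<eta>. (Y \<eta> - M) * \<Psi> \<eta>)"
    proof (intro pmf_integrable_bounded[of _ 1] bnd insert.prems(4))
      show "\<bar>Y \<eta> - M\<bar> \<le> 1" for \<eta> using Y[of \<eta>] M by (auto simp: abs_le_iff)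
    qed
    ultimately show ?thesis unfolding E_def by simp
  qed
  finally have eq: "E (\<lambda>\<eta>. ((\<Prod>z\<in>insert y B. of_bool (\<eta> z = k z)) - (\<Prod>z\<in>insert y B. msite s z (k z))) * \<Psi> \<eta>)
    = E (\<lambda>\<eta>. (of_bool (\<eta> y = k y) - a) * (Y \<eta> * \<Psi> \<eta>)) + a * E (\<lambda>\<eta>. (Y \<eta> - M) * \<Psi> \<eta>)" .
  have 1: "ennreal \<bar>E (\<lambda>\<eta>. (of_bool (\<eta> y = k y) - a) * (Y \<eta> * \<Psi> \<eta>))\<bar> \<le> site_error R e y s"
    unfolding E_def a_def
  proof (rule single_site[OF s _ _ _ e])
    show "\<bar>Y \<eta> * \<Psi> \<eta>\<bar> \<le> 1" for \<eta> by (intro bnd Ya insert.prems(4))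
    show "Y (add_at N y \<xi>) * \<Psi> (add_at N y \<xi>) = Y \<xi> * \<Psi> \<xi>" if "\<xi> \<in> configs N" for \<xi>
    proof -
      have "Y (add_at N y \<xi>) = Y \<xi>" unfolding Y_def using insert(2) by (intro prod.cong) (auto simp: add_at_def)
      then show ?thesis using insert.prems(5)[OF that, of y] by simp
    qed
  qed (use insert.prems in auto)
  have 2: "ennreal \<bar>E (\<lambda>\<eta>. (Y \<eta> - M) * \<Psi> \<eta>)\<bar> \<le> (\<Sum>z\<in>B. site_error R e z s)"
    unfolding E_def Y_def M_def by (rule insert.IH) (use insert.prems in auto)
  have "\<bar>E (\<lambda>\<eta>. (of_bool (\<eta> y = k y) - a) * (Y \<eta> * \<Psi> \<eta>)) + a * E (\<lambda>\<eta>. (Y \<eta> - M) * \<Psi> \<eta>)\<bar>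
    \<le> \<bar>E (\<lambda>\<eta>. (of_bool (\<eta> y = k y) - a) * (Y \<eta> * \<Psi> \<eta>))\<bar> + \<bar>E (\<lambda>\<eta>. (Y \<eta> - M) * \<Psi> \<eta>)\<bar>"
    using a by (intro order_trans[OF abs_triangle_ineq] add_mono order_refl) (simp add: abs_mult mult_left_le_one_le)
  then have "ennreal \<bar>E (\<lambda>\<eta>. ((\<Prod>z\<in>insert y B. of_bool (\<eta> z = k z)) - (\<Prod>z\<in>insert y B. msite s z (k z))) * \<Psi> \<eta>)\<bar>
    \<le> ennreal \<bar>E (\<lambda>\<eta>. (of_bool (\<eta> y = k y) - a) * (Y \<eta> * \<Psi> \<eta>))\<bar> + ennreal \<bar>E (\<lambda>\<eta>. (Y \<eta> - M) * \<Psi> \<eta>)\<bar>"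
    unfolding eq by (simp flip: ennreal_plus)
  also have "\<dots> \<le> site_error R e y s + (\<Sum>z\<in>B. site_error R e z s)" by (intro add_mono 1 2)
  finally show ?case using insert(1,2) by (simp add: E_def)
qed simp

section \<open>Averages of local patterns\<close>

definition pattern :: "int set \<Rightarrow> (int \<Rightarrow> nat) \<Rightarrow> int \<Rightarrow> (int \<Rightarrow> nat) \<Rightarrow> real" where
  "pattern A k x \<eta> = (\<Prod>z\<in>A. of_bool (\<eta> (z + x) = k z))"

definition pattern_prob :: "int set \<Rightarrow> (int \<Rightarrow> nat) \<Rightarrow> real \<Rightarrow> int \<Rightarrow> real" where
  "pattern_prob A k s x = (\<Prod>z\<in>A. msite s (z + x) (k z))"

definition pattern_average :: "int set \<Rightarrow> (int \<Rightarrow> nat) \<Rightarrow> int set \<Rightarrow> (int \<Rightarrow> real) \<Rightarrow> real \<Rightarrow> (int \<Rightarrow> nat) \<Rightarrow> real" where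
  "pattern_average A k I G s \<eta> = 1 / N * (\<Sum>x\<in>I. G x * (pattern A k x \<eta> - pattern_prob A k s x))"

lemma pattern_bounds: "finite A \<Longrightarrow> 0 \<le> pattern A k x \<eta>" "finite A \<Longrightarrow> pattern A k x \<eta> \<le> 1"
  unfolding pattern_def by (auto simp: prod_of_bool)

lemma pattern_prob_bounds: "0 \<le> pattern_prob A k s x" "pattern_prob A k s x \<le> 1"
  unfolding pattern_prob_def by (auto intro!: prod_nonneg prod_le_1 simp: pmf_le_1)

lemma pattern_deviation_le_1: "finite A \<Longrightarrow> \<bar>pattern A k x \<eta> - pattern_prob A k s x\<bar> \<le> 1"
  using pattern_bounds[of A k x \<eta>] pattern_prob_bounds[of A k s x] by auto

lemma card_subset_sites: "I \<subseteq> sites N \<Longrightarrow> real (card I) \<le> 3 * N"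
  using card_mono[of "sites N" I] card_sites[of N] N by simp

lemma pattern_average_le:
  fixes CG :: real and G :: "int \<Rightarrow> real"
  assumes "finite J" "finite A" "\<And>x. x \<in> J \<Longrightarrow> \<bar>G x\<bar> \<le> CG"
  shows "\<bar>1 / N * (\<Sum>x\<in>J. G x * (pattern A k x \<eta> - pattern_prob A k s x))\<bar> \<le> CG * card J / N"
proof -
  have "\<bar>\<Sum>x\<in>J. G x * (pattern A k x \<eta> - pattern_prob A k s x)\<bar> \<le> (\<Sum>x\<in>J. CG)"
  proof (rule order_trans[OF sum_abs], intro sum_mono)
    fix x assume "x \<in> J"
    have "\<bar>G x * (pattern A k x \<eta> - pattern_prob A k s x)\<bar> \<le> CG * 1"
      unfolding abs_mult using assms(3)[OF \<open>x \<in> J\<close>] pattern_deviation_le_1[OF assms(2)] by (intro mult_mono) auto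
    then show "\<bar>G x * (pattern A k x \<eta> - pattern_prob A k s x)\<bar> \<le> CG" by simp
  qed
  then show ?thesis using N by (simp add: abs_mult divide_right_mono mult.commute)
qed

text \<open>The average is split by whether the translated pattern meets the one at
  \<open>x\<close>. The overlapping part is of order \<open>1 / N\<close> by counting. The other
  part does not depend on the sites of the pattern at \<open>x\<close> and serves as the test
  function of \<open>multi_site\<close>.\<close>

lemma pattern_correlation:
  fixes CG :: real and G :: "int \<Rightarrow> real"
  assumes s: "s \<in> {0..T}" and A: "finite A" and I: "I \<subseteq> sites N" "\<And>x z. x \<in> I \<Longrightarrow> z \<in> A \<Longrightarrow> z + x \<in> sites N"
    and G: "\<And>x. x \<in> I \<Longrightarrow> \<bar>G x\<bar> \<le> CG" and CG: "CG > 0" and k: "\<And>z. z \<in> A \<Longrightarrow> k z \<le> R" and e: "e > 0"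
    and x: "x \<in> I"
  shows "ennreal \<bar>measure_pmf.expectation (P s) (\<lambda>\<eta>. (pattern A k x \<eta> - pattern_prob A k s x) * pattern_average A k I G s \<eta>)\<bar>
    \<le> ennreal (CG * real (card A) ^ 2 / N) + ennreal (3 * CG) * (\<Sum>z\<in>A. site_error R e (z + x) s)"
proof -
  have fI: "finite I" using I(1) finite_subset by blast
  define near where "near = {y \<in> I. (\<lambda>z. z + y) ` A \<inter> (\<lambda>z. z + x) ` A \<noteq> {}}"
  define far where "far = I - near"
  define U where "U = (\<lambda>J \<eta>. 1 / N * (\<Sum>x\<in>J. G x * (pattern A k x \<eta> - pattern_prob A k s x)))"
  define D where "D = (\<lambda>\<eta>. pattern A k x \<eta> - pattern_prob A k s x)"
  define E :: "((int \<Rightarrow> nat) \<Rightarrow> real) \<Rightarrow> real" where "E = measure_pmf.expectation (P s)"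
  have Db: "\<bar>D \<eta>\<bar> \<le> 1" for \<eta> unfolding D_def by (rule pattern_deviation_le_1[OF A])
  \<comment> \<open>An overlap means \<open>b + y = a + x\<close> with \<open>a\<close>,
    \<open>b\<close> in \<open>A\<close>, and the pair determines \<open>y\<close>.\<close>
  have cn: "card near \<le> card A ^ 2"
  proof -
    have "near \<subseteq> (\<lambda>(a, b). a + x - b) ` (A \<times> A)"
    proof
      fix y assume "y \<in> near"
      then obtain a b where "a \<in> A" "b \<in> A" "b + y = a + x" by (auto simp: near_def)
      then show "y \<in> (\<lambda>(a, b). a + x - b) ` (A \<times> A)" by (intro image_eqI[of _ _ "(a, b)"]) auto
    qed
    then have "card near \<le> card ((\<lambda>(a, b). a + x - b) ` (A \<times> A))" using A by (intro card_mono) auto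
    also have "\<dots> \<le> card (A \<times> A)" by (rule card_image_le) (use A in auto)
    finally show ?thesis by (simp add: card_cartesian_product power2_eq_square)
  qed
  have "finite near" "finite far" using fI by (auto simp: near_def far_def)
  have Ub: "\<bar>U J \<eta>\<bar> \<le> CG * card J / N" if "J \<subseteq> I" for J \<eta>
    unfolding U_def using finite_subset[OF that fI] A G that by (intro pattern_average_le) auto
  have "pattern_average A k I G s \<eta> = U near \<eta> + U far \<eta>" for \<eta>
  proof -
    have "near \<subseteq> I" by (auto simp: near_def)
    then show ?thesis unfolding pattern_average_def U_def far_def sum.subset_diff[OF \<open>near \<subseteq> I\<close> fI] by (simp add: algebra_simps)
  qed
  then have "E (\<lambda>\<eta>. D \<eta> * pattern_average A k I G s \<eta>) = E (\<lambda>\<eta>. D \<eta> * U near \<eta> + D \<eta> * U far \<eta>)"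
    by (simp add: distrib_left)
  also have "\<dots> = E (\<lambda>\<eta>. D \<eta> * U near \<eta>) + E (\<lambda>\<eta>. D \<eta> * U far \<eta>)"
  proof -
    have "integrable (measure_pmf (P s)) (\<lambda>\<eta>. D \<eta> * U J \<eta>)" if "J \<subseteq> I" for J
    proof (rule pmf_integrable_bounded[of _ "1 * (CG * card J / N)"])
      show "\<bar>D \<eta> * U J \<eta>\<bar> \<le> 1 * (CG * card J / N)" for \<eta>
        unfolding abs_mult by (intro mult_mono Db Ub[OF that]) auto
    qed
    then show ?thesis unfolding E_def by (intro Bochner_Integration.integral_add) (auto simp: near_def far_def)
  qed
  finally have split: "E (\<lambda>\<eta>. D \<eta> * pattern_average A k I G s \<eta>) = E (\<lambda>\<eta>. D \<eta> * U near \<eta>) + E (\<lambda>\<eta>. D \<eta> * U far \<eta>)" .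
  have 1: "\<bar>E (\<lambda>\<eta>. D \<eta> * U near \<eta>)\<bar> \<le> CG * real (card A) ^ 2 / N"
    unfolding E_def
  proof (rule pmf_abs_expectation_le)
    fix \<eta>
    have "\<bar>D \<eta> * U near \<eta>\<bar> \<le> 1 * (CG * card near / N)"
      unfolding abs_mult by (intro mult_mono Db Ub) (auto simp: near_def)
    also have "\<dots> \<le> CG * real (card A) ^ 2 / N"
      using cn CG of_nat_mono[OF cn, where 'a=real] by (auto intro!: divide_right_mono mult_left_mono)
    finally show "\<bar>D \<eta> * U near \<eta>\<bar> \<le> CG * real (card A) ^ 2 / N" .
  qed
  define B where "B = (\<lambda>z. z + x) ` A"
  have inj: "inj_on (\<lambda>z. z + x) A" by (auto simp: inj_on_def)
  \<comment> \<open>The far part has at most \<open>3 * N\<close> terms of size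
    \<open>CG / N\<close>, so division by \<open>3 * CG\<close> makes it an admissible test
    function.\<close>
  define \<Psi> where "\<Psi> = (\<lambda>\<eta>. U far \<eta> / (3 * CG))"
  have "ennreal \<bar>E (\<lambda>\<eta>. ((\<Prod>w\<in>B. of_bool (\<eta> w = k (w - x))) - (\<Prod>w\<in>B. msite s w (k (w - x)))) * \<Psi> \<eta>)\<bar> \<le> (\<Sum>w\<in>B. site_error R e w s)"
    unfolding E_def
  proof (rule multi_site[OF s _ _ e])
    show "finite B" using A by (simp add: B_def)
    show "B \<subseteq> sites N" using I(2)[OF x] by (auto simp: B_def)
    show "k (w - x) \<le> R" if "w \<in> B" for w using that k by (auto simp: B_def)
    show "\<bar>\<Psi> \<eta>\<bar> \<le> 1" for \<eta>
    proof -
      have "\<bar>U far \<eta>\<bar> \<le> CG * card far / N" by (rule Ub) (auto simp: far_def)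
      also have "\<dots> \<le> CG * (3 * N) / N" using CG card_subset_sites[of far] I(1) by (intro divide_right_mono mult_left_mono) (auto simp: far_def)
      also have "\<dots> = 3 * CG" using N by simp
      finally show ?thesis using CG by (simp add: \<Psi>_def abs_divide)
    qed
    show "\<Psi> (add_at N w \<xi>) = \<Psi> \<xi>" if "\<xi> \<in> configs N" "w \<in> B" for \<xi> w
    proof -
      have "pattern A k y (add_at N w \<xi>) = pattern A k y \<xi>" if "y \<in> far" for y
        unfolding pattern_def
      proof (intro prod.cong refl)
        fix z assume "z \<in> A"
        with that \<open>w \<in> B\<close> have "z + y \<noteq> w" by (auto simp: far_def near_def B_def)
        then show "of_bool (add_at N w \<xi> (z + y) = k z) = (of_bool (\<xi> (z + y) = k z) :: real)" by (simp add: add_at_def)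
      qed
      then show ?thesis unfolding \<Psi>_def U_def by simp
    qed
  qed
  moreover have "(\<Prod>w\<in>B. of_bool (\<eta> w = k (w - x)) :: real) = pattern A k x \<eta>" for \<eta>
    unfolding B_def pattern_def by (subst prod.reindex[OF inj]) simp
  moreover have "(\<Prod>w\<in>B. msite s w (k (w - x))) = pattern_prob A k s x"
    unfolding B_def pattern_prob_def by (subst prod.reindex[OF inj]) simp
  moreover have "(\<Sum>w\<in>B. site_error R e w s) = (\<Sum>z\<in>A. site_error R e (z + x) s)"
    unfolding B_def by (subst sum.reindex[OF inj]) simp
  ultimately have "ennreal \<bar>E (\<lambda>\<eta>. D \<eta> * \<Psi> \<eta>)\<bar> \<le> (\<Sum>z\<in>A. site_error R e (z + x) s)" by (simp add: D_def)
  moreover have "E (\<lambda>\<eta>. D \<eta> * U far \<eta>) = (3 * CG) * E (\<lambda>\<eta>. D \<eta> * \<Psi> \<eta>)"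
    unfolding E_def \<Psi>_def using CG by (subst integral_mult_right_zero[symmetric]) (simp add: mult.left_commute)
  ultimately have 2: "ennreal \<bar>E (\<lambda>\<eta>. D \<eta> * U far \<eta>)\<bar> \<le> ennreal (3 * CG) * (\<Sum>z\<in>A. site_error R e (z + x) s)"
    using CG by (simp add: abs_mult ennreal_mult mult_left_mono)
  have "ennreal \<bar>E (\<lambda>\<eta>. D \<eta> * pattern_average A k I G s \<eta>)\<bar> \<le> ennreal (\<bar>E (\<lambda>\<eta>. D \<eta> * U near \<eta>)\<bar> + \<bar>E (\<lambda>\<eta>. D \<eta> * U far \<eta>)\<bar>)"
    unfolding split by (intro ennreal_leI abs_triangle_ineq)
  also have "\<dots> = ennreal \<bar>E (\<lambda>\<eta>. D \<eta> * U near \<eta>)\<bar> + ennreal \<bar>E (\<lambda>\<eta>. D \<eta> * U far \<eta>)\<bar>" by simp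
  also have "\<dots> \<le> ennreal (CG * real (card A) ^ 2 / N) + ennreal (3 * CG) * (\<Sum>z\<in>A. site_error R e (z + x) s)"
    by (intro add_mono ennreal_leI 1 2)
  finally show ?thesis by (simp add: E_def D_def)
qed

text \<open>One factor of the square is expanded, which leaves the correlations of
  \<open>pattern_correlation\<close>. A site belongs to the patterns of at most
  \<open>card A\<close> positions, so the site errors add up to at most \<open>card A\<close> times
  their sum over all sites.\<close>

lemma variance_bound:
  fixes CG :: real and G :: "int \<Rightarrow> real"
  assumes s: "s \<in> {0..T}" and A: "finite A" and I: "I \<subseteq> sites N" "\<And>x z. x \<in> I \<Longrightarrow> z \<in> A \<Longrightarrow> z + x \<in> sites N"
    and G: "\<And>x. x \<in> I \<Longrightarrow> \<bar>G x\<bar> \<le> CG" and CG: "CG > 0" and k: "\<And>z. z \<in> A \<Longrightarrow> k z \<le> R" and e: "e > 0"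
  shows "ennreal (measure_pmf.expectation (P s) (\<lambda>\<eta>. (pattern_average A k I G s \<eta>)\<^sup>2))
    \<le> ennreal (3 * CG\<^sup>2 * real (card A) ^ 2 / N) + ennreal (3 * CG\<^sup>2 * card A / N) * (\<Sum>y\<in>sites N. site_error R e y s)"
proof -
  have fI: "finite I" using I(1) finite_subset by blast
  define E :: "((int \<Rightarrow> nat) \<Rightarrow> real) \<Rightarrow> real" where "E = measure_pmf.expectation (P s)"
  define D where "D = (\<lambda>x \<eta>. pattern A k x \<eta> - pattern_prob A k s x)"
  define U where "U = pattern_average A k I G s"
  have Ub: "\<bar>U \<eta>\<bar> \<le> CG * card I / N" for \<eta> unfolding U_def pattern_average_def by (rule pattern_average_le) (use fI A G in auto)
  have int: "integrable (measure_pmf (P s)) (\<lambda>\<eta>. D x \<eta> * U \<eta>)" for x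
  proof (rule pmf_integrable_bounded[of _ "1 * (CG * card I / N)"])
    show "\<bar>D x \<eta> * U \<eta>\<bar> \<le> 1 * (CG * card I / N)" for \<eta>
      unfolding abs_mult D_def by (intro mult_mono pattern_deviation_le_1 A Ub) auto
  qed
  have "E (\<lambda>\<eta>. (U \<eta>)\<^sup>2) = E (\<lambda>\<eta>. \<Sum>x\<in>I. 1 / N * G x * (D x \<eta> * U \<eta>))"
  proof -
    have "(U \<eta>)\<^sup>2 = (\<Sum>x\<in>I. 1 / N * G x * (D x \<eta> * U \<eta>))" for \<eta>
    proof -
      have "(U \<eta>)\<^sup>2 = (1 / N * (\<Sum>x\<in>I. G x * D x \<eta>)) * U \<eta>" by (simp add: power2_eq_square U_def pattern_average_def D_def)
      also have "\<dots> = (\<Sum>x\<in>I. 1 / N * G x * (D x \<eta> * U \<eta>))"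
        unfolding sum_distrib_left sum_distrib_right by (intro sum.cong refl) (simp only: mult.assoc)
      finally show ?thesis .
    qed
    then show ?thesis by simp
  qed
  also have "\<dots> = (\<Sum>x\<in>I. 1 / N * G x * E (\<lambda>\<eta>. D x \<eta> * U \<eta>))"
    unfolding E_def using int by (subst Bochner_Integration.integral_sum) auto
  also have "\<dots> \<le> (\<Sum>x\<in>I. CG / N * \<bar>E (\<lambda>\<eta>. D x \<eta> * U \<eta>)\<bar>)"
  proof (intro sum_mono)
    fix x assume "x \<in> I"
    have "1 / N * G x * E (\<lambda>\<eta>. D x \<eta> * U \<eta>) \<le> \<bar>1 / N * G x\<bar> * \<bar>E (\<lambda>\<eta>. D x \<eta> * U \<eta>)\<bar>"
      by (simp only: abs_mult[symmetric] abs_ge_self)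
    also have "\<dots> \<le> CG / N * \<bar>E (\<lambda>\<eta>. D x \<eta> * U \<eta>)\<bar>"
      using G[OF \<open>x \<in> I\<close>] by (intro mult_right_mono) (auto simp: abs_mult divide_right_mono)
    finally show "1 / N * G x * E (\<lambda>\<eta>. D x \<eta> * U \<eta>) \<le> CG / N * \<bar>E (\<lambda>\<eta>. D x \<eta> * U \<eta>)\<bar>" .
  qed
  finally have "ennreal (E (\<lambda>\<eta>. (U \<eta>)\<^sup>2)) \<le> ennreal (\<Sum>x\<in>I. CG / N * \<bar>E (\<lambda>\<eta>. D x \<eta> * U \<eta>)\<bar>)" by (rule ennreal_leI)
  also have "\<dots> = (\<Sum>x\<in>I. ennreal (CG / N) * ennreal \<bar>E (\<lambda>\<eta>. D x \<eta> * U \<eta>)\<bar>)"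
    using CG by (subst sum_ennreal[symmetric]) (auto simp: ennreal_mult[symmetric] simp del: sum_ennreal)
  also have "\<dots> \<le> (\<Sum>x\<in>I. ennreal (CG / N) * (ennreal (CG * real (card A) ^ 2 / N) + ennreal (3 * CG) * (\<Sum>z\<in>A. site_error R e (z + x) s)))"
    unfolding E_def D_def U_def by (intro sum_mono mult_left_mono pattern_correlation[OF s A I G CG k e]) auto
  also have "\<dots> = of_nat (card I) * (ennreal (CG / N) * ennreal (CG * real (card A) ^ 2 / N))
      + ennreal (CG / N) * ennreal (3 * CG) * (\<Sum>x\<in>I. \<Sum>z\<in>A. site_error R e (z + x) s)"
    by (simp add: distrib_left sum.distrib sum_distrib_left mult.assoc)
  also have "\<dots> \<le> ennreal (3 * CG\<^sup>2 * real (card A) ^ 2 / N) + ennreal (3 * CG\<^sup>2 / N) * (of_nat (card A) * (\<Sum>y\<in>sites N. site_error R e y s))"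
  proof (intro add_mono mult_mono)
    have "of_nat (card I) * (ennreal (CG / N) * ennreal (CG * real (card A) ^ 2 / N)) = ennreal (card I * (CG / N * (CG * real (card A) ^ 2 / N)))"
      using CG by (simp add: ennreal_mult[symmetric] ennreal_of_nat_eq_real_of_nat)
    also have "\<dots> \<le> ennreal (3 * N * (CG / N * (CG * real (card A) ^ 2 / N)))"
      using CG card_subset_sites[OF I(1)] by (intro ennreal_leI mult_right_mono) auto
    also have "3 * N * (CG / N * (CG * real (card A) ^ 2 / N)) = 3 * CG\<^sup>2 * real (card A) ^ 2 / N"
      using N by (simp add: power2_eq_square)
    finally show "of_nat (card I) * (ennreal (CG / N) * ennreal (CG * real (card A) ^ 2 / N)) \<le> ennreal (3 * CG\<^sup>2 * real (card A) ^ 2 / N)" .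
    show "ennreal (CG / N) * ennreal (3 * CG) \<le> ennreal (3 * CG\<^sup>2 / N)"
      using CG by (simp add: ennreal_mult[symmetric] power2_eq_square mult_ac)
    have "(\<Sum>x\<in>I. \<Sum>z\<in>A. site_error R e (z + x) s) = (\<Sum>z\<in>A. \<Sum>x\<in>I. site_error R e (z + x) s)" by (rule sum.swap)
    also have "\<dots> \<le> (\<Sum>z\<in>A. \<Sum>y\<in>sites N. site_error R e y s)"
    proof (intro sum_mono)
      fix z assume z: "z \<in> A"
      have "(\<Sum>x\<in>I. site_error R e (z + x) s) = (\<Sum>y\<in>(\<lambda>x. z + x) ` I. site_error R e y s)"
        by (subst sum.reindex) (auto simp: inj_on_def)
      also have "\<dots> \<le> (\<Sum>y\<in>sites N. site_error R e y s)" using I(2) z by (intro sum_mono2) auto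
      finally show "(\<Sum>x\<in>I. site_error R e (z + x) s) \<le> (\<Sum>y\<in>sites N. site_error R e y s)" .
    qed
    finally show "(\<Sum>x\<in>I. \<Sum>z\<in>A. site_error R e (z + x) s) \<le> of_nat (card A) * (\<Sum>y\<in>sites N. site_error R e y s)" by simp
  qed auto
  also have "ennreal (3 * CG\<^sup>2 / N) * (of_nat (card A) * (\<Sum>y\<in>sites N. site_error R e y s)) = ennreal (3 * CG\<^sup>2 * card A / N) * (\<Sum>y\<in>sites N. site_error R e y s)"
    by (simp add: ennreal_of_nat_eq_real_of_nat ennreal_mult'[symmetric] mult.assoc[symmetric])
  finally show ?thesis by (simp add: E_def U_def)
qed

text \<open>From \<open>\<bar>U\<bar> \<le> d + U * U / d\<close> and the variance bound. The time
  integral acts on the Glauber forms, of which there are at most \<open>3 * N\<close>; the rest is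
  bounded at each time. The form of the bound is that needed in \<open>parameter_choice\<close>: it
  is small after choosing \<open>d\<close>, then \<open>R\<close>, then \<open>e\<close>, then
  N.\<close>

lemma indicator_average_bound:
  fixes CG :: real and G :: "int \<Rightarrow> real"
  assumes A: "finite A" and I: "I \<subseteq> sites N" "\<And>x z. x \<in> I \<Longrightarrow> z \<in> A \<Longrightarrow> z + x \<in> sites N"
    and G: "\<And>x. x \<in> I \<Longrightarrow> \<bar>G x\<bar> \<le> CG" and CG: "CG > 0" and k: "\<And>z. z \<in> A \<Longrightarrow> k z \<le> R" and e: "e > 0" and d: "d > 0"
    and R: "R \<ge> 1"
  shows "(\<integral>\<^sup>+s\<in>{0..T}. (\<integral>\<^sup>+\<eta>. ennreal \<bar>pattern_average A k I G s \<eta>\<bar> \<partial>measure_pmf (P s)) \<partial>lborel)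
    \<le> ennreal (d * T + 3 * CG\<^sup>2 / d * (real (card A) ^ 2 * T / N
        + card A * (6 * (recursion_sum R * l1 / (2 * e)) * entropy_const * real N ^ 2 / (l0 * c)
                     + T * (3 * (recursion_sum R * (e * (3 * l1 + Cg * R)) + tail R) + particle_const / R))))"
proof -
  define a where "a = recursion_sum R * l1 / (2 * e)"
  define b where "b = recursion_sum R * (e * (3 * l1 + Cg * R)) + tail R"
  define K where "K = 3 * CG\<^sup>2 * card A / (d * N)"
  define L where "L = d + 3 * CG\<^sup>2 / d * (real (card A) ^ 2 / N) + K * N * (3 * b + particle_const / R)"
  have a: "a \<ge> 0" unfolding a_def using recursion_sum_pos[of R] l1 e by simp
  have b: "b \<ge> 0" unfolding b_def using recursion_sum_pos[of R] l1 e Cg tail_nonneg[of R] by simp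
  have K: "K \<ge> 0" unfolding K_def using d by simp
  have L: "L \<ge> 0" unfolding L_def using d b K particle_const by simp
  have fI: "finite I" using I(1) finite_subset by blast
  have pt: "(\<integral>\<^sup>+\<eta>. ennreal \<bar>pattern_average A k I G s \<eta>\<bar> \<partial>measure_pmf (P s)) \<le> ennreal L + (\<Sum>y\<in>sites N. ennreal (K * a) * Glauber_form y s)"
    if s: "s \<in> {0..T}" for s
  proof -
    define U where "U = pattern_average A k I G s"
    have Ub: "\<bar>U \<eta>\<bar> \<le> CG * card I / N" for \<eta> unfolding U_def pattern_average_def by (rule pattern_average_le) (use fI A G in auto)
    have int: "integrable (measure_pmf (P s)) (\<lambda>\<eta>. (U \<eta>)\<^sup>2)"
    proof (rule pmf_integrable_bounded)
      show "\<bar>(U \<eta>)\<^sup>2\<bar> \<le> (CG * card I / N)\<^sup>2" for \<eta> using power_mono[OF Ub[of \<eta>], of 2] by simp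
    qed
    have "(\<integral>\<^sup>+\<eta>. ennreal \<bar>U \<eta>\<bar> \<partial>measure_pmf (P s)) \<le> (\<integral>\<^sup>+\<eta>. ennreal (d + (U \<eta>)\<^sup>2 / d) \<partial>measure_pmf (P s))"
    proof (intro nn_integral_mono ennreal_leI)
      fix \<eta>
      have "0 \<le> (\<bar>U \<eta>\<bar> - d)\<^sup>2" by simp
      then have "2 * (\<bar>U \<eta>\<bar> * d) \<le> (U \<eta>)\<^sup>2 + d\<^sup>2" by (simp add: power2_diff algebra_simps)
      moreover have "0 \<le> \<bar>U \<eta>\<bar> * d" using d by simp
      ultimately have "\<bar>U \<eta>\<bar> * d \<le> (U \<eta>)\<^sup>2 + d\<^sup>2" by linarith
      then show "\<bar>U \<eta>\<bar> \<le> d + (U \<eta>)\<^sup>2 / d" using d by (simp add: field_simps power2_eq_square)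
    qed
    also have "\<dots> = ennreal (measure_pmf.expectation (P s) (\<lambda>\<eta>. d + (U \<eta>)\<^sup>2 / d))"
      using int d by (intro nn_integral_eq_integral) auto
    also have "measure_pmf.expectation (P s) (\<lambda>\<eta>. d + (U \<eta>)\<^sup>2 / d) = d + 1 / d * measure_pmf.expectation (P s) (\<lambda>\<eta>. (U \<eta>)\<^sup>2)"
      using int by (subst Bochner_Integration.integral_add) auto
    also have "ennreal (d + 1 / d * measure_pmf.expectation (P s) (\<lambda>\<eta>. (U \<eta>)\<^sup>2))
      = ennreal d + ennreal (1 / d) * ennreal (measure_pmf.expectation (P s) (\<lambda>\<eta>. (U \<eta>)\<^sup>2))"
      using d by (simp add: ennreal_mult'[symmetric] flip: ennreal_plus)
    also have "\<dots> \<le> ennreal d + ennreal (1 / d) * (ennreal (3 * CG\<^sup>2 * real (card A) ^ 2 / N) + ennreal (3 * CG\<^sup>2 * card A / N) * (\<Sum>y\<in>sites N. site_error R e y s))"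
      unfolding U_def by (intro add_mono order_refl mult_left_mono variance_bound[OF s A I G CG k e]) auto
    also have "\<dots> = ennreal d + ennreal (3 * CG\<^sup>2 / d * (real (card A) ^ 2 / N)) + ennreal K * (\<Sum>y\<in>sites N. site_error R e y s)"
    proof -
      have h1: "ennreal (1 / d) * ennreal (3 * CG\<^sup>2 * real (card A) ^ 2 / N) = ennreal (3 * CG\<^sup>2 / d * (real (card A) ^ 2 / N))"
        using d by (subst ennreal_mult'[symmetric]) auto
      have h2: "ennreal (1 / d) * ennreal (3 * CG\<^sup>2 * card A / N) = ennreal K"
        using d unfolding K_def by (subst ennreal_mult'[symmetric]) auto
      show ?thesis unfolding distrib_left mult.assoc[symmetric] h1 h2 add.assoc ..
    qed
    also have "(\<Sum>y\<in>sites N. site_error R e y s) = (\<Sum>y\<in>sites N. ennreal a * Glauber_form y s) + ennreal (\<Sum>y\<in>sites N. b + measure_pmf.prob (P s) {\<eta>. \<eta> y > R})"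
      unfolding site_error_def a_def[symmetric] b_def[symmetric] sum.distrib[of "\<lambda>y. ennreal a * Glauber_form y s"]
      using b by (subst sum_ennreal) auto
    also have "(\<Sum>y\<in>sites N. b + measure_pmf.prob (P s) {\<eta>. \<eta> y > R}) \<le> N * (3 * b + particle_const / R)"
    proof -
      have "(\<Sum>y\<in>sites N. b + measure_pmf.prob (P s) {\<eta>. \<eta> y > R}) = card (sites N) * b + (\<Sum>y\<in>sites N. measure_pmf.prob (P s) {\<eta>. \<eta> y > R})"
        by (simp add: sum.distrib)
      also have "\<dots> \<le> 3 * N * b + particle_const * N / R"
        using b card_subset_sites[of "sites N"] by (intro add_mono mult_right_mono sum_tail_prob[OF s R]) auto
      finally show ?thesis by (simp add: algebra_simps)
    qed
    also have "ennreal d + ennreal (3 * CG\<^sup>2 / d * (real (card A) ^ 2 / N)) + ennreal K * ((\<Sum>y\<in>sites N. ennreal a * Glauber_form y s) + ennreal (N * (3 * b + particle_const / R)))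
       = ennreal L + (\<Sum>y\<in>sites N. ennreal (K * a) * Glauber_form y s)"
    proof -
      have 1: "ennreal K * (\<Sum>y\<in>sites N. ennreal a * Glauber_form y s) = (\<Sum>y\<in>sites N. ennreal (K * a) * Glauber_form y s)"
        unfolding sum_distrib_left using K by (simp add: ennreal_mult' mult.assoc)
      have 2: "ennreal K * ennreal (N * (3 * b + particle_const / R)) = ennreal (K * N * (3 * b + particle_const / R))"
        using K by (simp add: ennreal_mult'[symmetric] mult.assoc)
      have 3: "ennreal d + ennreal (3 * CG\<^sup>2 / d * (real (card A) ^ 2 / N)) + ennreal (K * N * (3 * b + particle_const / R)) = ennreal L"
        unfolding L_def using d K b particle_const by (simp flip: ennreal_plus)
      show ?thesis unfolding distrib_left[of "ennreal K"] 1 2 3[symmetric] by (simp only: ac_simps)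
    qed
    finally show ?thesis by (simp add: U_def add_mono mult_left_mono ennreal_leI)
  qed
  have "(\<integral>\<^sup>+s\<in>{0..T}. (\<integral>\<^sup>+\<eta>. ennreal \<bar>pattern_average A k I G s \<eta>\<bar> \<partial>measure_pmf (P s)) \<partial>lborel)
    \<le> (\<integral>\<^sup>+s. ennreal L * indicator {0..T} s + (\<Sum>y\<in>sites N. ennreal (K * a) * (Glauber_form y s * indicator {0..T} s)) \<partial>lborel)"
    using pt by (intro nn_integral_mono) (auto simp: indicator_def sum_distrib_left)
  also have "\<dots> = ennreal L * ennreal T + (\<Sum>y\<in>sites N. ennreal (K * a) * (\<integral>\<^sup>+s\<in>{0..T}. Glauber_form y s \<partial>lborel))"
    using Glauber_form_measurable T
    by (subst nn_integral_add) (auto simp: nn_integral_sum nn_integral_cmult nn_integral_cmult_indicator)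
  also have "\<dots> \<le> ennreal L * ennreal T + (\<Sum>y\<in>sites N. ennreal (K * a) * ennreal (2 * entropy_const * real N ^ 2 / (l0 * c)))"
    by (intro add_mono order_refl sum_mono mult_left_mono integral_Glauber_form) auto
  also have "\<dots> = ennreal (L * T + card (sites N) * (K * a * (2 * entropy_const * real N ^ 2 / (l0 * c))))"
    using L T K a entropy_const l0 c
    by (simp add: ennreal_mult[symmetric] ennreal_of_nat_eq_real_of_nat flip: ennreal_plus)
  also have "\<dots> \<le> ennreal (d * T + 3 * CG\<^sup>2 / d * (real (card A) ^ 2 * T / N
        + card A * (6 * a * entropy_const * real N ^ 2 / (l0 * c) + T * (3 * b + particle_const / R))))"
  proof (intro ennreal_leI)
    have "card (sites N) * (K * a * (2 * entropy_const * real N ^ 2 / (l0 * c))) \<le> 3 * N * (K * a * (2 * entropy_const * real N ^ 2 / (l0 * c)))"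
      using card_subset_sites[of "sites N"] K a entropy_const l0 c by (intro mult_right_mono) auto
    also have "\<dots> = (K * N) * (6 * a * entropy_const * real N ^ 2 / (l0 * c))" by simp
    finally have "L * T + card (sites N) * (K * a * (2 * entropy_const * real N ^ 2 / (l0 * c))) \<le> L * T + (K * N) * (6 * a * entropy_const * real N ^ 2 / (l0 * c))" by simp
    also have KN: "K * N = 3 * CG\<^sup>2 / d * card A" using N by (simp add: K_def)
    also have "L * T + 3 * CG\<^sup>2 / d * card A * (6 * a * entropy_const * real N ^ 2 / (l0 * c))
       = d * T + 3 * CG\<^sup>2 / d * (real (card A) ^ 2 * T / N
        + card A * (6 * a * entropy_const * real N ^ 2 / (l0 * c) + T * (3 * b + particle_const / R)))"
      unfolding L_def KN by (simp add: algebra_simps)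
    finally show "L * T + card (sites N) * (K * a * (2 * entropy_const * real N ^ 2 / (l0 * c))) \<le> \<dots>" .
  qed
  finally show ?thesis by (simp only: a_def b_def)
qed

end

section \<open>Local functions under product measures\<close>

definition determined_on :: "((int \<Rightarrow> nat) \<Rightarrow> 'c) \<Rightarrow> int set \<Rightarrow> bool" where
  "determined_on f A \<longleftrightarrow> (\<forall>\<eta> \<xi>. (\<forall>z\<in>A. \<eta> z = \<xi> z) \<longrightarrow> f \<eta> = f \<xi>)"

lemma determined_onD: "determined_on f A \<Longrightarrow> (\<And>z. z \<in> A \<Longrightarrow> \<eta> z = \<xi> z) \<Longrightarrow> f \<eta> = f \<xi>"
  unfolding determined_on_def by blast

definition cut :: "int set \<Rightarrow> (int \<Rightarrow> nat) \<Rightarrow> int \<Rightarrow> nat" where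
  "cut A \<eta> = (\<lambda>z. if z \<in> A then \<eta> z else 0)"

lemma determined_on_cut: "determined_on f A \<Longrightarrow> f (cut A \<eta>) = f \<eta>"
  by (rule determined_onD) (auto simp: cut_def)

text \<open>Links the infinite product measure in \<open>phi_hat\<close> with the discrete laws used
  elsewhere. The restriction to \<open>A\<close> has the finite product law; since the coordinates
  of \<open>Pi_pmf\<close> are independent, its restriction has the same law; and
  \<open>cut A\<close> sends both to functions that vanish off \<open>A\<close>.\<close>

lemma cut_homogeneous:
  assumes A: "finite A" "A \<noteq> {}"
  shows "cut A \<in> measurable (homogeneous_law g lam) (count_space UNIV)"
    and "distr (homogeneous_law g lam) (count_space UNIV) (cut A) = measure_pmf (Pi_pmf A 0 (\<lambda>_. site_law g lam))"
proof -
  define p where "p = site_law g lam"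
  have cs: "PiM A (\<lambda>_. count_space (UNIV :: nat set)) = count_space (PiE A (\<lambda>_. UNIV))"
    by (rule count_space_PiM_finite) (use A in auto)
  have sets_eq: "sets (PiM A (\<lambda>_. measure_pmf p)) = sets (count_space (PiE A (\<lambda>_. UNIV :: nat set)))"
    unfolding cs[symmetric] by (intro sets_PiM_cong) auto
  have m1: "(\<lambda>f. restrict f A) \<in> measurable (homogeneous_law g lam) (PiM A (\<lambda>_. measure_pmf p))"
    unfolding homogeneous_law_def p_def by (rule measurable_restrict_subset) simp
  have m2: "cut A \<in> measurable (PiM A (\<lambda>_. measure_pmf p)) (count_space UNIV)"
    unfolding measurable_cong_sets[OF sets_eq refl] by simp
  have cr: "cut A (restrict f A) = cut A f" for f by (auto simp: cut_def)
  show meas: "cut A \<in> measurable (homogeneous_law g lam) (count_space UNIV)"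
    using measurable_compose[OF m1 m2] by (simp add: cr)
  interpret product_prob_space "\<lambda>_. measure_pmf p" "UNIV :: int set"
    by (intro product_prob_spaceI) (rule prob_space_measure_pmf)
  have "distr (homogeneous_law g lam) (count_space UNIV) (cut A)
      = distr (distr (homogeneous_law g lam) (PiM A (\<lambda>_. measure_pmf p)) (\<lambda>f. restrict f A)) (count_space UNIV) (cut A)"
    by (subst distr_distr[OF m2 m1]) (simp add: comp_def cr)
  also have "distr (homogeneous_law g lam) (PiM A (\<lambda>_. measure_pmf p)) (\<lambda>f. restrict f A) = PiM A (\<lambda>_. measure_pmf p)"
    unfolding homogeneous_law_def p_def[symmetric] by (rule distr_PiM_restrict_finite) (use A in auto)
  also have "PiM A (\<lambda>_. measure_pmf p) = PiM A (\<lambda>i. distr (measure_pmf (Pi_pmf A 0 (\<lambda>_. p))) (count_space UNIV) (\<lambda>f. f i))"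
  proof (intro PiM_cong refl)
    fix i assume "i \<in> A"
    then have "measure_pmf p = measure_pmf (map_pmf (\<lambda>f. f i) (Pi_pmf A 0 (\<lambda>_. p)))"
      by (subst Pi_pmf_component) (use A in auto)
    then show "measure_pmf p = distr (measure_pmf (Pi_pmf A 0 (\<lambda>_. p))) (count_space UNIV) (\<lambda>f. f i)"
      by (simp add: map_pmf_rep_eq)
  qed
  also have "\<dots> = distr (measure_pmf (Pi_pmf A 0 (\<lambda>_. p))) (PiM A (\<lambda>_. count_space UNIV)) (\<lambda>f. \<lambda>i\<in>A. f i)"
    by (rule iffD1[OF prob_space.indep_vars_iff_distr_eq_PiM'[OF prob_space_measure_pmf], OF _ _ indep_vars_Pi_pmf, symmetric])
       (use A in auto)
  also have "distr \<dots> (count_space UNIV) (cut A) = distr (measure_pmf (Pi_pmf A 0 (\<lambda>_. p))) (count_space UNIV) (cut A \<circ> (\<lambda>f. restrict f A))"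
  proof (rule distr_distr)
    show "cut A \<in> measurable (PiM A (\<lambda>_. count_space UNIV)) (count_space UNIV)"
      unfolding cs by simp
  qed (simp add: cs)
  also have "cut A \<circ> (\<lambda>f. restrict f A) = cut A" by (simp add: comp_def cr)
  also have "distr (measure_pmf (Pi_pmf A 0 (\<lambda>_. p))) (count_space UNIV) (cut A) = measure_pmf (map_pmf (cut A) (Pi_pmf A 0 (\<lambda>_. p)))"
    by (simp add: map_pmf_rep_eq)
  also have "map_pmf (cut A) (Pi_pmf A 0 (\<lambda>_. p)) = Pi_pmf A 0 (\<lambda>_. p)"
    unfolding cut_def[abs_def] using A by (subst Pi_pmf_subset[symmetric]) auto
  finally show "distr (homogeneous_law g lam) (count_space UNIV) (cut A) = measure_pmf (Pi_pmf A 0 (\<lambda>_. site_law g lam))"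
    by (simp add: p_def)
qed

lemma homogeneous_local:
  fixes f :: "(int \<Rightarrow> nat) \<Rightarrow> real"
  assumes A: "finite A" "A \<noteq> {}" and f: "determined_on f A"
  shows "integrable (homogeneous_law g lam) f \<longleftrightarrow> integrable (measure_pmf (Pi_pmf A 0 (\<lambda>_. site_law g lam))) f"
    and "(LINT \<eta>|homogeneous_law g lam. f \<eta>) = measure_pmf.expectation (Pi_pmf A 0 (\<lambda>_. site_law g lam)) f"
proof -
  show "integrable (homogeneous_law g lam) f \<longleftrightarrow> integrable (measure_pmf (Pi_pmf A 0 (\<lambda>_. site_law g lam))) f"
    unfolding cut_homogeneous(2)[OF A, symmetric]
    by (subst integrable_distr_eq[OF cut_homogeneous(1)[OF A]]) (auto simp: determined_on_cut[OF f])
  show "(LINT \<eta>|homogeneous_law g lam. f \<eta>) = measure_pmf.expectation (Pi_pmf A 0 (\<lambda>_. site_law g lam)) f"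
    unfolding cut_homogeneous(2)[OF A, symmetric]
    by (subst integral_distr[OF cut_homogeneous(1)[OF A]]) (auto simp: determined_on_cut[OF f])
qed

lemma nn_integral_Pi_pmf_local:
  assumes "finite S" "A \<subseteq> S" and f: "determined_on f A"
  shows "(\<integral>\<^sup>+\<eta>. f \<eta> \<partial>measure_pmf (Pi_pmf S 0 p)) = (\<integral>\<^sup>+\<eta>. f \<eta> \<partial>measure_pmf (Pi_pmf A 0 p))"
proof -
  have "(\<integral>\<^sup>+\<eta>. f \<eta> \<partial>measure_pmf (Pi_pmf A 0 p)) = (\<integral>\<^sup>+\<eta>. f (cut A \<eta>) \<partial>measure_pmf (Pi_pmf S 0 p))"
    unfolding Pi_pmf_subset[OF assms(1,2)] by (simp add: cut_def)
  then show ?thesis by (simp add: determined_on_cut[OF f])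
qed

lemma nn_integral_Pi_pmf_two_blocks:
  assumes "finite A" "finite B" "A \<inter> B = {}" and f: "determined_on f A" and h: "determined_on h B"
  shows "(\<integral>\<^sup>+\<eta>. f \<eta> * h \<eta> \<partial>measure_pmf (Pi_pmf (A \<union> B) 0 p))
    = (\<integral>\<^sup>+\<eta>. f \<eta> \<partial>measure_pmf (Pi_pmf A 0 p)) * (\<integral>\<^sup>+\<eta>. h \<eta> \<partial>measure_pmf (Pi_pmf B 0 p))"
proof -
  have "(\<integral>\<^sup>+\<eta>. f \<eta> * h \<eta> \<partial>measure_pmf (Pi_pmf (A \<union> B) 0 p))
    = (\<integral>\<^sup>+(a, b). f (\<lambda>x. if x \<in> A then a x else b x) * h (\<lambda>x. if x \<in> A then a x else b x) \<partial>measure_pmf (pair_pmf (Pi_pmf A 0 p) (Pi_pmf B 0 p)))"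
    unfolding Pi_pmf_union[OF assms(1-3)] by (simp add: case_prod_unfold)
  also have "\<dots> = (\<integral>\<^sup>+(a, b). f a * h b \<partial>measure_pmf (pair_pmf (Pi_pmf A 0 p) (Pi_pmf B 0 p)))"
  proof -
    have "f (\<lambda>x. if x \<in> A then a x else b x) = f a" for a b by (rule determined_onD[OF f]) simp
    moreover have "h (\<lambda>x. if x \<in> A then a x else b x) = h b" for a b
      by (rule determined_onD[OF h]) (use assms(3) in auto)
    ultimately show ?thesis by simp
  qed
  also have "\<dots> = (\<integral>\<^sup>+a. \<integral>\<^sup>+b. f a * h b \<partial>measure_pmf (Pi_pmf B 0 p) \<partial>measure_pmf (Pi_pmf A 0 p))"
    by (simp add: nn_integral_pair_pmf')
  also have "\<dots> = (\<integral>\<^sup>+\<eta>. f \<eta> \<partial>measure_pmf (Pi_pmf A 0 p)) * (\<integral>\<^sup>+\<eta>. h \<eta> \<partial>measure_pmf (Pi_pmf B 0 p))"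
    by (simp add: nn_integral_cmult nn_integral_multc)
  finally show ?thesis .
qed

lemma nn_integral_Pi_pmf_blocks:
  fixes F :: "int \<Rightarrow> (int \<Rightarrow> nat) \<Rightarrow> ennreal"
  assumes "finite J" "finite S" "\<And>x. x \<in> J \<Longrightarrow> B x \<subseteq> S" "\<And>x. x \<in> J \<Longrightarrow> determined_on (F x) (B x)"
    and "\<And>x y. x \<in> J \<Longrightarrow> y \<in> J \<Longrightarrow> x \<noteq> y \<Longrightarrow> B x \<inter> B y = {}"
  shows "(\<integral>\<^sup>+\<eta>. (\<Prod>x\<in>J. F x \<eta>) \<partial>measure_pmf (Pi_pmf S 0 p)) = (\<Prod>x\<in>J. \<integral>\<^sup>+\<eta>. F x \<eta> \<partial>measure_pmf (Pi_pmf (B x) 0 p))"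
  using assms(1,3-)
proof (induction J rule: finite_induct)
  case (insert y J)
  define R where "R = S - B y"
  have S: "S = B y \<union> R" "B y \<inter> R = {}" "finite (B y)" "finite R"
    using insert.prems(1)[of y] assms(2) finite_subset by (auto simp: R_def)
  have loc: "determined_on (\<lambda>\<eta>. \<Prod>x\<in>J. F x \<eta>) R"
    unfolding determined_on_def
  proof (intro allI impI prod.cong refl)
    fix \<eta> \<xi> :: "int \<Rightarrow> nat" and x assume eq: "\<forall>z\<in>R. \<eta> z = \<xi> z" and x: "x \<in> J"
    have "B x \<subseteq> R" using insert.prems(1)[of x] insert.prems(3)[of x y] x insert(2) by (auto simp: R_def)
    then show "F x \<eta> = F x \<xi>" using eq insert.prems(2)[of x] x by (intro determined_onD[of "F x" "B x"]) auto
  qed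
  have "(\<integral>\<^sup>+\<eta>. (\<Prod>x\<in>insert y J. F x \<eta>) \<partial>measure_pmf (Pi_pmf S 0 p)) = (\<integral>\<^sup>+\<eta>. F y \<eta> * (\<Prod>x\<in>J. F x \<eta>) \<partial>measure_pmf (Pi_pmf (B y \<union> R) 0 p))"
    using insert(1,2) S(1) by simp
  also have "\<dots> = (\<integral>\<^sup>+\<eta>. F y \<eta> \<partial>measure_pmf (Pi_pmf (B y) 0 p)) * (\<integral>\<^sup>+\<eta>. (\<Prod>x\<in>J. F x \<eta>) \<partial>measure_pmf (Pi_pmf R 0 p))"
    by (rule nn_integral_Pi_pmf_two_blocks[OF S(3,4,2) _ loc]) (use insert.prems in auto)
  also have "(\<integral>\<^sup>+\<eta>. (\<Prod>x\<in>J. F x \<eta>) \<partial>measure_pmf (Pi_pmf R 0 p)) = (\<integral>\<^sup>+\<eta>. (\<Prod>x\<in>J. F x \<eta>) \<partial>measure_pmf (Pi_pmf S 0 p))"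
    by (rule nn_integral_Pi_pmf_local[symmetric, OF assms(2) _ loc]) (auto simp: R_def)
  also have "\<dots> = (\<Prod>x\<in>J. \<integral>\<^sup>+\<eta>. F x \<eta> \<partial>measure_pmf (Pi_pmf (B x) 0 p))"
    using insert.prems by (intro insert.IH) auto
  finally show ?case using insert(1,2) by simp
qed simp

lemma nn_integral_Pi_pmf_shift:
  fixes A :: "int set" and x :: int
  assumes "finite A"
  shows "(\<integral>\<^sup>+\<eta>. f (\<lambda>z. \<eta> (z + x)) \<partial>measure_pmf (Pi_pmf ((\<lambda>z. z + x) ` A) 0 (\<lambda>_. p))) = (\<integral>\<^sup>+\<eta>. f \<eta> \<partial>measure_pmf (Pi_pmf A 0 (\<lambda>_. p)))"
proof -
  have "Pi_pmf A 0 (\<lambda>_. p) = map_pmf (\<lambda>g. g \<circ> (\<lambda>z. z + x)) (Pi_pmf ((\<lambda>z. z + x) ` A) 0 (\<lambda>_. p))"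
    by (rule Pi_pmf_bij_betw) (use assms in \<open>auto simp: bij_betw_def inj_on_def\<close>)
  then show ?thesis by (simp add: comp_def)
qed

context zr_evol begin

text \<open>The translates of \<open>w\<close> by points of one residue class modulo \<open>2 * a + 1\<close> depend on disjoint sets of sites, so the entropy
  inequality applies to their sum.\<close>

lemma block_tail_bound:
  fixes w :: "(int \<Rightarrow> nat) \<Rightarrow> real"
  assumes s: "s \<in> {0..T}" and A: "A \<subseteq> {- a..a}" "a \<ge> 0" and w: "determined_on w A" "\<And>\<eta>. 0 \<le> w \<eta>" and gam: "gam > 0"
    and m: "(\<integral>\<^sup>+\<eta>. ennreal (exp (gam * w \<eta>)) \<partial>measure_pmf (Pi_pmf A 0 (\<lambda>_. site_law g l1))) \<le> ennreal (exp b)" "b \<ge> 0"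
    and I: "I \<subseteq> sites N" "\<And>x z. x \<in> I \<Longrightarrow> z \<in> A \<Longrightarrow> z + x \<in> sites N"
  shows "(\<integral>\<^sup>+\<eta>. ennreal (\<Sum>x\<in>I. w (\<lambda>z. \<eta> (z + x))) \<partial>measure_pmf (P s)) \<le> ennreal ((2 * a + 1) * (entropy_const + 1 + 3 * b) / gam * N)"
proof -
  define md where "md = 2 * a + 1"
  define J where "J = (\<lambda>r. {x \<in> I. x mod md = r})"
  have fA: "finite A" using A by (meson finite_atLeastAtMost_int finite_subset)
  have fI: "finite I" using I(1) finite_subset by blast
  then have fJ: "finite (J r)" for r by (simp add: J_def)
  have res: "(\<integral>\<^sup>+\<eta>. ennreal (\<Sum>x\<in>J r. w (\<lambda>z. \<eta> (z + x))) \<partial>measure_pmf (P s)) \<le> ennreal ((entropy_const + 1 + 3 * b) * N / gam)" for r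
  proof -
    define W where "W = (\<lambda>\<eta>. gam * (\<Sum>x\<in>J r. w (\<lambda>z. \<eta> (z + x))))"
    have W0: "0 \<le> W \<eta>" for \<eta> unfolding W_def using gam w(2) by (intro mult_nonneg_nonneg sum_nonneg) auto
    have "(\<integral>\<^sup>+\<eta>. ennreal (exp (W \<eta>)) \<partial>measure_pmf (max_law N)) \<le> ennreal (exp (3 * N * b))"
    proof -
      have "(\<integral>\<^sup>+\<eta>. ennreal (exp (W \<eta>)) \<partial>measure_pmf (max_law N))
        = (\<integral>\<^sup>+\<eta>. (\<Prod>x\<in>J r. ennreal (exp (gam * w (\<lambda>z. \<eta> (z + x))))) \<partial>measure_pmf (Pi_pmf (sites N) 0 (\<lambda>_. site_law g l1)))"
        unfolding max_law_def W_def sum_distrib_left by (simp add: exp_sum[OF fJ] prod_ennreal)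
      also have "\<dots> = (\<Prod>x\<in>J r. \<integral>\<^sup>+\<eta>. ennreal (exp (gam * w (\<lambda>z. \<eta> (z + x)))) \<partial>measure_pmf (Pi_pmf ((\<lambda>z. z + x) ` A) 0 (\<lambda>_. site_law g l1)))"
      proof (rule nn_integral_Pi_pmf_blocks)
        fix x assume x: "x \<in> J r"
        show "(\<lambda>z. z + x) ` A \<subseteq> sites N" using x I(2) by (auto simp: J_def)
        show "determined_on (\<lambda>\<eta>. ennreal (exp (gam * w (\<lambda>z. \<eta> (z + x))))) ((\<lambda>z. z + x) ` A)"
          unfolding determined_on_def by (auto intro!: arg_cong[where f="\<lambda>v. ennreal (exp (gam * v))"] determined_onD[OF w(1)])
        fix y assume y: "y \<in> J r" "x \<noteq> y"
        show "(\<lambda>z. z + x) ` A \<inter> (\<lambda>z. z + y) ` A = {}"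
        proof (rule ccontr)
          assume "\<not> ?thesis"
          then obtain z z' where z: "z \<in> A" "z' \<in> A" "z + x = z' + y" by auto
          then have "x - y = z' - z" by simp
          moreover have "\<bar>z' - z\<bar> < md"
          proof -
            have "z \<in> {-a..a}" "z' \<in> {-a..a}" using z A(1) by auto
            then show ?thesis by (auto simp: md_def abs_if)
          qed
          moreover have "md dvd x - y"
          proof -
            have "x mod md = y mod md" using x y by (simp add: J_def)
            then show ?thesis by (simp only: mod_eq_dvd_iff)
          qed
          ultimately have "x - y = 0" using zdvd_not_zless[of "\<bar>x - y\<bar>" md] by (metis dvd_abs_iff zero_less_abs_iff)
          then show False using y by simp
        qed
      qed (use fJ in auto)
      also have "\<dots> = (\<Prod>x\<in>J r. \<integral>\<^sup>+\<eta>. ennreal (exp (gam * w \<eta>)) \<partial>measure_pmf (Pi_pmf A 0 (\<lambda>_. site_law g l1)))"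
        by (intro prod.cong refl nn_integral_Pi_pmf_shift[OF fA])
      also have "\<dots> \<le> (\<Prod>x\<in>J r. ennreal (exp b))"
        using m(1) by (intro prod_mono_ennreal) auto
      also have "\<dots> = ennreal (exp (card (J r) * b))"
        by (simp only: prod_constant ennreal_power exp_ge_zero exp_of_nat_mult)
      also have "\<dots> \<le> ennreal (exp (3 * N * b))"
      proof -
        have "real (card (J r)) \<le> 3 * N" by (rule card_subset_sites) (use I(1) in \<open>auto simp: J_def\<close>)
        then show ?thesis using m(2) by (auto intro!: ennreal_leI mult_right_mono)
      qed
      finally show ?thesis .
    qed
    then have "(\<integral>\<^sup>+\<eta>. ennreal (W \<eta>) \<partial>measure_pmf (P s)) \<le> ennreal (entropy_const * N + 1 + 3 * N * b)"
      using m(2) by (intro exp_moment_bound[OF s W0]) auto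
    also have "\<dots> \<le> ennreal ((entropy_const + 1 + 3 * b) * N)" using N by (intro ennreal_leI) (simp add: algebra_simps)
    finally have *: "(\<integral>\<^sup>+\<eta>. ennreal (W \<eta>) \<partial>measure_pmf (P s)) \<le> ennreal ((entropy_const + 1 + 3 * b) * N)" .
    have "(\<integral>\<^sup>+\<eta>. ennreal (\<Sum>x\<in>J r. w (\<lambda>z. \<eta> (z + x))) \<partial>measure_pmf (P s)) = (\<integral>\<^sup>+\<eta>. ennreal (1 / gam) * ennreal (W \<eta>) \<partial>measure_pmf (P s))"
      using gam by (intro nn_integral_cong, subst ennreal_mult'[symmetric]) (auto simp: W_def)
    also have "\<dots> = ennreal (1 / gam) * (\<integral>\<^sup>+\<eta>. ennreal (W \<eta>) \<partial>measure_pmf (P s))" by (rule nn_integral_cmult) auto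
    also have "\<dots> \<le> ennreal (1 / gam) * ennreal ((entropy_const + 1 + 3 * b) * N)" by (intro mult_left_mono *) auto
    also have "\<dots> = ennreal ((entropy_const + 1 + 3 * b) * N / gam)" using gam by (subst ennreal_mult'[symmetric]) auto
    finally show ?thesis .
  qed
  have "(\<Sum>x\<in>I. w (\<lambda>z. \<eta> (z + x))) = (\<Sum>r\<in>{0..<md}. \<Sum>x\<in>J r. w (\<lambda>z. \<eta> (z + x)))" for \<eta>
  proof -
    have "md > 0" using A(2) by (simp add: md_def)
    then have "(\<lambda>x. x mod md) ` I \<subseteq> {0..<md}" by auto
    from sum.group[OF fI _ this, of "\<lambda>x. w (\<lambda>z. \<eta> (z + x))"] show ?thesis by (simp add: J_def)
  qed
  then have "(\<integral>\<^sup>+\<eta>. ennreal (\<Sum>x\<in>I. w (\<lambda>z. \<eta> (z + x))) \<partial>measure_pmf (P s))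
    = (\<integral>\<^sup>+\<eta>. (\<Sum>r\<in>{0..<md}. ennreal (\<Sum>x\<in>J r. w (\<lambda>z. \<eta> (z + x)))) \<partial>measure_pmf (P s))"
    using w(2) by (subst sum_ennreal) (auto intro: sum_nonneg)
  also have "\<dots> = (\<Sum>r\<in>{0..<md}. \<integral>\<^sup>+\<eta>. ennreal (\<Sum>x\<in>J r. w (\<lambda>z. \<eta> (z + x))) \<partial>measure_pmf (P s))"
    by (rule nn_integral_sum) auto
  also have "\<dots> \<le> (\<Sum>r\<in>{0..<md}. ennreal ((entropy_const + 1 + 3 * b) * N / gam))" by (intro sum_mono res)
  also have "\<dots> = ennreal ((2 * a + 1) * (entropy_const + 1 + 3 * b) / gam * N)"
  proof -
    have "(entropy_const + 1 + 3 * b) * N / gam \<ge> 0" using entropy_const m(2) gam by simp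
    then have "(\<Sum>r\<in>{0..<md}. ennreal ((entropy_const + 1 + 3 * b) * N / gam)) = ennreal (\<Sum>r\<in>{0..<md}. (entropy_const + 1 + 3 * b) * N / gam)"
      by (subst sum_ennreal) auto
    also have "(\<Sum>r\<in>{0..<md}. (entropy_const + 1 + 3 * b) * N / gam) = (2 * a + 1) * (entropy_const + 1 + 3 * b) / gam * N"
      using A(2) by (simp add: md_def)
    finally show ?thesis .
  qed
  finally show ?thesis by simp
qed

end

section \<open>The forward equation\<close>

lemma countable_configs: "countable (configs N)"
  unfolding configs_UN_bounded_configs by (intro countable_UN) (auto intro: countable_finite)

text \<open>The points of the countable set with mass 0 form a null set, so almost every value is an
  atom.\<close>

lemma pmf_of_countable_prob:
  assumes "prob_space M" "X \<in> measurable M (count_space UNIV)" "countable C" "\<And>\<omega>. \<omega> \<in> space M \<Longrightarrow> X \<omega> \<in> C"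
  shows "measure_pmf (Abs_pmf (distr M (count_space UNIV) X)) = distr M (count_space UNIV) X"
proof (rule Abs_pmf_inverse, intro CollectI conjI)
  interpret prob_space M by fact
  let ?D = "distr M (count_space UNIV) X"
  show "prob_space ?D" by (rule prob_space_distr) fact
  interpret D: prob_space ?D by fact
  have "AE x in ?D. \<forall>y\<in>C. x = y \<longrightarrow> measure ?D {y} \<noteq> 0"
  proof (subst AE_ball_countable[OF assms(3)], intro ballI)
    fix y
    show "AE x in ?D. x = y \<longrightarrow> measure ?D {y} \<noteq> 0"
    proof (cases "measure ?D {y} = 0")
      case True
      then have "{y} \<in> null_sets ?D" by (simp add: null_sets_def D.emeasure_eq_measure)
      from AE_not_in[OF this] show ?thesis by eventually_elim auto
    qed simp
  qed
  moreover have "AE x in ?D. x \<in> C"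
    using assms by (subst AE_distr_iff) auto
  ultimately show "AE x in ?D. measure ?D {x} \<noteq> 0" by eventually_elim auto
qed simp

locale zr_proc = zr_params +
  fixes \<alpha> :: real and N :: nat and M :: "'w measure" and X :: "real \<Rightarrow> 'w \<Rightarrow> int \<Rightarrow> nat"
  assumes zrp: "zero_range_process \<alpha> g lm lp N M X" and N1: "N \<ge> 1"
begin

sublocale prob_space M using zrp by (simp add: zero_range_process_def)

text \<open>The process is only given for nonnegative times; \<open>clamp\<close> makes the integrands measurable on the whole line.\<close>

definition clamp :: "real \<Rightarrow> real" where "clamp s = max 0 (min T s)"

definition speed :: real where "speed = real N powr (2 + \<alpha>) / 2"

lemma speed: "speed > 0" using N1 by (simp add: speed_def)

lemma clamp: "clamp s \<in> {0..T}" "s \<in> {0..T} \<Longrightarrow> clamp s = s" "0 \<le> clamp s"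
  using T by (auto simp: clamp_def)

lemma clamp_cont: "continuous_on UNIV clamp" unfolding clamp_def[abs_def] by (intro continuous_intros)

lemma X_meas: "t \<ge> 0 \<Longrightarrow> X t \<in> measurable M (count_space (configs N))"
  using zrp by (simp add: zero_range_process_def)

lemma X_configs: "t \<ge> 0 \<Longrightarrow> \<omega> \<in> space M \<Longrightarrow> X t \<omega> \<in> configs N"
  using measurable_space[OF X_meas] by simp

lemma X_meas_UNIV: "t \<ge> 0 \<Longrightarrow> X t \<in> measurable M (count_space UNIV)"
  by (rule measurable_compose[OF X_meas]) auto

definition law_at :: "real \<Rightarrow> (int \<Rightarrow> nat) pmf" where
  "law_at s = Abs_pmf (distr M (count_space UNIV) (X s))"

lemma law_at_eq: "s \<ge> 0 \<Longrightarrow> measure_pmf (law_at s) = distr M (count_space UNIV) (X s)"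
  unfolding law_at_def
  by (rule pmf_of_countable_prob[OF prob_space_axioms X_meas_UNIV countable_configs[of N]]) (auto intro: X_configs)

lemma set_law_at: assumes "s \<ge> 0" shows "set_pmf (law_at s) \<subseteq> configs N"
proof -
  have "AE \<eta> in measure_pmf (law_at s). \<eta> \<in> configs N"
    unfolding law_at_eq[OF assms] using X_configs[OF assms] by (subst AE_distr_iff[OF X_meas_UNIV[OF assms]]) auto
  then show ?thesis by (auto simp: AE_measure_pmf_iff)
qed

lemma pmf_law_at: "s \<ge> 0 \<Longrightarrow> pmf (law_at s) \<zeta> = (\<integral>\<omega>. of_bool (\<zeta> = X s \<omega>) \<partial>M)"
proof -
  assume s: "s \<ge> 0"
  have "pmf (law_at s) \<zeta> = measure (distr M (count_space UNIV) (X s)) {\<zeta>}"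
    by (simp add: measure_pmf_single[symmetric] law_at_eq[OF s])
  also have "\<dots> = prob (X s -` {\<zeta>} \<inter> space M)"
    by (rule measure_distr[OF X_meas_UNIV[OF s]]) simp
  also have "\<dots> = (\<integral>\<omega>. indicator (X s -` {\<zeta>} \<inter> space M) \<omega> \<partial>M)" by simp
  also have "\<dots> = (\<integral>\<omega>. of_bool (\<zeta> = X s \<omega>) \<partial>M)"
    by (intro Bochner_Integration.integral_cong) (auto simp: indicator_def)
  finally show ?thesis .
qed

text \<open>By right continuity the indicator is the limit of its values on grids to the right of \<open>s\<close>.\<close>

lemma joint_indicator: "(\<lambda>(s, \<omega>). of_bool (\<zeta> = X (clamp s) \<omega>) :: real) \<in> borel_measurable (lborel \<Otimes>\<^sub>M M)"
proof -
  define dn where "dn = (\<lambda>(n::nat) s. (real (nat \<lfloor>real (Suc n) * s\<rfloor>) + 1) / real (Suc n))"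
  have dn: "s < dn n s \<and> dn n s \<le> s + 1 / real (Suc n)" if "s \<ge> 0" for n s
  proof -
    have "real (nat \<lfloor>real (Suc n) * s\<rfloor>) = of_int \<lfloor>real (Suc n) * s\<rfloor>" using that by simp
    then have "real (Suc n) * s < real (nat \<lfloor>real (Suc n) * s\<rfloor>) + 1" "real (nat \<lfloor>real (Suc n) * s\<rfloor>) \<le> real (Suc n) * s"
      by linarith+
    then have "s < (real (nat \<lfloor>real (Suc n) * s\<rfloor>) + 1) / real (Suc n)" "real (nat \<lfloor>real (Suc n) * s\<rfloor>) / real (Suc n) \<le> s"
      by (simp_all only: pos_less_divide_eq pos_divide_le_eq of_nat_0_less_iff zero_less_Suc mult.commute)
    then show ?thesis unfolding dn_def add_divide_distrib by simp
  qed
  have pi: "Measurable.pred M (\<lambda>\<omega>. \<zeta> = X t \<omega>)" if "t \<ge> 0" for t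
    using measurable_compose[OF X_meas_UNIV[OF that], of "\<lambda>\<eta>. \<zeta> = \<eta>" "count_space UNIV"] by simp
  show ?thesis
  proof (rule borel_measurable_LIMSEQ_real)
    show "(\<lambda>(s, \<omega>). of_bool (\<zeta> = X (dn n (clamp s)) \<omega>) :: real) \<in> borel_measurable (lborel \<Otimes>\<^sub>M M)" for n
    proof -
      define f where "f = (\<lambda>(i::nat) (p::real \<times> 'w). of_bool (\<zeta> = X ((real i + 1) / real (Suc n)) (snd p)) :: real)"
      have "(\<lambda>p. f (nat \<lfloor>real (Suc n) * clamp (fst p)\<rfloor>) p) \<in> borel_measurable (lborel \<Otimes>\<^sub>M M)"
      proof (rule measurable_compose_countable)
        show "f i \<in> borel_measurable (lborel \<Otimes>\<^sub>M M)" for i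
          unfolding f_def
        proof (rule measurable_compose[OF measurable_snd])
          have "Measurable.pred M (\<lambda>\<omega>. \<zeta> = X ((real i + 1) / real (Suc n)) \<omega>)" by (rule pi) simp
          then show "(\<lambda>\<omega>. of_bool (\<zeta> = X ((real i + 1) / real (Suc n)) \<omega>) :: real) \<in> borel_measurable M"
            by (rule measurable_compose) simp
        qed
        have "clamp \<in> borel_measurable borel" by (rule borel_measurable_continuous_onI[OF clamp_cont])
        then have "(\<lambda>s. nat \<lfloor>real (Suc n) * clamp s\<rfloor>) \<in> measurable borel (count_space UNIV)" by measurable
        then show "(\<lambda>p. nat \<lfloor>real (Suc n) * clamp (fst p)\<rfloor>) \<in> measurable (lborel \<Otimes>\<^sub>M M) (count_space UNIV)"
          by (intro measurable_compose[OF measurable_fst]) simp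
      qed
      then show ?thesis by (simp add: f_def dn_def case_prod_unfold)
    qed
    fix p :: "real \<times> 'w" assume "p \<in> space (lborel \<Otimes>\<^sub>M M)"
    then have \<omega>: "snd p \<in> space M" by (auto simp: space_pair_measure)
    define t where "t = clamp (fst p)"
    have t: "t \<ge> 0" by (simp add: t_def clamp)
    have "eventually (\<lambda>s. X s (snd p) = X t (snd p)) (at_right t)"
      using zrp \<omega> t by (auto simp: zero_range_process_def)
    moreover have "filterlim (\<lambda>n. dn n t) (at_right t) sequentially"
    proof (rule tendsto_imp_filterlim_at_right)
      show "(\<lambda>n. dn n t) \<longlonglongrightarrow> t"
      proof (rule tendsto_sandwich[where f="\<lambda>_. t" and h="\<lambda>n. t + 1 / real (Suc n)"])
        show "(\<lambda>n. t + 1 / real (Suc n)) \<longlonglongrightarrow> t"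
          using tendsto_add[OF tendsto_const LIMSEQ_inverse_real_of_nat, of t] by (simp add: inverse_eq_divide)
      qed (use dn[OF t] in \<open>auto intro!: always_eventually less_imp_le\<close>)
      show "\<forall>\<^sub>F n in sequentially. t < dn n t" using dn[OF t] by simp
    qed
    ultimately have "\<forall>\<^sub>F n in sequentially. X (dn n t) (snd p) = X t (snd p)"
      by (rule eventually_compose_filterlim)
    then have "\<forall>\<^sub>F n in sequentially. (case p of (s, \<omega>) \<Rightarrow> of_bool (\<zeta> = X (dn n (clamp s)) \<omega>)) = ((case p of (s, \<omega>) \<Rightarrow> of_bool (\<zeta> = X (clamp s) \<omega>)) :: real)"
      by eventually_elim (auto simp: t_def case_prod_unfold)
    then show "(\<lambda>n. case p of (s, \<omega>) \<Rightarrow> of_bool (\<zeta> = X (dn n (clamp s)) \<omega>)) \<longlonglongrightarrow> ((case p of (s, \<omega>) \<Rightarrow> of_bool (\<zeta> = X (clamp s) \<omega>)) :: real)"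
      by (rule tendsto_eventually)
  qed
qed

lemma joint_X: "(\<lambda>p. X (clamp (fst p)) (snd p)) \<in> measurable (lborel \<Otimes>\<^sub>M M) (count_space (configs N))"
proof (subst measurable_count_space_eq_countable[OF countable_configs], intro conjI ballI)
  show "(\<lambda>p. X (clamp (fst p)) (snd p)) \<in> space (lborel \<Otimes>\<^sub>M M) \<rightarrow> configs N"
    using X_configs clamp by (auto simp: space_pair_measure)
  fix \<zeta>
  have "(\<lambda>(s, \<omega>). of_bool (\<zeta> = X (clamp s) \<omega>) :: real) -` {1} \<inter> space (lborel \<Otimes>\<^sub>M M) \<in> sets (lborel \<Otimes>\<^sub>M M)"
    by (rule measurable_sets[OF joint_indicator]) simp
  moreover have "(\<lambda>(s, \<omega>). of_bool (\<zeta> = X (clamp s) \<omega>) :: real) -` {1} \<inter> space (lborel \<Otimes>\<^sub>M M)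
     = (\<lambda>p. X (clamp (fst p)) (snd p)) -` {\<zeta>} \<inter> space (lborel \<Otimes>\<^sub>M M)"
    by (auto simp: case_prod_unfold)
  ultimately show "(\<lambda>p. X (clamp (fst p)) (snd p)) -` {\<zeta>} \<inter> space (lborel \<Otimes>\<^sub>M M) \<in> sets (lborel \<Otimes>\<^sub>M M)" by simp
qed

lemma lx_clamp_meas: "(\<lambda>s. lx N (clamp s) x) \<in> borel_measurable borel"
proof (rule borel_measurable_continuous_onI)
  have "continuous_on UNIV ((\<lambda>s. lx N s x) \<circ> clamp)"
    by (intro continuous_on_compose clamp_cont continuous_on_subset[OF lx_cont]) (use clamp in auto)
  then show "continuous_on UNIV (\<lambda>s. lx N (clamp s) x)" by (simp add: comp_def)
qed

text \<open>The martingale property between the times 0 and \<open>t\<close>: conditioning preserves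
  the mean, and at time 0 the process is 0 because its integral runs over a single point.\<close>

lemma dynkin_mean:
  assumes f: "finite {\<eta>. f \<eta> \<noteq> 0}" and t: "t \<ge> 0"
  shows "integrable M (dynkin_process \<alpha> g lm lp N X f t)" "(\<integral>\<omega>. dynkin_process \<alpha> g lm lp N X f t \<omega> \<partial>M) = 0"
proof -
  let ?D = "dynkin_process \<alpha> g lm lp N X f"
  let ?F = "natural_filtration M X 0"
  show int: "integrable M (?D t)" using zrp f t by (auto simp: zero_range_process_def)
  have "sets ?F \<subseteq> sets M"
    unfolding natural_filtration_def
  proof (subst sets_measure_of)
    show "{X s -` {\<xi>} \<inter> space M |s \<xi>. 0 \<le> s \<and> s \<le> 0} \<subseteq> Pow (space M)" by auto
    show "sigma_sets (space M) {X s -` {\<xi>} \<inter> space M |s \<xi>. 0 \<le> s \<and> s \<le> 0} \<subseteq> sets M"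
      using measurable_sets[OF X_meas_UNIV] by (intro sets.sigma_sets_subset) auto
  qed
  then have sub: "subalgebra M ?F" by (simp add: subalgebra_def natural_filtration_def space_measure_of_conv)
  interpret finite_measure_subalgebra M ?F by unfold_locales (rule sub)
  have D0: "?D 0 \<omega> = 0" for \<omega>
  proof -
    have "AE s in lborel. indicator {0..0} s *\<^sub>R zr_generator \<alpha> g lm lp N s f (X s \<omega>) = 0"
      using AE_lborel_singleton[of "0::real"] by eventually_elim simp
    then have "(LINT s:{0..0}|lborel. zr_generator \<alpha> g lm lp N s f (X s \<omega>)) = 0"
      unfolding set_lebesgue_integral_def by (rule integral_eq_zero_AE)
    then show ?thesis by (simp add: dynkin_process_def)
  qed
  have "AE \<omega> in M. real_cond_exp M ?F (?D t) \<omega> = ?D 0 \<omega>" using zrp f t by (auto simp: zero_range_process_def)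
  then have "AE \<omega> in M. real_cond_exp M ?F (?D t) \<omega> = 0" by (simp add: D0)
  then have "(\<integral>\<omega>. real_cond_exp M ?F (?D t) \<omega> \<partial>M) = 0" by (rule integral_eq_zero_AE)
  then show "(\<integral>\<omega>. ?D t \<omega> \<partial>M) = 0" using real_cond_exp_int(2)[OF int] by simp
qed

text \<open>Written through \<open>drift\<close>, the generator along the path is linear in the
  point mass at the current state. Its mean is therefore obtained by putting the law in place of the
  point mass, see \<open>gen_path_mean\<close>.\<close>

definition gen_path :: "nat \<Rightarrow> ((int \<Rightarrow> nat) \<Rightarrow> real) \<Rightarrow> real \<Rightarrow> 'w \<Rightarrow> real" where
  "gen_path K f s \<omega> = speed * drift g N (lx N (clamp s)) (\<lambda>\<zeta>. of_bool (\<zeta> = X (clamp s) \<omega>)) K f"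

definition gen_mean :: "nat \<Rightarrow> ((int \<Rightarrow> nat) \<Rightarrow> real) \<Rightarrow> real \<Rightarrow> real" where
  "gen_mean K f s = speed * drift g N (lx N (clamp s)) (pmf (law_at (clamp s))) K f"

definition gen_bound :: "nat \<Rightarrow> ((int \<Rightarrow> nat) \<Rightarrow> real) \<Rightarrow> real" where
  "gen_bound K f = speed * (\<Sum>\<xi>\<in>bounded_configs N K. \<Sum>x\<in>bonds N.
     (\<bar>g (add_at N x \<xi> x)\<bar> + l1) * \<bar>f (add_at N (x + 1) \<xi>) - f (add_at N x \<xi>)\<bar>
   + (\<bar>g (add_at N (x + 1) \<xi> (x + 1))\<bar> + l1) * \<bar>f (add_at N x \<xi>) - f (add_at N (x + 1) \<xi>)\<bar>)"

lemma rate_bound: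
  assumes "x \<in> {- int N - 1..int N + 1}" shows "\<bar>rate g N (lx N (clamp s)) x \<eta>\<bar> \<le> \<bar>g (\<eta> x)\<bar> + l1"
  using lx_bounds[OF assms clamp(1), of s] lx_pos[OF assms clamp(1), of s] l1 by (auto simp: rate_def)

lemma drift_bound:
  assumes p: "\<And>\<zeta>. \<bar>p \<zeta>\<bar> \<le> 1"
  shows "\<bar>speed * drift g N (lx N (clamp s)) p K f\<bar> \<le> gen_bound K f"
proof -
  have "\<bar>drift g N (lx N (clamp s)) p K f\<bar> \<le> (\<Sum>\<xi>\<in>bounded_configs N K. \<Sum>x\<in>bonds N.
     (\<bar>g (add_at N x \<xi> x)\<bar> + l1) * \<bar>f (add_at N (x + 1) \<xi>) - f (add_at N x \<xi>)\<bar>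
   + (\<bar>g (add_at N (x + 1) \<xi> (x + 1))\<bar> + l1) * \<bar>f (add_at N x \<xi>) - f (add_at N (x + 1) \<xi>)\<bar>)"
    unfolding drift_def
  proof (intro order_trans[OF sum_abs] sum_mono order_trans[OF abs_triangle_ineq] add_mono)
    fix \<xi> x assume x: "x \<in> bonds N"
    have law_flux: "\<bar>flux g N (lx N (clamp s)) p y \<xi>\<bar> \<le> \<bar>g (add_at N y \<xi> y)\<bar> + l1" if "y \<in> {- int N - 1..int N + 1}" for y
    proof -
      have "\<bar>flux g N (lx N (clamp s)) p y \<xi>\<bar> \<le> 1 * (\<bar>g (add_at N y \<xi> y)\<bar> + l1)"
        unfolding flux_def abs_mult using p rate_bound[OF that] by (intro mult_mono) auto
      then show ?thesis by simp
    qed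
    show "\<bar>flux g N (lx N (clamp s)) p x \<xi> * (f (add_at N (x + 1) \<xi>) - f (add_at N x \<xi>))\<bar> \<le> (\<bar>g (add_at N x \<xi> x)\<bar> + l1) * \<bar>f (add_at N (x + 1) \<xi>) - f (add_at N x \<xi>)\<bar>"
      unfolding abs_mult by (intro mult_right_mono law_flux) (use bonds_range(1)[OF x] in auto)
    show "\<bar>flux g N (lx N (clamp s)) p (x + 1) \<xi> * (f (add_at N x \<xi>) - f (add_at N (x + 1) \<xi>))\<bar> \<le> (\<bar>g (add_at N (x + 1) \<xi> (x + 1))\<bar> + l1) * \<bar>f (add_at N x \<xi>) - f (add_at N (x + 1) \<xi>)\<bar>"
      unfolding abs_mult by (intro mult_right_mono law_flux) (use bonds_range(1)[OF x] in auto)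
  qed
  then show ?thesis using speed by (simp add: gen_bound_def abs_mult mult_left_mono)
qed

lemma rate_meas: "(\<lambda>s. rate g N (lx N (clamp s)) x \<eta>) \<in> borel_measurable borel"
  unfolding rate_def using lx_clamp_meas by (cases "x \<in> sites N") auto

lemma gen_path_meas: "(\<lambda>p. gen_path K f (fst p) (snd p)) \<in> borel_measurable (lborel \<Otimes>\<^sub>M M)"
proof -
  have i: "(\<lambda>p. of_bool (\<zeta> = X (clamp (fst p)) (snd p)) :: real) \<in> borel_measurable (lborel \<Otimes>\<^sub>M M)" for \<zeta>
    using joint_indicator[of \<zeta>] by (simp add: case_prod_unfold)
  have r: "(\<lambda>p. rate g N (lx N (clamp (fst p))) x \<eta>) \<in> borel_measurable (lborel \<Otimes>\<^sub>M M)" for x \<eta>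
    by (rule measurable_compose[OF measurable_fst]) (simp add: rate_meas)
  show ?thesis unfolding gen_path_def drift_def flux_def
    by (intro borel_measurable_times borel_measurable_sum borel_measurable_add borel_measurable_const i r)
qed

lemma gen_path_bound: "\<bar>gen_path K f s \<omega>\<bar> \<le> gen_bound K f"
  unfolding gen_path_def by (rule drift_bound) simp

lemma gen_bound: "gen_bound K f \<ge> 0" using gen_path_bound[of K f 0] by (meson abs_ge_zero order_trans)

lemma of_bool_X_int: "t \<ge> 0 \<Longrightarrow> integrable M (\<lambda>\<omega>. of_bool (\<zeta> = X t \<omega>) :: real)"
proof (rule integrable_const_bound[where B=1])
  assume t: "t \<ge> 0"
  show "(\<lambda>\<omega>. of_bool (\<zeta> = X t \<omega>) :: real) \<in> borel_measurable M"
    using measurable_compose[OF X_meas_UNIV[OF t], of "\<lambda>\<eta>. of_bool (\<zeta> = \<eta>) :: real" borel] by simp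
qed auto

lemma gen_path_mean: "(\<integral>\<omega>. gen_path K f s \<omega> \<partial>M) = gen_mean K f s"
proof -
  have i: "integrable M (\<lambda>\<omega>. flux g N (lx N (clamp s)) (\<lambda>\<zeta>. of_bool (\<zeta> = X (clamp s) \<omega>)) x \<xi> * a)"
    "(\<integral>\<omega>. flux g N (lx N (clamp s)) (\<lambda>\<zeta>. of_bool (\<zeta> = X (clamp s) \<omega>)) x \<xi> * a \<partial>M) = flux g N (lx N (clamp s)) (pmf (law_at (clamp s))) x \<xi> * a" for x \<xi> a
    unfolding flux_def using of_bool_X_int[OF clamp(3)] by (auto simp: pmf_law_at[OF clamp(3)])
  define A where "A = (\<lambda>\<xi> x \<omega>. flux g N (lx N (clamp s)) (\<lambda>\<zeta>. of_bool (\<zeta> = X (clamp s) \<omega>)) x \<xi> * (f (add_at N (x + 1) \<xi>) - f (add_at N x \<xi>))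
    + flux g N (lx N (clamp s)) (\<lambda>\<zeta>. of_bool (\<zeta> = X (clamp s) \<omega>)) (x + 1) \<xi> * (f (add_at N x \<xi>) - f (add_at N (x + 1) \<xi>)))"
  have I: "integrable M (A \<xi> x)" for \<xi> x unfolding A_def by (intro Bochner_Integration.integrable_add i)
  have A: "(\<integral>\<omega>. A \<xi> x \<omega> \<partial>M) = flux g N (lx N (clamp s)) (pmf (law_at (clamp s))) x \<xi> * (f (add_at N (x + 1) \<xi>) - f (add_at N x \<xi>))
    + flux g N (lx N (clamp s)) (pmf (law_at (clamp s))) (x + 1) \<xi> * (f (add_at N x \<xi>) - f (add_at N (x + 1) \<xi>))" for \<xi> x
    unfolding A_def by (subst Bochner_Integration.integral_add) (simp_all only: i)
  have "(\<integral>\<omega>. gen_path K f s \<omega> \<partial>M) = speed * (\<integral>\<omega>. (\<Sum>\<xi>\<in>bounded_configs N K. \<Sum>x\<in>bonds N. A \<xi> x \<omega>) \<partial>M)"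
    unfolding gen_path_def drift_def A_def by (rule integral_mult_right_zero)
  also have "(\<integral>\<omega>. (\<Sum>\<xi>\<in>bounded_configs N K. \<Sum>x\<in>bonds N. A \<xi> x \<omega>) \<partial>M) = (\<Sum>\<xi>\<in>bounded_configs N K. \<integral>\<omega>. (\<Sum>x\<in>bonds N. A \<xi> x \<omega>) \<partial>M)"
    by (rule Bochner_Integration.integral_sum) (intro Bochner_Integration.integrable_sum I)
  also have "\<dots> = (\<Sum>\<xi>\<in>bounded_configs N K. \<Sum>x\<in>bonds N. \<integral>\<omega>. A \<xi> x \<omega> \<partial>M)"
    by (intro sum.cong refl Bochner_Integration.integral_sum I)
  finally show ?thesis unfolding A gen_mean_def drift_def .
qed

lemma gen_mean_meas: "gen_mean K f \<in> borel_measurable lborel"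
proof -
  have "(\<lambda>s. \<integral>\<omega>. (case (s, \<omega>) of (s, \<omega>) \<Rightarrow> gen_path K f s \<omega>) \<partial>M) \<in> borel_measurable lborel"
    by (rule borel_measurable_lebesgue_integral) (use gen_path_meas in \<open>simp add: case_prod_unfold\<close>)
  then show ?thesis by (simp add: gen_path_mean cong: measurable_cong)
qed

lemma gen_mean_bound: "\<bar>gen_mean K f s\<bar> \<le> gen_bound K f"
  unfolding gen_mean_def by (rule drift_bound) (simp add: pmf_le_1)

text \<open>The mean of Dynkin's formula. For fixed \<open>K\<close> and \<open>f\<close> the
  integrand is bounded by \<open>gen_bound K f\<close>, which justifies the exchange of time
  integral and expectation.\<close>

lemma forward_integral:
  assumes f: "\<And>\<eta>. \<eta> \<notin> bounded_configs N K \<Longrightarrow> f \<eta> = 0" and t: "t \<in> {0..T}"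
  shows "(\<Sum>\<zeta>\<in>bounded_configs N K. f \<zeta> * pmf (law_at t) \<zeta>) - (\<Sum>\<zeta>\<in>bounded_configs N K. f \<zeta> * pmf (law_at 0) \<zeta>) = (LINT s:{0..t}|lborel. gen_mean K f s)"
proof -
  have fin: "finite {\<eta>. f \<eta> \<noteq> 0}" by (rule finite_subset[OF _ finite_bounded_configs[of N K]]) (use f in auto)
  have t0: "t \<ge> 0" using t by simp
  have fX: "f \<eta> = (\<Sum>\<zeta>\<in>bounded_configs N K. f \<zeta> * of_bool (\<zeta> = \<eta>))" for \<eta>
    using f[of \<eta>] by (cases "\<eta> \<in> bounded_configs N K") (auto simp: of_bool_def if_distrib[of "\<lambda>x. _ * x"] cong: if_cong)
  have Ef: "integrable M (\<lambda>\<omega>. f (X s \<omega>))" "(\<integral>\<omega>. f (X s \<omega>) \<partial>M) = (\<Sum>\<zeta>\<in>bounded_configs N K. f \<zeta> * pmf (law_at s) \<zeta>)" if "s \<ge> 0" for s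
  proof -
    have i: "integrable M (\<lambda>\<omega>. f \<zeta> * of_bool (\<zeta> = X s \<omega>))" for \<zeta> by (intro integrable_mult_right of_bool_X_int that)
    show "integrable M (\<lambda>\<omega>. f (X s \<omega>))"
      by (subst fX) (intro Bochner_Integration.integrable_sum i)
    show "(\<integral>\<omega>. f (X s \<omega>) \<partial>M) = (\<Sum>\<zeta>\<in>bounded_configs N K. f \<zeta> * pmf (law_at s) \<zeta>)"
      by (subst fX, subst Bochner_Integration.integral_sum) (use i in \<open>auto simp: pmf_law_at[OF that]\<close>)
  qed
  have gen: "(LINT s:{0..t}|lborel. zr_generator \<alpha> g lm lp N s f (X s \<omega>)) = (\<integral>s. indicator {0..t} s *\<^sub>R gen_path K f s \<omega> \<partial>lborel)"
    if "\<omega> \<in> space M" for \<omega>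
    unfolding set_lebesgue_integral_def
  proof (intro Bochner_Integration.integral_cong refl)
    fix s :: real
    show "indicator {0..t} s *\<^sub>R zr_generator \<alpha> g lm lp N s f (X s \<omega>) = indicator {0..t} s *\<^sub>R gen_path K f s \<omega>"
    proof (cases "s \<in> {0..t}")
      case True
      then have s: "s \<in> {0..T}" using t by auto
      have "real_of_int (int N + 1) / (real N + 1) = 1" "real_of_int (- int N - 1) / (real N + 1) = - 1"
        by (auto simp: field_simps)
      then have l: "lx N s (int N + 1) = lp s" "lx N s (- int N - 1) = lm s"
        by (simp_all add: site_fugacity_def lambda_bar_def add_divide_distrib[symmetric] diff_divide_distrib[symmetric] add.commute)
      have "zr_generator \<alpha> g lm lp N s f (X s \<omega>) = speed * drift g N (lx N s) (\<lambda>\<zeta>. of_bool (\<zeta> = X s \<omega>)) K f"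
        unfolding speed_def by (rule generator_eq_drift) (use g0 f X_configs[of s \<omega>] l s that in auto)
      then show ?thesis using clamp(2)[OF s] by (simp add: gen_path_def)
    qed simp
  qed
  define h where "h = (\<lambda>s \<omega>. indicator {0..t} s *\<^sub>R gen_path K f s \<omega>)"
  have sf: "sigma_finite_measure M" by unfold_locales
  interpret pair_sigma_finite "lborel :: real measure" M by unfold_locales
  have hint: "integrable (lborel \<Otimes>\<^sub>M M) (case_prod h)"
  proof (rule integrableI_bounded_set[where A="{0..t} \<times> space M" and B="gen_bound K f"])
    show "{0..t} \<times> space M \<in> sets (lborel \<Otimes>\<^sub>M M)" by (intro pair_measureI) auto
    have "case_prod h = (\<lambda>p. indicator {0..t} (fst p) *\<^sub>R gen_path K f (fst p) (snd p))"
      by (auto simp: h_def case_prod_unfold)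
    moreover have "(\<lambda>p. indicator {0..t} (fst p) *\<^sub>R gen_path K f (fst p) (snd p)) \<in> borel_measurable (lborel \<Otimes>\<^sub>M M)"
      by (intro borel_measurable_scaleR gen_path_meas measurable_compose[OF measurable_fst]) auto
    ultimately show "case_prod h \<in> borel_measurable (lborel \<Otimes>\<^sub>M M)" by simp
    show "emeasure (lborel \<Otimes>\<^sub>M M) ({0..t} \<times> space M) < \<infinity>"
    proof -
      have "emeasure (lborel \<Otimes>\<^sub>M M) ({0..t} \<times> space M) = emeasure lborel {0..t} * emeasure M (space M)"
        by (rule sigma_finite_measure.emeasure_pair_measure_Times[OF sf]) auto
      then show ?thesis using t0 by (simp add: emeasure_space_1)
    qed
    show "AE p in lborel \<Otimes>\<^sub>M M. p \<in> {0..t} \<times> space M \<longrightarrow> norm (case_prod h p) \<le> gen_bound K f"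
      using gen_path_bound gen_bound by (intro AE_I2) (auto simp: h_def indicator_def)
    show "AE p in lborel \<Otimes>\<^sub>M M. p \<notin> {0..t} \<times> space M \<longrightarrow> case_prod h p = 0"
      by (intro AE_I2) (auto simp: h_def space_pair_measure indicator_def)
  qed
  have "0 = (\<integral>\<omega>. dynkin_process \<alpha> g lm lp N X f t \<omega> \<partial>M)" using dynkin_mean(2)[OF fin t0] by simp
  also have "\<dots> = (\<integral>\<omega>. (f (X t \<omega>) - f (X 0 \<omega>)) - (\<integral>s. h s \<omega> \<partial>lborel) \<partial>M)"
    unfolding dynkin_process_def h_def by (intro Bochner_Integration.integral_cong refl) (simp add: gen)
  also have "\<dots> = ((\<integral>\<omega>. f (X t \<omega>) \<partial>M) - (\<integral>\<omega>. f (X 0 \<omega>) \<partial>M)) - (\<integral>\<omega>. (\<integral>s. h s \<omega> \<partial>lborel) \<partial>M)"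
    using Ef(1)[OF t0] Ef(1)[of 0] integrable_snd[OF hint] by simp
  also have "(\<integral>\<omega>. (\<integral>s. h s \<omega> \<partial>lborel) \<partial>M) = (\<integral>s. (\<integral>\<omega>. h s \<omega> \<partial>M) \<partial>lborel)"
    by (rule Fubini_integral[OF hint])
  also have "(\<lambda>s. \<integral>\<omega>. h s \<omega> \<partial>M) = (\<lambda>s. indicator {0..t} s *\<^sub>R gen_mean K f s)"
    by (simp add: h_def gen_path_mean)
  finally show ?thesis using Ef(2)[OF t0] Ef(2)[of 0] by (simp add: set_lebesgue_integral_def)
qed

lemma gen_mean_set_integrable: "set_integrable lborel {0..t} (gen_mean K f)"
  unfolding set_integrable_def
proof (rule integrableI_bounded_set_indicator[where B="gen_bound K f"])
  show "AE x in lborel. x \<in> {0..t} \<longrightarrow> norm (gen_mean K f x) \<le> gen_bound K f" using gen_mean_bound by simp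
  show "emeasure lborel {0..t} < \<infinity>" by (cases "0 \<le> t") auto
qed (use gen_mean_meas in auto)

lemma forward_integral_HK:
  assumes f: "\<And>\<eta>. \<eta> \<notin> bounded_configs N K \<Longrightarrow> f \<eta> = 0" and t: "t \<in> {0..T}"
  shows "(\<Sum>\<zeta>\<in>bounded_configs N K. f \<zeta> * pmf (law_at t) \<zeta>) = (\<Sum>\<zeta>\<in>bounded_configs N K. f \<zeta> * pmf (law_at 0) \<zeta>) + integral {0..t} (gen_mean K f)"
proof -
  have "(\<Sum>\<zeta>\<in>bounded_configs N K. f \<zeta> * pmf (law_at t) \<zeta>) - (\<Sum>\<zeta>\<in>bounded_configs N K. f \<zeta> * pmf (law_at 0) \<zeta>) = (LINT s:{0..t}|lborel. gen_mean K f s)"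
    by (rule forward_integral) (use f t in auto)
  also have "\<dots> = integral {0..t} (gen_mean K f)"
    by (rule set_borel_integral_eq_integral(2)[OF gen_mean_set_integrable])
  finally show ?thesis by linarith
qed

text \<open>First half of a bootstrap: an integral equation with a merely bounded measurable
  integrand makes the law continuous in time. This makes the integrand continuous in turn, so that
  \<open>forward_equation\<close> holds at every time.\<close>

lemma law_at_cont:
  assumes "\<zeta> \<in> configs N" shows "continuous_on {0..T} (\<lambda>t. pmf (law_at t) \<zeta>)"
proof -
  obtain K where K: "\<zeta> \<in> bounded_configs N K" using assms configs_UN_bounded_configs by auto
  define f where "f = (\<lambda>\<eta>. of_bool (\<eta> = \<zeta>) :: real)"
  have f: "f \<eta> = 0" if "\<eta> \<notin> bounded_configs N K" for \<eta> using that K by (auto simp: f_def)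
  have s: "(\<Sum>\<xi>\<in>bounded_configs N K. f \<xi> * pmf (law_at t) \<xi>) = pmf (law_at t) \<zeta>" for t
    using K by (auto simp: f_def of_bool_def if_distrib[of "\<lambda>x. x * _"] cong: if_cong)
  have "continuous_on {0..T} (\<lambda>t. pmf (law_at 0) \<zeta> + integral {0..t} (gen_mean K f))"
    by (intro continuous_intros indefinite_integral_continuous_1 set_borel_integral_eq_integral(1)[OF gen_mean_set_integrable])
  then show ?thesis
  proof (rule continuous_on_eq)
    fix t assume t: "t \<in> {0..T}"
    have "(\<Sum>\<xi>\<in>bounded_configs N K. f \<xi> * pmf (law_at t) \<xi>) = (\<Sum>\<xi>\<in>bounded_configs N K. f \<xi> * pmf (law_at 0) \<xi>) + integral {0..t} (gen_mean K f)"
      by (rule forward_integral_HK[OF f t])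
    then show "pmf (law_at 0) \<zeta> + integral {0..t} (gen_mean K f) = pmf (law_at t) \<zeta>" by (simp only: s)
  qed
qed

lemma gen_mean_cont: "continuous_on {0..T} (gen_mean K f)"
proof -
  have "continuous_on {0..T} (\<lambda>s. speed * drift g N (lx N s) (pmf (law_at s)) K f)"
    unfolding drift_def flux_def rate_def
  proof (intro continuous_on_mult_left continuous_on_sum continuous_on_add continuous_on_mult_right continuous_on_mult)
    fix \<xi> x assume "\<xi> \<in> bounded_configs N K"
    then have c: "add_at N y \<xi> \<in> configs N" for y using bounded_configs_subset add_at_configs by blast
    show "continuous_on {0..T} (\<lambda>s. pmf (law_at s) (add_at N x \<xi>))" "continuous_on {0..T} (\<lambda>s. pmf (law_at s) (add_at N (x + 1) \<xi>))"
      by (rule law_at_cont[OF c])+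
    show "continuous_on {0..T} (\<lambda>s. if x \<in> sites N then g (add_at N x \<xi> x) else lx N s x)"
      using lx_cont by (cases "x \<in> sites N") auto
    show "continuous_on {0..T} (\<lambda>s. if x + 1 \<in> sites N then g (add_at N (x + 1) \<xi> (x + 1)) else lx N s (x + 1))"
      using lx_cont by (cases "x + 1 \<in> sites N") auto
  qed
  then show ?thesis by (rule continuous_on_eq) (simp add: gen_mean_def clamp(2))
qed

lemma forward_equation:
  assumes f: "\<And>\<eta>. \<eta> \<notin> bounded_configs N K \<Longrightarrow> f \<eta> = 0" and s: "s \<in> {0..T}"
  shows "((\<lambda>s. \<Sum>\<zeta>\<in>bounded_configs N K. f \<zeta> * pmf (law_at s) \<zeta>) has_real_derivative speed * drift g N (lx N s) (pmf (law_at s)) K f) (at s within {0..T})"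
proof -
  have "((\<lambda>t. (\<Sum>\<zeta>\<in>bounded_configs N K. f \<zeta> * pmf (law_at 0) \<zeta>) + integral {0..t} (gen_mean K f)) has_real_derivative 0 + gen_mean K f s) (at s within {0..T})"
    by (intro DERIV_add DERIV_const integral_has_real_derivative gen_mean_cont s)
  then have "((\<lambda>s. \<Sum>\<zeta>\<in>bounded_configs N K. f \<zeta> * pmf (law_at s) \<zeta>) has_real_derivative 0 + gen_mean K f s) (at s within {0..T})"
  proof (rule has_field_derivative_transform_within[OF _ zero_less_one s])
    fix t assume t: "t \<in> {0..T}"
    show "(\<Sum>\<zeta>\<in>bounded_configs N K. f \<zeta> * pmf (law_at 0) \<zeta>) + integral {0..t} (gen_mean K f) = (\<Sum>\<zeta>\<in>bounded_configs N K. f \<zeta> * pmf (law_at t) \<zeta>)"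
      by (rule forward_integral_HK[OF f t, symmetric])
  qed
  then show ?thesis using clamp(2)[OF s] by (simp add: gen_mean_def)
qed

text \<open>The analogue of \<open>mgf_const\<close> for the initial profile, whose fugacities vary
  with the site; the partition function in the denominator is estimated by 1.\<close>

definition init_mgf_const :: real where "init_mgf_const = 3 * ln (Z (exp 1 * l1))"

text \<open>In \<open>C + 2\<close> one unit makes \<open>f0 * ln f0 + 1\<close> nonnegative and the
  other is the mass of the reference weight. The remaining terms are the cost of changing the
  reference measure.\<close>

definition init_const :: "real \<Rightarrow> real" where
  "init_const C = C + 2 + ln (l1 / l0) * (C + 2 + init_mgf_const) + 3 * ln (Z l1)"

text \<open>The hypothesis refers to the profile at \<open>x / N\<close> with the partition
  functions of the sites, the conclusion to the profile at \<open>x / (N + 1)\<close> with the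
  common \<open>Z l1\<close>. The logarithm of the quotient is at most linear in the particle number
  plus a term of order N, and the mean particle number is of order N by Young's inequality relative
  to the initial profile.\<close>

lemma initial_entropy:
  assumes f0: "\<And>\<xi>. \<xi> \<in> configs N \<Longrightarrow> f0 \<xi> \<ge> 0"
    and rel_density: "distr M (count_space UNIV) (X 0) = density (measure_pmf (profile_law g lm lp N 0)) (\<lambda>\<xi>. ennreal (f0 \<xi>))"
    and int: "integrable (measure_pmf (profile_law g lm lp N 0)) (\<lambda>\<xi>. f0 \<xi> * ln (f0 \<xi>))"
    and le: "(LINT \<xi>|measure_pmf (profile_law g lm lp N 0). f0 \<xi> * ln (f0 \<xi>)) \<le> C * real N"
    and F: "finite F" "F \<subseteq> configs N"
  shows "(\<Sum>\<xi>\<in>F. nm N 0 \<xi> * ent (pmf (law_at 0) \<xi> / nm N 0 \<xi>)) \<le> init_const C * N"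
proof -
  have z: "0 \<in> {0..T}" using T by simp
  define mu where "mu = profile_law g lm lp N 0"
  define p where "p = pmf (law_at 0)"
  define l where "l = (\<lambda>x. lambda_bar lm lp (of_int x / real N) 0)"
  have r: "of_int x / real N \<in> {-1..1}" if "x \<in> sites N" for x using that N1 by (auto simp: sites_def field_simps)
  have lb: "l0 \<le> l x" "l x \<le> l1" "0 < l x" if "x \<in> sites N" for x
    using lb_bounds[OF r[OF that] z] l0 by (auto simp: l_def)
  have init_mgf_const: "init_mgf_const \<ge> 0" unfolding init_mgf_const_def using Z_ge_1[of "exp 1 * l1"] l1 by simp
  have kap: "ln (l1 / l0) \<ge> 0" "l1 / l0 \<ge> 1" using l01 l0 by auto
  have Z1: "ln (Z l1) \<ge> 0" using Z_ge_1[OF l1] by simp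
  have pmu: "p \<xi> = f0 \<xi> * pmf mu \<xi>" if "\<xi> \<in> configs N" for \<xi>
  proof -
    have "ennreal (p \<xi>) = emeasure (measure_pmf (law_at 0)) {\<xi>}" by (simp add: p_def emeasure_pmf_single)
    also have "\<dots> = emeasure (density (measure_pmf mu) (\<lambda>\<xi>. ennreal (f0 \<xi>))) {\<xi>}"
      using rel_density law_at_eq[of 0] by (simp add: mu_def)
    also have "\<dots> = ennreal (f0 \<xi>) * ennreal (pmf mu \<xi>)"
      by (subst emeasure_density) (auto simp: nn_integral_cmult_indicator emeasure_pmf_single)
    also have "\<dots> = ennreal (f0 \<xi> * pmf mu \<xi>)" using f0[OF that] by (simp add: ennreal_mult)
    finally show ?thesis using f0[OF that] by (simp add: p_def)
  qed
  have mul: "mu = Pi_pmf (sites N) 0 (\<lambda>x. site_law g (l x))" by (simp add: mu_def profile_law_def l_def)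
  have muval: "pmf mu \<xi> = (\<Prod>x\<in>sites N. l x ^ \<xi> x / (gfact g (\<xi> x) * Z (l x)))" if "\<xi> \<in> configs N" for \<xi>
  proof -
    have "pmf mu \<xi> = (\<Prod>x\<in>sites N. pmf (site_law g (l x)) (\<xi> x))"
      unfolding mul by (intro pmf_Pi') (use that in \<open>auto simp: configs_def\<close>)
    also have "\<dots> = (\<Prod>x\<in>sites N. l x ^ \<xi> x / (gfact g (\<xi> x) * Z (l x)))"
      by (intro prod.cong refl pmf_site lb(3))
    finally show ?thesis .
  qed
  have mupos: "pmf mu \<xi> > 0" if "\<xi> \<in> configs N" for \<xi>
    unfolding muval[OF that] using gfp Z_ge_1 lb(3) by (intro prod_pos divide_pos_pos mult_pos_pos) (auto intro: less_le_trans[OF zero_less_one])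
  have ratio: "ln (pmf mu \<xi> / nm N 0 \<xi>) \<le> ln (l1 / l0) * nparts N \<xi> + 3 * ln (Z l1) * N" if \<xi>: "\<xi> \<in> configs N" for \<xi>
  proof -
    have "pmf mu \<xi> / nm N 0 \<xi> = (\<Prod>x\<in>sites N. (l x / lx N 0 x) ^ \<xi> x * (Z l1 / Z (l x)))"
      unfolding muval[OF \<xi>] ref_weight_def prod_dividef[symmetric]
    proof (intro prod.cong refl)
      fix x assume x: "x \<in> sites N"
      have "lx N 0 x \<noteq> 0" "gfact g (\<xi> x) \<noteq> 0" "Z l1 \<noteq> 0" "Z (l x) \<noteq> 0"
        using lx_pos[OF bonds_range(2)[OF x] z] gfp[of "\<xi> x"] Z_ge_1[OF l1] Z_ge_1[OF lb(3)[OF x]] by auto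
      then show "l x ^ \<xi> x / (gfact g (\<xi> x) * Z (l x)) / (lx N 0 x ^ \<xi> x / (gfact g (\<xi> x) * Z l1)) = (l x / lx N 0 x) ^ \<xi> x * (Z l1 / Z (l x))"
        by (simp add: field_simps)
    qed
    also have "\<dots> \<le> (\<Prod>x\<in>sites N. (l1 / l0) ^ \<xi> x * Z l1)"
    proof (intro prod_mono conjI)
      fix x assume x: "x \<in> sites N"
      have a: "0 < lx N 0 x" "l0 \<le> lx N 0 x" "0 < Z (l x)" "1 \<le> Z (l x)"
        using lx_pos[OF bonds_range(2)[OF x] z] lx_bounds(1)[OF bonds_range(2)[OF x] z] Z_ge_1[OF lb(3)[OF x]] by auto
      show "0 \<le> (l x / lx N 0 x) ^ \<xi> x * (Z l1 / Z (l x))" using a lb(3)[OF x] Z_ge_1[OF l1] by simp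
      have "Z l1 / Z (l x) \<le> Z l1" using a Z_ge_1[OF l1] by (simp add: divide_le_eq mult_le_cancel_left1)
      moreover have "l x / lx N 0 x \<le> l1 / l0" using a lb[OF x] l0 l1 by (intro frac_le) auto
      ultimately show "(l x / lx N 0 x) ^ \<xi> x * (Z l1 / Z (l x)) \<le> (l1 / l0) ^ \<xi> x * Z l1"
        using a lb[OF x] Z_ge_1[OF l1] l0 l1 by (intro mult_mono power_mono) auto
    qed
    also have "\<dots> = (l1 / l0) ^ nparts N \<xi> * Z l1 ^ card (sites N)"
      by (simp add: prod.distrib power_sum[symmetric] nparts_def)
    finally have le: "pmf mu \<xi> / nm N 0 \<xi> \<le> (l1 / l0) ^ nparts N \<xi> * Z l1 ^ card (sites N)" .
    have "0 < pmf mu \<xi> / nm N 0 \<xi>" using mupos[OF \<xi>] nm_pos[OF z, of N \<xi>] by simp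
    then have "ln (pmf mu \<xi> / nm N 0 \<xi>) \<le> ln ((l1 / l0) ^ nparts N \<xi> * Z l1 ^ card (sites N))" using le by simp
    also have "\<dots> = nparts N \<xi> * ln (l1 / l0) + card (sites N) * ln (Z l1)"
      using kap Z_ge_1[OF l1] l0 l1 by (subst ln_mult_pos) (auto simp: ln_realpow)
    also have "card (sites N) * ln (Z l1) \<le> (3 * real N) * ln (Z l1)"
      using N1 Z1 by (intro mult_right_mono) (auto simp: card_sites)
    finally show ?thesis by (simp add: mult_ac)
  qed
  have mul: "mu = Pi_pmf (sites N) 0 (\<lambda>x. site_law g (l x))" by (simp add: mu_def profile_law_def l_def)
  have intn: "(\<integral>\<^sup>+\<xi>. ennreal (exp (real (nparts N \<xi>))) \<partial>measure_pmf mu) \<le> ennreal (exp (init_mgf_const * N))"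
    unfolding mul
  proof (rule nn_integral_exp_nparts[OF N1 _ init_mgf_const])
    fix x assume x: "x \<in> sites N"
    have "Z (exp 1 * l x) / Z (l x) \<le> Z (exp 1 * l1) / 1"
      using Z_ge_1[OF lb(3)[OF x]] Z_ge_1[of "exp 1 * l1"] Z_mono[of "exp 1 * l x" "exp 1 * l1"] lb[OF x] l1 by (intro frac_le) auto
    also have "\<dots> = exp (init_mgf_const / 3)" using Z_ge_1[of "exp 1 * l1"] l1 by (simp add: init_mgf_const_def)
    finally show "0 < l x \<and> Z (exp 1 * l x) / Z (l x) \<le> exp (init_mgf_const / 3)" using lb(3)[OF x] by simp
  qed
  \<comment> \<open>After adding 1 the integrand is nonnegative, so a partial sum is bounded by the
    whole integral.\<close>
  have fent: "(\<Sum>\<xi>\<in>F. pmf mu \<xi> * (f0 \<xi> * ln (f0 \<xi>) + 1)) \<le> C * N + 1"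
  proof -
    have "(\<Sum>\<xi>\<in>F. pmf mu \<xi> * (f0 \<xi> * ln (f0 \<xi>) + 1)) = measure_pmf.expectation mu (\<lambda>\<xi>. indicator F \<xi> * (f0 \<xi> * ln (f0 \<xi>) + 1))"
      using F(1) by (subst integral_measure_pmf_real[of F]) (auto simp: indicator_def mult.commute split: if_splits intro!: sum.cong)
    also have "\<dots> \<le> measure_pmf.expectation mu (\<lambda>\<xi>. f0 \<xi> * ln (f0 \<xi>) + 1)"
    proof (rule integral_mono_AE)
      show i: "integrable (measure_pmf mu) (\<lambda>\<xi>. f0 \<xi> * ln (f0 \<xi>) + 1)" using int by (simp add: mu_def)
      show "integrable (measure_pmf mu) (\<lambda>\<xi>. indicator F \<xi> * (f0 \<xi> * ln (f0 \<xi>) + 1))"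
        using integrable_mult_indicator[OF _ i, of F] by simp
      show "AE \<xi> in measure_pmf mu. indicator F \<xi> * (f0 \<xi> * ln (f0 \<xi>) + 1) \<le> f0 \<xi> * ln (f0 \<xi>) + 1"
      proof (rule AE_pmfI)
        fix \<xi> assume "\<xi> \<in> set_pmf mu"
        then have "\<xi> \<in> configs N"
          unfolding mul configs_def by (rule subsetD[OF set_Pi_pmf_subset[OF finite_sites]])
        then have "-1 \<le> f0 \<xi> * ln (f0 \<xi>)" by (intro xlnx_ge f0)
        then show "indicator F \<xi> * (f0 \<xi> * ln (f0 \<xi>) + 1) \<le> f0 \<xi> * ln (f0 \<xi>) + 1" by (auto simp: indicator_def)
      qed
    qed
    also have "\<dots> = (LINT \<xi>|measure_pmf mu. f0 \<xi> * ln (f0 \<xi>)) + 1" using int by (simp add: mu_def)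
    finally show ?thesis using le by (simp add: mu_def)
  qed

  have pm: "(\<Sum>\<xi>\<in>F. p \<xi>) \<le> 1"
    using measure_measure_pmf_finite[OF F(1), of "law_at 0"] measure_pmf.prob_le_1[of "law_at 0" F] by (simp add: p_def)
  have pn: "(\<Sum>\<xi>\<in>F. p \<xi> * nparts N \<xi>) \<le> (C + 2 + init_mgf_const) * N"
  proof -
    have "(\<Sum>\<xi>\<in>F. p \<xi> * nparts N \<xi>) \<le> (\<Sum>\<xi>\<in>F. pmf mu \<xi> * (f0 \<xi> * ln (f0 \<xi>) + 1) + pmf mu \<xi> * exp (nparts N \<xi>) * exp (- init_mgf_const * N) + init_mgf_const * N * p \<xi>)"
    proof (intro sum_mono)
      fix \<xi> assume "\<xi> \<in> F"
      then have \<xi>: "\<xi> \<in> configs N" using F by auto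
      have "pmf mu \<xi> * (f0 \<xi> * (nparts N \<xi> - init_mgf_const * N)) \<le> pmf mu \<xi> * (f0 \<xi> * ln (f0 \<xi>) + 1 + exp (nparts N \<xi> - init_mgf_const * N))"
        using young_xlnx[OF f0[OF \<xi>], of "nparts N \<xi> - init_mgf_const * N"] f0[OF \<xi>] by (intro mult_left_mono) auto
      also have "exp (nparts N \<xi> - init_mgf_const * N) = exp (nparts N \<xi>) * exp (- init_mgf_const * N)" by (simp flip: exp_add)
      finally show "p \<xi> * nparts N \<xi> \<le> pmf mu \<xi> * (f0 \<xi> * ln (f0 \<xi>) + 1) + pmf mu \<xi> * exp (nparts N \<xi>) * exp (- init_mgf_const * N) + init_mgf_const * N * p \<xi>"
        unfolding pmu[OF \<xi>] by (simp add: algebra_simps)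
    qed
    also have "\<dots> = (\<Sum>\<xi>\<in>F. pmf mu \<xi> * (f0 \<xi> * ln (f0 \<xi>) + 1)) + (\<Sum>\<xi>\<in>F. pmf mu \<xi> * exp (nparts N \<xi>)) * exp (- init_mgf_const * N) + init_mgf_const * N * (\<Sum>\<xi>\<in>F. p \<xi>)"
      by (simp only: sum.distrib sum_distrib_left sum_distrib_right)
    also have "\<dots> \<le> (C * N + 1) + exp (init_mgf_const * N) * exp (- init_mgf_const * N) + init_mgf_const * N * 1"
      using F init_mgf_const by (intro add_mono fent mult_right_mono mult_left_mono pm sum_pmf_weight_le[OF _ _ _ intn]) auto
    also have "\<dots> = C * N + 2 + init_mgf_const * N" by (simp flip: exp_add)
    also have "\<dots> \<le> (C + 2 + init_mgf_const) * N" using N1 by (simp add: algebra_simps)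
    finally show ?thesis .
  qed
  have "(\<Sum>\<xi>\<in>F. nm N 0 \<xi> * ent (p \<xi> / nm N 0 \<xi>))
    \<le> (\<Sum>\<xi>\<in>F. pmf mu \<xi> * (f0 \<xi> * ln (f0 \<xi>) + 1) + ln (l1 / l0) * (p \<xi> * nparts N \<xi>) + 3 * ln (Z l1) * N * p \<xi> + nm N 0 \<xi>)"
  proof (intro sum_mono)
    fix \<xi> assume "\<xi> \<in> F"
    then have \<xi>: "\<xi> \<in> configs N" using F by auto
    have n: "nm N 0 \<xi> > 0" by (rule nm_pos[OF z])
    have p0: "p \<xi> \<ge> 0" by (simp add: p_def)
    have "nm N 0 \<xi> * ent (p \<xi> / nm N 0 \<xi>) \<le> nm N 0 \<xi> * (p \<xi> / nm N 0 \<xi> * ln (p \<xi> / nm N 0 \<xi>) + 1)"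
      using n p0 by (intro mult_left_mono ent_le_xlnx) auto
    also have "\<dots> = p \<xi> * ln (p \<xi> / nm N 0 \<xi>) + nm N 0 \<xi>" using n by (simp add: field_simps)
    also have "p \<xi> * ln (p \<xi> / nm N 0 \<xi>) = p \<xi> * (ln (f0 \<xi>) + ln (pmf mu \<xi> / nm N 0 \<xi>))"
    proof (cases "f0 \<xi> = 0")
      case False
      then have "f0 \<xi> > 0" using f0[OF \<xi>] by simp
      have "p \<xi> / nm N 0 \<xi> = f0 \<xi> * (pmf mu \<xi> / nm N 0 \<xi>)" by (simp add: pmu[OF \<xi>])
      also have "ln \<dots> = ln (f0 \<xi>) + ln (pmf mu \<xi> / nm N 0 \<xi>)"
        using \<open>f0 \<xi> > 0\<close> mupos[OF \<xi>] n by (intro ln_mult_pos) auto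
      finally show ?thesis by simp
    qed (simp add: pmu[OF \<xi>])
    also have "p \<xi> * (ln (f0 \<xi>) + ln (pmf mu \<xi> / nm N 0 \<xi>)) \<le> p \<xi> * (ln (f0 \<xi>) + (ln (l1 / l0) * nparts N \<xi> + 3 * ln (Z l1) * N))"
      using p0 ratio[OF \<xi>] by (intro mult_left_mono) auto
    also have "\<dots> = pmf mu \<xi> * (f0 \<xi> * ln (f0 \<xi>)) + ln (l1 / l0) * (p \<xi> * nparts N \<xi>) + 3 * ln (Z l1) * N * p \<xi>"
      by (simp add: pmu[OF \<xi>] distrib_left mult_ac)
    finally show "nm N 0 \<xi> * ent (p \<xi> / nm N 0 \<xi>)
      \<le> pmf mu \<xi> * (f0 \<xi> * ln (f0 \<xi>) + 1) + ln (l1 / l0) * (p \<xi> * nparts N \<xi>) + 3 * ln (Z l1) * N * p \<xi> + nm N 0 \<xi>"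
      using mupos[OF \<xi>] by (simp add: distrib_left)
  qed
  also have "\<dots> = (\<Sum>\<xi>\<in>F. pmf mu \<xi> * (f0 \<xi> * ln (f0 \<xi>) + 1)) + ln (l1 / l0) * (\<Sum>\<xi>\<in>F. p \<xi> * nparts N \<xi>) + 3 * ln (Z l1) * N * (\<Sum>\<xi>\<in>F. p \<xi>) + (\<Sum>\<xi>\<in>F. nm N 0 \<xi>)"
    by (simp only: sum.distrib sum_distrib_left)
  also have "\<dots> \<le> (C * N + 1) + ln (l1 / l0) * ((C + 2 + init_mgf_const) * N) + 3 * ln (Z l1) * N * 1 + 1"
    using kap Z1 F by (intro add_mono fent mult_left_mono pn pm nm_mass_le z) auto
  also have "\<dots> \<le> init_const C * N" using N1 by (simp add: init_const_def algebra_simps)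
  finally show ?thesis by (simp add: p_def)
qed

lemma evol:
  assumes "\<And>\<xi>. \<xi> \<in> configs N \<Longrightarrow> f0 \<xi> \<ge> 0"
    and "distr M (count_space UNIV) (X 0) = density (measure_pmf (profile_law g lm lp N 0)) (\<lambda>\<xi>. ennreal (f0 \<xi>))"
    and "integrable (measure_pmf (profile_law g lm lp N 0)) (\<lambda>\<xi>. f0 \<xi> * ln (f0 \<xi>))"
    and "(LINT \<xi>|measure_pmf (profile_law g lm lp N 0). f0 \<xi> * ln (f0 \<xi>)) \<le> C * real N"
  shows "zr_evol g lm lp lm' lp' T l0 l1 Lam Cg N speed (init_const C) law_at"
proof (unfold_locales)
  show "N \<ge> 1" "speed > 0" using N1 speed by auto
  show "set_pmf (law_at s) \<subseteq> configs N" if "s \<in> {0..T}" for s by (rule set_law_at) (use that in auto)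
qed (use forward_equation initial_entropy[OF assms] in auto)

end

section \<open>Riemann sums\<close>

text \<open>The step function with the value of \<open>H\<close> at the left end of each cell. Its
  integral is the Riemann sum without the term of the right end \<open>x = N\<close>.\<close>

definition grid_step :: "nat \<Rightarrow> (real \<Rightarrow> real) \<Rightarrow> real \<Rightarrow> real" where
  "grid_step N H y = (\<Sum>x\<in>{- int N..<int N}. H (of_int x / N) * indicator {of_int x / N..<(of_int x + 1) / N} y)"

definition grid_floor :: "nat \<Rightarrow> real \<Rightarrow> real" where "grid_floor N y = of_int \<lfloor>y * N\<rfloor> / N"

lemma grid_floor_bounds: assumes "N \<ge> 1" shows "grid_floor N y \<le> y" "y - 1 / N < grid_floor N y"
proof -
  have N: "real N > 0" using assms by simp
  have "of_int \<lfloor>y * N\<rfloor> / real N \<le> y" by (subst pos_divide_le_eq[OF N]) linarith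
  then show "grid_floor N y \<le> y" by (simp add: grid_floor_def)
  have "y * N - 1 < of_int \<lfloor>y * N\<rfloor>" by linarith
  then have "(y * N - 1) / N < of_int \<lfloor>y * N\<rfloor> / N" by (rule divide_strict_right_mono[OF _ N])
  then show "y - 1 / N < grid_floor N y" using N by (simp add: grid_floor_def diff_divide_distrib)
qed

lemma grid_floor_range: assumes "N \<ge> 1" "y \<in> {-1..<1}" shows "grid_floor N y \<in> {-1..1}"
proof -
  have "- real N \<le> y * N" using mult_right_mono[of "-1" y "real N"] assms by simp
  then have "- int N \<le> \<lfloor>y * N\<rfloor>" by (simp add: le_floor_iff)
  then have "- real N \<le> of_int \<lfloor>y * N\<rfloor>" by linarith
  then have "-1 \<le> grid_floor N y" using assms by (simp add: grid_floor_def pos_le_divide_eq)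
  then show ?thesis using grid_floor_bounds(1)[OF assms(1), of y] assms(2) by auto
qed

lemma grid_cell:
  fixes N :: nat and x :: int and y :: real
  assumes "N \<ge> 1" shows "y \<in> {of_int x / N..<(of_int x + 1) / N} \<longleftrightarrow> x = \<lfloor>y * N\<rfloor>"
proof -
  have N: "real N > 0" using assms by simp
  have "y \<in> {of_int x / N..<(of_int x + 1) / N} \<longleftrightarrow> of_int x \<le> y * N \<and> y * N < of_int x + 1"
    using N by (auto simp: pos_divide_le_eq pos_less_divide_eq)
  also have "\<dots> \<longleftrightarrow> x = \<lfloor>y * N\<rfloor>" by linarith
  finally show ?thesis .
qed

lemma grid_step_eq:
  assumes "N \<ge> 1" shows "grid_step N H y = (if y \<in> {-1..<1} then H (grid_floor N y) else 0)"
proof -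
  have N: "real N > 0" using assms by simp
  have "grid_step N H y = (\<Sum>x\<in>{- int N..<int N}. if x = \<lfloor>y * N\<rfloor> then H (grid_floor N y) else 0)"
    unfolding grid_step_def indicator_def grid_cell[OF assms] by (intro sum.cong) (auto simp: grid_floor_def)
  also have "\<dots> = (if \<lfloor>y * N\<rfloor> \<in> {- int N..<int N} then H (grid_floor N y) else 0)" by simp
  also have "\<lfloor>y * N\<rfloor> \<in> {- int N..<int N} \<longleftrightarrow> - real N \<le> y * N \<and> y * N < real N"
    by (auto simp: le_floor_iff floor_less_iff)
  also have "\<dots> \<longleftrightarrow> y \<in> {-1..<1}"
    using mult_le_cancel_right_pos[OF N, of "-1" y] mult_less_cancel_right_pos[OF N, of y 1] by simp
  finally show ?thesis .
qed

lemma grid_step_integral: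
  assumes "N \<ge> 1"
  shows "integrable lborel (grid_step N H)" "(\<integral>y. grid_step N H y \<partial>lborel) = 1 / N * (\<Sum>x\<in>{- int N..<int N}. H (of_int x / N))"
proof -
  have m: "emeasure lborel {of_int x / N..<(of_int x + 1) / N} = ennreal (1 / N)" for x :: int
    using assms by (simp add: divide_right_mono diff_divide_distrib[symmetric])
  have i: "integrable lborel (\<lambda>y. H (of_int x / N) * indicator {of_int x / N..<(of_int x + 1) / N} y)" for x :: int
    using m[of x] by (intro integrable_mult_right) auto
  show "integrable lborel (grid_step N H)" unfolding grid_step_def[abs_def] by (intro Bochner_Integration.integrable_sum i)
  have "(\<integral>y. grid_step N H y \<partial>lborel) = (\<Sum>x\<in>{- int N..<int N}. H (of_int x / N) * (1 / N))"
    unfolding grid_step_def using i m by (subst Bochner_Integration.integral_sum) (auto simp: measure_def)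
  then show "(\<integral>y. grid_step N H y \<partial>lborel) = 1 / N * (\<Sum>x\<in>{- int N..<int N}. H (of_int x / N))"
    by (simp add: sum_distrib_left mult.commute)
qed

lemma borel_restricted:
  fixes G :: "real \<Rightarrow> real"
  assumes "G \<in> borel_measurable (restrict_space borel {-1..1})"
  shows "(\<lambda>y. indicator {-1..<1} y * G y) \<in> borel_measurable borel"
proof -
  have "(\<lambda>y. indicator {-1..1} y *\<^sub>R G y) \<in> borel_measurable borel"
    using assms by (subst (asm) borel_measurable_restrict_space_iff) auto
  then have "(\<lambda>y. indicator {-1..<1} y * (indicator {-1..1} y *\<^sub>R G y)) \<in> borel_measurable borel"
    by (intro borel_measurable_times) auto
  moreover have "(\<lambda>y. indicator {-1..<1} y * (indicator {-1..1} y *\<^sub>R G y)) = (\<lambda>y. indicator {-1..<1} y * G y)"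
    by (auto simp: indicator_def fun_eq_iff)
  ultimately show ?thesis by simp
qed

text \<open>At a continuity point the values at the left ends of the cells converge, so dominated
  convergence applies. The proof runs over \<open>Suc N\<close> to avoid cells of length
  \<open>1 / 0\<close>.\<close>

lemma grid_step_L1:
  fixes G :: "real \<Rightarrow> real"
  assumes Gm: "G \<in> borel_measurable (restrict_space borel {-1..1})"
    and Gb: "\<And>y. y \<in> {-1..1} \<Longrightarrow> \<bar>G y\<bar> \<le> CG"
    and Gc: "AE y in lborel. y \<in> {-1..1} \<longrightarrow> continuous (at y within {-1..1}) G"
  shows "(\<lambda>N. \<integral>y. \<bar>grid_step N G y - indicator {-1..<1} y * G y\<bar> \<partial>lborel) \<longlonglongrightarrow> 0"
proof -
  have CG: "CG \<ge> 0" using Gb[of 0] by simp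
  have "(\<lambda>N. \<integral>y. \<bar>grid_step (Suc N) G y - indicator {-1..<1} y * G y\<bar> \<partial>lborel) \<longlonglongrightarrow> (\<integral>y. 0 \<partial>(lborel :: real measure))"
  proof (rule integral_dominated_convergence[where w="\<lambda>y. indicator {-1..<1} y * (2 * CG)"])
    show "integrable lborel (\<lambda>y::real. indicator {-1..<1} y * (2 * CG))"
      by (intro integrable_mult_left) (auto simp: integrable_indicator_iff)
    have "grid_step (Suc N) G \<in> borel_measurable lborel" for N
      using grid_step_integral(1)[of "Suc N" G] by auto
    then show "(\<lambda>y. \<bar>grid_step (Suc N) G y - indicator {-1..<1} y * G y\<bar>) \<in> borel_measurable lborel" for N
      using borel_restricted[OF Gm] by (intro borel_measurable_abs borel_measurable_diff) auto
    show "AE y in lborel. norm \<bar>grid_step (Suc N) G y - indicator {-1..<1} y * G y\<bar> \<le> indicator {-1..<1} y * (2 * CG)" for N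
    proof (rule AE_I2)
      fix y :: real
      show "norm \<bar>grid_step (Suc N) G y - indicator {-1..<1} y * G y\<bar> \<le> indicator {-1..<1} y * (2 * CG)"
        using Gb[of "grid_floor (Suc N) y"] Gb[of y] grid_floor_range[of "Suc N" y] by (auto simp: grid_step_eq indicator_def abs_le_iff)
    qed
    show "AE y in lborel. (\<lambda>N. \<bar>grid_step (Suc N) G y - indicator {-1..<1} y * G y\<bar>) \<longlonglongrightarrow> 0"
      using Gc
    proof eventually_elim
      case (elim y)
      show ?case
      proof (cases "y \<in> {-1..<1}")
        case True
        then have c: "continuous (at y within {-1..1}) G" using elim by auto
        have gt: "(\<lambda>N. grid_floor (Suc N) y) \<longlonglongrightarrow> y"
        proof (rule tendsto_sandwich[where f="\<lambda>N. y - 1 / real (Suc N)" and h="\<lambda>_. y"])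
          show "(\<lambda>N. y - 1 / real (Suc N)) \<longlonglongrightarrow> y"
            using tendsto_diff[OF tendsto_const LIMSEQ_inverse_real_of_nat, of y] by (simp add: inverse_eq_divide)
          show "\<forall>\<^sub>F N in sequentially. y - 1 / real (Suc N) \<le> grid_floor (Suc N) y"
            using grid_floor_bounds(2)[of "Suc _" y] by (intro always_eventually allI less_imp_le) auto
          show "\<forall>\<^sub>F N in sequentially. grid_floor (Suc N) y \<le> y"
            using grid_floor_bounds(1)[of "Suc _" y] by (intro always_eventually allI) auto
        qed auto
        have "(\<lambda>N. G (grid_floor (Suc N) y)) \<longlonglongrightarrow> G y"
        proof (rule continuous_within_tendsto_compose[OF c _ gt])
          show "\<forall>\<^sub>F N in sequentially. grid_floor (Suc N) y \<in> {-1..1}"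
            using grid_floor_range[OF _ True] by (intro always_eventually allI) auto
        qed
        then have "(\<lambda>N. \<bar>G (grid_floor (Suc N) y) - G y\<bar>) \<longlonglongrightarrow> 0"
          using tendsto_rabs_zero[OF iffD2[OF LIM_zero_iff]] by blast
        then show ?thesis using True by (simp add: grid_step_eq)
      next
        case False
        then show ?thesis by (simp add: grid_step_eq del: atLeastLessThan_iff)
      qed
    qed
  qed auto
  then show ?thesis by (subst filterlim_sequentially_Suc[symmetric]) simp
qed

text \<open>Uniformity in \<open>s\<close> holds because the roughness of \<open>G\<close> enters
  through an L1 distance that does not involve \<open>s\<close>, while the family \<open>F s\<close>
  is equicontinuous and bounded. The set of summation may miss up to \<open>m\<close> sites at a
  cost of order \<open>1 / N\<close>.\<close>

lemma riemann_uniform: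
  fixes G :: "real \<Rightarrow> real" and F :: "real \<Rightarrow> real \<Rightarrow> real" and S :: "real set" and I :: "nat \<Rightarrow> int set" and CG CF :: real and m :: nat
  assumes Gm: "G \<in> borel_measurable (restrict_space borel {-1..1})"
    and Gb: "\<And>y. y \<in> {-1..1} \<Longrightarrow> \<bar>G y\<bar> \<le> CG"
    and Gc: "AE y in lborel. y \<in> {-1..1} \<longrightarrow> continuous (at y within {-1..1}) G"
    and Fb: "\<And>s y. s \<in> S \<Longrightarrow> y \<in> {-1..1} \<Longrightarrow> \<bar>F s y\<bar> \<le> CF"
    and Fe: "\<And>e. e > 0 \<Longrightarrow> \<exists>d>0. \<forall>s\<in>S. \<forall>y\<in>{-1..1}. \<forall>y'\<in>{-1..1}. \<bar>y - y'\<bar> \<le> d \<longrightarrow> \<bar>F s y - F s y'\<bar> \<le> e"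
    and I: "\<And>N. I N \<subseteq> sites N" "\<And>N. card (sites N - I N) \<le> m"
    and e: "e > 0"
  shows "\<forall>\<^sub>F N in sequentially. \<forall>s\<in>S.
    \<bar>1 / real N * (\<Sum>x\<in>I N. G (of_int x / N) * F s (of_int x / N)) - (LINT y:{-1..1}|lborel. G y * F s y)\<bar> \<le> e"
proof (cases "S = {}")
  case False
  have CG: "CG \<ge> 0" using Gb[of 0] by simp
  have CF: "CF \<ge> 0" using Fb[of _ 0] False by force
  define a where "a = (\<lambda>N. \<integral>y. \<bar>grid_step N G y - indicator {-1..<1} y * G y\<bar> \<partial>lborel)"
  have a: "a \<longlonglongrightarrow> 0" unfolding a_def by (rule grid_step_L1[OF Gm Gb Gc])
  define e' where "e' = e / (4 * (2 * CG + 1))"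
  have e': "e' > 0" "2 * CG * e' \<le> e / 4" using e CG by (auto simp: e'_def field_simps)
  obtain d where d: "d > 0" "\<And>s y y'. s \<in> S \<Longrightarrow> y \<in> {-1..1} \<Longrightarrow> y' \<in> {-1..1} \<Longrightarrow> \<bar>y - y'\<bar> \<le> d \<Longrightarrow> \<bar>F s y - F s y'\<bar> \<le> e'"
    using Fe[OF e'(1)] by blast
  have "(\<lambda>N. CF * a N) \<longlonglongrightarrow> 0" by (rule tendsto_mult_right_zero[OF a])
  then have ev1: "\<forall>\<^sub>F N in sequentially. CF * a N < e / 4" by (rule order_tendstoD) (use e in auto)
  have ev2: "\<forall>\<^sub>F N in sequentially. 1 / real N < d"
    by (rule order_tendstoD[OF lim_1_over_n]) (use d in auto)
  have ev3: "\<forall>\<^sub>F N in sequentially. (1 + real m) * (CG * CF) / real N < e / 4"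
    by (rule order_tendstoD[OF lim_const_over_n]) (use e in auto)
  show ?thesis
    using ev1 ev2 ev3 eventually_ge_at_top[of "1::nat"]
  proof eventually_elim
    case (elim N)
    then have N: "N \<ge> 1" by simp
    show ?case
    proof (intro ballI)
      fix s assume s: "s \<in> S"
      define H where "H = (\<lambda>y. G y * F s y)"
      define J where "J = {- int N..<int N}"
      have r: "of_int x / real N \<in> {-1..1}" if "x \<in> sites N" for x using that N by (auto simp: sites_def field_simps)
      have Hb: "\<bar>H y\<bar> \<le> CG * CF" if "y \<in> {-1..1}" for y
        unfolding H_def abs_mult using Gb[OF that] Fb[OF s that] CG by (intro mult_mono) auto
      \<comment> \<open>The 1 accounts for the site N, which \<open>J\<close> lacks, and
        \<open>m\<close> for the sites missing in \<open>I N\<close>.\<close>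
      have bdry: "\<bar>1 / real N * (\<Sum>x\<in>I N. H (of_int x / N)) - 1 / real N * (\<Sum>x\<in>J. H (of_int x / N))\<bar> \<le> (1 + real m) * (CG * CF) / real N"
      proof -
        have fin: "finite (I N)" "finite J" using I(1)[of N] finite_subset by (auto simp: J_def)
        have J: "J \<subseteq> sites N" by (auto simp: J_def sites_def)
        have "(\<Sum>x\<in>I N. H (of_int x / N)) - (\<Sum>x\<in>J. H (of_int x / N)) = (\<Sum>x\<in>I N - J. H (of_int x / N)) - (\<Sum>x\<in>J - I N. H (of_int x / N))"
          using sum.Int_Diff[OF fin(1), of "\<lambda>x. H (of_int x / N)" J] sum.Int_Diff[OF fin(2), of "\<lambda>x. H (of_int x / N)" "I N"]
          by (simp add: Int_commute)
        also have "\<bar>\<dots>\<bar> \<le> (\<Sum>x\<in>I N - J. CG * CF) + (\<Sum>x\<in>J - I N. CG * CF)"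
        proof (rule order_trans[OF abs_triangle_ineq4], intro add_mono)
          show "\<bar>\<Sum>x\<in>I N - J. H (of_int x / N)\<bar> \<le> (\<Sum>x\<in>I N - J. CG * CF)"
            by (rule order_trans[OF sum_abs], intro sum_mono Hb r) (use I(1) in auto)
          show "\<bar>\<Sum>x\<in>J - I N. H (of_int x / N)\<bar> \<le> (\<Sum>x\<in>J - I N. CG * CF)"
            by (rule order_trans[OF sum_abs], intro sum_mono Hb r) (use J in auto)
        qed
        also have "\<dots> = real (card (I N - J) + card (J - I N)) * (CG * CF)" by (simp add: distrib_right)
        also have "\<dots> \<le> (1 + real m) * (CG * CF)"
        proof (intro mult_right_mono)
          have "I N - J \<subseteq> {int N}" using I(1)[of N] by (auto simp: J_def sites_def)
          then have "card (I N - J) \<le> 1" using card_mono[of "{int N}" "I N - J"] by simp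
          moreover have "card (J - I N) \<le> m" using I(2)[of N] card_mono[of "sites N - I N" "J - I N"] J by (auto intro: order_trans)
          ultimately show "real (card (I N - J) + card (J - I N)) \<le> 1 + real m" by simp
        qed (use CG CF in simp)
        finally have "\<bar>(\<Sum>x\<in>I N. H (of_int x / N)) - (\<Sum>x\<in>J. H (of_int x / N))\<bar> / N \<le> (1 + real m) * (CG * CF) / real N"
          by (intro divide_right_mono) auto
        then show ?thesis by (simp add: diff_divide_distrib[symmetric] abs_divide)
      qed
      have Fc: "continuous_on {-1..1} (F s)"
      proof (rule continuous_onI)
        fix y assume y: "y \<in> {-1..1::real}"
        fix \<epsilon> :: real assume "\<epsilon> > 0"
        with Fe[of \<epsilon>] obtain d' where "d' > 0" "\<forall>s\<in>S. \<forall>y\<in>{-1..1}. \<forall>y'\<in>{-1..1}. \<bar>y - y'\<bar> \<le> d' \<longrightarrow> \<bar>F s y - F s y'\<bar> \<le> \<epsilon>" by blast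
        then show "\<exists>d>0. \<forall>x'\<in>{-1..1}. dist x' y < d \<longrightarrow> dist (F s x') (F s y) \<le> \<epsilon>"
          using s y by (intro exI[of _ d']) (auto simp: dist_real_def)
      qed
      have Fm: "(\<lambda>y. indicator {-1..1} y *\<^sub>R F s y) \<in> borel_measurable borel"
        by (rule borel_measurable_continuous_on_indicator[OF _ Fc]) simp
      have Hm: "(\<lambda>y. indicator {-1..<1} y * H y) \<in> borel_measurable borel"
      proof -
        have "(\<lambda>y. (indicator {-1..<1} y * G y) * (indicator {-1..1} y *\<^sub>R F s y)) \<in> borel_measurable borel"
          by (intro borel_measurable_times borel_restricted[OF Gm] Fm)
        moreover have "(\<lambda>y. (indicator {-1..<1} y * G y) * (indicator {-1..1} y *\<^sub>R F s y)) = (\<lambda>y. indicator {-1..<1} y * H y)"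
          by (auto simp: indicator_def H_def fun_eq_iff)
        ultimately show ?thesis by simp
      qed
      have Hi: "integrable lborel (\<lambda>y. indicator {-1..<1} y * H y)"
      proof (rule integrableI_bounded_set[where A="{-1..<1}" and B="CG * CF"])
        show "AE y in lborel. y \<in> {-1..<1} \<longrightarrow> norm (indicator {-1..<1} y * H y) \<le> CG * CF"
          using Hb by (intro AE_I2) auto
      qed (use Hm in auto)
      have LI: "(LINT y:{-1..1}|lborel. G y * F s y) = (\<integral>y. indicator {-1..<1} y * H y \<partial>lborel)"
        unfolding set_lebesgue_integral_def
      proof (rule integral_cong_AE)
        show AE: "AE y in lborel. indicator {-1..1} y *\<^sub>R (G y * F s y) = indicator {-1..<1} y * H y"
          using AE_lborel_singleton[of "1::real"] by eventually_elim (auto simp: indicator_def H_def)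
        have "(\<lambda>y. (indicator {-1..1} y *\<^sub>R G y) * (indicator {-1..1} y *\<^sub>R F s y)) \<in> borel_measurable borel"
          using Gm by (intro borel_measurable_times Fm) (subst (asm) borel_measurable_restrict_space_iff, auto)
        moreover have "(\<lambda>y. (indicator {-1..1} y *\<^sub>R G y) * (indicator {-1..1} y *\<^sub>R F s y)) = (\<lambda>y. indicator {-1..1} y *\<^sub>R (G y * F s y))"
          by (auto simp: indicator_def fun_eq_iff)
        ultimately show "(\<lambda>y. indicator {-1..1} y *\<^sub>R (G y * F s y)) \<in> borel_measurable lborel" by simp
      qed (use Hm in auto)
      have gi: "integrable lborel (\<lambda>y. \<bar>grid_step N G y - indicator {-1..<1} y * G y\<bar>)"
      proof (intro integrable_abs Bochner_Integration.integrable_diff grid_step_integral(1)[OF N])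
        show "integrable lborel (\<lambda>y. indicator {-1..<1} y * G y)"
        proof (rule integrableI_bounded_set[where A="{-1..<1}" and B=CG])
          show "AE y in lborel. y \<in> {-1..<1} \<longrightarrow> norm (indicator {-1..<1} y * G y) \<le> CG"
            using Gb by (intro AE_I2) auto
        qed (use borel_restricted[OF Gm] in auto)
      qed
      have "1 / real N * (\<Sum>x\<in>J. H (of_int x / N)) - (LINT y:{-1..1}|lborel. G y * F s y) = (\<integral>y. grid_step N H y - indicator {-1..<1} y * H y \<partial>lborel)"
        unfolding LI J_def grid_step_integral(2)[OF N, symmetric]
        by (rule Bochner_Integration.integral_diff[OF grid_step_integral(1)[OF N] Hi, symmetric])
      also have "\<bar>\<dots>\<bar> \<le> (\<integral>y. \<bar>grid_step N H y - indicator {-1..<1} y * H y\<bar> \<partial>lborel)"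
        by (rule integral_abs_bound)
      also have "\<dots> \<le> (\<integral>y. CF * \<bar>grid_step N G y - indicator {-1..<1} y * G y\<bar> + indicator {-1..<1} y * (CG * e') \<partial>lborel)"
      proof (rule integral_mono)
        show "integrable lborel (\<lambda>y. \<bar>grid_step N H y - indicator {-1..<1} y * H y\<bar>)"
          by (intro integrable_abs Bochner_Integration.integrable_diff grid_step_integral(1)[OF N] Hi)
        show "integrable lborel (\<lambda>y. CF * \<bar>grid_step N G y - indicator {-1..<1} y * G y\<bar> + indicator {-1..<1} y * (CG * e'))"
          by (intro Bochner_Integration.integrable_add integrable_mult_right gi integrable_mult_left) (auto simp: integrable_indicator_iff)
        fix y :: real
        show "\<bar>grid_step N H y - indicator {-1..<1} y * H y\<bar> \<le> CF * \<bar>grid_step N G y - indicator {-1..<1} y * G y\<bar> + indicator {-1..<1} y * (CG * e')"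
        proof (cases "y \<in> {-1..<1}")
          case True
          define y' where "y' = grid_floor N y"
          have y': "y' \<in> {-1..1}" "y \<in> {-1..1}" "\<bar>y' - y\<bar> \<le> d"
            using grid_floor_range[OF N True] grid_floor_bounds[OF N, of y] elim(2) True by (auto simp: y'_def)
          have "H y' - H y = F s y' * (G y' - G y) + G y * (F s y' - F s y)" by (simp add: H_def algebra_simps)
          also have "\<bar>\<dots>\<bar> \<le> \<bar>F s y'\<bar> * \<bar>G y' - G y\<bar> + \<bar>G y\<bar> * \<bar>F s y' - F s y\<bar>"
            by (rule order_trans[OF abs_triangle_ineq]) (simp add: abs_mult)
          also have "\<dots> \<le> CF * \<bar>G y' - G y\<bar> + CG * e'"
            using Fb[OF s y'(1)] Gb[OF y'(2)] d(2)[OF s y'(1,2,3)] CG by (intro add_mono mult_right_mono mult_mono) auto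
          finally show ?thesis using True by (simp add: grid_step_eq[OF N] y'_def)
        next
          case False
          then show ?thesis by (simp add: grid_step_eq[OF N] del: atLeastLessThan_iff)
        qed
      qed
      also have "\<dots> = CF * a N + 2 * (CG * e')"
      proof -
        have "(\<integral>y. indicator {-1..<1} y * (CG * e') \<partial>(lborel :: real measure)) = 2 * (CG * e')" by simp
        then show ?thesis unfolding a_def
          by (subst Bochner_Integration.integral_add) (use gi in \<open>auto simp: integrable_indicator_iff\<close>)
      qed
      also have "\<dots> \<le> e / 4 + e / 4" using elim(1) e'(2) by simp
      finally have 1: "\<bar>1 / real N * (\<Sum>x\<in>J. H (of_int x / N)) - (LINT y:{-1..1}|lborel. G y * F s y)\<bar> \<le> e / 4 + e / 4" .
      have "\<bar>1 / real N * (\<Sum>x\<in>I N. H (of_int x / N)) - (LINT y:{-1..1}|lborel. G y * F s y)\<bar> \<le> e"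
        using 1 bdry elim(3) e by linarith
      then show "\<bar>1 / real N * (\<Sum>x\<in>I N. G (of_int x / N) * F s (of_int x / N)) - (LINT y:{-1..1}|lborel. G y * F s y)\<bar> \<le> e"
        by (simp add: H_def)
    qed
  qed
qed simp

section \<open>Continuity in the fugacity\<close>

context zr_params begin

lemma Z_isCont: assumes "lam > 0" shows "isCont Z lam"
proof -
  have s: "summable (\<lambda>k. (1 / gfact g k) * (lam + 1) ^ k)" using sm[of "lam + 1"] assms by simp
  have "isCont (\<lambda>x. \<Sum>k. (1 / gfact g k) * x ^ k) lam"
    by (rule isCont_powser[OF s]) (use assms in auto)
  moreover have "Z = (\<lambda>x. \<Sum>k. (1 / gfact g k) * x ^ k)" by (simp add: Z_def partition_fun_def fun_eq_iff)
  ultimately show ?thesis by simp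
qed

lemma site_cont: "continuous_on {l0..l1} (\<lambda>lam. site lam k)"
proof (rule continuous_on_eq)
  show "continuous_on {l0..l1} (\<lambda>lam. lam ^ k / (gfact g k * Z lam))"
  proof (intro continuous_intros)
    show "continuous_on {l0..l1} Z"
      using Z_isCont l0 by (intro continuous_at_imp_continuous_on) auto
    show "\<forall>x\<in>{l0..l1}. gfact g k * Z x \<noteq> 0"
    proof
      fix x assume "x \<in> {l0..l1}"
      then have "Z x \<ge> 1" using l0 by (intro Z_ge_1) auto
      then show "gfact g k * Z x \<noteq> 0" using gfp[of k] by simp
    qed
  qed
  show "lam ^ k / (gfact g k * Z lam) = site lam k" if "lam \<in> {l0..l1}" for lam
    using pmf_site[of lam k] that l0 by auto
qed

lemma lb_lipschitz:
  assumes s: "s \<in> {0..T}" shows "\<bar>lambda_bar lm lp r s - lambda_bar lm lp r' s\<bar> \<le> l1 * \<bar>r - r'\<bar>"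
proof -
  have "lambda_bar lm lp r s - lambda_bar lm lp r' s = (lp s - lm s) / 2 * (r - r')"
    by (simp add: lambda_bar_def field_simps)
  moreover have "(lp s - lm s) / 2 \<le> l1" "- ((lp s - lm s) / 2) \<le> l1"
    using conjunct1[OF lm_bounds[OF s]] conjunct2[OF lm_bounds[OF s]]
      conjunct1[OF lp_bounds[OF s]] conjunct2[OF lp_bounds[OF s]] l0 by (simp_all add: field_simps)
  then have "\<bar>(lp s - lm s) / 2\<bar> \<le> l1" by (rule abs_leI)
  ultimately show ?thesis by (simp only: abs_mult) (rule mult_right_mono, auto)
qed

end

section \<open>Truncation of the local function\<close>

locale zr_phi = zr_params +
  fixes \<phi> :: "(int \<Rightarrow> nat) \<Rightarrow> real" and A :: "int set"
  assumes A: "finite A" "A \<noteq> {}" and loc: "determined_on \<phi> A"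
    and expo: "\<And>lam gam. lam > 0 \<Longrightarrow> gam > 0 \<Longrightarrow>
      integrable (measure_pmf (Pi_pmf A 0 (\<lambda>_. site_law g lam))) (\<lambda>\<xi>. exp (gam * \<bar>\<phi> \<xi>\<bar>))"
begin

definition local_law :: "real \<Rightarrow> (int \<Rightarrow> nat) pmf" where "local_law lam = Pi_pmf A 0 (\<lambda>_. site_law g lam)"
text \<open>The occupation numbers are truncated, not the values of \<open>\<phi>\<close>: what
  remains is a finite linear combination of pattern indicators.\<close>

definition phi_tail :: "nat \<Rightarrow> (int \<Rightarrow> nat) \<Rightarrow> real" where "phi_tail R \<eta> = \<bar>\<phi> \<eta>\<bar> * of_bool (\<exists>z\<in>A. \<eta> z > R)"
definition cube_configs :: "nat \<Rightarrow> (int \<Rightarrow> nat) set" where "cube_configs R = PiE_dflt A 0 (\<lambda>_. {..R})"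
definition tail_exp_moment :: "real \<Rightarrow> nat \<Rightarrow> real" where "tail_exp_moment gam R = measure_pmf.expectation (local_law l1) (\<lambda>\<eta>. exp (gam * phi_tail R \<eta>))"
definition truncated_mean :: "nat \<Rightarrow> real \<Rightarrow> real" where "truncated_mean R lam = (\<Sum>k\<in>cube_configs R. \<phi> k * (\<Prod>z\<in>A. site lam (k z)))"
definition local_mean :: "real \<Rightarrow> real" where "local_mean lam = measure_pmf.expectation (local_law lam) \<phi>"
text \<open>A bound on the mean of \<open>phi_tail R\<close> for all fugacities in
  \<open>{l0..l1}\<close>. The power of \<open>Z l1\<close> compares the law with that at
  \<open>l1\<close> site by site, and the rest comes from \<open>x \<le> exp x - 1\<close>.\<close>

definition tail_mean :: "nat \<Rightarrow> real" where "tail_mean R = Z l1 ^ card A * (tail_exp_moment 1 R - 1)"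

lemma finite_cube_configs: "finite (cube_configs R)" unfolding cube_configs_def using A by (intro finite_PiE_dflt) auto

lemma cube_configs_le: "k \<in> cube_configs R \<Longrightarrow> z \<in> A \<Longrightarrow> k z \<le> R" unfolding cube_configs_def PiE_dflt_def by auto

lemma phi_tail_nonneg: "0 \<le> phi_tail R \<eta>" by (simp add: phi_tail_def)
lemma phi_tail_le: "phi_tail R \<eta> \<le> \<bar>\<phi> \<eta>\<bar>" by (simp add: phi_tail_def of_bool_def)

lemma phi_tail_determined_on: "determined_on (phi_tail R) A"
  unfolding determined_on_def
proof (intro allI impI)
  fix \<eta> \<xi> :: "int \<Rightarrow> nat" assume eq: "\<forall>z\<in>A. \<eta> z = \<xi> z"
  then have "\<phi> \<eta> = \<phi> \<xi>" by (intro determined_onD[OF loc]) auto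
  with eq show "phi_tail R \<eta> = phi_tail R \<xi>" by (simp add: phi_tail_def)
qed

lemma exp_phi_tail_int: "lam > 0 \<Longrightarrow> gam > 0 \<Longrightarrow> integrable (measure_pmf (local_law lam)) (\<lambda>\<eta>. exp (gam * phi_tail R \<eta>))"
  unfolding local_law_def
  by (rule Bochner_Integration.integrable_bound[OF expo[of lam gam]]) (auto intro!: mult_left_mono phi_tail_le)

lemma abs_phi_int: "lam > 0 \<Longrightarrow> integrable (measure_pmf (local_law lam)) (\<lambda>\<eta>. \<bar>\<phi> \<eta>\<bar>)"
  unfolding local_law_def
proof (rule Bochner_Integration.integrable_bound[OF expo[of lam 1]])
  show "AE \<eta> in measure_pmf (Pi_pmf A 0 (\<lambda>_. site_law g lam)). norm \<bar>\<phi> \<eta>\<bar> \<le> norm (exp (1 * \<bar>\<phi> \<eta>\<bar>))"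
  proof (rule AE_pmfI)
    fix \<eta>
    show "norm \<bar>\<phi> \<eta>\<bar> \<le> norm (exp (1 * \<bar>\<phi> \<eta>\<bar>))"
      unfolding mult_1 real_norm_def abs_exp_cancel using exp_ge_add_one_self[of "\<bar>\<phi> \<eta>\<bar>"] by linarith
  qed
qed auto

lemma phi_tail_int: "lam > 0 \<Longrightarrow> integrable (measure_pmf (local_law lam)) (phi_tail R)"
  by (rule Bochner_Integration.integrable_bound[OF abs_phi_int[of lam]]) (auto simp: phi_tail_nonneg phi_tail_le)

text \<open>The limit is 1 because the tail vanishes once \<open>R\<close> exceeds the occupation
  numbers on \<open>A\<close>. Thus for each exponent, however large, a suitable \<open>R\<close>
  brings the moment below \<open>exp 1\<close>.\<close>

lemma tail_exp_moment_tendsto: assumes gam: "gam > 0" shows "tail_exp_moment gam \<longlonglongrightarrow> 1"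
proof -
  have "(\<lambda>R. measure_pmf.expectation (local_law l1) (\<lambda>\<eta>. exp (gam * phi_tail R \<eta>))) \<longlonglongrightarrow> measure_pmf.expectation (local_law l1) (\<lambda>\<eta>. 1)"
  proof (rule integral_dominated_convergence[where w="\<lambda>\<eta>. exp (gam * \<bar>\<phi> \<eta>\<bar>)"])
    show "integrable (measure_pmf (local_law l1)) (\<lambda>\<eta>. exp (gam * \<bar>\<phi> \<eta>\<bar>))" unfolding local_law_def by (rule expo[OF l1 gam])
    show "AE \<eta> in measure_pmf (local_law l1). norm (exp (gam * phi_tail R \<eta>)) \<le> exp (gam * \<bar>\<phi> \<eta>\<bar>)" for R
      using gam by (intro AE_pmfI) (auto intro!: mult_left_mono phi_tail_le)
    show "AE \<eta> in measure_pmf (local_law l1). (\<lambda>R. exp (gam * phi_tail R \<eta>)) \<longlonglongrightarrow> 1"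
    proof (rule AE_pmfI, rule tendsto_eventually)
      fix \<eta> :: "int \<Rightarrow> nat"
      have "\<eta> z \<le> (\<Sum>z\<in>A. \<eta> z)" if "z \<in> A" for z using that A by (intro member_le_sum) auto
      then have "phi_tail R \<eta> = 0" if "R \<ge> (\<Sum>z\<in>A. \<eta> z)" for R
        using that unfolding phi_tail_def by (auto simp: not_less intro: order_trans)
      then show "\<forall>\<^sub>F R in sequentially. exp (gam * phi_tail R \<eta>) = 1"
        by (intro eventually_sequentiallyI[of "\<Sum>z\<in>A. \<eta> z"]) simp
    qed
  qed auto
  then show ?thesis by (simp add: tail_exp_moment_def[abs_def])
qed

lemma tail_exp_moment_nn: "gam > 0 \<Longrightarrow> (\<integral>\<^sup>+\<eta>. ennreal (exp (gam * phi_tail R \<eta>)) \<partial>measure_pmf (Pi_pmf A 0 (\<lambda>_. site_law g l1))) = ennreal (tail_exp_moment gam R)"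
  unfolding tail_exp_moment_def local_law_def[symmetric] by (rule nn_integral_eq_integral[OF exp_phi_tail_int[OF l1]]) auto

lemma tail_mean_tendsto: "tail_mean \<longlonglongrightarrow> 0"
proof -
  have "(\<lambda>R. Z l1 ^ card A * (tail_exp_moment 1 R - 1)) \<longlonglongrightarrow> Z l1 ^ card A * (1 - 1)"
    by (intro tendsto_intros tail_exp_moment_tendsto) simp
  then show ?thesis by (simp add: tail_mean_def[abs_def])
qed

lemma local_law_compare:
  assumes "lam \<in> {l0..l1}" shows "pmf (local_law lam) \<eta> \<le> Z l1 ^ card A * pmf (local_law l1) \<eta>"
proof (cases "\<forall>x. x \<notin> A \<longrightarrow> \<eta> x = 0")
  case True
  have lam: "lam > 0" "lam \<le> l1" using assms l0 by auto
  have "pmf (local_law lam) \<eta> = (\<Prod>x\<in>A. site lam (\<eta> x))" unfolding local_law_def using A True by (intro pmf_Pi') auto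
  also have "\<dots> \<le> (\<Prod>x\<in>A. Z l1 * site l1 (\<eta> x))"
  proof (intro prod_mono conjI pmf_nonneg)
    fix x
    have "lam ^ \<eta> x / (gfact g (\<eta> x) * Z lam) \<le> l1 ^ \<eta> x / (gfact g (\<eta> x) * 1)"
      using lam gfp[of "\<eta> x"] Z_ge_1[OF lam(1)] by (intro frac_le power_mono mult_left_mono) auto
    then show "site lam (\<eta> x) \<le> Z l1 * site l1 (\<eta> x)"
      using Z_ge_1[OF l1] by (simp add: pmf_site[OF lam(1)] pmf_site[OF l1])
  qed
  also have "\<dots> = Z l1 ^ card A * (\<Prod>x\<in>A. site l1 (\<eta> x))" by (simp add: prod.distrib)
  also have "(\<Prod>x\<in>A. site l1 (\<eta> x)) = pmf (local_law l1) \<eta>" unfolding local_law_def using A True by (intro pmf_Pi'[symmetric]) auto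
  finally show ?thesis .
next
  case False
  then have "pmf (local_law lam) \<eta> = 0" unfolding local_law_def using A by (intro pmf_Pi_outside) auto
  then show ?thesis using Z_ge_1[OF l1] by simp
qed

lemma expectation_phi_tail:
  assumes "lam \<in> {l0..l1}" shows "measure_pmf.expectation (local_law lam) (phi_tail R) \<le> tail_mean R"
proof -
  have lam: "lam > 0" using assms l0 by auto
  define ZZ where "ZZ = Z l1 ^ card A"
  have ZZ: "ZZ \<ge> 0" using Z_ge_1[OF l1] by (simp add: ZZ_def)
  have "ennreal (measure_pmf.expectation (local_law lam) (phi_tail R)) = (\<integral>\<^sup>+\<eta>. ennreal (phi_tail R \<eta>) \<partial>measure_pmf (local_law lam))"
    by (rule nn_integral_eq_integral[OF phi_tail_int[OF lam], symmetric]) (auto simp: phi_tail_nonneg)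
  also have "\<dots> = (\<integral>\<^sup>+\<eta>. ennreal (pmf (local_law lam) \<eta>) * ennreal (phi_tail R \<eta>) \<partial>count_space UNIV)"
    by (rule nn_integral_measure_pmf)
  also have "\<dots> \<le> (\<integral>\<^sup>+\<eta>. ennreal ZZ * (ennreal (pmf (local_law l1) \<eta>) * ennreal (phi_tail R \<eta>)) \<partial>count_space UNIV)"
  proof (rule nn_integral_mono)
    fix \<eta>
    have "ennreal (pmf (local_law lam) \<eta>) \<le> ennreal (ZZ * pmf (local_law l1) \<eta>)"
      unfolding ZZ_def by (rule ennreal_leI[OF local_law_compare[OF assms]])
    also have "\<dots> = ennreal ZZ * ennreal (pmf (local_law l1) \<eta>)" using ZZ by (rule ennreal_mult')
    finally show "ennreal (pmf (local_law lam) \<eta>) * ennreal (phi_tail R \<eta>) \<le> ennreal ZZ * (ennreal (pmf (local_law l1) \<eta>) * ennreal (phi_tail R \<eta>))"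
      unfolding mult.assoc[symmetric] by (rule mult_right_mono) simp
  qed
  also have "\<dots> = ennreal ZZ * (\<integral>\<^sup>+\<eta>. ennreal (phi_tail R \<eta>) \<partial>measure_pmf (local_law l1))"
    by (subst nn_integral_cmult) (auto simp: nn_integral_measure_pmf)
  also have "(\<integral>\<^sup>+\<eta>. ennreal (phi_tail R \<eta>) \<partial>measure_pmf (local_law l1)) = ennreal (measure_pmf.expectation (local_law l1) (phi_tail R))"
    by (rule nn_integral_eq_integral[OF phi_tail_int[OF l1]]) (auto simp: phi_tail_nonneg)
  also have "ennreal ZZ * \<dots> = ennreal (ZZ * measure_pmf.expectation (local_law l1) (phi_tail R))"
    using ZZ by (simp add: ennreal_mult')
  finally have "measure_pmf.expectation (local_law lam) (phi_tail R) \<le> ZZ * measure_pmf.expectation (local_law l1) (phi_tail R)"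
    using ZZ by (subst (asm) ennreal_le_iff) (auto intro!: mult_nonneg_nonneg Bochner_Integration.integral_nonneg simp: phi_tail_nonneg)
  also have "measure_pmf.expectation (local_law l1) (phi_tail R) \<le> measure_pmf.expectation (local_law l1) (\<lambda>\<eta>. exp (1 * phi_tail R \<eta>) - 1)"
  proof (rule integral_mono[OF phi_tail_int[OF l1]])
    show "integrable (measure_pmf (local_law l1)) (\<lambda>\<eta>. exp (1 * phi_tail R \<eta>) - 1)"
      by (intro Bochner_Integration.integrable_diff exp_phi_tail_int l1) auto
    show "phi_tail R \<eta> \<le> exp (1 * phi_tail R \<eta>) - 1" for \<eta>
      unfolding mult_1 using exp_ge_add_one_self[of "phi_tail R \<eta>"] by linarith
  qed
  also have "\<dots> = tail_exp_moment 1 R - 1"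
    unfolding tail_exp_moment_def using exp_phi_tail_int[OF l1, of 1 R] by (subst Bochner_Integration.integral_diff) auto
  finally show ?thesis using ZZ by (simp add: tail_mean_def ZZ_def mult_left_mono)
qed

lemma phi_decomp:
  "\<phi> \<eta> = (\<Sum>k\<in>cube_configs R. \<phi> k * of_bool (\<forall>z\<in>A. \<eta> z = k z)) + \<phi> \<eta> * of_bool (\<exists>z\<in>A. \<eta> z > R)"
proof -
  define k0 where "k0 = cut A \<eta>"
  have "(\<Sum>k\<in>cube_configs R. \<phi> k * of_bool (\<forall>z\<in>A. \<eta> z = k z)) = (\<Sum>k\<in>cube_configs R. if k = k0 then \<phi> k0 else 0)"
  proof (intro sum.cong refl)
    fix k assume k: "k \<in> cube_configs R"
    have "(\<forall>z\<in>A. \<eta> z = k z) \<longleftrightarrow> k = k0"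
      using k by (auto simp: cube_configs_def PiE_dflt_def k0_def cut_def fun_eq_iff)
    then show "\<phi> k * of_bool (\<forall>z\<in>A. \<eta> z = k z) = (if k = k0 then \<phi> k0 else 0)" by simp
  qed
  also have "\<dots> = (if k0 \<in> cube_configs R then \<phi> k0 else 0)" using finite_cube_configs by simp
  also have "k0 \<in> cube_configs R \<longleftrightarrow> \<not> (\<exists>z\<in>A. \<eta> z > R)" by (auto simp: cube_configs_def PiE_dflt_def k0_def cut_def not_less)
  also have "\<phi> k0 = \<phi> \<eta>" unfolding k0_def by (rule determined_on_cut[OF loc])
  finally show ?thesis by simp
qed

lemma truncated_mean_approx:
  assumes "lam \<in> {l0..l1}" shows "\<bar>truncated_mean R lam - local_mean lam\<bar> \<le> tail_mean R"
proof -
  have lam: "lam > 0" using assms l0 by auto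
  have i1: "integrable (measure_pmf (local_law lam)) (\<lambda>\<eta>. \<phi> k * of_bool (\<forall>z\<in>A. \<eta> z = k z))" for k
    by (rule pmf_integrable_bounded[of _ "\<bar>\<phi> k\<bar>"]) (auto simp: of_bool_def)
  have i2: "integrable (measure_pmf (local_law lam)) (\<lambda>\<eta>. \<phi> \<eta> * of_bool (\<exists>z\<in>A. \<eta> z > R))"
    by (rule Bochner_Integration.integrable_bound[OF abs_phi_int[OF lam]]) (auto simp: of_bool_def)
  have "measure_pmf.expectation (local_law lam) (\<lambda>\<eta>. of_bool (\<forall>z\<in>A. \<eta> z = k z)) = (\<Prod>z\<in>A. site lam (k z))" if k: "k \<in> cube_configs R" for k
  proof -
    have k0: "k x = 0" if "x \<notin> A" for x using k that by (auto simp: cube_configs_def PiE_dflt_def)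
    have "measure_pmf.expectation (local_law lam) (\<lambda>\<eta>. of_bool (\<forall>z\<in>A. \<eta> z = k z)) = measure_pmf.expectation (local_law lam) (\<lambda>\<eta>. of_bool (\<eta> = k) :: real)"
    proof (intro integral_cong_AE AE_pmfI)
      fix \<eta> assume "\<eta> \<in> set_pmf (local_law lam)"
      then have "\<And>x. x \<notin> A \<Longrightarrow> \<eta> x = 0" using set_Pi_pmf_subset[OF A(1), of 0 "\<lambda>_. site_law g lam"] by (auto simp: local_law_def)
      then have "(\<forall>z\<in>A. \<eta> z = k z) \<longleftrightarrow> \<eta> = k" using k0 by (auto simp: fun_eq_iff)
      then show "of_bool (\<forall>z\<in>A. \<eta> z = k z) = (of_bool (\<eta> = k) :: real)" by simp
    qed auto
    also have "\<dots> = pmf (local_law lam) k" by (subst integral_measure_pmf_real[of "{k}"]) auto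
    also have "\<dots> = (\<Prod>z\<in>A. site lam (k z))" unfolding local_law_def using A k0 by (intro pmf_Pi') auto
    finally show ?thesis .
  qed
  then have "truncated_mean R lam = measure_pmf.expectation (local_law lam) (\<lambda>\<eta>. \<Sum>k\<in>cube_configs R. \<phi> k * of_bool (\<forall>z\<in>A. \<eta> z = k z))"
    unfolding truncated_mean_def using i1 by (subst Bochner_Integration.integral_sum) auto
  moreover have "local_mean lam = measure_pmf.expectation (local_law lam) (\<lambda>\<eta>. \<Sum>k\<in>cube_configs R. \<phi> k * of_bool (\<forall>z\<in>A. \<eta> z = k z))
     + measure_pmf.expectation (local_law lam) (\<lambda>\<eta>. \<phi> \<eta> * of_bool (\<exists>z\<in>A. \<eta> z > R))"
    unfolding local_mean_def Bochner_Integration.integral_cong[OF refl phi_decomp[of _ R]]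
    by (rule Bochner_Integration.integral_add) (use i1 i2 in auto)
  ultimately have "\<bar>truncated_mean R lam - local_mean lam\<bar> = \<bar>measure_pmf.expectation (local_law lam) (\<lambda>\<eta>. \<phi> \<eta> * of_bool (\<exists>z\<in>A. \<eta> z > R))\<bar>" by simp
  also have "\<dots> \<le> measure_pmf.expectation (local_law lam) (\<lambda>\<eta>. \<bar>\<phi> \<eta> * of_bool (\<exists>z\<in>A. \<eta> z > R)\<bar>)" by (rule integral_abs_bound)
  also have "(\<lambda>\<eta>. \<bar>\<phi> \<eta> * of_bool (\<exists>z\<in>A. \<eta> z > R)\<bar>) = phi_tail R" by (simp add: phi_tail_def fun_eq_iff abs_mult)
  also have "measure_pmf.expectation (local_law lam) (phi_tail R) \<le> tail_mean R" by (rule expectation_phi_tail[OF assms])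
  finally show ?thesis .
qed

lemma truncated_mean_cont: "continuous_on {l0..l1} (truncated_mean R)"
  unfolding truncated_mean_def[abs_def] by (intro continuous_intros site_cont)

lemma local_mean_cont: "continuous_on {l0..l1} local_mean"
proof (rule uniform_limit_theorem[of _ truncated_mean])
  show "\<forall>\<^sub>F R in sequentially. continuous_on {l0..l1} (truncated_mean R)" using truncated_mean_cont by simp
  show "uniform_limit {l0..l1} truncated_mean local_mean sequentially"
  proof (rule uniform_limitI)
    fix e :: real assume "e > 0"
    with tail_mean_tendsto have "\<forall>\<^sub>F R in sequentially. tail_mean R < e" by (rule order_tendstoD)
    then show "\<forall>\<^sub>F R in sequentially. \<forall>lam\<in>{l0..l1}. dist (truncated_mean R lam) (local_mean lam) < e"
      by eventually_elim (auto simp: dist_real_def intro: le_less_trans[OF truncated_mean_approx])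
  qed
qed auto

lemma local_mean_eq: "phi_hat g \<phi> lam = local_mean lam"
  unfolding phi_hat_def local_mean_def local_law_def by (rule homogeneous_local(2)[OF A loc])

lemma local_mean_bounded: obtains CF where "CF \<ge> 0" "\<And>lam. lam \<in> {l0..l1} \<Longrightarrow> \<bar>local_mean lam\<bar> \<le> CF"
proof -
  have "bounded (local_mean ` {l0..l1})" by (rule compact_imp_bounded[OF compact_continuous_image[OF local_mean_cont]]) simp
  then obtain B where "\<forall>x\<in>local_mean ` {l0..l1}. norm x \<le> B" unfolding bounded_iff by auto
  then have "\<bar>local_mean lam\<bar> \<le> \<bar>B\<bar>" if "lam \<in> {l0..l1}" for lam using that by force
  then show ?thesis by (rule that[OF abs_ge_zero])
qed

end

section \<open>The law of large numbers\<close>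

locale zr_avg = zr_phi +
  fixes a :: int and G :: "real \<Rightarrow> real" and CG :: real
  assumes aA: "A \<subseteq> {- a..a}" "a \<ge> 0"
    and Gm: "G \<in> borel_measurable (restrict_space borel {-1..1})"
    and Gb: "\<And>y. y \<in> {-1..1} \<Longrightarrow> \<bar>G y\<bar> \<le> CG"
    and Gc: "AE y in lborel. y \<in> {-1..1} \<longrightarrow> continuous (at y within {-1..1}) G"
    and CG: "CG > 0"
begin

definition inner_sites :: "nat \<Rightarrow> int set" where "inner_sites N = {x \<in> sites N. \<forall>z\<in>A. z + x \<in> sites N}"

definition target :: "real \<Rightarrow> real" where
  "target s = (LINT y:{-1..1}|lborel. G y * local_mean (lambda_bar lm lp y s))"

lemma inner_sites: "inner_sites N \<subseteq> sites N" "x \<in> inner_sites N \<Longrightarrow> z \<in> A \<Longrightarrow> z + x \<in> sites N"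
  by (auto simp: inner_sites_def)

lemma card_sites_diff_inner: "card (sites N - inner_sites N) \<le> 2 * nat a"
proof -
  have "sites N - inner_sites N \<subseteq> {- int N..- int N + a - 1} \<union> {int N - a + 1..int N}"
    using aA unfolding inner_sites_def sites_def by fastforce
  then have "card (sites N - inner_sites N) \<le> card ({- int N..- int N + a - 1} \<union> {int N - a + 1..int N})"
    by (rule card_mono[rotated]) simp
  also have "\<dots> \<le> card {- int N..- int N + a - 1} + card {int N - a + 1..int N}" by (rule card_Un_le)
  also have "\<dots> = 2 * nat a" by simp
  finally show ?thesis .
qed

lemma card_inner_sites_le: assumes "N \<ge> 1" shows "real (card (inner_sites N)) \<le> 3 * N"
  using card_mono[OF _ inner_sites(1)[of N]] card_sites[of N] assms by simp

lemma grid_range: "N \<ge> 1 \<Longrightarrow> x \<in> sites N \<Longrightarrow> of_int x / real N \<in> {-1..1}"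
  by (auto simp: sites_def field_simps)

lemma G_inner_le: "N \<ge> 1 \<Longrightarrow> x \<in> inner_sites N \<Longrightarrow> \<bar>G (of_int x / real N)\<bar> \<le> CG"
  using Gb grid_range inner_sites(1) by blast

lemma site_ucont:
  assumes "e > 0"
  obtains d where "d > 0" "\<And>j lam lam'. j \<le> R \<Longrightarrow> lam \<in> {l0..l1} \<Longrightarrow> lam' \<in> {l0..l1} \<Longrightarrow>
    \<bar>lam - lam'\<bar> < d \<Longrightarrow> \<bar>site lam j - site lam' j\<bar> \<le> e"
proof -
  have "\<exists>d>0. \<forall>lam\<in>{l0..l1}. \<forall>lam'\<in>{l0..l1}. \<bar>lam - lam'\<bar> < d \<longrightarrow> \<bar>site lam j - site lam' j\<bar> \<le> e" for j
    using compact_uniformly_continuous[OF site_cont[of j]] assms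
    unfolding uniformly_continuous_on_def dist_real_def by (fastforce simp: abs_minus_commute)
  then obtain d where d: "\<And>j. d j > 0"
    "\<And>j lam lam'. lam \<in> {l0..l1} \<Longrightarrow> lam' \<in> {l0..l1} \<Longrightarrow> \<bar>lam - lam'\<bar> < d j \<Longrightarrow> \<bar>site lam j - site lam' j\<bar> \<le> e"
    by metis
  show ?thesis
  proof (rule that[of "Min (d ` {..R})"])
    show "Min (d ` {..R}) > 0" using d(1) by (subst Min_gr_iff) auto
    show "\<bar>site lam j - site lam' j\<bar> \<le> e"
      if "j \<le> R" "lam \<in> {l0..l1}" "lam' \<in> {l0..l1}" "\<bar>lam - lam'\<bar> < Min (d ` {..R})" for j lam lam'
    proof (rule d(2)[OF that(2,3)])
      have "Min (d ` {..R}) \<le> d j" using that(1) by (intro Min_le) auto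
      with that(4) show "\<bar>lam - lam'\<bar> < d j" by (rule less_le_trans)
    qed
  qed
qed

text \<open>Covers both the displacement by \<open>z\<close> and the change from
  \<open>N + 1\<close> to \<open>N\<close> in the scaling.\<close>

lemma lx_near:
  assumes "N \<ge> 1" "x \<in> sites N" "z \<in> A" "s \<in> {0..T}"
  shows "\<bar>lx N s (z + x) - lambda_bar lm lp (of_int x / real N) s\<bar> \<le> l1 * (of_int a + 1) / N"
proof -
  have N: "real N > 0" using assms by simp
  have x: "\<bar>real_of_int x\<bar> \<le> N" using assms(2) by (auto simp: sites_def)
  have z: "\<bar>real_of_int z\<bar> \<le> of_int a" using assms(3) aA by (auto simp: abs_if)
  have "of_int (z + x) / real (N + 1) - of_int x / real N = (of_int z - of_int x / N) / (N + 1)"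
    using N by (simp add: field_simps)
  also have "\<bar>\<dots>\<bar> \<le> (of_int a + 1) / (N + 1)"
  proof -
    have "\<bar>of_int x / real N\<bar> \<le> 1" using x N by simp
    then have "\<bar>of_int z - of_int x / real N\<bar> \<le> of_int a + 1" using z by linarith
    then show ?thesis by (simp add: abs_divide divide_right_mono)
  qed
  also have "\<dots> \<le> (of_int a + 1) / N" using N aA by (intro divide_left_mono) auto
  finally have b: "\<bar>of_int (z + x) / real (N + 1) - of_int x / real N\<bar> \<le> (of_int a + 1) / N" .
  have "\<bar>lx N s (z + x) - lambda_bar lm lp (of_int x / real N) s\<bar> \<le> l1 * \<bar>of_int (z + x) / real (N + 1) - of_int x / real N\<bar>"
    unfolding site_fugacity_def by (rule lb_lipschitz[OF assms(4)])
  also have "\<dots> \<le> l1 * ((of_int a + 1) / N)" using b l1 by (intro mult_left_mono) auto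
  finally show ?thesis by simp
qed

text \<open>A deterministic statement: on the window \<open>x + A\<close> the slowly varying
  fugacities are replaced by the single macroscopic one, by uniform continuity of the finitely many
  site probabilities involved; \<open>tail_mean R\<close> then completes the truncated mean.\<close>

lemma local_equilibrium:
  assumes e: "e > 0"
  shows "\<forall>\<^sub>F N in sequentially. \<forall>s\<in>{0..T}. \<forall>x\<in>inner_sites N.
    \<bar>(\<Sum>k\<in>cube_configs R. \<phi> k * (\<Prod>z\<in>A. site (lx N s (z + x)) (k z))) - local_mean (lambda_bar lm lp (of_int x / real N) s)\<bar> \<le> tail_mean R + e"
proof -
  define S where "S = (\<Sum>k\<in>cube_configs R. \<bar>\<phi> k\<bar>) * card A"
  have S: "S \<ge> 0" unfolding S_def by (intro mult_nonneg_nonneg sum_nonneg) auto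
  define e1 where "e1 = e / (S + 1)"
  have e1: "e1 > 0" using e S by (simp add: e1_def)
  obtain d where d: "d > 0" "\<And>j lam lam'. j \<le> R \<Longrightarrow> lam \<in> {l0..l1} \<Longrightarrow> lam' \<in> {l0..l1} \<Longrightarrow>
    \<bar>lam - lam'\<bar> < d \<Longrightarrow> \<bar>site lam j - site lam' j\<bar> \<le> e1" using site_ucont[OF e1] by blast
  have "(\<lambda>N. l1 * (of_int a + 1) / real N) \<longlonglongrightarrow> 0" by (rule lim_const_over_n)
  then have "\<forall>\<^sub>F N in sequentially. l1 * (of_int a + 1) / real N < d" using d(1) by (rule order_tendstoD)
  then show ?thesis using eventually_ge_at_top[of 1]
  proof (eventually_elim, intro ballI)
    fix N s x assume near: "l1 * (of_int a + 1) / real N < d" and N: "N \<ge> 1" and s: "s \<in> {0..T}" and x: "x \<in> inner_sites N"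
    define lam where "lam = lambda_bar lm lp (of_int x / real N) s"
    have xs: "x \<in> sites N" using x inner_sites(1) by blast
    have lam: "lam \<in> {l0..l1}" using lb_bounds[OF grid_range[OF N xs] s] by (simp add: lam_def)
    have "\<bar>(\<Sum>k\<in>cube_configs R. \<phi> k * (\<Prod>z\<in>A. site (lx N s (z + x)) (k z))) - truncated_mean R lam\<bar>
      \<le> (\<Sum>k\<in>cube_configs R. \<bar>\<phi> k\<bar> * (card A * e1))"
      unfolding truncated_mean_def sum_subtractf[symmetric]
    proof (rule order_trans[OF sum_abs], rule sum_mono)
      fix k assume k: "k \<in> cube_configs R"
      have "norm ((\<Prod>z\<in>A. site (lx N s (z + x)) (k z)) - (\<Prod>z\<in>A. site lam (k z)))
        \<le> (\<Sum>z\<in>A. norm (site (lx N s (z + x)) (k z) - site lam (k z)))"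
        by (rule norm_prod_diff) (auto simp: pmf_le_1)
      also have "\<dots> \<le> (\<Sum>z\<in>A. e1)"
      proof (rule sum_mono)
        fix z assume z: "z \<in> A"
        have "lx N s (z + x) \<in> {l0..l1}" using lx_bounds[OF bonds_range(2)[OF inner_sites(2)[OF x z]] s] by simp
        moreover have "\<bar>lx N s (z + x) - lam\<bar> < d" using lx_near[OF N xs z s] near unfolding lam_def by simp
        ultimately show "norm (site (lx N s (z + x)) (k z) - site lam (k z)) \<le> e1"
          using d(2)[OF cube_configs_le[OF k z]] lam by simp
      qed
      finally have "\<bar>(\<Prod>z\<in>A. site (lx N s (z + x)) (k z)) - (\<Prod>z\<in>A. site lam (k z))\<bar> \<le> card A * e1" by simp
      then show "\<bar>\<phi> k * (\<Prod>z\<in>A. site (lx N s (z + x)) (k z)) - \<phi> k * (\<Prod>z\<in>A. site lam (k z))\<bar> \<le> \<bar>\<phi> k\<bar> * (card A * e1)"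
        unfolding right_diff_distrib[symmetric] abs_mult by (intro mult_left_mono) auto
    qed
    also have "\<dots> = S * e1" by (simp add: S_def sum_distrib_right mult.assoc)
    also have "\<dots> \<le> (S + 1) * e1" using e1 by (intro mult_right_mono) auto
    also have "\<dots> = e" using S by (simp add: e1_def)
    finally show "\<bar>(\<Sum>k\<in>cube_configs R. \<phi> k * (\<Prod>z\<in>A. site (lx N s (z + x)) (k z))) - local_mean lam\<bar> \<le> tail_mean R + e"
      using truncated_mean_approx[OF lam, of R] by linarith
  qed
qed

lemma riemann_target:
  assumes e: "e > 0"
  shows "\<forall>\<^sub>F N in sequentially. \<forall>s\<in>{0..T}.
    \<bar>1 / real N * (\<Sum>x\<in>inner_sites N. G (of_int x / N) * local_mean (lambda_bar lm lp (of_int x / N) s)) - target s\<bar> \<le> e"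
proof -
  obtain CF where CF: "\<And>lam. lam \<in> {l0..l1} \<Longrightarrow> \<bar>local_mean lam\<bar> \<le> CF" using local_mean_bounded by blast
  show ?thesis unfolding target_def
  proof (rule riemann_uniform[OF Gm Gb Gc _ _ inner_sites(1) card_sites_diff_inner e])
    show "\<bar>local_mean (lambda_bar lm lp y s)\<bar> \<le> CF" if "s \<in> {0..T}" "y \<in> {-1..1}" for s y
      using lb_bounds[OF that(2,1)] by (intro CF) simp
    fix e :: real assume "e > 0"
    with compact_uniformly_continuous[OF local_mean_cont] obtain d where d: "d > 0"
      "\<And>x y. x \<in> {l0..l1} \<Longrightarrow> y \<in> {l0..l1} \<Longrightarrow> \<bar>x - y\<bar> < d \<Longrightarrow> \<bar>local_mean x - local_mean y\<bar> < e"
      unfolding uniformly_continuous_on_def dist_real_def by (metis compact_Icc)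
    show "\<exists>d>0. \<forall>s\<in>{0..T}. \<forall>y\<in>{-1..1}. \<forall>y'\<in>{-1..1}. \<bar>y - y'\<bar> \<le> d \<longrightarrow>
        \<bar>local_mean (lambda_bar lm lp y s) - local_mean (lambda_bar lm lp y' s)\<bar> \<le> e"
    proof (intro exI[of _ "d / (2 * l1)"] conjI ballI impI)
      show "d / (2 * l1) > 0" using d(1) l1 by simp
      fix s y y' assume s: "s \<in> {0..T}" and y: "y \<in> {-1..1::real}" "y' \<in> {-1..1::real}" and yy: "\<bar>y - y'\<bar> \<le> d / (2 * l1)"
      have "l1 * \<bar>y - y'\<bar> \<le> l1 * (d / (2 * l1))" using yy l1 by (intro mult_left_mono) auto
      also have "\<dots> < d" using l1 d(1) by simp
      finally have "\<bar>lambda_bar lm lp y s - lambda_bar lm lp y' s\<bar> < d" using lb_lipschitz[OF s, of y y'] by linarith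
      then show "\<bar>local_mean (lambda_bar lm lp y s) - local_mean (lambda_bar lm lp y' s)\<bar> \<le> e"
        using lb_bounds[OF y(1) s] lb_bounds[OF y(2) s] by (intro less_imp_le d(2)) auto
    qed
  qed
qed

lemma deterministic_error:
  assumes e: "e > 0"
  shows "\<forall>\<^sub>F N in sequentially. \<forall>s\<in>{0..T}.
    \<bar>1 / real N * (\<Sum>x\<in>inner_sites N. G (of_int x / N) * (\<Sum>k\<in>cube_configs R. \<phi> k * (\<Prod>z\<in>A. site (lx N s (z + x)) (k z)))) - target s\<bar>
      \<le> 3 * CG * (tail_mean R + e) + e"
  using local_equilibrium[OF e, of R] riemann_target[OF e] eventually_ge_at_top[of 1]
proof (eventually_elim, intro ballI)
  fix N s assume 1: "\<forall>s\<in>{0..T}. \<forall>x\<in>inner_sites N.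
    \<bar>(\<Sum>k\<in>cube_configs R. \<phi> k * (\<Prod>z\<in>A. site (lx N s (z + x)) (k z))) - local_mean (lambda_bar lm lp (of_int x / real N) s)\<bar> \<le> tail_mean R + e"
    and 2: "\<forall>s\<in>{0..T}.
    \<bar>1 / real N * (\<Sum>x\<in>inner_sites N. G (of_int x / N) * local_mean (lambda_bar lm lp (of_int x / N) s)) - target s\<bar> \<le> e"
    and N: "N \<ge> 1" and s: "s \<in> {0..T}"
  let ?m = "\<lambda>x. \<Sum>k\<in>cube_configs R. \<phi> k * (\<Prod>z\<in>A. site (lx N s (z + x)) (k z))"
  let ?p = "\<lambda>x. local_mean (lambda_bar lm lp (of_int x / N) s)"
  have t: "0 \<le> tail_mean R + e" if "x \<in> inner_sites N" for x using 1 s that by (meson abs_ge_zero order_trans)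
  have "\<bar>1 / real N * (\<Sum>x\<in>inner_sites N. G (of_int x / N) * ?m x) - 1 / real N * (\<Sum>x\<in>inner_sites N. G (of_int x / N) * ?p x)\<bar>
    = 1 / real N * \<bar>\<Sum>x\<in>inner_sites N. G (of_int x / N) * (?m x - ?p x)\<bar>"
    by (simp only: right_diff_distrib[symmetric] sum_subtractf[symmetric] abs_mult) simp
  also have "\<dots> \<le> 1 / real N * (\<Sum>x\<in>inner_sites N. CG * (tail_mean R + e))"
  proof (rule mult_left_mono, rule order_trans[OF sum_abs], rule sum_mono)
    fix x assume x: "x \<in> inner_sites N"
    show "\<bar>G (of_int x / N) * (?m x - ?p x)\<bar> \<le> CG * (tail_mean R + e)"
      unfolding abs_mult using G_inner_le[OF N x] 1 s x CG by (intro mult_mono) auto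
  qed simp
  also have "\<dots> = real (card (inner_sites N)) / N * (CG * (tail_mean R + e))" by simp
  also have "\<dots> \<le> 3 * (CG * (tail_mean R + e))"
  proof (cases "inner_sites N = {}")
    case False
    then have "0 \<le> tail_mean R + e" using t by blast
    then show ?thesis using card_inner_sites_le[OF N] N CG by (intro mult_right_mono) (auto simp: pos_divide_le_eq)
  next
    case True
    have "tail_mean R \<ge> 0" using truncated_mean_approx[of l1 R] l01 by (meson abs_ge_zero atLeastAtMost_iff order_refl order_trans)
    then show ?thesis using True e CG by simp
  qed
  finally show "\<bar>1 / real N * (\<Sum>x\<in>inner_sites N. G (of_int x / N) * ?m x) - target s\<bar> \<le> 3 * CG * (tail_mean R + e) + e"
    using 2[rule_format, OF s] by linarith
qed

end

section \<open>The estimate for fixed N\<close>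

context zr_proc
begin

text \<open>Reduces the expected time integral to the one-time laws. As there are countably many
  states, measurability in time for each fixed state suffices for joint measurability.\<close>

lemma tonelli:
  fixes h :: "real \<Rightarrow> (int \<Rightarrow> nat) \<Rightarrow> ennreal"
  assumes h: "\<And>\<eta>. (\<lambda>s. h s \<eta>) \<in> borel_measurable borel"
  shows "(\<integral>\<^sup>+\<omega>. (\<integral>\<^sup>+s. h s (X (clamp s) \<omega>) \<partial>lborel) \<partial>M) = (\<integral>\<^sup>+s. (\<integral>\<^sup>+\<eta>. h s \<eta> \<partial>measure_pmf (law_at (clamp s))) \<partial>lborel)"
    and "(\<lambda>s. \<integral>\<^sup>+\<eta>. h s \<eta> \<partial>measure_pmf (law_at (clamp s))) \<in> borel_measurable lborel"
proof -
  define H where "H = (\<lambda>p. h (fst p) (X (clamp (fst p)) (snd p)))"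
  have H: "H \<in> borel_measurable (lborel \<Otimes>\<^sub>M M)"
    unfolding H_def
  proof (rule measurable_compose_countable'[where f="\<lambda>\<eta> p. h (fst p) \<eta>", OF _ joint_X countable_configs])
    show "(\<lambda>p. h (fst p) \<eta>) \<in> borel_measurable (lborel \<Otimes>\<^sub>M M)" for \<eta>
      by (rule measurable_compose[OF measurable_fst]) (simp add: h)
  qed
  interpret P: pair_sigma_finite lborel M ..
  have eq: "(\<integral>\<^sup>+\<omega>. H (s, \<omega>) \<partial>M) = (\<integral>\<^sup>+\<eta>. h s \<eta> \<partial>measure_pmf (law_at (clamp s)))" for s
    unfolding law_at_eq[OF clamp(3)] H_def by (subst nn_integral_distr[OF X_meas_UNIV[OF clamp(3)]]) auto
  have "(\<integral>\<^sup>+\<omega>. (\<integral>\<^sup>+s. H (s, \<omega>) \<partial>lborel) \<partial>M) = (\<integral>\<^sup>+s. (\<integral>\<^sup>+\<omega>. H (s, \<omega>) \<partial>M) \<partial>lborel)"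
    using P.nn_integral_snd[OF H] nn_integral_fst[OF H] by simp
  then show "(\<integral>\<^sup>+\<omega>. (\<integral>\<^sup>+s. h s (X (clamp s) \<omega>) \<partial>lborel) \<partial>M) = (\<integral>\<^sup>+s. (\<integral>\<^sup>+\<eta>. h s \<eta> \<partial>measure_pmf (law_at (clamp s))) \<partial>lborel)"
    unfolding eq by (simp add: H_def)
  show "(\<lambda>s. \<integral>\<^sup>+\<eta>. h s \<eta> \<partial>measure_pmf (law_at (clamp s))) \<in> borel_measurable lborel"
    using borel_measurable_nn_integral_fst[OF H] unfolding eq .
qed

lemma site_clamp_meas:
  assumes "y \<in> sites N" shows "(\<lambda>s. site (lx N (clamp s) y) j) \<in> borel_measurable borel"
proof (rule borel_measurable_continuous_onI)
  have c: "continuous_on UNIV (\<lambda>s. lx N (clamp s) y)"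
    by (rule continuous_on_compose2[OF lx_cont clamp_cont]) (use clamp in auto)
  show "continuous_on UNIV (\<lambda>s. site (lx N (clamp s) y) j)"
    by (rule continuous_on_compose2[OF site_cont c])
      (use lx_bounds[OF bonds_range(2)[OF assms] clamp(1)] in auto)
qed

end

locale zr_main = zr_avg + zr_proc
begin

definition local_average :: "(int \<Rightarrow> nat) \<Rightarrow> real" where
  "local_average \<eta> = 1 / real N * (\<Sum>x\<in>inner_sites N. G (of_int x / N) * \<phi> (\<lambda>z. \<eta> (z + x)))"

text \<open>Holds for every configuration. The three terms are the truncated part of
  \<open>\<phi>\<close>, the fluctuations of finitely many patterns around their local equilibrium
  probabilities, and the deterministic error.\<close>

lemma local_average_error:
  assumes ev: "zr_evol g lm lp lm' lp' T l0 l1 Lam Cg N speed C0 law_at" and s: "s \<in> {0..T}"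
    and D: "\<bar>1 / real N * (\<Sum>x\<in>inner_sites N. G (of_int x / N) * (\<Sum>k\<in>cube_configs R. \<phi> k * (\<Prod>z\<in>A. site (lx N s (z + x)) (k z)))) - target s\<bar> \<le> D"
  shows "\<bar>local_average \<eta> - target s\<bar> \<le> CG / N * (\<Sum>x\<in>inner_sites N. phi_tail R (\<lambda>z. \<eta> (z + x)))
    + (\<Sum>k\<in>cube_configs R. \<bar>\<phi> k\<bar> * \<bar>zr_evol.pattern_average g lm lp N A k (inner_sites N) (\<lambda>x. G (of_int x / N)) s \<eta>\<bar>) + D"
proof -
  interpret E: zr_evol g lm lp lm' lp' T l0 l1 Lam Cg N speed C0 law_at by fact
  define w where "w = (\<lambda>x. \<phi> (\<lambda>z. \<eta> (z + x)) * of_bool (\<exists>z\<in>A. \<eta> (z + x) > R))"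
  let ?G = "\<lambda>x. G (of_int x / real N)"
  have "\<phi> (\<lambda>z. \<eta> (z + x)) = (\<Sum>k\<in>cube_configs R. \<phi> k * E.pattern A k x \<eta>) + w x" for x
  proof -
    have "E.pattern A k x \<eta> = of_bool (\<forall>z\<in>A. \<eta> (z + x) = k z)" for k
      unfolding E.pattern_def using A(1) by (induction A rule: finite_induct) auto
    then show ?thesis using phi_decomp[of "\<lambda>z. \<eta> (z + x)" R] by (simp add: w_def)
  qed
  then have "local_average \<eta> = 1 / N * (\<Sum>x\<in>inner_sites N. ?G x * ((\<Sum>k\<in>cube_configs R. \<phi> k * (E.pattern A k x \<eta> - E.pattern_prob A k s x)) + (\<Sum>k\<in>cube_configs R. \<phi> k * E.pattern_prob A k s x) + w x))"
    unfolding local_average_def by (simp add: right_diff_distrib sum_subtractf)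
  also have "\<dots> = 1 / N * (\<Sum>x\<in>inner_sites N. ?G x * (\<Sum>k\<in>cube_configs R. \<phi> k * (E.pattern A k x \<eta> - E.pattern_prob A k s x)))
    + 1 / N * (\<Sum>x\<in>inner_sites N. ?G x * (\<Sum>k\<in>cube_configs R. \<phi> k * E.pattern_prob A k s x)) + 1 / N * (\<Sum>x\<in>inner_sites N. ?G x * w x)"
    by (simp only: distrib_left sum.distrib)
  also have "1 / N * (\<Sum>x\<in>inner_sites N. ?G x * (\<Sum>k\<in>cube_configs R. \<phi> k * (E.pattern A k x \<eta> - E.pattern_prob A k s x))) = (\<Sum>k\<in>cube_configs R. \<phi> k * E.pattern_average A k (inner_sites N) ?G s \<eta>)"
    unfolding E.pattern_average_def sum_distrib_left by (subst sum.swap) (intro sum.cong refl; simp)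
  finally have e: "local_average \<eta> - target s = (\<Sum>k\<in>cube_configs R. \<phi> k * E.pattern_average A k (inner_sites N) ?G s \<eta>)
    + (1 / N * (\<Sum>x\<in>inner_sites N. ?G x * (\<Sum>k\<in>cube_configs R. \<phi> k * E.pattern_prob A k s x)) - target s) + 1 / N * (\<Sum>x\<in>inner_sites N. ?G x * w x)" by simp
  have "\<bar>1 / N * (\<Sum>x\<in>inner_sites N. ?G x * w x)\<bar> = 1 / N * \<bar>\<Sum>x\<in>inner_sites N. ?G x * w x\<bar>" by (simp add: abs_mult)
  also have "\<dots> \<le> 1 / N * (\<Sum>x\<in>inner_sites N. CG * phi_tail R (\<lambda>z. \<eta> (z + x)))"
  proof (rule mult_left_mono, rule order_trans[OF sum_abs], rule sum_mono)
    fix x assume x: "x \<in> inner_sites N"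
    have "\<bar>w x\<bar> = phi_tail R (\<lambda>z. \<eta> (z + x))" by (simp add: w_def phi_tail_def abs_mult)
    then show "\<bar>?G x * w x\<bar> \<le> CG * phi_tail R (\<lambda>z. \<eta> (z + x))"
      unfolding abs_mult using G_inner_le[OF N1 x] by (simp add: mult_right_mono phi_tail_nonneg)
  qed simp
  finally have w: "\<bar>1 / N * (\<Sum>x\<in>inner_sites N. ?G x * w x)\<bar> \<le> CG / N * (\<Sum>x\<in>inner_sites N. phi_tail R (\<lambda>z. \<eta> (z + x)))"
    by (simp add: sum_distrib_left)
  have "\<bar>\<Sum>k\<in>cube_configs R. \<phi> k * E.pattern_average A k (inner_sites N) ?G s \<eta>\<bar> \<le> (\<Sum>k\<in>cube_configs R. \<bar>\<phi> k\<bar> * \<bar>E.pattern_average A k (inner_sites N) ?G s \<eta>\<bar>)"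
    by (rule order_trans[OF sum_abs]) (simp add: abs_mult)
  moreover have "\<bar>1 / N * (\<Sum>x\<in>inner_sites N. ?G x * (\<Sum>k\<in>cube_configs R. \<phi> k * E.pattern_prob A k s x)) - target s\<bar> \<le> D"
    using D by (simp add: E.pattern_prob_def)
  ultimately show ?thesis using w unfolding e by linarith
qed

lemma pattern_average_meas:
  assumes ev: "zr_evol g lm lp lm' lp' T l0 l1 Lam Cg N speed C0 law_at"
  shows "(\<lambda>s. zr_evol.pattern_average g lm lp N A k (inner_sites N) H (clamp s) \<eta>) \<in> borel_measurable borel"
proof -
  interpret E: zr_evol g lm lp lm' lp' T l0 l1 Lam Cg N speed C0 law_at by fact
  have "(\<lambda>s. E.pattern_prob A k (clamp s) x) \<in> borel_measurable borel" if "x \<in> inner_sites N" for x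
    unfolding E.pattern_prob_def using inner_sites(2)[OF that] by (intro borel_measurable_prod site_clamp_meas)
  then show ?thesis unfolding E.pattern_average_def
    by (intro borel_measurable_times borel_measurable_sum borel_measurable_diff borel_measurable_const)
qed

lemma main_bound:
  assumes ev: "zr_evol g lm lp lm' lp' T l0 l1 Lam Cg N speed C0 law_at"
    and gam: "gam > 0" "tail_exp_moment gam R \<le> exp 1"
    and D: "\<And>s. s \<in> {0..T} \<Longrightarrow>
      \<bar>1 / real N * (\<Sum>x\<in>inner_sites N. G (of_int x / N) * (\<Sum>k\<in>cube_configs R. \<phi> k * (\<Prod>z\<in>A. site (lx N s (z + x)) (k z)))) - target s\<bar> \<le> D"
    and B: "\<And>k. k \<in> cube_configs R \<Longrightarrow>
      (\<integral>\<^sup>+s\<in>{0..T}. (\<integral>\<^sup>+\<eta>. ennreal \<bar>zr_evol.pattern_average g lm lp N A k (inner_sites N) (\<lambda>x. G (of_int x / N)) s \<eta>\<bar> \<partial>measure_pmf (law_at s)) \<partial>lborel) \<le> ennreal B" "B \<ge> 0"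
  shows "(\<integral>\<^sup>+\<omega>. (\<integral>\<^sup>+s\<in>{0..T}. ennreal \<bar>local_average (X s \<omega>) - target s\<bar> \<partial>lborel) \<partial>M)
    \<le> ennreal (T * (CG * ((2 * of_int a + 1) * (zr_evol.entropy_const g T l0 l1 Lam C0 + 4) / gam) + D) + (\<Sum>k\<in>cube_configs R. \<bar>\<phi> k\<bar>) * B)"
proof -
  interpret E: zr_evol g lm lp lm' lp' T l0 l1 Lam Cg N speed C0 law_at by fact
  let ?U = "\<lambda>k s \<eta>. E.pattern_average A k (inner_sites N) (\<lambda>x. G (of_int x / N)) s \<eta>"
  define W where "W = (\<lambda>\<eta>. \<Sum>x\<in>inner_sites N. phi_tail R (\<lambda>z. \<eta> (z + x)))"
  have W: "W \<eta> \<ge> 0" for \<eta> unfolding W_def by (intro sum_nonneg phi_tail_nonneg)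
  define BW where "BW = (2 * of_int a + 1) * (E.entropy_const + 4) / gam"
  have BW: "BW \<ge> 0" unfolding BW_def using aA E.entropy_const gam by (intro divide_nonneg_pos mult_nonneg_nonneg) auto
  have D0: "D \<ge> 0" using D[of 0] T by (meson abs_ge_zero atLeastAtMost_iff less_imp_le order_refl order_trans)
  define h where "h = (\<lambda>s \<eta>. (ennreal (CG / N) * ennreal (W \<eta>) + (\<Sum>k\<in>cube_configs R. ennreal \<bar>\<phi> k\<bar> * ennreal \<bar>?U k (clamp s) \<eta>\<bar>) + ennreal D) * indicator {0..T} s)"
  have Um: "(\<lambda>s. ennreal \<bar>?U k (clamp s) \<eta>\<bar>) \<in> borel_measurable borel" for k \<eta>
    using pattern_average_meas[OF ev] by measurable
  have hm: "(\<lambda>s. h s \<eta>) \<in> borel_measurable borel" for \<eta>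
    unfolding h_def by (intro borel_measurable_times_ennreal borel_measurable_add borel_measurable_sum borel_measurable_const Um borel_measurable_indicator) auto
  have B0: "(\<lambda>s. \<integral>\<^sup>+\<eta>. ennreal \<bar>?U k (clamp s) \<eta>\<bar> \<partial>measure_pmf (law_at (clamp s))) \<in> borel_measurable lborel" for k
    by (rule tonelli(2)) (rule Um)
  have Bm: "(\<lambda>s. (\<integral>\<^sup>+\<eta>. ennreal \<bar>?U k (clamp s) \<eta>\<bar> \<partial>measure_pmf (law_at (clamp s))) * indicator {0..T} s) \<in> borel_measurable lborel" for k
    by (rule borel_measurable_times_ennreal[OF B0]) simp
  have "(\<integral>\<^sup>+\<omega>. (\<integral>\<^sup>+s\<in>{0..T}. ennreal \<bar>local_average (X s \<omega>) - target s\<bar> \<partial>lborel) \<partial>M) \<le> (\<integral>\<^sup>+\<omega>. (\<integral>\<^sup>+s. h s (X (clamp s) \<omega>) \<partial>lborel) \<partial>M)"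
  proof (intro nn_integral_mono)
    fix \<omega> s
    show "ennreal \<bar>local_average (X s \<omega>) - target s\<bar> * indicator {0..T} s \<le> h s (X (clamp s) \<omega>)"
    proof (cases "s \<in> {0..T}")
      case True
      have "ennreal \<bar>local_average (X s \<omega>) - target s\<bar> \<le> ennreal (CG / N * W (X s \<omega>) + (\<Sum>k\<in>cube_configs R. \<bar>\<phi> k\<bar> * \<bar>?U k s (X s \<omega>)\<bar>) + D)"
        unfolding W_def by (rule ennreal_leI[OF local_average_error[OF ev True D[OF True]]])
      also have "\<dots> = h s (X s \<omega>)"
      proof -
        have "ennreal (\<Sum>k\<in>cube_configs R. \<bar>\<phi> k\<bar> * \<bar>?U k s (X s \<omega>)\<bar>) = (\<Sum>k\<in>cube_configs R. ennreal \<bar>\<phi> k\<bar> * ennreal \<bar>?U k s (X s \<omega>)\<bar>)"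
          by (subst sum_ennreal[symmetric]) (auto simp: ennreal_mult')
        moreover have "ennreal (CG / N * W (X s \<omega>)) = ennreal (CG / N) * ennreal (W (X s \<omega>))"
          using CG by (intro ennreal_mult' divide_nonneg_nonneg) auto
        moreover have "0 \<le> CG / N * W (X s \<omega>)" using CG W by simp
        ultimately show ?thesis using True D0 clamp(2)[OF True]
          by (simp add: h_def ennreal_plus sum_nonneg)
      qed
      finally show ?thesis using True clamp(2)[OF True] by simp
    qed simp
  qed
  also have "\<dots> = (\<integral>\<^sup>+s. (\<integral>\<^sup>+\<eta>. h s \<eta> \<partial>measure_pmf (law_at (clamp s))) \<partial>lborel)" by (rule tonelli(1)[OF hm])
  also have "\<dots> \<le> (\<integral>\<^sup>+s. (ennreal (CG * BW + D) * indicator {0..T} s + (\<Sum>k\<in>cube_configs R. ennreal \<bar>\<phi> k\<bar> * ((\<integral>\<^sup>+\<eta>. ennreal \<bar>?U k (clamp s) \<eta>\<bar> \<partial>measure_pmf (law_at (clamp s))) * indicator {0..T} s))) \<partial>lborel)"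
  proof (rule nn_integral_mono)
    fix s
    show "(\<integral>\<^sup>+\<eta>. h s \<eta> \<partial>measure_pmf (law_at (clamp s))) \<le> ennreal (CG * BW + D) * indicator {0..T} s + (\<Sum>k\<in>cube_configs R. ennreal \<bar>\<phi> k\<bar> * ((\<integral>\<^sup>+\<eta>. ennreal \<bar>?U k (clamp s) \<eta>\<bar> \<partial>measure_pmf (law_at (clamp s))) * indicator {0..T} s))"
    proof (cases "s \<in> {0..T}")
      case True
      \<comment> \<open>\<open>block_tail_bound\<close> with \<open>b = 1\<close>, since the
        exponential moment is at most \<open>exp 1\<close>; this is the origin of the 4 in the
        bound.\<close>
      have "(\<integral>\<^sup>+\<eta>. ennreal (W \<eta>) \<partial>measure_pmf (law_at s)) \<le> ennreal ((2 * of_int a + 1) * (E.entropy_const + 1 + 3 * 1) / gam * N)"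
        unfolding W_def
        by (rule E.block_tail_bound[OF True aA phi_tail_determined_on phi_tail_nonneg gam(1) _ _ inner_sites])
          (use gam in \<open>auto simp: tail_exp_moment_nn intro: ennreal_leI\<close>)
      then have "(\<integral>\<^sup>+\<eta>. ennreal (W \<eta>) \<partial>measure_pmf (law_at s)) \<le> ennreal (BW * N)" by (simp add: BW_def algebra_simps)
      then have "ennreal (CG / N) * (\<integral>\<^sup>+\<eta>. ennreal (W \<eta>) \<partial>measure_pmf (law_at s)) \<le> ennreal (CG / N) * ennreal (BW * N)"
        by (rule mult_left_mono) simp
      also have "\<dots> = ennreal (CG * BW)" using CG N1 BW by (simp add: ennreal_mult'[symmetric])
      finally have w: "ennreal (CG / N) * (\<integral>\<^sup>+\<eta>. ennreal (W \<eta>) \<partial>measure_pmf (law_at s)) \<le> ennreal (CG * BW)" .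
      have "(\<integral>\<^sup>+\<eta>. h s \<eta> \<partial>measure_pmf (law_at (clamp s))) = ennreal (CG / N) * (\<integral>\<^sup>+\<eta>. ennreal (W \<eta>) \<partial>measure_pmf (law_at s))
        + (\<Sum>k\<in>cube_configs R. ennreal \<bar>\<phi> k\<bar> * (\<integral>\<^sup>+\<eta>. ennreal \<bar>?U k s \<eta>\<bar> \<partial>measure_pmf (law_at s))) + ennreal D"
        using True clamp(2)[OF True] by (simp add: h_def nn_integral_add nn_integral_sum nn_integral_cmult)
      also have "\<dots> \<le> ennreal (CG * BW) + (\<Sum>k\<in>cube_configs R. ennreal \<bar>\<phi> k\<bar> * (\<integral>\<^sup>+\<eta>. ennreal \<bar>?U k s \<eta>\<bar> \<partial>measure_pmf (law_at s))) + ennreal D"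
        using w by (intro add_mono order_refl)
      also have "\<dots> = ennreal (CG * BW + D) + (\<Sum>k\<in>cube_configs R. ennreal \<bar>\<phi> k\<bar> * (\<integral>\<^sup>+\<eta>. ennreal \<bar>?U k s \<eta>\<bar> \<partial>measure_pmf (law_at s)))"
        using CG BW D0 by (simp add: ennreal_plus ac_simps)
      finally show ?thesis using True clamp(2)[OF True] by simp
    qed (simp add: h_def)
  qed
  also have "\<dots> = (\<integral>\<^sup>+s. ennreal (CG * BW + D) * indicator {0..T} s \<partial>lborel) + (\<integral>\<^sup>+s. (\<Sum>k\<in>cube_configs R. ennreal \<bar>\<phi> k\<bar> * ((\<integral>\<^sup>+\<eta>. ennreal \<bar>?U k (clamp s) \<eta>\<bar> \<partial>measure_pmf (law_at (clamp s))) * indicator {0..T} s)) \<partial>lborel)"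
    by (intro nn_integral_add borel_measurable_sum borel_measurable_times_ennreal[OF borel_measurable_const] Bm borel_measurable_indicator) simp
  also have "(\<integral>\<^sup>+s. (\<Sum>k\<in>cube_configs R. ennreal \<bar>\<phi> k\<bar> * ((\<integral>\<^sup>+\<eta>. ennreal \<bar>?U k (clamp s) \<eta>\<bar> \<partial>measure_pmf (law_at (clamp s))) * indicator {0..T} s)) \<partial>lborel)
    = (\<Sum>k\<in>cube_configs R. ennreal \<bar>\<phi> k\<bar> * (\<integral>\<^sup>+s. (\<integral>\<^sup>+\<eta>. ennreal \<bar>?U k (clamp s) \<eta>\<bar> \<partial>measure_pmf (law_at (clamp s))) * indicator {0..T} s \<partial>lborel))"
    by (simp only: nn_integral_sum[OF borel_measurable_times_ennreal[OF borel_measurable_const Bm]] nn_integral_cmult[OF Bm])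
  also have "\<dots> \<le> (\<Sum>k\<in>cube_configs R. ennreal \<bar>\<phi> k\<bar> * ennreal B)"
  proof (intro sum_mono mult_left_mono)
    fix k assume k: "k \<in> cube_configs R"
    have "(\<integral>\<^sup>+s. (\<integral>\<^sup>+\<eta>. ennreal \<bar>?U k (clamp s) \<eta>\<bar> \<partial>measure_pmf (law_at (clamp s))) * indicator {0..T} s \<partial>lborel)
      = (\<integral>\<^sup>+s\<in>{0..T}. (\<integral>\<^sup>+\<eta>. ennreal \<bar>?U k s \<eta>\<bar> \<partial>measure_pmf (law_at s)) \<partial>lborel)"
      by (intro nn_integral_cong) (auto simp: indicator_def clamp(2))
    then show "(\<integral>\<^sup>+s. (\<integral>\<^sup>+\<eta>. ennreal \<bar>?U k (clamp s) \<eta>\<bar> \<partial>measure_pmf (law_at (clamp s))) * indicator {0..T} s \<partial>lborel) \<le> ennreal B"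
      using B(1)[OF k] by simp
  qed simp
  also have "(\<Sum>k\<in>cube_configs R. ennreal \<bar>\<phi> k\<bar> * ennreal B) = ennreal ((\<Sum>k\<in>cube_configs R. \<bar>\<phi> k\<bar>) * B)"
    using B(2) by (simp add: sum_distrib_right[symmetric] ennreal_mult' sum_nonneg)
  also have "(\<integral>\<^sup>+s. ennreal (CG * BW + D) * indicator {0..T} s \<partial>lborel) = ennreal (T * (CG * BW + D))"
    using T CG BW D0 by (subst nn_integral_cmult_indicator) (auto simp: ennreal_mult'[symmetric] mult.commute simp del: ennreal_plus)
  also have "ennreal (T * (CG * BW + D)) + ennreal ((\<Sum>k\<in>cube_configs R. \<bar>\<phi> k\<bar>) * B) = ennreal (T * (CG * BW + D) + (\<Sum>k\<in>cube_configs R. \<bar>\<phi> k\<bar>) * B)"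
    using T CG BW D0 B(2) by (intro ennreal_plus[symmetric] mult_nonneg_nonneg add_nonneg_nonneg sum_nonneg) auto
  finally show ?thesis unfolding BW_def by (simp only: add_left_mono)
qed

end

text \<open>The mixed configuration agrees with \<open>\<eta>\<close> on \<open>A\<close> and with
  \<open>\<xi>\<close> on \<open>B\<close>, because the two coincide on the intersection.\<close>

lemma depends_on_Int:
  assumes "depends_on \<phi> A" "depends_on \<phi> B" shows "depends_on \<phi> (A \<inter> B)"
  unfolding depends_on_def
proof (intro allI impI)
  fix \<eta> \<xi> :: "int \<Rightarrow> nat" assume eq: "\<forall>z\<in>A \<inter> B. \<eta> z = \<xi> z"
  define \<zeta> where "\<zeta> = (\<lambda>z. if z \<in> A then \<eta> z else \<xi> z)"
  have "\<phi> \<eta> = \<phi> \<zeta>" using assms(1) unfolding depends_on_def by (auto simp: \<zeta>_def)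
  also have "\<phi> \<zeta> = \<phi> \<xi>"
    using assms(2)[unfolded depends_on_def, rule_format, of \<zeta> \<xi>] eq by (auto simp: \<zeta>_def)
  finally show "\<phi> \<eta> = \<phi> \<xi>" .
qed

text \<open>The least dependence set determines over which sites \<open>empirical_average\<close> sums.\<close>

lemma local_function_support:
  assumes "local_function \<phi>"
  obtains A where "finite A" "depends_on \<phi> A" "\<And>B. depends_on \<phi> B \<Longrightarrow> A \<subseteq> B"
proof -
  obtain A0 where A0: "finite A0 \<and> depends_on \<phi> A0" using assms by (auto simp: local_function_def)
  obtain A where A: "finite A" "depends_on \<phi> A" and least: "\<And>B. finite B \<and> depends_on \<phi> B \<Longrightarrow> card A \<le> card B"
    using ex_has_least_nat[of "\<lambda>A. finite A \<and> depends_on \<phi> A", OF A0, of card] by blast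
  show ?thesis
  proof (rule that[OF A])
    fix B assume "depends_on \<phi> B"
    then have "card A \<le> card (A \<inter> B)" using A depends_on_Int by (intro least) auto
    then have "A \<inter> B = A" using A by (intro card_subset_eq) (auto intro: le_antisym card_mono)
    then show "A \<subseteq> B" by blast
  qed
qed

text \<open>Translating back shows that \<open>\<phi>\<close> depends only on the sites that the
  shift sends into \<open>B\<close>; leastness of \<open>A\<close> then gives the implication from
  left to right.\<close>

lemma depends_on_shift:
  assumes A: "depends_on \<phi> A" "\<And>B. depends_on \<phi> B \<Longrightarrow> A \<subseteq> B"
  shows "depends_on (shift x \<phi>) B \<longleftrightarrow> (\<forall>z\<in>A. z + x \<in> B)"
proof
  assume B: "depends_on (shift x \<phi>) B"
  have "depends_on \<phi> {z. z + x \<in> B}"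
    unfolding depends_on_def
  proof (intro allI impI)
    fix \<eta> \<xi> :: "int \<Rightarrow> nat" assume eq: "\<forall>z\<in>{z. z + x \<in> B}. \<eta> z = \<xi> z"
    have "shift x \<phi> (\<lambda>z. \<eta> (z - x)) = shift x \<phi> (\<lambda>z. \<xi> (z - x))"
      using eq by (intro B[unfolded depends_on_def, rule_format]) simp
    then show "\<phi> \<eta> = \<phi> \<xi>" by (simp add: shift_def)
  qed
  then show "\<forall>z\<in>A. z + x \<in> B" using A(2) by blast
next
  assume B: "\<forall>z\<in>A. z + x \<in> B"
  show "depends_on (shift x \<phi>) B"
    unfolding depends_on_def shift_def
    by (intro allI impI A(1)[unfolded depends_on_def, rule_format]) (use B in simp)
qed

section \<open>Choice of the parameters and the limit\<close>

context zr_avg begin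

text \<open>The order matters: \<open>d\<close> takes a quarter of \<open>b\<close>, then
  \<open>R'\<close> makes the tails small, then \<open>e\<close> compensates
  \<open>recursion_sum R'\<close>, which depends on \<open>R'\<close>, and the two remaining terms
  vanish with N.\<close>

lemma parameter_choice:
  fixes b entropy_const particle_const \<alpha> :: real
  assumes b: "b > 0" and \<alpha>: "\<alpha> > 0"
  obtains d e R' where "d > 0" "e > 0" "R' \<ge> 1" "R' \<ge> R"
    "\<forall>\<^sub>F N in sequentially. d * T + 3 * CG\<^sup>2 / d * (real (card A) ^ 2 * T / real N
        + card A * (6 * (recursion_sum R' * l1 / (2 * e)) * entropy_const * real N ^ 2 / (l0 * (real N powr (2 + \<alpha>) / 2))
                     + T * (3 * (recursion_sum R' * (e * (3 * l1 + Cg * real R')) + tail R') + particle_const / real R'))) \<le> b"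
proof -
  define d where "d = b / (4 * T)"
  have d: "d > 0" "d * T = b / 4" using b T by (auto simp: d_def)
  define K where "K = 3 * CG\<^sup>2 / d * card A"
  have K: "K > 0" unfolding K_def using CG d A by (simp add: card_gt_0_iff)
  have "(\<lambda>R'. K * T * (3 * tail R' + particle_const / real R')) \<longlonglongrightarrow> K * T * (3 * 0 + 0)"
    by (intro tendsto_intros tail_tendsto lim_const_over_n)
  then have "\<forall>\<^sub>F R' in sequentially. K * T * (3 * tail R' + particle_const / real R') < b / 4"
    using b by (intro order_tendstoD) auto
  then have "\<forall>\<^sub>F R' in sequentially. K * T * (3 * tail R' + particle_const / real R') < b / 4 \<and> R' \<ge> max R 1"
    using eventually_ge_at_top by (rule eventually_conj)
  then obtain R' where R': "K * T * (3 * tail R' + particle_const / real R') < b / 4" "R' \<ge> max R 1"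
    using eventually_happens'[OF sequentially_bot] by blast
  define Q where "Q = K * T * 3 * recursion_sum R' * (3 * l1 + Cg * real R')"
  have Q: "Q > 0" unfolding Q_def using K T recursion_sum_pos[of R'] l1 Cg
    by (intro mult_pos_pos add_pos_nonneg) auto
  define e where "e = b / (8 * Q)"
  have e: "e > 0" "Q * e = b / 8" using b Q by (auto simp: e_def)
  define F where "F = (\<lambda>N. d * T + 3 * CG\<^sup>2 / d * (real (card A) ^ 2 * T / real N
        + card A * (6 * (recursion_sum R' * l1 / (2 * e)) * entropy_const * real N ^ 2 / (l0 * (real N powr (2 + \<alpha>) / 2))
                     + T * (3 * (recursion_sum R' * (e * (3 * l1 + Cg * real R')) + tail R') + particle_const / real R'))))"
  \<comment> \<open>The place where \<open>\<alpha> > 0\<close> enters: the square of N left by the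
    path argument is divided by the speed of order \<open>N powr (2 + \<alpha>)\<close>.\<close>
  have p: "(\<lambda>N. 6 * (recursion_sum R' * l1 / (2 * e)) * entropy_const * real N ^ 2 / (l0 * (real N powr (2 + \<alpha>) / 2))) \<longlonglongrightarrow> 0"
  proof -
    have "(\<lambda>N. 6 * (recursion_sum R' * l1 / (2 * e)) * entropy_const / l0 * 2 * real N powr (- \<alpha>)) \<longlonglongrightarrow> 6 * (recursion_sum R' * l1 / (2 * e)) * entropy_const / l0 * 2 * 0"
      using \<alpha> by (intro tendsto_mult tendsto_const tendsto_neg_powr filterlim_real_sequentially) auto
    moreover have "\<forall>\<^sub>F N in sequentially. 6 * (recursion_sum R' * l1 / (2 * e)) * entropy_const / l0 * 2 * real N powr (- \<alpha>)
      = 6 * (recursion_sum R' * l1 / (2 * e)) * entropy_const * real N ^ 2 / (l0 * (real N powr (2 + \<alpha>) / 2))"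
      using eventually_ge_at_top[of 1]
    proof eventually_elim
      case (elim N)
      then have "real N powr (2 + \<alpha>) = real N ^ 2 * real N powr \<alpha>" by (simp add: powr_add powr_numeral)
      then show ?case using elim by (simp add: powr_minus field_simps)
    qed
    ultimately show ?thesis by (simp add: tendsto_cong)
  qed
  have "F \<longlonglongrightarrow> d * T + 3 * CG\<^sup>2 / d * (0
        + card A * (0 + T * (3 * (recursion_sum R' * (e * (3 * l1 + Cg * real R')) + tail R') + particle_const / real R')))"
    unfolding F_def by (intro tendsto_add tendsto_mult tendsto_const p lim_const_over_n)
  also have "d * T + 3 * CG\<^sup>2 / d * (0
        + card A * (0 + T * (3 * (recursion_sum R' * (e * (3 * l1 + Cg * real R')) + tail R') + particle_const / real R')))
    = d * T + (Q * e + K * T * (3 * tail R' + particle_const / real R'))"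
    unfolding Q_def K_def by (simp add: algebra_simps add_divide_distrib)
  finally have "\<forall>\<^sub>F N in sequentially. F N < b"
    by (rule order_tendstoD(2)) (use R'(1) d(2) e(2) b in linarith)
  then have "\<forall>\<^sub>F N in sequentially. F N \<le> b" by eventually_elim simp
  then show ?thesis using R'(2) by (intro that[OF d(1) e(1), of R']) (auto simp: F_def)
qed

lemma local_average_tendsto:
  fixes M :: "nat \<Rightarrow> 'w measure" and X :: "nat \<Rightarrow> real \<Rightarrow> 'w \<Rightarrow> int \<Rightarrow> nat"
  assumes \<alpha>: "\<alpha> > 0"
    and zrp: "\<And>N. N \<ge> 1 \<Longrightarrow> zero_range_process \<alpha> g lm lp N (M N) (X N)"
    and f0: "\<And>N \<xi>. N \<ge> 1 \<Longrightarrow> \<xi> \<in> configs N \<Longrightarrow> f0 N \<xi> \<ge> 0"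
    and X0: "\<And>N. N \<ge> 1 \<Longrightarrow> distr (M N) (count_space UNIV) (X N 0) =
            density (measure_pmf (profile_law g lm lp N 0)) (\<lambda>\<xi>. ennreal (f0 N \<xi>))"
    and ent: "\<And>N. N \<ge> 1 \<Longrightarrow>
            integrable (measure_pmf (profile_law g lm lp N 0)) (\<lambda>\<xi>. f0 N \<xi> * ln (f0 N \<xi>))"
      "\<And>N. N \<ge> 1 \<Longrightarrow>
            (LINT \<xi>|measure_pmf (profile_law g lm lp N 0). f0 N \<xi> * ln (f0 N \<xi>)) \<le> C * real N"
  shows "(\<lambda>N. \<integral>\<^sup>+\<omega>. (\<integral>\<^sup>+s\<in>{0..T}. ennreal
      \<bar>1 / real N * (\<Sum>x\<in>inner_sites N. G (of_int x / N) * \<phi> (\<lambda>z. X N s \<omega> (z + x))) - target s\<bar> \<partial>lborel) \<partial>M N) \<longlonglongrightarrow> 0"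
proof (rule tendsto_zero_ennreal)
  fix r :: real assume r: "r > 0"
  define C0 where "C0 = zr_proc.init_const g l0 l1 C"
  define entropy_const where "entropy_const = zr_evol.entropy_const g T l0 l1 Lam C0"
  define particle_const where "particle_const = zr_evol.particle_const g T l0 l1 Lam C0"
  have main: "zr_main g lm lp lm' lp' T l0 l1 Lam Cg \<phi> A a G CG \<alpha> N (M N) (X N)" if N: "N \<ge> 1" for N
    by unfold_locales (use zrp[OF N] N in auto)
  have ev: "zr_evol g lm lp lm' lp' T l0 l1 Lam Cg N (zr_proc.speed \<alpha> N) C0 (zr_proc.law_at (M N) (X N))"
    if N: "N \<ge> 1" for N
  proof -
    interpret m: zr_main g lm lp lm' lp' T l0 l1 Lam Cg \<phi> A a G CG \<alpha> N "M N" "X N" by (rule main[OF N])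
    show ?thesis unfolding C0_def by (rule m.evol[OF f0 X0 ent]) (use N in auto)
  qed
  have entropy_const: "entropy_const \<ge> 0" unfolding entropy_const_def by (rule zr_evol.entropy_const[OF ev[of 1]]) simp
  define Q where "Q = CG * ((2 * of_int a + 1) * (entropy_const + 4))"
  have Q: "Q > 0" unfolding Q_def using CG aA entropy_const by (intro mult_pos_pos) auto
  \<comment> \<open>In the estimate of the truncated part the entropy is divided by
    \<open>gam\<close>, so a large exponent makes this contribution \<open>r / 8\<close>. Only
    afterwards \<open>R\<close> is taken so large that the exponential moment with this exponent is
    at most \<open>exp 1\<close>.\<close>
  define gam where "gam = 8 * T * Q / r"
  have gam: "gam > 0" "T * (Q / gam) = r / 8" unfolding gam_def using r T Q by (auto simp: field_simps)
  have "\<forall>\<^sub>F R in sequentially. tail_exp_moment gam R < exp 1"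
    using tail_exp_moment_tendsto[OF gam(1)] by (rule order_tendstoD) simp
  moreover have "(\<lambda>R. 3 * T * CG * tail_mean R) \<longlonglongrightarrow> 3 * T * CG * 0"
    by (intro tendsto_intros tail_mean_tendsto)
  then have "\<forall>\<^sub>F R in sequentially. 3 * T * CG * tail_mean R < r / 8"
    using r by (intro order_tendstoD) auto
  ultimately have "\<forall>\<^sub>F R in sequentially. tail_exp_moment gam R < exp 1 \<and> 3 * T * CG * tail_mean R < r / 8"
    by (rule eventually_conj)
  then obtain R where R: "tail_exp_moment gam R < exp 1" "3 * T * CG * tail_mean R < r / 8"
    using eventually_happens'[OF sequentially_bot] by blast
  define V where "V = 3 * T * CG + T"
  have V: "V > 0" unfolding V_def using T CG by (simp add: add_pos_pos)
  define e' where "e' = r / (8 * V)"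
  have e': "e' > 0" "V * e' = r / 8" unfolding e'_def using r V by auto
  define S where "S = (\<Sum>k\<in>cube_configs R. \<bar>\<phi> k\<bar>)"
  have S: "S \<ge> 0" unfolding S_def by (intro sum_nonneg) auto
  define b where "b = r / (2 * (S + 1))"
  have b: "b > 0" "S * b \<le> r / 2" unfolding b_def using r S by (auto simp: field_simps)
  \<comment> \<open>\<open>R\<close> truncates \<open>\<phi>\<close> and \<open>R'\<close> the
    one-site recursion. The latter comes second, as \<open>b\<close> depends on the size
    \<open>S\<close> of the truncated function; \<open>R' \<ge> R\<close> lets the recursion reach
    all patterns that occur.\<close>
  obtain d e R' where de: "d > 0" "e > 0" "R' \<ge> 1" "R' \<ge> R" and
    B: "\<forall>\<^sub>F N in sequentially. d * T + 3 * CG\<^sup>2 / d * (real (card A) ^ 2 * T / real N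
        + card A * (6 * (recursion_sum R' * l1 / (2 * e)) * entropy_const * real N ^ 2 / (l0 * (real N powr (2 + \<alpha>) / 2))
                     + T * (3 * (recursion_sum R' * (e * (3 * l1 + Cg * real R')) + tail R') + particle_const / real R'))) \<le> b"
    using parameter_choice[OF b(1) \<alpha>, of R entropy_const particle_const] by blast
  from B deterministic_error[OF e'(1), of R] eventually_ge_at_top[of 1]
  show "\<forall>\<^sub>F N in sequentially. (\<integral>\<^sup>+\<omega>. (\<integral>\<^sup>+s\<in>{0..T}. ennreal
      \<bar>1 / real N * (\<Sum>x\<in>inner_sites N. G (of_int x / N) * \<phi> (\<lambda>z. X N s \<omega> (z + x))) - target s\<bar> \<partial>lborel) \<partial>M N) < ennreal r"
  proof eventually_elim
    case (elim N)
    note N = elim(3)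
    interpret m: zr_main g lm lp lm' lp' T l0 l1 Lam Cg \<phi> A a G CG \<alpha> N "M N" "X N" by (rule main[OF N])
    interpret E: zr_evol g lm lp lm' lp' T l0 l1 Lam Cg N m.speed C0 m.law_at by (rule ev[OF N])
    let ?U = "\<lambda>k s \<eta>. E.pattern_average A k (inner_sites N) (\<lambda>x. G (of_int x / N)) s \<eta>"
    define D where "D = 3 * CG * (tail_mean R + e') + e'"
    have U: "(\<integral>\<^sup>+s\<in>{0..T}. (\<integral>\<^sup>+\<eta>. ennreal \<bar>?U k s \<eta>\<bar> \<partial>measure_pmf (m.law_at s)) \<partial>lborel) \<le> ennreal b" if k: "k \<in> cube_configs R" for k
    proof -
      have "(\<integral>\<^sup>+s\<in>{0..T}. (\<integral>\<^sup>+\<eta>. ennreal \<bar>?U k s \<eta>\<bar> \<partial>measure_pmf (m.law_at s)) \<partial>lborel)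
        \<le> ennreal (d * T + 3 * CG\<^sup>2 / d * (real (card A) ^ 2 * T / N
          + card A * (6 * (recursion_sum R' * l1 / (2 * e)) * E.entropy_const * real N ^ 2 / (l0 * m.speed)
                     + T * (3 * (recursion_sum R' * (e * (3 * l1 + Cg * real R')) + tail R') + E.particle_const / real R'))))"
        by (rule E.indicator_average_bound[OF A(1) inner_sites G_inner_le[OF N] CG _ de(2,1,3)])
          (use cube_configs_le[OF k] de(4) in \<open>auto intro: order_trans\<close>)
      also have "\<dots> \<le> ennreal b" using elim(1) unfolding m.speed_def entropy_const_def particle_const_def by (rule ennreal_leI)
      finally show ?thesis .
    qed
    have "(\<integral>\<^sup>+\<omega>. (\<integral>\<^sup>+s\<in>{0..T}. ennreal \<bar>m.local_average (X N s \<omega>) - target s\<bar> \<partial>lborel) \<partial>M N)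
      \<le> ennreal (T * (CG * ((2 * of_int a + 1) * (E.entropy_const + 4) / gam) + D) + (\<Sum>k\<in>cube_configs R. \<bar>\<phi> k\<bar>) * b)"
      using elim(2) R(1) b(1) unfolding D_def
      by (intro m.main_bound[OF E.zr_evol_axioms gam(1)] U) auto
    also have "T * (CG * ((2 * of_int a + 1) * (E.entropy_const + 4) / gam) + D) + (\<Sum>k\<in>cube_configs R. \<bar>\<phi> k\<bar>) * b
      = T * (Q / gam) + (3 * T * CG * tail_mean R + V * e') + S * b"
      unfolding Q_def entropy_const_def S_def D_def V_def by (simp add: distrib_left distrib_right mult.assoc mult.left_commute[of T])
    also have "ennreal \<dots> < ennreal r"     proof (rule ennreal_lessI[OF r])
      have "p + (q + v) + w < r" if "p = r / 8" "q < r / 8" "v = r / 8" "w \<le> r / 2" for p q v w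
        using that r by linarith
      then show "T * (Q / gam) + (3 * T * CG * tail_mean R + V * e') + S * b < r"
        using gam(2) R(2) e'(2) b(2) by blast
    qed
    finally show ?case by (simp add: m.local_average_def)
  qed
qed

end

lemma Lipschitz_linear_growth:
  fixes g :: "nat \<Rightarrow> real"
  assumes "g 0 = 0" "bdd_above (range (\<lambda>k. \<bar>g (k + 1) - g k\<bar>))"
  obtains c where "\<And>k. g k \<le> c * real k"
proof -
  obtain c where c: "\<And>k. \<bar>g (k + 1) - g k\<bar> \<le> c" using assms(2) by (auto simp: bdd_above_def)
  have "g k \<le> c * real k" for k
  proof (induction k)
    case (Suc k)
    then show ?case using c[of k] by (simp add: algebra_simps)
  qed (simp add: assms)
  then show ?thesis by (rule that)
qed

lemma continuous_positive_bounds: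
  fixes f :: "real \<Rightarrow> real"
  assumes "continuous_on {0..t} f" "t > 0" "\<And>s. s \<in> {0..t} \<Longrightarrow> f s > 0"
  obtains a b where "a > 0" "\<And>s. s \<in> {0..t} \<Longrightarrow> a \<le> f s \<and> f s \<le> b"
proof -
  have ne: "{0..t} \<noteq> {}" using assms(2) by simp
  obtain s1 where "s1 \<in> {0..t}" "\<And>s. s \<in> {0..t} \<Longrightarrow> f s1 \<le> f s"
    using continuous_attains_inf[OF compact_Icc ne assms(1)] by blast
  moreover obtain s2 where "\<And>s. s \<in> {0..t} \<Longrightarrow> f s \<le> f s2"
    using continuous_attains_sup[OF compact_Icc ne assms(1)] by blast
  ultimately show ?thesis using assms(3) by (intro that[of "f s1" "f s2"]) auto
qed

theorem theorem4p1:
  fixes \<alpha> :: real and g :: "nat \<Rightarrow> real"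
    and lm lp lm' lp' :: "real \<Rightarrow> real"
    and M :: "nat \<Rightarrow> 'w measure"
    and \<eta> :: "nat \<Rightarrow> real \<Rightarrow> 'w \<Rightarrow> int \<Rightarrow> nat"
    and f0 :: "nat \<Rightarrow> (int \<Rightarrow> nat) \<Rightarrow> real"
    and C t :: real
    and \<phi> :: "(int \<Rightarrow> nat) \<Rightarrow> real"
    and G :: "real \<Rightarrow> real"
  assumes "\<alpha> > 0"
    and "g 0 = 0" and "\<And>k. k > 0 \<Longrightarrow> g k > 0"
    and "bdd_above (range (\<lambda>k. \<bar>g (k + 1) - g k\<bar>))"
    and "\<And>lam. lam > 0 \<Longrightarrow> summable (\<lambda>k. lam ^ k / gfact g k)"
    and "\<And>s. s \<ge> 0 \<Longrightarrow> lm s > 0" and "\<And>s. s \<ge> 0 \<Longrightarrow> lp s > 0"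
    and "\<And>s. s \<ge> 0 \<Longrightarrow> (lm has_real_derivative lm' s) (at s within {0..})"
    and "\<And>s. s \<ge> 0 \<Longrightarrow> (lp has_real_derivative lp' s) (at s within {0..})"
    and "bounded (lm' ` {0..})" and "bounded (lp' ` {0..})"
    and "\<And>N. N \<ge> 1 \<Longrightarrow> zero_range_process \<alpha> g lm lp N (M N) (\<eta> N)"
    and "\<And>N \<xi>. N \<ge> 1 \<Longrightarrow> \<xi> \<in> configs N \<Longrightarrow> f0 N \<xi> \<ge> 0"
    and "\<And>N. N \<ge> 1 \<Longrightarrow> distr (M N) (count_space UNIV) (\<eta> N 0) =
            density (measure_pmf (profile_law g lm lp N 0)) (\<lambda>\<xi>. ennreal (f0 N \<xi>))"
    and "C > 0"
    and "\<And>N. N \<ge> 1 \<Longrightarrow>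
            integrable (measure_pmf (profile_law g lm lp N 0)) (\<lambda>\<xi>. f0 N \<xi> * ln (f0 N \<xi>))"
    and "\<And>N. N \<ge> 1 \<Longrightarrow>
            (LINT \<xi>|measure_pmf (profile_law g lm lp N 0). f0 N \<xi> * ln (f0 N \<xi>)) \<le> C * real N"
    and "t > 0"
    and "local_function \<phi>"
    and "\<And>lam \<gamma>. lam > 0 \<Longrightarrow> \<gamma> > 0 \<Longrightarrow>
            integrable (homogeneous_law g lam) (\<lambda>\<xi>. exp (\<gamma> * \<bar>\<phi> \<xi>\<bar>))"
    and "G \<in> borel_measurable (restrict_space borel {-1..1})" and "bounded (G ` {-1..1})"
    and "AE y in lborel. y \<in> {-1..1} \<longrightarrow> continuous (at y within {-1..1}) G"
  shows "(\<lambda>N. \<integral>\<^sup>+\<omega>. (\<integral>\<^sup>+s\<in>{0..t}. ennreal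
            \<bar>empirical_average N G \<phi> (\<eta> N s \<omega>)
              - (LINT y:{-1..1}|lborel. G y * phi_hat g \<phi> (lambda_bar lm lp y s))\<bar> \<partial>lborel) \<partial>M N)
          \<longlonglongrightarrow> 0"
proof -
  have deriv: "(f has_real_derivative f' s) (at s within {0..t})"
    if "\<And>s. s \<ge> 0 \<Longrightarrow> (f has_real_derivative f' s) (at s within {0..})" "s \<in> {0..t}" for f f' :: "real \<Rightarrow> real" and s
    by (rule has_field_derivative_subset[OF that(1)]) (use that(2) in auto)
  have cont: "continuous_on {0..t} f"
    if "\<And>s. s \<ge> 0 \<Longrightarrow> (f has_real_derivative f' s) (at s within {0..})" for f f' :: "real \<Rightarrow> real"
    by (rule DERIV_continuous_on[of _ f f']) (rule deriv[OF that])
  obtain a1 b1 where ab1: "a1 > 0" "\<And>s. s \<in> {0..t} \<Longrightarrow> a1 \<le> lm s \<and> lm s \<le> b1"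
    using continuous_positive_bounds[OF cont[OF assms(8)] \<open>t > 0\<close>] assms(6) by auto
  obtain a2 b2 where ab2: "a2 > 0" "\<And>s. s \<in> {0..t} \<Longrightarrow> a2 \<le> lp s \<and> lp s \<le> b2"
    using continuous_positive_bounds[OF cont[OF assms(9)] \<open>t > 0\<close>] assms(7) by auto
  obtain B1 where B1: "\<And>s. s \<ge> 0 \<Longrightarrow> \<bar>lm' s\<bar> \<le> B1" using assms(10) by (auto simp: bounded_iff)
  obtain B2 where B2: "\<And>s. s \<ge> 0 \<Longrightarrow> \<bar>lp' s\<bar> \<le> B2" using assms(11) by (auto simp: bounded_iff)
  obtain Cg where Cg: "\<And>k. g k \<le> Cg * real k" using Lipschitz_linear_growth[OF assms(2,4)] by blast
  obtain BG where BG: "\<And>y. y \<in> {-1..1} \<Longrightarrow> \<bar>G y\<bar> \<le> BG" using assms(22) unfolding bounded_iff by (metis imageI real_norm_def)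
  obtain A where supp: "finite A" "depends_on \<phi> A" "\<And>B. depends_on \<phi> B \<Longrightarrow> A \<subseteq> B"
    using local_function_support[OF \<open>local_function \<phi>\<close>] by blast
  \<comment> \<open>The least set is empty for constant \<open>\<phi>\<close>, but a nonempty one is
    required. The point 0 only adds the condition that \<open>x\<close> itself is a site, so the
    range of summation is unchanged.\<close>
  define A' where "A' = insert 0 A"
  have A': "finite A'" "A' \<noteq> {}" using supp by (auto simp: A'_def)
  have loc: "determined_on \<phi> A'" using supp(2) unfolding depends_on_def determined_on_def A'_def by blast
  define a where "a = (\<Sum>z\<in>A'. \<bar>z\<bar>)"
  have "\<bar>z\<bar> \<le> a" if "z \<in> A'" for z unfolding a_def using that A' by (intro member_le_sum) auto
  then have aA: "A' \<subseteq> {- a..a}" by (auto simp: abs_le_iff minus_le_iff)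
  have locexp: "determined_on (\<lambda>\<xi>. exp (\<gamma> * \<bar>\<phi> \<xi>\<bar>)) A'" for \<gamma>
    unfolding determined_on_def using loc[unfolded determined_on_def] by metis
  \<comment> \<open>The maximum with 1 makes the bound on G positive also for G = 0.\<close>
  interpret zr_avg g lm lp lm' lp' t "min a1 a2" "max b1 b2" "max B1 B2" Cg \<phi> A' a G "max BG 1"
  proof unfold_locales
    show "integrable (measure_pmf (Pi_pmf A' 0 (\<lambda>_. site_law g lam))) (\<lambda>\<xi>. exp (gam * \<bar>\<phi> \<xi>\<bar>))"
      if "lam > 0" "gam > 0" for lam gam
      using assms(20)[OF that] unfolding homogeneous_local(1)[OF A' locexp] .
    show "\<bar>G y\<bar> \<le> max BG 1" if "y \<in> {-1..1}" for y using BG[OF that] by simp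
    show "0 \<le> a" unfolding a_def by (intro sum_nonneg) auto
    show "(lm has_real_derivative lm' s) (at s within {0..t})" if "s \<in> {0..t}" for s by (rule deriv[OF assms(8) that])
    show "(lp has_real_derivative lp' s) (at s within {0..t})" if "s \<in> {0..t}" for s by (rule deriv[OF assms(9) that])
    show "min a1 a2 \<le> lm s \<and> lm s \<le> max b1 b2" if "s \<in> {0..t}" for s using ab1(2)[OF that] by auto
    show "min a1 a2 \<le> lp s \<and> lp s \<le> max b1 b2" if "s \<in> {0..t}" for s using ab2(2)[OF that] by auto
    show "\<bar>lm' s\<bar> \<le> max B1 B2" if "s \<in> {0..t}" for s using B1[of s] that by auto
    show "\<bar>lp' s\<bar> \<le> max B1 B2" if "s \<in> {0..t}" for s using B2[of s] that by auto
    show "0 < min a1 a2" using ab1(1) ab2(1) by simp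
    show "(0 :: real) < max BG 1" by simp
  qed (fact assms A' loc aA Cg)+
  have sh: "depends_on (shift x \<phi>) B \<longleftrightarrow> (\<forall>z\<in>A. z + x \<in> B)" for x B
    by (rule depends_on_shift[OF supp(2)]) (rule supp(3))
  have inner_sites: "{x \<in> sites N. depends_on (shift x \<phi>) (sites N)} = inner_sites N" for N
    unfolding inner_sites_def sh by (auto simp: A'_def)
  show ?thesis
    using local_average_tendsto[OF assms(1) assms(12) assms(13) assms(14) assms(16) assms(17)]
    unfolding empirical_average_def inner_sites target_def local_mean_eq shift_def .
qed

end
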